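(* Let $k$ be an algebraically closed field and let $A=kQ/I$ be a finite dimensional monomial (or, more generally, semimonomial) $k$-algebra. Then $\mathrm{mt}\text{-}\mathrm{rank}(\mathrm{HH}^1(A))=0$ if and only if $Q$ is a tree.
   Context: Here $Q$ is a finite quiver and $I$ is an admissible ideal of $kQ$, so that $Q$ is the Gabriel quiver of $A$. "$Q$ is a tree" means that the underlying graph of $Q$ has no cycles, i.e. $\beta_1(Q)=m-n+c=0$, where $n$, $m$, $c$ are the numbers of vertices, arrows and connected components of $Q$. A minimal relation in $I$ is a nonzero element $r=\sum_{i=1}^s a_ip_i\in I$, with $p_i$ distinct paths and $a_i\in k\smallsetminus\{0\}$, such that $\sum_{i\in T}a_ip_i\notin I$ for every proper nonempty $T\subset\{1,\dots,s\}$. The algebra is monomial if $I$ is generated by paths, and semimonomial if, in any minimal relation $\sum a_ip_i$ in $I$, all the paths $p_i$ contain exactly the same arrows, each occurring the same number of times. $\mathrm{HH}^1(A)=\mathrm{Der}(A)/\mathrm{Inn}(A)$ is the Lie algebra of $k$-linear derivations of $A$ modulo inner derivations. If $\mathrm{char}\,k=0$: $\mathrm{HH}^1(A)$ is identified with the Lie algebra of the affine algebraic group $\mathrm{Out}(A)$ of outer automorphisms of $A$; a Lie subalgebra is a torus if it is the Lie algebra of a closed algebraic subgroup of $\mathrm{Out}(A)$ isomorphic to a group of invertible diagonal $n\times n$ matrices over $k$, for some $n$. If $\mathrm{char}\,k=p>0$: $\mathrm{HH}^1(A)$ is a restricted Lie algebra with $p$-power operation induced by $f\mapsto f^p$ on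 derivations; a torus is a restricted subalgebra that is abelian and each of whose elements $x$ is semisimple, i.e. $x$ lies in the restricted subalgebra generated by $x^{[p]}$. In both cases $\mathrm{mt}\text{-}\mathrm{rank}(\mathrm{HH}^1(A))$ is the maximal dimension of a torus in $\mathrm{HH}^1(A)$. *)

theory Defs
  imports
    "HOL-Algebra.Bij"
    "HOL-Algebra.Ideal_Product"
    "HOL-Algebra.QuotRing"
    "HOL-Computational_Algebra.Polynomial"
    "HOL-Library.Poly_Mapping"
    "Graph_Theory.Graph_Theory"
    "Jordan_Normal_Form.Determinant"
    "Jordan_Normal_Form.VS_Connect"
begin

section \<open>Quivers and path algebras\<close>

text \<open>
  A finite quiver is a \<^locale>\<open>fin_digraph\<close>, which allows loops and multiple arrows.
  \<^term>\<open>pre_digraph.sccs_verts\<close> of the symmetrised digraph is the set of vertex sets of the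
  connected components of the underlying graph.
\<close>

definition betti_number :: "('v, 'e) pre_digraph \<Rightarrow> int" where
  "betti_number Q = int (card (arcs Q)) - int (card (verts Q))
     + int (card (pre_digraph.sccs_verts (with_proj (mk_symmetric Q))))"

definition tree_quiver :: "('v, 'e) pre_digraph \<Rightarrow> bool" where
  "tree_quiver Q \<longleftrightarrow> betti_number Q = 0"

text \<open>
  A path is stored with its source and target, so that \<open>(v, [], v)\<close> is the trivial path at \<open>v\<close>.
  Paths are composed from left to right.
\<close>

type_synonym ('v, 'e) qpath = "'v \<times> 'e list \<times> 'v"

definition qpaths :: "('v, 'e) pre_digraph \<Rightarrow> ('v, 'e) qpath set" where
  "qpaths Q = {(u, p, v). pre_digraph.awalk Q u p v}"

definition path_arrows :: "('v, 'e) qpath \<Rightarrow> 'e list" where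
  "path_arrows p = fst (snd p)"

fun path_mult :: "('v, 'e) qpath \<Rightarrow> ('v, 'e) qpath \<Rightarrow> (('v, 'e) qpath \<Rightarrow>\<^sub>0 'k::comm_ring_1)" where
  "path_mult (u, p, v) (w, q, z) =
     (if v = w then Poly_Mapping.single (u, p @ q, z) 1 else 0)"

definition path_algebra ::
  "('v, 'e) pre_digraph \<Rightarrow> ('k::comm_ring_1, ('v, 'e) qpath \<Rightarrow>\<^sub>0 'k) module" where
  "path_algebra Q =
    \<lparr>carrier = {f. Poly_Mapping.keys f \<subseteq> qpaths Q},
     monoid.mult = (\<lambda>f g. \<Sum>p\<in>Poly_Mapping.keys f. \<Sum>q\<in>Poly_Mapping.keys g.
       Poly_Mapping.map ((*) (Poly_Mapping.lookup f p * Poly_Mapping.lookup g q)) (path_mult p q)),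
     one = (\<Sum>v\<in>verts Q. Poly_Mapping.single (v, [], v) 1),
     ring.zero = 0,
     add = (+),
     module.smult = (\<lambda>c. Poly_Mapping.map ((*) c))\<rparr>"

definition arrow_ideal :: "('v, 'e) pre_digraph \<Rightarrow> (('v, 'e) qpath \<Rightarrow>\<^sub>0 'k::comm_ring_1) set" where
  "arrow_ideal Q = genideal (path_algebra Q)
     ((\<lambda>e. Poly_Mapping.single (tail Q e, [e], head Q e) 1) ` arcs Q)"

definition ideal_power :: "('a, 'b) ring_scheme \<Rightarrow> 'a set \<Rightarrow> nat \<Rightarrow> 'a set" where
  "ideal_power R J n = (ideal_prod R J ^^ n) (carrier R)"

definition admissible_ideal ::
  "('v, 'e) pre_digraph \<Rightarrow> (('v, 'e) qpath \<Rightarrow>\<^sub>0 'k::comm_ring_1) set \<Rightarrow> bool" where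
  "admissible_ideal Q I \<longleftrightarrow> ideal I (path_algebra Q) \<and>
     I \<subseteq> ideal_power (path_algebra Q) (arrow_ideal Q) 2 \<and>
     (\<exists>N\<ge>2. ideal_power (path_algebra Q) (arrow_ideal Q) N \<subseteq> I)"

definition minimal_relation ::
  "(('v, 'e) qpath \<Rightarrow>\<^sub>0 'k::comm_ring_1) set \<Rightarrow> (('v, 'e) qpath \<Rightarrow>\<^sub>0 'k) \<Rightarrow> bool" where
  "minimal_relation I r \<longleftrightarrow> r \<in> I \<and> r \<noteq> 0 \<and>
     (\<forall>T. T \<subset> Poly_Mapping.keys r \<and> T \<noteq> {} \<longrightarrow>
       (\<Sum>p\<in>T. Poly_Mapping.single p (Poly_Mapping.lookup r p)) \<notin> I)"

definition monomial_ideal ::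
  "('v, 'e) pre_digraph \<Rightarrow> (('v, 'e) qpath \<Rightarrow>\<^sub>0 'k::comm_ring_1) set \<Rightarrow> bool" where
  "monomial_ideal Q I \<longleftrightarrow>
     (\<exists>S\<subseteq>qpaths Q. I = genideal (path_algebra Q) ((\<lambda>p. Poly_Mapping.single p 1) ` S))"

definition semimonomial_ideal :: "(('v, 'e) qpath \<Rightarrow>\<^sub>0 'k::comm_ring_1) set \<Rightarrow> bool" where
  "semimonomial_ideal I \<longleftrightarrow> (\<forall>r. minimal_relation I r \<longrightarrow>
     (\<forall>p\<in>Poly_Mapping.keys r. \<forall>q\<in>Poly_Mapping.keys r.
        mset (path_arrows p) = mset (path_arrows q)))"

text \<open>
  The quotient of a possibly non-associative algebra by a two-sided ideal: \<^const>\<open>FactRing\<close>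
  with the induced scalar multiplication.
\<close>

definition quotient_algebra :: "('k, 'a) module \<Rightarrow> 'a set \<Rightarrow> ('k, 'a set) module" where
  "quotient_algebra M N = ring.extend (M Quot N)
     \<lparr>module.smult = (\<lambda>c X. \<Union>x\<in>X. N +>\<^bsub>M\<^esub> (c \<odot>\<^bsub>M\<^esub> x))\<rparr>"


section \<open>The first Hochschild cohomology\<close>

definition derivations :: "('k::field, 'a) module \<Rightarrow> ('a \<Rightarrow> 'a) set" where
  "derivations A = {D \<in> extensional (carrier A). D \<in> module_hom class_ring A A \<and>
     (\<forall>x\<in>carrier A. \<forall>y\<in>carrier A. D (x \<otimes>\<^bsub>A\<^esub> y) = D x \<otimes>\<^bsub>A\<^esub> y \<oplus>\<^bsub>A\<^esub> x \<otimes>\<^bsub>A\<^esub> D y)}"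

definition inner_derivations :: "('k::field, 'a) module \<Rightarrow> ('a \<Rightarrow> 'a) set" where
  "inner_derivations A =
     {(\<lambda>x\<in>carrier A. a \<otimes>\<^bsub>A\<^esub> x \<ominus>\<^bsub>A\<^esub> x \<otimes>\<^bsub>A\<^esub> a) |a. a \<in> carrier A}"

text \<open>
  In \<open>Der\<close> and \<open>HH1\<close> the multiplication of the record is the Lie bracket; the field
  \<^const>\<open>one\<close> has no meaning there.
\<close>

definition Der :: "('k::field, 'a) module \<Rightarrow> ('k, 'a \<Rightarrow> 'a) module" where
  "Der A =
    \<lparr>carrier = derivations A,
     monoid.mult = (\<lambda>D E. \<lambda>x\<in>carrier A. D (E x) \<ominus>\<^bsub>A\<^esub> E (D x)),
     one = undefined,
     ring.zero = (\<lambda>x\<in>carrier A. \<zero>\<^bsub>A\<^esub>),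
     add = (\<lambda>D E. \<lambda>x\<in>carrier A. D x \<oplus>\<^bsub>A\<^esub> E x),
     module.smult = (\<lambda>c D. \<lambda>x\<in>carrier A. c \<odot>\<^bsub>A\<^esub> D x)\<rparr>"

definition HH1 :: "('k::field, 'a) module \<Rightarrow> ('k, ('a \<Rightarrow> 'a) set) module" where
  "HH1 A = quotient_algebra (Der A) (inner_derivations A)"

definition lie_subalgebra :: "('k::field, 'a) module \<Rightarrow> 'a set \<Rightarrow> bool" where
  "lie_subalgebra L T \<longleftrightarrow> subspace class_ring T L \<and> (\<forall>x\<in>T. \<forall>y\<in>T. x \<otimes>\<^bsub>L\<^esub> y \<in> T)"


section \<open>Tori in positive characteristic\<close>

definition HH1_p_power :: "('k::field, 'a) module \<Rightarrow> ('a \<Rightarrow> 'a) set \<Rightarrow> ('a \<Rightarrow> 'a) set" where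
  "HH1_p_power A X =
     (\<Union>D\<in>X. inner_derivations A +>\<^bsub>Der A\<^esub> restrict (D ^^ CHAR('k)) (carrier A))"

definition restricted_subalgebra :: "('k::field, 'a) module \<Rightarrow> ('a \<Rightarrow> 'a) set set \<Rightarrow> bool" where
  "restricted_subalgebra A T \<longleftrightarrow> lie_subalgebra (HH1 A) T \<and> (\<forall>x\<in>T. HH1_p_power A x \<in> T)"

definition generated_restricted_subalgebra ::
  "('k::field, 'a) module \<Rightarrow> ('a \<Rightarrow> 'a) set set \<Rightarrow> ('a \<Rightarrow> 'a) set set" where
  "generated_restricted_subalgebra A S = \<Inter> {T. restricted_subalgebra A T \<and> S \<subseteq> T}"

definition torus_char_p :: "('k::field, 'a) module \<Rightarrow> ('a \<Rightarrow> 'a) set set \<Rightarrow> bool" where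
  "torus_char_p A T \<longleftrightarrow> restricted_subalgebra A T \<and>
     (\<forall>x\<in>T. \<forall>y\<in>T. x \<otimes>\<^bsub>HH1 A\<^esub> y = \<zero>\<^bsub>HH1 A\<^esub>) \<and>
     (\<forall>x\<in>T. x \<in> generated_restricted_subalgebra A {HH1_p_power A x})"


section \<open>Affine algebraic groups\<close>

text \<open>
  Over an algebraically closed field, an affine algebraic group is given by its group of points
  together with its coordinate ring, a ring of functions on the points. These functions are
  extensional on the carrier.
\<close>

inductive_set function_algebra :: "'x set \<Rightarrow> ('x \<Rightarrow> 'k::field) set \<Rightarrow> ('x \<Rightarrow> 'k) set"
  for X :: "'x set" and S :: "('x \<Rightarrow> 'k) set" where
  const: "(\<lambda>x\<in>X. c) \<in> function_algebra X S"
| gen: "f \<in> S \<Longrightarrow> restrict f X \<in> function_algebra X S"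
| add: "f \<in> function_algebra X S \<Longrightarrow> g \<in> function_algebra X S \<Longrightarrow>
    (\<lambda>x\<in>X. f x + g x) \<in> function_algebra X S"
| mult: "f \<in> function_algebra X S \<Longrightarrow> g \<in> function_algebra X S \<Longrightarrow>
    (\<lambda>x\<in>X. f x * g x) \<in> function_algebra X S"

definition zariski_closed :: "'x set \<Rightarrow> ('x \<Rightarrow> 'k::field) set \<Rightarrow> 'x set \<Rightarrow> bool" where
  "zariski_closed X R Z \<longleftrightarrow> (\<exists>S\<subseteq>R. Z = {x \<in> X. \<forall>f\<in>S. f x = 0})"

definition closed_subgroup :: "'g monoid \<Rightarrow> ('g \<Rightarrow> 'k::field) set \<Rightarrow> 'g set \<Rightarrow> bool" where
  "closed_subgroup G R H \<longleftrightarrow> subgroup H G \<and> zariski_closed (carrier G) R H"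

definition algebraic_group_iso ::
  "'g monoid \<Rightarrow> ('g \<Rightarrow> 'k::field) set \<Rightarrow> 'h monoid \<Rightarrow> ('h \<Rightarrow> 'k) set \<Rightarrow> ('g \<Rightarrow> 'h) \<Rightarrow> bool" where
  "algebraic_group_iso G R H S \<phi> \<longleftrightarrow> \<phi> \<in> iso G H \<and>
     (\<forall>f\<in>S. (\<lambda>x\<in>carrier G. f (\<phi> x)) \<in> R) \<and>
     (\<forall>f\<in>R. (\<lambda>y\<in>carrier H. f (inv_into (carrier G) \<phi> y)) \<in> S)"

definition tangent_space ::
  "'x set \<Rightarrow> ('x \<Rightarrow> 'k::field) set \<Rightarrow> 'x \<Rightarrow> (('x \<Rightarrow> 'k) \<Rightarrow> 'k) set" where
  "tangent_space X R e = {\<delta> \<in> extensional R.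
     (\<forall>f\<in>R. \<forall>g\<in>R. \<delta> (\<lambda>x\<in>X. f x + g x) = \<delta> f + \<delta> g) \<and>
     (\<forall>c. \<forall>f\<in>R. \<delta> (\<lambda>x\<in>X. c * f x) = c * \<delta> f) \<and>
     (\<forall>f\<in>R. \<forall>g\<in>R. \<delta> (\<lambda>x\<in>X. f x * g x) = f e * \<delta> g + \<delta> f * g e)}"

text \<open>The Lie algebra of a closed subgroup \<open>H\<close>, inside the tangent space of \<open>G\<close> at the identity.\<close>

definition lie_algebra_of ::
  "'g monoid \<Rightarrow> ('g \<Rightarrow> 'k::field) set \<Rightarrow> 'g set \<Rightarrow> (('g \<Rightarrow> 'k) \<Rightarrow> 'k) set" where
  "lie_algebra_of G R H = {\<delta> \<in> tangent_space (carrier G) R \<one>\<^bsub>G\<^esub>.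
     \<forall>f\<in>R. (\<forall>h\<in>H. f h = 0) \<longrightarrow> \<delta> f = 0}"

definition diagonal_group :: "nat \<Rightarrow> 'k::field mat monoid" where
  "diagonal_group n =
    \<lparr>carrier = {M \<in> carrier_mat n n. diagonal_mat M \<and> invertible_mat M},
     monoid.mult = (*),
     one = 1\<^sub>m n\<rparr>"

definition diagonal_group_functions :: "nat \<Rightarrow> ('k::field mat \<Rightarrow> 'k) set" where
  "diagonal_group_functions n = function_algebra (carrier (diagonal_group n))
     ({(\<lambda>M. M $$ (i, j)) |i j. i < n \<and> j < n} \<union> {\<lambda>M. inverse (det M)})"


section \<open>Outer automorphisms\<close>

definition algebra_automorphisms :: "('k::field, 'a) module \<Rightarrow> ('a \<Rightarrow> 'a) set" where
  "algebra_automorphisms A =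
     Bij (carrier A) \<inter> Ring.ring_hom A A \<inter> module_hom class_ring A A"

definition Aut :: "('k::field, 'a) module \<Rightarrow> ('a \<Rightarrow> 'a) monoid" where
  "Aut A = BijGroup (carrier A)\<lparr>carrier := algebra_automorphisms A\<rparr>"

text \<open>
  The coordinate ring of \<open>Aut A\<close> as a closed subgroup of the general linear group of the
  finite-dimensional space \<open>A\<close>: the entries of the inverse matrix generate the same ring as the
  inverse of the determinant does.
\<close>

definition linear_functionals :: "('k::field, 'a) module \<Rightarrow> ('a \<Rightarrow> 'k) set" where
  "linear_functionals A = {l.
     (\<forall>x\<in>carrier A. \<forall>y\<in>carrier A. l (x \<oplus>\<^bsub>A\<^esub> y) = l x + l y) \<and>
     (\<forall>c. \<forall>x\<in>carrier A. l (c \<odot>\<^bsub>A\<^esub> x) = c * l x)}"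

definition Aut_functions :: "('k::field, 'a) module \<Rightarrow> (('a \<Rightarrow> 'a) \<Rightarrow> 'k) set" where
  "Aut_functions A = function_algebra (carrier (Aut A))
     ({(\<lambda>\<phi>. l (\<phi> a)) |l a. l \<in> linear_functionals A \<and> a \<in> carrier A} \<union>
      {(\<lambda>\<phi>. l ((inv\<^bsub>Aut A\<^esub> \<phi>) a)) |l a. l \<in> linear_functionals A \<and> a \<in> carrier A})"

definition inner_automorphisms :: "('k::field, 'a) module \<Rightarrow> ('a \<Rightarrow> 'a) set" where
  "inner_automorphisms A =
     {(\<lambda>x\<in>carrier A. u \<otimes>\<^bsub>A\<^esub> x \<otimes>\<^bsub>A\<^esub> inv\<^bsub>A\<^esub> u) |u. u \<in> Units A}"

definition Out :: "('k::field, 'a) module \<Rightarrow> ('a \<Rightarrow> 'a) set monoid" where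
  "Out A = Aut A Mod inner_automorphisms A"

definition pullback_to_Aut ::
  "('k::field, 'a) module \<Rightarrow> (('a \<Rightarrow> 'a) set \<Rightarrow> 'k) \<Rightarrow> ('a \<Rightarrow> 'a) \<Rightarrow> 'k" where
  "pullback_to_Aut A F =
     (\<lambda>\<phi>\<in>carrier (Aut A). F (inner_automorphisms A #>\<^bsub>Aut A\<^esub> \<phi>))"

text \<open>
  The coordinate ring of a quotient of an affine algebraic group by a closed normal subgroup
  consists of the regular functions that are constant on cosets.
\<close>

definition Out_functions :: "('k::field, 'a) module \<Rightarrow> (('a \<Rightarrow> 'a) set \<Rightarrow> 'k) set" where
  "Out_functions A =
     {F \<in> extensional (carrier (Out A)). pullback_to_Aut A F \<in> Aut_functions A}"


section \<open>Tori in characteristic zero\<close>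

text \<open>
  The identification of \<open>HH1 A\<close> with the Lie algebra of \<open>Out A\<close>. A derivation \<open>D\<close> corresponds
  to the tangent vector \<open>\<epsilon>\<close> of \<open>Aut A\<close> at the identity whose value at the matrix coefficient
  \<open>\<phi> \<mapsto> l (\<phi> a)\<close> is \<open>l (D a)\<close>, and the class of \<open>D\<close> corresponds to the image of \<open>\<epsilon>\<close> under the
  differential of the projection from \<open>Aut A\<close> to \<open>Out A\<close>.
\<close>

definition derivation_tangent ::
  "('k::field, 'a) module \<Rightarrow> ('a \<Rightarrow> 'a) \<Rightarrow> ((('a \<Rightarrow> 'a) \<Rightarrow> 'k) \<Rightarrow> 'k) \<Rightarrow> bool" where
  "derivation_tangent A D \<epsilon> \<longleftrightarrow>
     \<epsilon> \<in> tangent_space (carrier (Aut A)) (Aut_functions A) \<one>\<^bsub>Aut A\<^esub> \<and>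
     (\<forall>l\<in>linear_functionals A. \<forall>a\<in>carrier A.
        \<epsilon> (\<lambda>\<phi>\<in>carrier (Aut A). l (\<phi> a)) = l (D a))"

definition HH1_tangent ::
  "('k::field, 'a) module \<Rightarrow> ('a \<Rightarrow> 'a) set \<Rightarrow> ((('a \<Rightarrow> 'a) set \<Rightarrow> 'k) \<Rightarrow> 'k) \<Rightarrow> bool" where
  "HH1_tangent A x \<delta> \<longleftrightarrow> (\<exists>D\<in>x. \<exists>\<epsilon>. derivation_tangent A D \<epsilon> \<and>
     \<delta> = (\<lambda>F\<in>Out_functions A. \<epsilon> (pullback_to_Aut A F)))"

definition HH1_lie_algebra_of ::
  "('k::field, 'a) module \<Rightarrow> ('a \<Rightarrow> 'a) set set \<Rightarrow> ('a \<Rightarrow> 'a) set set" where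
  "HH1_lie_algebra_of A H = {x \<in> carrier (HH1 A).
     \<exists>\<delta>\<in>lie_algebra_of (Out A) (Out_functions A) H. HH1_tangent A x \<delta>}"

definition torus_char_0 :: "('k::field, 'a) module \<Rightarrow> ('a \<Rightarrow> 'a) set set \<Rightarrow> bool" where
  "torus_char_0 A T \<longleftrightarrow> lie_subalgebra (HH1 A) T \<and>
     (\<exists>H. closed_subgroup (Out A) (Out_functions A) H \<and>
       (\<exists>n \<phi>. algebraic_group_iso
          (Out A\<lparr>carrier := H\<rparr>) ((\<lambda>f. restrict f H) ` Out_functions A)
          (diagonal_group n) (diagonal_group_functions n) \<phi>) \<and>
       T = HH1_lie_algebra_of A H)"


section \<open>The maximal toral rank\<close>

definition torus :: "('k::field, 'a) module \<Rightarrow> ('a \<Rightarrow> 'a) set set \<Rightarrow> bool" where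
  "torus A T \<longleftrightarrow> (if CHAR('k) = 0 then torus_char_0 A T else torus_char_p A T)"

definition mt_rank :: "('k::field, 'a) module \<Rightarrow> nat" where
  "mt_rank A = Max {vectorspace.dim class_ring (HH1 A\<lparr>carrier := T\<rparr>) |T. torus A T}"

end

theory Submission
  imports Defs
begin

text \<open>
  Over a forest any two parallel paths coincide, so every derivation is inner up to a rescaling of the arrows, and
  a rescaling over a forest is inner as well; hence the first Hochschild cohomology vanishes. If the underlying
  graph contains a cycle, then the derivation that counts an arrow of the cycle in a path descends to \<open>A\<close>, because
  all paths in a minimal relation have the same arrows, and it is not inner, because inner derivations have sum
  zero along cycles. In characteristic \<open>p\<close> this derivation is its own \<open>p\<close>-th power and spans a torus.

  In characteristic zero it has to be tangent to a closed one-dimensional torus of \<open>Out A\<close>, namely the classes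
  of the rescalings of one arrow. Closedness needs invariants of an automorphism \<open>phi\<close> modulo inner ones. The
  associated graded automorphism of \<open>phi\<close> for the filtration by path length is a rescaling if and only if certain
  products of matrix entries of \<open>phi\<close> and its inverse vanish, and a rescaling is determined modulo conjugations by
  its products along cycles. The remaining unipotent part of \<open>phi\<close> is brought, degree by degree and by regular
  formulas, into a normal form modulo inner automorphisms, whose entries are regular invariants.
\<close>

no_notation vwalk_join (infixr \<open>\<oplus>\<close> 65)

section \<open>Cycles of the underlying graph\<close>

text \<open>Beyond the multiplication of path classes, three features of \<open>A\<close> carry the
  argument, and \<open>path_quotient\<close> isolates them: operators \<open>T chi\<close> scaling
  each path class by an arbitrary function of its multiset of arrows, coordinates of vertices and
  arrows, and vanishing of long paths. Path classes may be linearly dependent, so linear statements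
  are proved by induction over a spanning set; the freedom in \<open>chi\<close> yields rescalings,
  counting derivations and length projections at once.

  The coordinate ring of \<open>Out A\<close> consists of the regular functions on
  \<open>Aut A\<close> that are constant on cosets, so closedness must be witnessed by explicit
  functions of this kind. This is why the invariants are products in which the weights of a
  conjugation cancel, and why the normal form uses polynomial formulas only. Forests need closedness
  too: \<open>mt_rank\<close> is a \<open>Max\<close>, so some torus must exist, and even the
  trivial subgroup has to be shown closed. The cycle is chosen with coefficient exactly 1 at the
  chosen arrow: this gives a nonzero class in every characteristic and a coordinate identifying the
  torus with the multiplicative group.\<close>

locale arrow_set =
  fixes V :: "'v set" and E :: "'e set" and s t :: "'e => 'v"
  assumes finV: "finite V" and finE: "finite E"
    and s_in: "e \<in> E ==> s e \<in> V" and t_in: "e \<in> E ==> t e \<in> V"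
begin

definition edge_rel :: "'e set => ('v \<times> 'v) set" where
  "edge_rel F = (\<Union>e\<in>F. {(s e, t e), (t e, s e)})"

definition conn :: "'e set => ('v \<times> 'v) set" where
  "conn F = (edge_rel F)\<^sup>*"

text \<open>Cellular boundary of an integral 1-chain of the underlying graph, so that
  \<open>cycles\<close> is its first homology up to values outside \<open>E\<close>, which are
  ignored. The coefficients are integers because chains also occur as exponents, in
  \<open>cochain_power\<close>.\<close>

definition boundary :: "('e => int) => 'v => int" where
  "boundary z v = (\<Sum>e\<in>E. z e * (of_bool (t e = v) - of_bool (s e = v)))"

definition cycles :: "('e => int) set" where
  "cycles = {z. \<forall>v. boundary z v = 0}"

lemma sym_edge_rel: "sym (edge_rel F)"
  by (auto simp: sym_def edge_rel_def)

lemma equiv_conn: "equiv UNIV (conn F)"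
  by (auto simp: equiv_def conn_def refl_rtrancl trans_rtrancl sym_edge_rel sym_rtrancl)

lemma conn_sym: "(x, y) \<in> conn F ==> (y, x) \<in> conn F"
  using equiv_conn by (metis equiv_def symD)

lemma conn_trans: "(x, y) \<in> conn F ==> (y, z) \<in> conn F ==> (x, z) \<in> conn F"
  using equiv_conn by (metis equiv_def transD)

lemma conn_refl [simp]: "(x, x) \<in> conn F"
  by (simp add: conn_def)

lemma conn_mono: "F \<subseteq> F' ==> conn F \<subseteq> conn F'"
  unfolding conn_def by (rule rtrancl_mono) (auto simp: edge_rel_def)

lemma conn_arrow: "e \<in> F ==> (s e, t e) \<in> conn F"
  unfolding conn_def by (rule r_into_rtrancl) (auto simp: edge_rel_def)

text \<open>Crossing the new arrow a second time leads back to an end that was already reached, so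
  at most one crossing, in one of the two directions, is ever needed.\<close>

lemma conn_insert:
  "(x, y) \<in> conn (insert e F) \<longleftrightarrow> (x, y) \<in> conn F \<or>
     ((x, s e) \<in> conn F \<and> (t e, y) \<in> conn F) \<or> ((x, t e) \<in> conn F \<and> (s e, y) \<in> conn F)"
(is "_ \<longleftrightarrow> ?c x y")
proof
  assume "(x, y) \<in> conn (insert e F)"
  then show "?c x y" unfolding conn_def[of "insert e F"]
  proof (induction rule: rtrancl_induct)
    case base
    show ?case by simp
  next
    case (step y y')
    have "(y, y') \<in> edge_rel F \<or> (y = s e \<and> y' = t e) \<or> (y = t e \<and> y' = s e)"
      using step.hyps(2) by (auto simp: edge_rel_def)
    then show ?case
    proof (elim disjE conjE)
      assume "(y, y') \<in> edge_rel F"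
      then have "(y, y') \<in> conn F" by (simp add: conn_def r_into_rtrancl)
      then show ?thesis using step.IH conn_trans[of _ y F y'] by blast
    next
      assume "y = s e" "y' = t e"
      then show ?thesis using step.IH conn_trans[of x "s e" F "t e"] conn_sym[of "t e" "s e" F] conn_refl
        by blast
    next
      assume "y = t e" "y' = s e"
      then show ?thesis using step.IH conn_trans[of x "t e" F "s e"] conn_sym[of "s e" "t e" F] conn_refl
        by blast
    qed
  qed
next
  have sub: "conn F \<subseteq> conn (insert e F)" by (rule conn_mono) auto
  have st: "(s e, t e) \<in> conn (insert e F)" "(t e, s e) \<in> conn (insert e F)"
    using conn_arrow[of e "insert e F"] conn_sym by auto
  assume "?c x y"
  then show "(x, y) \<in> conn (insert e F)"
    using sub st conn_trans[of x "s e" "insert e F" "t e"] conn_trans[of x "t e" "insert e F" y]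
      conn_trans[of x "t e" "insert e F" "s e"] conn_trans[of x "s e" "insert e F" y] by blast
qed

text \<open>An arrow inside one class leaves the relation unchanged; an arrow between two classes
  merges exactly these two.\<close>

lemma card_components_insert:
  assumes "e \<in> E"
  shows "int (card (V // conn (insert e F))) =
    int (card (V // conn F)) - of_bool ((s e, t e) \<notin> conn F)"
proof (cases "(s e, t e) \<in> conn F")
  case True
  have "(x, y) \<in> conn (insert e F) \<longleftrightarrow> (x, y) \<in> conn F" for x y
    using conn_insert[of x y e F] True conn_sym[OF True] conn_trans[of x "s e" F "t e"]
      conn_trans[of x "t e" F "s e"] conn_trans[of x "s e" F y] conn_trans[of x "t e" F y] by blast
  then have "conn (insert e F) = conn F" by auto
  then show ?thesis using True by simp
next
  case False
  let ?R = "conn F" and ?R' = "conn (insert e F)"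
  define q where "q C = ?R' `` C" for C
  have sub: "?R \<subseteq> ?R'" by (rule conn_mono) auto
  have q_class: "q (?R `` {v}) = ?R' `` {v}" for v
    unfolding q_def using sub conn_trans[of v _ "insert e F"] conn_refl[of v F] by blast
  have fin: "finite (V // ?R)" using finV by (simp add: quotient_def)
  let ?T = "?R `` {t e}"
  have T_in: "?T \<in> V // ?R" using t_in[OF assms] by (rule quotientI)
  have S_in: "?R `` {s e} \<in> V // ?R" using s_in[OF assms] by (rule quotientI)
  have S_T: "?R `` {s e} \<noteq> ?T" using False conn_sym conn_refl by blast
  \<comment> \<open>The classes of the two ends of \<open>e\<close> are the only ones that
    \<open>q\<close> identifies, so omitting one of them makes \<open>q\<close> bijective.\<close>
  have "bij_betw q (V // ?R - {?T}) (V // ?R')"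
    unfolding bij_betw_def
  proof
    show "inj_on q (V // ?R - {?T})"
    proof (rule inj_onI)
      fix C D assume C: "C \<in> V // ?R - {?T}" and D: "D \<in> V // ?R - {?T}" and eq: "q C = q D"
      obtain u v where uv: "C = ?R `` {u}" "D = ?R `` {v}"
        using C D by (auto elim!: quotientE)
      have "(u, v) \<in> ?R'" using eq uv q_class conn_refl by (metis Image_singleton_iff)
      moreover have "(u, t e) \<notin> ?R" "(v, t e) \<notin> ?R"
        using C D uv equiv_class_eq[OF equiv_conn] by auto
      ultimately have "(u, v) \<in> ?R" using conn_sym by (auto simp: conn_insert)
      then show "C = D" using uv equiv_class_eq[OF equiv_conn] by auto
    qed
    show "q ` (V // ?R - {?T}) = V // ?R'"
    proof (intro equalityI subsetI)
      fix D assume "D \<in> q ` (V // ?R - {?T})"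
      then obtain C where "D = q C" "C \<in> V // ?R" by blast
      then obtain v where "v \<in> V" "D = q (?R `` {v})" by (auto elim!: quotientE)
      then show "D \<in> V // ?R'" using q_class by (auto intro: quotientI)
    next
      fix C assume "C \<in> V // ?R'"
      then obtain v where v: "v \<in> V" "C = ?R' `` {v}" by (auto elim!: quotientE)
      show "C \<in> q ` (V // ?R - {?T})"
      proof (cases "?R `` {v} = ?T")
        case True
        then have "(t e, v) \<in> ?R" using conn_refl by blast
        then have "(s e, v) \<in> ?R'" by (simp add: conn_insert)
        then have "C = q (?R `` {s e})"
          using v q_class equiv_class_eq[OF equiv_conn] by metis
        then show ?thesis using S_in S_T by blast
      next
        case False
        then show ?thesis using v q_class quotientI[OF v(1)] by (metis Diff_iff imageI singletonD)
      qed
    qed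
  qed
  then have "card (V // ?R') = card (V // ?R - {?T})" by (simp add: bij_betw_same_card)
  also have "\<dots> = card (V // ?R) - 1" using T_in by simp
  finally show ?thesis using False T_in fin
    by (simp add: of_nat_diff card_gt_0_iff Suc_leI) (metis card_gt_0_iff empty_iff One_nat_def Suc_leI of_nat_1 of_nat_diff)
qed

text \<open>Induction on the arrows: an arrow between vertices already connected raises the number
  by one, any other arrow leaves it unchanged. Starting from 0 it stays nonnegative and becomes
  positive only after some arrow has closed a cycle.\<close>

lemma cycle_space_rank:
  assumes "F \<subseteq> E"
  shows "int (card F) - int (card V) + int (card (V // conn F)) \<ge> 0 \<and>
    (int (card F) - int (card V) + int (card (V // conn F)) > 0 \<longrightarrow>
      (\<exists>a\<in>F. (s a, t a) \<in> conn (F - {a})))"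
proof -
  have "finite F" using assms finE finite_subset by blast
  then show ?thesis using assms
  proof (induction F rule: finite_induct)
    case empty
    have "V // conn {} = (\<lambda>v. {v}) ` V"
      by (auto simp: quotient_def conn_def edge_rel_def)
    then show ?case by (simp add: card_image)
  next
    case (insert e F)
    note IH = insert.IH
    have e: "e \<in> E" and F: "F \<subseteq> E" using insert.prems by auto
    note c = card_components_insert[OF e, of F]
    show ?case
    proof (cases "(s e, t e) \<in> conn F")
      case True
      then have "(s e, t e) \<in> conn (insert e F - {e})" using insert.hyps by simp
      then show ?thesis using c True IH[OF F] insert.hyps by auto
    next
      case False
      have *: "int (card (insert e F)) - int (card V) + int (card (V // conn (insert e F)))
        = int (card F) - int (card V) + int (card (V // conn F))"
        using c False insert.hyps by simp
      have "\<exists>a\<in>insert e F. (s a, t a) \<in> conn (insert e F - {a})"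
        if ex: "\<exists>a\<in>F. (s a, t a) \<in> conn (F - {a})"
      proof -
        obtain a where a: "a \<in> F" "(s a, t a) \<in> conn (F - {a})" using ex by auto
        have "(s a, t a) \<in> conn (insert e F - {a})"
          using a(2) conn_mono[of "F - {a}" "insert e F - {a}"] by blast
        then show ?thesis using a by blast
      qed
      then show ?thesis using IH[OF F] * by auto
    qed
  qed
qed

section \<open>Chains, boundaries and bridges\<close>

lemma boundary_add: "boundary (\<lambda>e. y e + z e) v = boundary y v + boundary z v"
  by (simp add: boundary_def sum.distrib[symmetric] algebra_simps)

lemma boundary_diff: "boundary (\<lambda>e. y e - z e) v = boundary y v - boundary z v"
  by (simp add: boundary_def sum_subtractf[symmetric] algebra_simps)

lemma boundary_cmult: "boundary (\<lambda>e. a * z e) v = a * boundary z v"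
  by (simp add: boundary_def sum_distrib_left algebra_simps)

lemma boundary_arrow:
  assumes "e \<in> E"
  shows "boundary (\<lambda>f. of_bool (f = e)) v = of_bool (t e = v) - of_bool (s e = v)"
proof -
  have "boundary (\<lambda>f. of_bool (f = e)) v =
    (\<Sum>f\<in>E. if f = e then of_bool (t e = v) - of_bool (s e = v) else 0)"
    unfolding boundary_def by (rule sum.cong) auto
  then show ?thesis using assms finE by simp
qed

text \<open>A walk from \<open>u\<close> to \<open>v\<close>, each arrow counted with the sign of
  its direction, is such a chain.\<close>

lemma chain_of_conn:
  assumes "(u, v) \<in> conn F" "F \<subseteq> E"
  shows "\<exists>z. (\<forall>e. e \<notin> F \<longrightarrow> z e = 0) \<and> (\<forall>w. boundary z w = of_bool (v = w) - of_bool (u = w))"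
  using assms(1) unfolding conn_def
proof (induction rule: rtrancl_induct)
  case base
  show ?case by (rule exI[of _ "\<lambda>_. 0"]) (simp add: boundary_def)
next
  case (step y y')
  obtain z where z: "\<forall>e. e \<notin> F \<longrightarrow> z e = 0"
    "\<forall>w. boundary z w = of_bool (y = w) - of_bool (u = w)" using step.IH by auto
  obtain e where e: "e \<in> F" "(y, y') = (s e, t e) \<or> (y, y') = (t e, s e)"
    using step.hyps(2) by (auto simp: edge_rel_def)
  have eE: "e \<in> E" using e assms(2) by auto
  from e(2) show ?case
  proof
    assume "(y, y') = (s e, t e)"
    then show ?thesis using z e(1) eE
      by (intro exI[of _ "\<lambda>f. z f + of_bool (f = e)"]) (auto simp: boundary_add boundary_arrow)
  next
    assume "(y, y') = (t e, s e)"
    then show ?thesis using z e(1) eE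
      by (intro exI[of _ "\<lambda>f. z f - of_bool (f = e)"]) (auto simp: boundary_diff boundary_arrow)
  qed
qed

text \<open>Summation by parts: the boundary is adjoint to the coboundary
  \<open>f (t e) - f (s e)\<close>.\<close>

lemma sum_boundary:
  fixes f :: "'v => int"
  shows "(\<Sum>v\<in>V. f v * boundary z v) = (\<Sum>e\<in>E. z e * (f (t e) - f (s e)))"
proof -
  have "(\<Sum>v\<in>V. f v * boundary z v) =
    (\<Sum>v\<in>V. \<Sum>e\<in>E. z e * (f v * of_bool (t e = v) - f v * of_bool (s e = v)))"
    by (simp add: boundary_def sum_distrib_left algebra_simps)
  also have "\<dots> = (\<Sum>e\<in>E. \<Sum>v\<in>V. z e * (f v * of_bool (t e = v) - f v * of_bool (s e = v)))"
    by (rule sum.swap)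
  also have "\<dots> = (\<Sum>e\<in>E. z e * (f (t e) - f (s e)))"
  proof (rule sum.cong)
    fix e assume e: "e \<in> E"
    have "(\<Sum>v\<in>V. f v * of_bool (t e = v)) = f (t e)" "(\<Sum>v\<in>V. f v * of_bool (s e = v)) = f (s e)"
      using finV t_in[OF e] s_in[OF e] by (simp_all add: of_bool_def if_distrib cong: if_cong)
    then show "(\<Sum>v\<in>V. z e * (f v * of_bool (t e = v) - f v * of_bool (s e = v))) =
      z e * (f (t e) - f (s e))"
      by (simp add: sum_distrib_left[symmetric] sum_subtractf)
  qed simp
  finally show ?thesis .
qed

text \<open>Pair the cycle with the indicator function of the component of \<open>s b\<close> after
  deletion of \<open>b\<close>. The coboundary of this function vanishes on every arrow except
  \<open>b\<close>.\<close>

lemma bridge_cycle_zero: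
  assumes b: "b \<in> E" and nc: "(s b, t b) \<notin> conn (E - {b})" and z: "z \<in> cycles"
  shows "z b = 0"
proof -
  define f where "f v = (of_bool ((s b, v) \<in> conn (E - {b})) :: int)" for v
  have "0 = (\<Sum>v\<in>V. f v * boundary z v)" using z by (simp add: cycles_def)
  also have "\<dots> = (\<Sum>e\<in>E. z e * (f (t e) - f (s e)))" by (rule sum_boundary)
  also have "\<dots> = (\<Sum>e\<in>E. if e = b then - z b else 0)"
  proof (rule sum.cong)
    fix e assume e: "e \<in> E"
    show "z e * (f (t e) - f (s e)) = (if e = b then - z b else 0)"
    proof (cases "e = b")
      case False
      then have "(s e, t e) \<in> conn (E - {b})" using e conn_arrow by auto
      then have "(s b, t e) \<in> conn (E - {b}) \<longleftrightarrow> (s b, s e) \<in> conn (E - {b})"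
        using conn_trans[of "s b" "s e" "E - {b}" "t e"] conn_trans[of "s b" "t e" "E - {b}" "s e"]
          conn_sym[of "s e" "t e" "E - {b}"] by blast
      then have "f (t e) = f (s e)" by (simp add: f_def)
      then show ?thesis using False by simp
    next
      case True
      then show ?thesis using nc by (simp add: f_def)
    qed
  qed simp
  finally show ?thesis using b finE by simp
qed

text \<open>In a forest every arrow is a bridge: deleting an arrow whose ends stay connected would
  keep the components and make the cycle rank negative.\<close>

lemma forest_cycles:
  assumes "int (card E) - int (card V) + int (card (V // conn E)) = 0" and "z \<in> cycles" "e \<in> E"
  shows "z e = 0"
proof (rule bridge_cycle_zero[OF assms(3) _ assms(2)])
  show "(s e, t e) \<notin> conn (E - {e})"
  proof
    assume a: "(s e, t e) \<in> conn (E - {e})"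
    have "card E = Suc (card (E - {e}))" using assms(3) finE by (metis card_Suc_Diff1)
    moreover have "card (V // conn E) = card (V // conn (E - {e}))"
      using card_components_insert[OF assms(3), of "E - {e}"] a assms(3) by (simp add: insert_absorb)
    moreover have "int (card (E - {e})) - int (card V) + int (card (V // conn (E - {e}))) \<ge> 0"
      using cycle_space_rank[of "E - {e}"] by auto
    ultimately show False using assms(1) by simp
  qed
qed

text \<open>The arrow \<open>a\<close> closes up a chain that runs through the other arrows only,
  which is why its coefficient is 1 and not merely nonzero. This value survives in every
  characteristic and later makes the circulation along \<open>z\<close> a coordinate of the
  torus.\<close>

lemma nonforest_cycle:
  assumes "int (card E) - int (card V) + int (card (V // conn E)) \<noteq> 0"
  obtains a z where "a \<in> E" "z \<in> cycles" "z a = 1"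
proof -
  obtain a where a: "a \<in> E" "(s a, t a) \<in> conn (E - {a})"
    using cycle_space_rank[of E] assms by force
  obtain z where z: "\<forall>e. e \<notin> E - {a} \<longrightarrow> z e = 0"
    "\<forall>w. boundary z w = of_bool (t a = w) - of_bool (s a = w)"
    using chain_of_conn[OF a(2)] by auto
  have "boundary (\<lambda>e. of_bool (e = a) - z e) v = 0" for v
    using z(2) a(1) by (simp add: boundary_diff boundary_arrow)
  then have "(\<lambda>e. of_bool (e = a) - z e) \<in> cycles" by (simp add: cycles_def)
  moreover have "of_bool (a = a) - z a = 1" using z(1) by simp
  ultimately show thesis using that a(1) by blast
qed

section \<open>Potentials of cochains that are trivial on cycles\<close>

definition chain_to :: "'v => 'v => ('e => int) => bool" where
  "chain_to u v z \<longleftrightarrow> (\<forall>w. boundary z w = of_bool (v = w) - of_bool (u = w))"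

text \<open>The root of \<open>v\<close> is chosen by \<open>SOME\<close> from a predicate that is
  the same for both ends of an arrow, so roots agree along arrows without choosing representatives
  of components.\<close>

lemma rooted_chains:
  obtains r Z where "\<And>v. chain_to (r v) v (Z v)" "\<And>e. e \<in> E ==> r (s e) = r (t e)"
proof -
  have eq: "(\<exists>z. chain_to u (s e) z) \<longleftrightarrow> (\<exists>z. chain_to u (t e) z)" if e: "e \<in> E" for e u
  proof
    assume "\<exists>z. chain_to u (s e) z"
    then obtain z where "chain_to u (s e) z" ..
    then have "chain_to u (t e) (\<lambda>f. z f + of_bool (f = e))"
      using e by (simp add: chain_to_def boundary_add boundary_arrow)
    then show "\<exists>z. chain_to u (t e) z" by blast
  next
    assume "\<exists>z. chain_to u (t e) z"
    then obtain z where "chain_to u (t e) z" ..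
    then have "chain_to u (s e) (\<lambda>f. z f - of_bool (f = e))"
      using e by (simp add: chain_to_def boundary_diff boundary_arrow)
    then show "\<exists>z. chain_to u (s e) z" by blast
  qed
  define r where "r v = (SOME u. \<exists>z. chain_to u v z)" for v
  have "\<exists>u z. chain_to u v z" for v
    by (rule exI[of _ v], rule exI[of _ "\<lambda>_. 0"]) (simp add: chain_to_def boundary_def)
  then have "\<exists>z. chain_to (r v) v z" for v unfolding r_def by (rule someI_ex)
  then obtain Z where "\<And>v. chain_to (r v) v (Z v)" by metis
  moreover have "r (s e) = r (t e)" if "e \<in> E" for e
    unfolding r_def using eq[OF that] by simp
  ultimately show thesis using that by blast
qed

text \<open>The fundamental cycle of \<open>e\<close>: from the root to \<open>s e\<close>, along
  \<open>e\<close>, and back from \<open>t e\<close>.\<close>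

lemma arrow_chain_cycle:
  assumes "chain_to r (s e) y" "chain_to r (t e) z" "e \<in> E"
  shows "(\<lambda>f. y f + of_bool (f = e) - z f) \<in> cycles"
  using assms by (simp add: cycles_def chain_to_def boundary_add boundary_diff boundary_arrow)

text \<open>The multiplicative 1-cochain \<open>c\<close> evaluated on the chain
  \<open>z\<close>.\<close>

definition cochain_power :: "('e => 'k::field) => ('e => int) => 'k" where
  "cochain_power c z = (\<Prod>e\<in>E. c e powi z e)"

lemma cochain_power_add:
  "(\<And>e. e \<in> E ==> c e \<noteq> 0) ==>
    cochain_power c (\<lambda>e. y e + z e) = cochain_power c y * cochain_power c z"
  unfolding cochain_power_def prod.distrib[symmetric]
  by (rule prod.cong) (simp_all add: power_int_add)

lemma cochain_power_diff:
  "(\<And>e. e \<in> E ==> c e \<noteq> 0) ==>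
    cochain_power c (\<lambda>e. y e - z e) = cochain_power c y / cochain_power c z"
  unfolding cochain_power_def prod_dividef[symmetric]
  by (rule prod.cong) (simp_all add: power_int_diff)

lemma cochain_power_arrow:
  assumes "e \<in> E" shows "cochain_power c (\<lambda>f. of_bool (f = e)) = c e"
proof -
  have "cochain_power c (\<lambda>f. of_bool (f = e)) = (\<Prod>f\<in>E. if f = e then c e else 1)"
    unfolding cochain_power_def by (rule prod.cong) auto
  then show ?thesis using assms finE by simp
qed

lemma cochain_power_nonzero:
  "(\<And>e. e \<in> E ==> c e \<noteq> 0) ==> cochain_power c z \<noteq> 0"
  using finE by (auto simp: cochain_power_def)

text \<open>The potential at \<open>v\<close> is the inverse of the value of \<open>c\<close> on the
  chain from the root to \<open>v\<close>; its failure at an arrow would be the value of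
  \<open>c\<close> on the fundamental cycle of that arrow.\<close>

lemma multiplicative_potential:
  fixes c :: "'e => 'k::field"
  assumes nz: "\<And>e. e \<in> E ==> c e \<noteq> 0" and one: "\<And>z. z \<in> cycles ==> cochain_power c z = 1"
  obtains tau where "\<And>v. tau v \<noteq> 0" "\<And>e. e \<in> E ==> c e = tau (s e) / tau (t e)"
proof -
  obtain r Z where r: "\<And>v. chain_to (r v) v (Z v)" "\<And>e. e \<in> E ==> r (s e) = r (t e)"
    by (rule rooted_chains) blast
  define tau where "tau v = inverse (cochain_power c (Z v))" for v
  have "c e = tau (s e) / tau (t e)" if e: "e \<in> E" for e
  proof -
    have "(\<lambda>f. Z (s e) f + of_bool (f = e) - Z (t e) f) \<in> cycles"
      using arrow_chain_cycle r e by metis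
    then have "1 = cochain_power c (\<lambda>f. Z (s e) f + of_bool (f = e) - Z (t e) f)" using one by simp
    also have "\<dots> = cochain_power c (Z (s e)) * c e / cochain_power c (Z (t e))"
      using nz e by (simp add: cochain_power_add cochain_power_diff cochain_power_arrow)
    finally show ?thesis
      using cochain_power_nonzero[of c, OF nz] by (simp add: tau_def field_simps)
  qed
  moreover have "tau v \<noteq> 0" for v using cochain_power_nonzero[of c, OF nz] by (simp add: tau_def)
  ultimately show thesis using that by blast
qed

text \<open>Additive counterpart, for derivations in place of automorphisms.\<close>

lemma additive_potential:
  fixes d :: "'e => 'k::field"
  assumes zero: "\<And>z. z \<in> cycles ==> (\<Sum>e\<in>E. of_int (z e) * d e) = 0"
  obtains tau where "\<And>e. e \<in> E ==> d e = tau (s e) - tau (t e)"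
proof -
  obtain r Z where r: "\<And>v. chain_to (r v) v (Z v)" "\<And>e. e \<in> E ==> r (s e) = r (t e)"
    by (rule rooted_chains) blast
  define tau where "tau v = - (\<Sum>f\<in>E. of_int (Z v f) * d f)" for v
  have "d e = tau (s e) - tau (t e)" if e: "e \<in> E" for e
  proof -
    have "(\<lambda>f. Z (s e) f + of_bool (f = e) - Z (t e) f) \<in> cycles"
      using arrow_chain_cycle r e by metis
    then have "0 = (\<Sum>f\<in>E. of_int (Z (s e) f + of_bool (f = e) - Z (t e) f) * d f)"
      by (subst zero) auto
    also have "\<dots> = - tau (s e) + (\<Sum>f\<in>E. of_bool (f = e) * d f) + tau (t e)"
      by (simp add: tau_def algebra_simps sum.distrib sum_subtractf)
    also have "(\<Sum>f\<in>E. of_bool (f = e) * d f) = (\<Sum>f\<in>E. if f = e then d e else 0)"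
      by (rule sum.cong) auto
    also have "\<dots> = d e" using e finE by simp
    finally show ?thesis by (simp add: algebra_simps)
  qed
  then show thesis using that by blast
qed

text \<open>Regrouping the product by vertices turns the exponent of \<open>tau v\<close> into minus
  the boundary of \<open>z\<close> at \<open>v\<close>.\<close>

lemma cochain_power_coboundary:
  fixes tau :: "'v => 'k::field"
  assumes z: "z \<in> cycles" and nz: "\<And>v. tau v \<noteq> 0"
  shows "cochain_power (\<lambda>e. tau (s e) / tau (t e)) z = 1"
proof -
  have "cochain_power (\<lambda>e. tau (s e) / tau (t e)) z =
    (\<Prod>e\<in>E. \<Prod>v\<in>V. tau v powi (z e * (of_bool (s e = v) - of_bool (t e = v))))"
    unfolding cochain_power_def
  proof (rule prod.cong)
    fix e assume e: "e \<in> E"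
    have "(\<Prod>v\<in>V. tau v powi (z e * of_bool (s e = v))) = (\<Prod>v\<in>V. if s e = v then tau (s e) powi z e else 1)"
      "(\<Prod>v\<in>V. tau v powi (z e * of_bool (t e = v))) = (\<Prod>v\<in>V. if t e = v then tau (t e) powi z e else 1)"
      by (rule prod.cong; simp)+
    then have *: "(\<Prod>v\<in>V. tau v powi (z e * of_bool (s e = v))) = tau (s e) powi z e"
      "(\<Prod>v\<in>V. tau v powi (z e * of_bool (t e = v))) = tau (t e) powi z e"
      using s_in[OF e] t_in[OF e] finV by simp_all
    have "(\<Prod>v\<in>V. tau v powi (z e * (of_bool (s e = v) - of_bool (t e = v)))) =
      (\<Prod>v\<in>V. tau v powi (z e * of_bool (s e = v)) / tau v powi (z e * of_bool (t e = v)))"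
      by (simp add: right_diff_distrib power_int_diff nz)
    then show "(tau (s e) / tau (t e)) powi z e =
      (\<Prod>v\<in>V. tau v powi (z e * (of_bool (s e = v) - of_bool (t e = v))))"
      by (simp add: prod_dividef * power_int_divide_distrib)
  qed simp
  also have "\<dots> = (\<Prod>v\<in>V. \<Prod>e\<in>E. tau v powi (z e * (of_bool (s e = v) - of_bool (t e = v))))"
    by (rule prod.swap)
  also have "\<dots> = (\<Prod>v\<in>V. tau v powi (- boundary z v))"
  proof (rule prod.cong)
    fix v
    have pow_sum: "(\<Prod>e\<in>F. tau v powi g e) = tau v powi sum g F" if "finite F" for F and g :: "'e => int"
      using that by (induction F rule: finite_induct) (simp_all add: power_int_add nz)
    have "- boundary z v = (\<Sum>e\<in>E. z e * (of_bool (s e = v) - of_bool (t e = v)))"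
      by (simp add: boundary_def sum_negf[symmetric] algebra_simps)
    then show "(\<Prod>e\<in>E. tau v powi (z e * (of_bool (s e = v) - of_bool (t e = v)))) = tau v powi (- boundary z v)"
      using pow_sum[OF finE] by simp
  qed simp
  also have "\<dots> = 1" using z by (simp add: cycles_def)
  finally show ?thesis .
qed

lemma sum_additive_coboundary:
  fixes tau :: "'v => 'k::field"
  assumes z: "z \<in> cycles"
  shows "(\<Sum>e\<in>E. of_int (z e) * (tau (s e) - tau (t e))) = 0"
proof -
  have "(\<Sum>e\<in>E. of_int (z e) * (tau (s e) - tau (t e))) =
    (\<Sum>e\<in>E. \<Sum>v\<in>V. of_int (z e * (of_bool (s e = v) - of_bool (t e = v))) * tau v)"
  proof (rule sum.cong)
    fix e assume e: "e \<in> E"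
    have "(\<Sum>v\<in>V. of_bool (s e = v) * tau v) = (\<Sum>v\<in>V. if s e = v then tau (s e) else 0)"
      "(\<Sum>v\<in>V. of_bool (t e = v) * tau v) = (\<Sum>v\<in>V. if t e = v then tau (t e) else 0)"
      by (rule sum.cong; simp)+
    then have *: "(\<Sum>v\<in>V. of_bool (s e = v) * tau v) = tau (s e)"
      "(\<Sum>v\<in>V. of_bool (t e = v) * tau v) = tau (t e)"
      using s_in[OF e] t_in[OF e] finV by simp_all
    have "(\<Sum>v\<in>V. of_int (z e * (of_bool (s e = v) - of_bool (t e = v))) * tau v) =
      of_int (z e) * ((\<Sum>v\<in>V. of_bool (s e = v) * tau v) - (\<Sum>v\<in>V. of_bool (t e = v) * tau v))"
      by (simp add: sum_subtractf[symmetric] sum_distrib_left algebra_simps)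
    then show "of_int (z e) * (tau (s e) - tau (t e)) =
      (\<Sum>v\<in>V. of_int (z e * (of_bool (s e = v) - of_bool (t e = v))) * tau v)"
      by (simp add: *)
  qed simp
  also have "\<dots> = (\<Sum>v\<in>V. \<Sum>e\<in>E. of_int (z e * (of_bool (s e = v) - of_bool (t e = v))) * tau v)"
    by (rule sum.swap)
  also have "\<dots> = (\<Sum>v\<in>V. of_int (- boundary z v) * tau v)"
  proof (rule sum.cong)
    fix v
    have "(\<Sum>e\<in>E. of_int (z e * (of_bool (s e = v) - of_bool (t e = v)))) = (of_int (- boundary z v) :: 'k)"
      unfolding boundary_def of_int_minus of_int_sum sum_negf[symmetric]
      by (rule sum.cong) (auto simp: algebra_simps)
    then show "(\<Sum>e\<in>E. of_int (z e * (of_bool (s e = v) - of_bool (t e = v))) * tau v) =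
      of_int (- boundary z v) * tau v"
      by (simp add: sum_distrib_right[symmetric])
  qed simp
  also have "\<dots> = 0" using z by (simp add: cycles_def)
  finally show ?thesis .
qed

end

section \<open>Identification with the Betti number of a quiver\<close>

context fin_digraph
begin

sublocale arrow_set "verts G" "arcs G" "tail G" "head G"
  by unfold_locales auto

lemma reachable_symmetrised:
  assumes "u \<in> verts G"
  shows "u \<rightarrow>\<^sup>*\<^bsub>with_proj (mk_symmetric G)\<^esub> v \<longleftrightarrow> (u, v) \<in> conn (arcs G)"
proof -
  interpret S: pair_wf_digraph "mk_symmetric G" by rule
  have W: "wf_digraph (with_proj (mk_symmetric G))" by unfold_locales
  have ends: "arcs_ends (with_proj (mk_symmetric G)) = edge_rel (arcs G)"
    by (auto simp: edge_rel_def arcs_ends_def arc_to_ends_def parcs_mk_symmetric)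
  have "u \<rightarrow>\<^sup>*\<^bsub>with_proj (mk_symmetric G)\<^esub> v" if "(u, v) \<in> conn (arcs G)"
    using that unfolding conn_def
  proof (induction rule: rtrancl_induct)
    case base
    show ?case using assms by (simp add: S.reachable_refl)
  next
    case (step y y')
    then have "(y, y') \<in> arcs_ends (with_proj (mk_symmetric G))" using ends by simp
    with step.IH show ?case by (rule wf_digraph.reachable_adj_trans[OF W])
  qed
  moreover have "(u, v) \<in> conn (arcs G)" if "u \<rightarrow>\<^sup>*\<^bsub>with_proj (mk_symmetric G)\<^esub> v"
    using that ends unfolding conn_def
    by (metis reachable_def rtrancl_on_rtranclI)
  ultimately show ?thesis by blast
qed

text \<open>In the symmetrised digraph reachability is the equivalence relation \<open>conn\<close>,
  so its strongly connected components are the classes counted by the cycle rank.\<close>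

lemma sccs_verts_symmetrised:
  "pre_digraph.sccs_verts (with_proj (mk_symmetric G)) = verts G // conn (arcs G)"
proof -
  interpret S: pair_wf_digraph "mk_symmetric G" by rule
  let ?G = "with_proj (mk_symmetric G)"
  have vG: "u \<in> verts G" "v \<in> verts G" if "u \<rightarrow>\<^sup>*\<^bsub>?G\<^esub> v" for u v
    using S.reachable_in_verts[OF that] by auto
  have inV: "v \<in> verts G" if "u \<in> verts G" "(u, v) \<in> conn (arcs G)" for u v
    using that reachable_symmetrised vG by blast
  show ?thesis
  proof safe
    fix S assume S: "S \<in> pre_digraph.sccs_verts ?G"
    obtain u where u: "u \<in> S" using S by (auto simp: pre_digraph.sccs_verts_def)
    have "u \<rightarrow>\<^sup>*\<^bsub>?G\<^esub> u" using S u by (simp add: pre_digraph.sccs_verts_def)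
    then have uV: "u \<in> verts G" by (rule vG)
    have "S = conn (arcs G) `` {u}"
    proof safe
      fix v assume "v \<in> S"
      then have "u \<rightarrow>\<^sup>*\<^bsub>?G\<^esub> v" using S u by (auto simp: pre_digraph.sccs_verts_def)
      then show "(u, v) \<in> conn (arcs G)" using reachable_symmetrised[OF uV] by simp
    next
      fix v assume c: "(u, v) \<in> conn (arcs G)"
      then have "u \<rightarrow>\<^sup>*\<^bsub>?G\<^esub> v" "v \<rightarrow>\<^sup>*\<^bsub>?G\<^esub> u"
        using reachable_symmetrised[OF uV] reachable_symmetrised[OF inV[OF uV c]] conn_sym by auto
      then show "v \<in> S" using S u by (auto simp: pre_digraph.sccs_verts_def)
    qed
    then show "S \<in> verts G // conn (arcs G)" using uV by (auto intro: quotientI)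
  next
    fix S assume "S \<in> verts G // conn (arcs G)"
    then obtain u where u: "u \<in> verts G" "S = conn (arcs G) `` {u}" by (auto elim!: quotientE)
    have V: "v \<in> verts G" if "v \<in> S" for v using that u inV by auto
    show "S \<in> pre_digraph.sccs_verts ?G"
      unfolding pre_digraph.sccs_verts_def mem_Collect_eq
    proof (intro conjI ballI allI impI)
      show "S \<noteq> {}" using u conn_refl by blast
    next
      fix v w assume "v \<in> S" "w \<in> S"
      then show "v \<rightarrow>\<^sup>*\<^bsub>?G\<^esub> w"
        using reachable_symmetrised[OF V] u conn_sym conn_trans by (metis Image_singleton_iff)
    next
      fix v w assume v: "v \<in> S" and w: "w \<notin> S"
      then have "\<not> v \<rightarrow>\<^sup>*\<^bsub>?G\<^esub> w"
        using reachable_symmetrised[OF V] u conn_trans by (metis Image_singleton_iff)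
      then show "\<not> v \<rightarrow>\<^sup>*\<^bsub>?G\<^esub> w \<or> \<not> w \<rightarrow>\<^sup>*\<^bsub>?G\<^esub> v" ..
    qed
  qed
qed

lemma betti_number_eq:
  "betti_number G = int (card (arcs G)) - int (card (verts G)) + int (card (verts G // conn (arcs G)))"
  by (simp add: betti_number_def sccs_verts_symmetrised)

end

section \<open>Linear algebra over a field type\<close>

lemma vectorspace_class_ringI:
  fixes V :: "('k::field, 'a) module" (structure)
  assumes "abelian_group V"
    and "\<And>c x. x \<in> carrier V ==> c \<odot> x \<in> carrier V"
    and "\<And>c d x. x \<in> carrier V ==> (c + d) \<odot> x = c \<odot> x \<oplus> d \<odot> x"
    and "\<And>c x y. x \<in> carrier V ==> y \<in> carrier V ==> c \<odot> (x \<oplus> y) = c \<odot> x \<oplus> c \<odot> y"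
    and "\<And>c d x. x \<in> carrier V ==> (c * d) \<odot> x = c \<odot> (d \<odot> x)"
    and "\<And>x. x \<in> carrier V ==> 1 \<odot> x = x"
  shows "vectorspace class_ring V"
proof -
  have "Module.module class_ring V"
    by (rule moduleI) (use assms in \<open>auto intro: domain.axioms(1) field.axioms(1) class_field.field_axioms\<close>)
  then show ?thesis
    by (simp add: vectorspace_def class_field.field_axioms)
qed

locale kspace = vectorspace class_ring V for V :: "('k::field, 'a) module" (structure)
begin

lemma smult_in [simp, intro]: "x \<in> carrier V ==> c \<odot> x \<in> carrier V"
  using smult_closed by simp

lemma smult_add_left: "x \<in> carrier V ==> (c + d) \<odot> x = c \<odot> x \<oplus> d \<odot> x"
  using smult_l_distr by simp

lemma smult_add_right: "x \<in> carrier V ==> y \<in> carrier V ==> c \<odot> (x \<oplus> y) = c \<odot> x \<oplus> c \<odot> y"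
  using smult_r_distr by simp

lemma smult_smult: "x \<in> carrier V ==> c \<odot> (d \<odot> x) = (c * d) \<odot> x"
  using smult_assoc1 by simp

lemma smult_1 [simp]: "x \<in> carrier V ==> 1 \<odot> x = x"
  using smult_one by simp

lemma smult_0 [simp]: "x \<in> carrier V ==> 0 \<odot> x = \<zero>"
  using smult_l_null by simp

lemma smult_zero [simp]: "c \<odot> \<zero> = \<zero>"
  using smult_r_null by simp

lemma smult_neg_one: "x \<in> carrier V ==> (- 1) \<odot> x = \<ominus> x"
proof -
  assume x: "x \<in> carrier V"
  have "(-1) \<odot> x \<oplus> x = (-1 + 1) \<odot> x" using x by (subst smult_add_left) auto
  also have "\<dots> = \<zero>" using x by simp
  finally show ?thesis using x by (metis M.minus_equality smult_in)
qed

definition functional :: "('a => 'k) => bool" where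
  "functional l \<longleftrightarrow> (\<forall>x\<in>carrier V. \<forall>y\<in>carrier V. l (x \<oplus> y) = l x + l y) \<and>
     (\<forall>c. \<forall>x\<in>carrier V. l (c \<odot> x) = c * l x)"

lemma functional_add: "functional l ==> x \<in> carrier V ==> y \<in> carrier V ==> l (x \<oplus> y) = l x + l y"
  by (simp add: functional_def)

lemma functional_smult: "functional l ==> x \<in> carrier V ==> l (c \<odot> x) = c * l x"
  by (simp add: functional_def)

lemma functional_zero: "functional l ==> l \<zero> = 0"
  using functional_smult[of l \<zero> 0] by simp

lemma functional_neg: "functional l ==> x \<in> carrier V ==> l (\<ominus> x) = - l x"
  using functional_smult[of l x "-1"] by (simp add: smult_neg_one)

lemma functional_diff: "functional l ==> x \<in> carrier V ==> y \<in> carrier V ==> l (x \<ominus> y) = l x - l y"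
  by (simp add: M.minus_eq functional_add functional_neg)

lemmas functional_simps =
  functional_add functional_smult functional_zero functional_neg functional_diff

lemma functional_sum:
  assumes l: "functional l" and "finite I" and "\<And>i. i \<in> I ==> u i \<in> carrier V"
  shows "l (\<Oplus>i\<in>I. u i) = (\<Sum>i\<in>I. l (u i))"
  using assms(2,3)
proof (induction I rule: finite_induct)
  case empty
  then show ?case by (simp add: functional_zero[OF l])
next
  case (insert i I)
  then have "u \<in> I \<rightarrow> carrier V" "u i \<in> carrier V" by auto
  with insert show ?case by (simp add: functional_add[OF l])
qed

text \<open>
  Gaussian elimination: finitely many functionals admit vectors \<open>u i\<close> such that
  \<open>a \<mapsto> (\<Oplus>i\<in>I. f i a \<odot> u i)\<close> is a section of the joint evaluation map.
\<close>

lemma evaluation_section: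
  assumes "finite I" and "\<And>i. i \<in> I ==> functional (f i)"
  shows "\<exists>u. (\<forall>i\<in>I. u i \<in> carrier V) \<and>
    (\<forall>a\<in>carrier V. \<forall>j\<in>I. (\<Sum>i\<in>I. f i a * f j (u i)) = f j a)"
  using assms
proof (induction I rule: finite_induct)
  case empty
  then show ?case by simp
next
  case (insert k I)
  then obtain u where u: "\<And>i. i \<in> I ==> u i \<in> carrier V"
    and uf: "\<And>a j. a \<in> carrier V ==> j \<in> I ==> (\<Sum>i\<in>I. f i a * f j (u i)) = f j a"
    by force
  have fk: "functional (f k)" and fI: "\<And>i. i \<in> I ==> functional (f i)"
    using insert.prems by auto
  show ?case
  \<comment> \<open>Either \<open>f k\<close> vanishes on the joint kernel of the other functionals,
    and then the new vector may be zero; or a vector of that kernel can be normalised to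
    \<open>f k c = 1\<close>, and the old vectors are corrected along it.\<close>
  proof (cases "\<exists>c\<in>carrier V. (\<forall>j\<in>I. f j c = 0) \<and> f k c \<noteq> 0")
    case False
    define u' where "u' = u(k := \<zero>)"
    have "(\<Sum>i\<in>insert k I. f i a * f j (u' i)) = f j a" if a: "a \<in> carrier V" and j: "j \<in> insert k I" for a j
    proof -
      have fj: "functional (f j)" using j insert.prems by auto
      let ?s = "\<Oplus>i\<in>I. f i a \<odot> u i"
      have s: "?s \<in> carrier V" using u by (intro M.finsum_closed) auto
      have fs: "f j' ?s = (\<Sum>i\<in>I. f i a * f j' (u i))" if "functional (f j')" for j'
        using that u insert.hyps by (simp add: functional_sum functional_smult)
      have "f j' (a \<ominus> ?s) = 0" if "j' \<in> I" for j'
        using that a s fI uf fs by (simp add: functional_diff)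
      then have "f k (a \<ominus> ?s) = 0" using False a s by blast
      then have "f k a = f k ?s" using fk a s by (simp add: functional_diff)
      then have *: "f j a = f j ?s" using j uf[OF a] fs fI by auto
      have "(\<Sum>i\<in>insert k I. f i a * f j (u' i)) = (\<Sum>i\<in>I. f i a * f j (u' i))"
        using insert.hyps functional_zero[OF fj] by (simp add: u'_def)
      also have "\<dots> = (\<Sum>i\<in>I. f i a * f j (u i))"
        using insert.hyps by (intro sum.cong) (auto simp: u'_def)
      finally show ?thesis using * fs[OF fj] by simp
    qed
    moreover have "\<forall>i\<in>insert k I. u' i \<in> carrier V" using u by (auto simp: u'_def)
    ultimately show ?thesis by blast
  next
    case True
    then obtain c0 where c0: "c0 \<in> carrier V" "\<And>j. j \<in> I ==> f j c0 = 0" "f k c0 \<noteq> 0" by auto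
    define c where "c = inverse (f k c0) \<odot> c0"
    have c: "c \<in> carrier V" "\<And>j. j \<in> I ==> f j c = 0" "f k c = 1"
      using c0 fI fk by (auto simp: c_def functional_smult)
    define u' where "u' i = (if i = k then c else u i \<ominus> f k (u i) \<odot> c)" for i
    have u'_in: "u' i \<in> carrier V" if "i \<in> insert k I" for i
      using that u c by (auto simp: u'_def)
    have "(\<Sum>i\<in>insert k I. f i a * f j (u' i)) = f j a" if a: "a \<in> carrier V" and j: "j \<in> insert k I" for a j
    proof -
      have fj: "functional (f j)" using j insert.prems by auto
      have "(\<Sum>i\<in>insert k I. f i a * f j (u' i)) = f k a * f j c + (\<Sum>i\<in>I. f i a * f j (u' i))"
        using insert.hyps by (simp add: u'_def)
      also have "(\<Sum>i\<in>I. f i a * f j (u' i)) = (\<Sum>i\<in>I. f i a * f j (u i) - f i a * f k (u i) * f j c)"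
      proof (rule sum.cong)
        fix i assume i: "i \<in> I"
        then have "i \<noteq> k" using insert.hyps by auto
        then show "f i a * f j (u' i) = f i a * f j (u i) - f i a * f k (u i) * f j c"
          using u[OF i] c fj by (simp add: u'_def functional_simps algebra_simps)
      qed simp
      also have "f k a * f j c + \<dots> = f j a"
      proof (cases "j = k")
        case True
        then show ?thesis using c by (simp add: sum_subtractf)
      next
        case False
        then have "j \<in> I" using j by simp
        then show ?thesis using c uf[OF a] by simp
      qed
      finally show ?thesis .
    qed
    then show ?thesis using u'_in by blast
  qed
qed

text \<open>For a separating family the section of the evaluation map is an inverse. The
  \<open>u i\<close> form a spanning family with linear coordinates, not necessarily a
  basis.\<close>

lemma separating_expansion:
  assumes "finite I" and "\<And>i. i \<in> I ==> functional (f i)"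
    and sep: "\<And>x. x \<in> carrier V ==> (\<And>i. i \<in> I ==> f i x = 0) ==> x = \<zero>"
  obtains u where "\<And>i. i \<in> I ==> u i \<in> carrier V"
    and "\<And>a. a \<in> carrier V ==> a = (\<Oplus>i\<in>I. f i a \<odot> u i)"
proof -
  obtain u where u: "\<And>i. i \<in> I ==> u i \<in> carrier V"
    and uf: "\<And>a j. a \<in> carrier V ==> j \<in> I ==> (\<Sum>i\<in>I. f i a * f j (u i)) = f j a"
    using evaluation_section[of I f, OF assms(1,2)] by blast
  have "a = (\<Oplus>i\<in>I. f i a \<odot> u i)" if a: "a \<in> carrier V" for a
  proof -
    let ?s = "\<Oplus>i\<in>I. f i a \<odot> u i"
    have s: "?s \<in> carrier V" using u by (intro M.finsum_closed) auto
    have "f j (a \<ominus> ?s) = 0" if "j \<in> I" for j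
      using that a s assms(1,2) uf u by (simp add: functional_diff functional_sum functional_smult)
    then have "a \<ominus> ?s = \<zero>" using sep a s by simp
    then show ?thesis using a s by simp
  qed
  then show thesis using u that by blast
qed

text \<open>Finite dimension is handled through separating functionals instead of bases because
  these restrict to subspaces and are easy to write down on spaces of maps.\<close>

lemma fin_dim_of_separating:
  assumes "finite I" and "\<And>i. i \<in> I ==> functional (f i)"
    and "\<And>x. x \<in> carrier V ==> (\<And>i. i \<in> I ==> f i x = 0) ==> x = \<zero>"
  shows "fin_dim" and "dim \<le> card I"
proof -
  obtain u where u: "\<And>i. i \<in> I ==> u i \<in> carrier V"
    and ue: "\<And>a. a \<in> carrier V ==> a = (\<Oplus>i\<in>I. f i a \<odot> u i)"
    using separating_expansion[of I f, OF assms] by blast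
  have sub: "u ` I \<subseteq> carrier V" using u by auto
  have "a \<in> span (u ` I)" if a: "a \<in> carrier V" for a
  proof -
    have "J \<subseteq> I ==> (\<Oplus>i\<in>J. f i a \<odot> u i) \<in> span (u ` I)" if "finite J" for J
      using that
    proof (induction J rule: finite_induct)
      case empty
      then show ?case using span_is_submodule[OF sub] by (simp add: submodule.zero_closed)
    next
      case (insert i J)
      have "u i \<in> span (u ` I)" using insert.prems in_own_span[OF sub] by auto
      then have "f i a \<odot> u i \<in> span (u ` I)"
        using submodule.smult_closed[OF span_is_submodule[OF sub]] by simp
      moreover have "(\<Oplus>i\<in>insert i J. f i a \<odot> u i) = f i a \<odot> u i \<oplus> (\<Oplus>i\<in>J. f i a \<odot> u i)"
        using insert.prems insert.hyps u by (intro M.finsum_insert) auto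
      ultimately show ?case
        using insert submodule.m_closed[OF span_is_submodule[OF sub]] by auto
    qed
    then show ?thesis using ue[OF a] assms(1) by fastforce
  qed
  then have gen: "gen_set (u ` I)" using span_is_subset2[OF sub] by auto
  show "fin_dim" using gen sub assms(1) by (auto simp: fin_dim_def)
  have "dim \<le> card (u ` I)" using gen_ge_dim[OF _ sub gen] assms(1) by simp
  also have "\<dots> \<le> card I" using assms(1) by (rule card_image_le)
  finally show "dim \<le> card I" .
qed

lemma coordinate_functionals:
  assumes "fin_dim"
  obtains I :: "'a set" and f where "finite I" "\<And>i. i \<in> I ==> functional (f i)"
    "\<And>x. x \<in> carrier V ==> (\<And>i. i \<in> I ==> f i x = 0) ==> x = \<zero>"
proof -
  obtain B where B: "finite B" "basis B" using finite_basis_exists[OF assms] by blast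
  then have sub: "B \<subseteq> carrier V" by (simp add: basis_def)
  have ex1: "\<exists>!a. a \<in> B \<rightarrow>\<^sub>E UNIV \<and> lincomb a B = v" if "v \<in> carrier V" for v
    using basis_criterion[OF B(1) sub] B(2) that by simp
  define co where "co v = (THE a. a \<in> B \<rightarrow>\<^sub>E UNIV \<and> lincomb a B = v)" for v
  have co: "co v \<in> B \<rightarrow>\<^sub>E UNIV" "lincomb (co v) B = v" if "v \<in> carrier V" for v
    using theI'[OF ex1[OF that]] by (auto simp: co_def)
  have co_eq: "co v = a" if "a \<in> B \<rightarrow>\<^sub>E UNIV" "lincomb a B = v" "v \<in> carrier V" for a v
    using ex1[OF that(3)] co[OF that(3)] that by blast
  have co_add: "co (x \<oplus> y) b = co x b + co y b" if "x \<in> carrier V" "y \<in> carrier V" "b \<in> B" for x y b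
  proof -
    have "lincomb (\<lambda>b\<in>B. co x b + co y b) B = (\<Oplus>b\<in>B. co x b \<odot> b \<oplus> co y b \<odot> b)"
      unfolding lincomb_def using sub by (intro M.finsum_cong') (auto simp: smult_add_left)
    also have "\<dots> = lincomb (co x) B \<oplus> lincomb (co y) B"
      unfolding lincomb_def using sub by (intro M.finsum_addf) auto
    also have "\<dots> = x \<oplus> y" using that co by simp
    finally have "co (x \<oplus> y) = (\<lambda>b\<in>B. co x b + co y b)"
      using that by (intro co_eq) auto
    then show ?thesis using that by simp
  qed
  have co_smult: "co (c \<odot> x) b = c * co x b" if "x \<in> carrier V" "b \<in> B" for c x b
  proof -
    have "lincomb (\<lambda>b\<in>B. c * co x b) B = (\<Oplus>b\<in>B. c \<odot> (co x b \<odot> b))"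
      unfolding lincomb_def using sub by (intro M.finsum_cong') (auto simp: smult_smult)
    also have "\<dots> = c \<odot> lincomb (co x) B"
      unfolding lincomb_def using sub by (subst finsum_smult) auto
    also have "\<dots> = c \<odot> x" using that co by simp
    finally have "co (c \<odot> x) = (\<lambda>b\<in>B. c * co x b)"
      using that by (intro co_eq) auto
    then show ?thesis using that by simp
  qed
  show thesis
  proof (rule that[of B "\<lambda>b v. co v b"])
    show "functional (\<lambda>v. co v b)" if "b \<in> B" for b
      using that co_add co_smult by (simp add: functional_def)
    fix x assume x: "x \<in> carrier V" and z: "\<And>b. b \<in> B ==> co x b = 0"
    have "x = lincomb (co x) B" using co x by simp
    also have "\<dots> = (\<Oplus>b\<in>B. \<zero>)"
      unfolding lincomb_def using sub z by (intro M.finsum_cong') auto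
    finally show "x = \<zero>" by simp
  qed (rule B(1))
qed

lemma kspace_subspace:
  assumes "subspace class_ring T V"
  shows "kspace (V\<lparr>carrier := T\<rparr>)"
  using subspace_is_vs[OF assms] by (simp add: kspace_def)

text \<open>One separating family on \<open>V\<close> restricts to all subspaces, which gives a
  bound that is uniform in \<open>T\<close>.\<close>

lemma subspace_dim_le:
  assumes "fin_dim"
  obtains N where "\<And>T. subspace class_ring T V ==> vectorspace.dim class_ring (V\<lparr>carrier := T\<rparr>) \<le> N"
    and "\<And>T. subspace class_ring T V ==> vectorspace.fin_dim class_ring (V\<lparr>carrier := T\<rparr>)"
proof -
  obtain I :: "'a set" and f where I: "finite I" "\<And>i. i \<in> I ==> functional (f i)"
    "\<And>x. x \<in> carrier V ==> (\<And>i. i \<in> I ==> f i x = 0) ==> x = \<zero>"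
    using coordinate_functionals[OF assms] by metis
  have *: "vectorspace.fin_dim class_ring (V\<lparr>carrier := T\<rparr>)"
    "vectorspace.dim class_ring (V\<lparr>carrier := T\<rparr>) \<le> card I" if T: "subspace class_ring T V" for T
  proof -
    interpret T: kspace "V\<lparr>carrier := T\<rparr>" by (rule kspace_subspace[OF T])
    have sub: "T \<subseteq> carrier V" using T by (simp add: subspace_def submodule_def)
    have fnl: "T.functional (f i)" if "i \<in> I" for i
      using I(2)[OF that] sub unfolding T.functional_def functional_def
      by (simp add: subset_iff)
    have sep: "x = \<zero>\<^bsub>V\<lparr>carrier := T\<rparr>\<^esub>" if "x \<in> carrier (V\<lparr>carrier := T\<rparr>)" "\<And>i. i \<in> I ==> f i x = 0" for x
      using I(3) that sub by auto
    show "T.fin_dim" by (rule T.fin_dim_of_separating(1)[OF I(1) fnl sep])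
    show "T.dim \<le> card I" by (rule T.fin_dim_of_separating(2)[OF I(1) fnl sep])
  qed
  show thesis by (rule that[of "card I"]) (use * in auto)
qed

lemma dim_pos:
  assumes "fin_dim" and "x \<in> carrier V" "x \<noteq> \<zero>"
  shows "dim > 0"
proof (rule ccontr)
  assume "\<not> dim > 0"
  moreover obtain B where B: "finite B" "basis B" using finite_basis_exists[OF assms(1)] by blast
  ultimately have "B = {}" using dim_basis[OF B] by simp
  then have "carrier V = span {}" using B by (simp add: basis_def)
  then show False using assms by (auto simp: span_def lincomb_def)
qed

lemma dim_trivial:
  assumes "carrier V = {\<zero>}" shows "dim = 0"
  using fin_dim_of_separating(2)[of "{}"] assms by auto

end

subsection \<open>Quotients by submodules\<close>

locale quotient_space = kspace M for M :: "('k::field, 'a) module" (structure) +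
  fixes N :: "'a set"
  assumes sub: "submodule class_ring N M"
begin

lemma N_sub: "N \<subseteq> carrier M" using sub by (simp add: submodule_def)
lemma N_add: "x \<in> N ==> y \<in> N ==> x \<oplus> y \<in> N" using sub by (simp add: submodule_def)
lemma N_zero: "\<zero> \<in> N" using sub by (simp add: submodule_def)
lemma N_smult: "x \<in> N ==> c \<odot> x \<in> N" using sub by (simp add: submodule_def)
lemma N_neg: "x \<in> N ==> \<ominus> x \<in> N"
  using N_smult[of x "-1"] N_sub smult_neg_one by auto
sublocale abelian_subgroup N M
proof (rule abelian_subgroupI3)
  show "additive_subgroup N M"
    using N_sub N_add N_zero N_neg
    by (intro additive_subgroup.intro M.add.subgroupI) (auto simp: a_inv_def[symmetric])
  show "abelian_group M" by (rule M.abelian_group_axioms)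
qed

abbreviation cls :: "'a => 'a set" where "cls x \<equiv> N +>\<^bsub>M\<^esub> x"

lemma cls_eq_iff: "x \<in> carrier M ==> y \<in> carrier M ==> cls x = cls y \<longleftrightarrow> x \<ominus> y \<in> N"
  by (metis M.minus_eq a_rcos_module a_repr_independence' a_repr_independenceD)

lemma mem_cls_iff: "x \<in> carrier M ==> y \<in> cls x \<longleftrightarrow> y \<in> carrier M \<and> y \<ominus> x \<in> N"
  by (metis M.minus_eq a_elemrcos_carrier a_rcos_module)

lemma cls_self: "x \<in> carrier M ==> x \<in> cls x"
  by (rule a_rcos_self)

lemma quotient_carrier: "carrier (quotient_algebra M N) = cls ` carrier M"
  by (auto simp: quotient_algebra_def FactRing_def ring.defs A_RCOSETS_def' a_r_coset_def)

lemma quotient_zero: "\<zero>\<^bsub>quotient_algebra M N\<^esub> = N"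
  by (simp add: quotient_algebra_def FactRing_def ring.defs)

lemma cls_zero: "cls \<zero> = N"
  using N_sub by (simp add: a_coset_add_zero)

lemma quotient_add:
  "x \<in> carrier M ==> y \<in> carrier M ==> cls x \<oplus>\<^bsub>quotient_algebra M N\<^esub> cls y = cls (x \<oplus> y)"
  by (simp add: quotient_algebra_def FactRing_def ring.defs a_rcos_sum)

lemma quotient_smult:
  assumes x: "x \<in> carrier M"
  shows "c \<odot>\<^bsub>quotient_algebra M N\<^esub> cls x = cls (c \<odot> x)"
proof -
  have "cls (c \<odot> y) = cls (c \<odot> x)" if "y \<in> cls x" for y
  proof -
    have y: "y \<in> carrier M" "y \<ominus> x \<in> N" using that mem_cls_iff[OF x] by auto
    have "c \<odot> y \<ominus> c \<odot> x = c \<odot> (y \<ominus> x)"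
      using x y(1) by (simp add: M.minus_eq smult_add_right smult_neg_one[symmetric] smult_smult mult.commute)
    then show ?thesis using x y N_smult by (simp add: cls_eq_iff)
  qed
  then have "(\<Union>y\<in>cls x. cls (c \<odot> y)) = cls (c \<odot> x)" using cls_self[OF x] by blast
  then show ?thesis by (simp add: quotient_algebra_def FactRing_def ring.defs)
qed

text \<open>Compatibility is a hypothesis on the two given classes because the product may be a Lie
  bracket, to which facts about ideals of rings do not apply.\<close>

lemma quotient_mult:
  assumes x: "x \<in> carrier M" and y: "y \<in> carrier M"
    and cong: "\<And>x' y'. x' \<in> cls x ==> y' \<in> cls y ==>
      x' \<otimes> y' \<in> carrier M \<and> x' \<otimes> y' \<ominus> x \<otimes> y \<in> N" and xy: "x \<otimes> y \<in> carrier M"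
  shows "cls x \<otimes>\<^bsub>quotient_algebra M N\<^esub> cls y = cls (x \<otimes> y)"
proof -
  have "cls (x' \<otimes> y') = cls (x \<otimes> y)" if "x' \<in> cls x" "y' \<in> cls y" for x' y'
    using cong[OF that] xy by (simp add: cls_eq_iff)
  then have "(\<Union>x'\<in>cls x. \<Union>y'\<in>cls y. cls (x' \<otimes> y')) = cls (x \<otimes> y)"
    using cls_self[OF x] cls_self[OF y] by blast
  then show ?thesis by (simp add: quotient_algebra_def FactRing_def ring.defs rcoset_mult_def)
qed

lemma quotient_vectorspace: "kspace (quotient_algebra M N)"
proof -
  let ?Q = "quotient_algebra M N"
  have ag: "abelian_group ?Q"
  proof (rule abelian_groupI)
    fix X assume "X \<in> carrier ?Q"
    then obtain x where x: "x \<in> carrier M" "X = cls x" by (auto simp: quotient_carrier)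
    then have "cls (\<ominus> x) \<oplus>\<^bsub>?Q\<^esub> X = \<zero>\<^bsub>?Q\<^esub>" by (simp add: quotient_add M.l_neg quotient_zero cls_zero)
    then show "\<exists>Y\<in>carrier ?Q. Y \<oplus>\<^bsub>?Q\<^esub> X = \<zero>\<^bsub>?Q\<^esub>" using x by (auto simp: quotient_carrier)
  next
    show "\<zero>\<^bsub>?Q\<^esub> \<in> carrier ?Q"
      unfolding quotient_zero quotient_carrier using cls_zero by (metis M.zero_closed imageI)
  next
    fix X assume "X \<in> carrier ?Q"
    then obtain x where x: "x \<in> carrier M" "X = cls x" by (auto simp: quotient_carrier)
    have "cls \<zero> \<oplus>\<^bsub>?Q\<^esub> cls x = cls x" using x by (subst quotient_add) auto
    then show "\<zero>\<^bsub>?Q\<^esub> \<oplus>\<^bsub>?Q\<^esub> X = X" by (simp add: x quotient_zero cls_zero)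
  qed (auto simp: quotient_carrier quotient_add M.a_ac)
  then have "vectorspace class_ring ?Q"
    by (rule vectorspace_class_ringI)
      (auto simp: quotient_carrier quotient_add quotient_smult smult_add_left smult_add_right smult_smult)
  then show ?thesis by (simp add: kspace_def)
qed

lemma quotient_fin_dim:
  assumes "fin_dim"
  shows "vectorspace.fin_dim class_ring (quotient_algebra M N)"
proof -
  let ?Q = "quotient_algebra M N"
  interpret Q: kspace ?Q by (rule quotient_vectorspace)
  obtain B where B: "finite B" "B \<subseteq> carrier M" "span B = carrier M"
    using assms by (auto simp: fin_dim_def)
  have subQ: "cls ` B \<subseteq> carrier ?Q" using B by (auto simp: quotient_carrier)
  have "cls x \<in> Q.span (cls ` B)" if "x \<in> carrier M" for x
  proof -
    have "x \<in> {lincomb a B |a. a \<in> B \<rightarrow> carrier class_ring}"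
      using that B(3) finite_span[OF B(1,2)] by simp
    then obtain a where "x = lincomb a B \<and> a \<in> B \<rightarrow> carrier class_ring"
      unfolding mem_Collect_eq ..
    then have a: "x = lincomb a B" ..
    have *: "J \<subseteq> B ==> cls (lincomb a J) \<in> Q.span (cls ` B)" if "finite J" for J
      using that
    proof (induct J rule: finite_induct)
      case empty
      have "lincomb a {} = \<zero>" by (simp add: lincomb_def)
      then have "cls (lincomb a {}) = \<zero>\<^bsub>?Q\<^esub>" by (simp only: cls_zero quotient_zero)
      then show ?case using submodule.zero_closed[OF Q.span_is_submodule[OF subQ]] by simp
    next
      case (insert i J)
      have i: "i \<in> carrier M" and J: "J \<subseteq> carrier M" using insert.prems B by auto
      have lJ: "lincomb a J \<in> carrier M" using J by (intro lincomb_closed) auto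
      have "lincomb a (insert i J) = a i \<odot> i \<oplus> lincomb a J"
        unfolding lincomb_def using insert.hyps i J by (intro M.finsum_insert) auto
      then have "cls (lincomb a (insert i J)) = a i \<odot>\<^bsub>?Q\<^esub> cls i \<oplus>\<^bsub>?Q\<^esub> cls (lincomb a J)"
        using i lJ by (simp add: quotient_add quotient_smult)
      moreover have "cls i \<in> Q.span (cls ` B)"
        using insert.prems Q.in_own_span[OF subQ] by (meson imageI insert_subset subsetD)
      then have "a i \<odot>\<^bsub>?Q\<^esub> cls i \<in> Q.span (cls ` B)"
        by (rule submodule.smult_closed[OF Q.span_is_submodule[OF subQ], rotated]) simp
      moreover have "cls (lincomb a J) \<in> Q.span (cls ` B)" using insert.hyps(3) insert.prems by blast
      ultimately show ?case
        using submodule.m_closed[OF Q.span_is_submodule[OF subQ]] by metis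
    qed
    show ?thesis unfolding a by (rule *[OF B(1) order.refl])
  qed
  then have "Q.gen_set (cls ` B)" using Q.span_is_subset2[OF subQ] by (auto simp: quotient_carrier)
  then show ?thesis using B(1) subQ by (auto simp: Q.fin_dim_def)
qed

end

section \<open>Derivations\<close>

lemma (in quotient_space) mem_cls_iff_add:
  assumes "x \<in> carrier M"
  shows "y \<in> cls x \<longleftrightarrow> (\<exists>n\<in>N. y = x \<oplus> n)"
proof -
  have "y \<in> cls x \<longleftrightarrow> (\<exists>n\<in>N. y = n \<oplus> x)" by (auto simp: a_r_coset_def')
  then show ?thesis using assms N_sub M.a_comm by (metis subsetD)
qed

locale kalg = kspace A + ring A for A :: "('k::field, 'a) module" (structure) +
  assumes smult_mult_left: "x \<in> carrier A ==> y \<in> carrier A ==> (c \<odot> x) \<otimes> y = c \<odot> (x \<otimes> y)"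
    and smult_mult_right: "x \<in> carrier A ==> y \<in> carrier A ==> x \<otimes> (c \<odot> y) = c \<odot> (x \<otimes> y)"
    and fin_dim: "fin_dim"
begin

lemma linear_functionals_iff: "l \<in> linear_functionals A \<longleftrightarrow> functional l"
  by (simp add: linear_functionals_def functional_def)

lemma functionals_separate:
  assumes "x \<in> carrier A" "y \<in> carrier A" "\<And>l. functional l ==> l x = l y"
  shows "x = y"
proof -
  obtain I :: "'a set" and f where "finite I" "\<And>i. i \<in> I ==> functional (f i)"
    and sep: "\<And>x. x \<in> carrier A ==> (\<And>i. i \<in> I ==> f i x = 0) ==> x = \<zero>"
    using coordinate_functionals[OF fin_dim] by metis
  then have "x \<ominus> y = \<zero>" using assms by (intro sep) (auto simp: functional_diff)
  then show ?thesis using assms by simp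
qed

definition linear_map :: "('a => 'a) => bool" where
  "linear_map X \<longleftrightarrow> (\<forall>x\<in>carrier A. X x \<in> carrier A) \<and>
     (\<forall>x\<in>carrier A. \<forall>y\<in>carrier A. X (x \<oplus> y) = X x \<oplus> X y) \<and>
     (\<forall>c. \<forall>x\<in>carrier A. X (c \<odot> x) = c \<odot> X x)"

lemma linear_map_closed [simp]: "linear_map X ==> x \<in> carrier A ==> X x \<in> carrier A"
  by (simp add: linear_map_def)
lemma linear_map_add: "linear_map X ==> x \<in> carrier A ==> y \<in> carrier A ==> X (x \<oplus> y) = X x \<oplus> X y"
  by (simp add: linear_map_def)
lemma linear_map_smult: "linear_map X ==> x \<in> carrier A ==> X (c \<odot> x) = c \<odot> X x"
  by (simp add: linear_map_def)
lemma linear_map_zero: "linear_map X ==> X \<zero> = \<zero>"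
  using linear_map_smult[of X \<zero> 0] by simp
lemma linear_map_neg: "linear_map X ==> x \<in> carrier A ==> X (\<ominus> x) = \<ominus> X x"
  using linear_map_smult[of X x "-1"] by (simp add: smult_neg_one)
lemma linear_map_diff: "linear_map X ==> x \<in> carrier A ==> y \<in> carrier A ==> X (x \<ominus> y) = X x \<ominus> X y"
  by (simp add: minus_eq linear_map_add linear_map_neg)

lemmas linear_map_simps =
  linear_map_add linear_map_smult linear_map_zero linear_map_neg linear_map_diff

lemma linear_map_sum:
  assumes X: "linear_map X" and "finite I" and "\<And>i. i \<in> I ==> u i \<in> carrier A"
  shows "X (\<Oplus>i\<in>I. u i) = (\<Oplus>i\<in>I. X (u i))"
  using assms(2,3)
proof (induction I rule: finite_induct)
  case empty
  then show ?case by (simp add: linear_map_zero[OF X])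
next
  case (insert i I)
  then have "u \<in> I \<rightarrow> carrier A" "u i \<in> carrier A" "(\<lambda>i. X (u i)) \<in> I \<rightarrow> carrier A"
    using X by auto
  with insert X show ?case by (simp add: linear_map_add)
qed

lemma linear_map_module_hom: "X \<in> module_hom class_ring A A \<longleftrightarrow> linear_map X"
  by (auto simp: module_hom_def linear_map_def)

lemma functional_comp: "functional l ==> linear_map X ==> functional (\<lambda>x. l (X x))"
  by (simp add: functional_def linear_map_def)

lemma linear_map_comp: "linear_map X ==> linear_map Y ==> linear_map (\<lambda>x. X (Y x))"
  by (simp add: linear_map_def)

lemma linear_map_funpow: "linear_map X ==> linear_map (X ^^ n)"
proof (induction n)
  case 0
  then show ?case by (simp add: linear_map_def)
next
  case (Suc n)
  then show ?case using linear_map_comp[of X "X ^^ n"] by (simp add: comp_def)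
qed

lemma linear_map_mult_left: "a \<in> carrier A ==> linear_map (\<lambda>x. a \<otimes> x)"
  by (simp add: linear_map_def r_distr smult_mult_right)

lemma linear_map_mult_right: "a \<in> carrier A ==> linear_map (\<lambda>x. x \<otimes> a)"
  by (simp add: linear_map_def l_distr smult_mult_left)

lemma linear_map_restrict: "linear_map X ==> linear_map (restrict X (carrier A))"
  by (simp add: linear_map_def)

lemma derivations_iff:
  "D \<in> derivations A \<longleftrightarrow> D \<in> extensional (carrier A) \<and> linear_map D \<and>
    (\<forall>x\<in>carrier A. \<forall>y\<in>carrier A. D (x \<otimes> y) = D x \<otimes> y \<oplus> x \<otimes> D y)"
  by (simp add: derivations_def linear_map_module_hom)

lemma derivation_linear: "D \<in> derivations A ==> linear_map D"
  by (simp add: derivations_iff)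

lemma derivation_closed [simp]: "D \<in> derivations A ==> x \<in> carrier A ==> D x \<in> carrier A"
  by (simp add: derivations_iff)

lemma derivation_mult:
  "D \<in> derivations A ==> x \<in> carrier A ==> y \<in> carrier A ==> D (x \<otimes> y) = D x \<otimes> y \<oplus> x \<otimes> D y"
  by (simp add: derivations_iff)

lemmas derivation_simps = linear_map_simps[OF derivation_linear] derivation_mult

lemma derivation_eqI:
  "D \<in> derivations A ==> E \<in> derivations A ==> (\<And>x. x \<in> carrier A ==> D x = E x) ==> D = E"
  by (auto simp: derivations_iff intro: extensionalityI)

lemma Der_simps [simp]:
  "carrier (Der A) = derivations A"
  "\<zero>\<^bsub>Der A\<^esub> = (\<lambda>x\<in>carrier A. \<zero>)"
  "D \<oplus>\<^bsub>Der A\<^esub> E = (\<lambda>x\<in>carrier A. D x \<oplus> E x)"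
  "D \<otimes>\<^bsub>Der A\<^esub> E = (\<lambda>x\<in>carrier A. D (E x) \<ominus> E (D x))"
  "c \<odot>\<^bsub>Der A\<^esub> D = (\<lambda>x\<in>carrier A. c \<odot> D x)"
  by (simp_all add: Der_def)

lemma derivation_restrictI:
  assumes "\<And>x. x \<in> carrier A ==> F x \<in> carrier A"
    and "\<And>x y. x \<in> carrier A ==> y \<in> carrier A ==> F (x \<oplus> y) = F x \<oplus> F y"
    and "\<And>c x. x \<in> carrier A ==> F (c \<odot> x) = c \<odot> F x"
    and "\<And>x y. x \<in> carrier A ==> y \<in> carrier A ==> F (x \<otimes> y) = F x \<otimes> y \<oplus> x \<otimes> F y"
  shows "(\<lambda>x\<in>carrier A. F x) \<in> derivations A"
  unfolding derivations_iff linear_map_def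
  using assms by (intro conjI ballI allI restrict_extensional)
    (simp_all only: restrict_apply' add.m_closed smult_in m_closed)

lemma smult_diff_right: "x \<in> carrier A ==> y \<in> carrier A ==> c \<odot> (x \<ominus> y) = c \<odot> x \<ominus> c \<odot> y"
  by (simp add: minus_eq smult_add_right smult_neg_one[symmetric] smult_smult mult.commute del: mult_minus_left mult_minus_right)

lemma derivation_zero_map: "(\<lambda>x\<in>carrier A. \<zero>) \<in> derivations A"
  by (rule derivation_restrictI) simp_all

lemma derivation_add:
  assumes D: "D \<in> derivations A" and E: "E \<in> derivations A"
  shows "(\<lambda>x\<in>carrier A. D x \<oplus> E x) \<in> derivations A"
proof (rule derivation_restrictI)
  fix x y assume x: "x \<in> carrier A" and y: "y \<in> carrier A"
  have c: "D x \<in> carrier A" "D y \<in> carrier A" "E x \<in> carrier A" "E y \<in> carrier A"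
    using D E x y by simp_all
  show "D (x \<oplus> y) \<oplus> E (x \<oplus> y) = D x \<oplus> E x \<oplus> (D y \<oplus> E y)"
    unfolding derivation_simps(1)[OF D x y] derivation_simps(1)[OF E x y] using c by algebra
  show "D (x \<otimes> y) \<oplus> E (x \<otimes> y) = (D x \<oplus> E x) \<otimes> y \<oplus> x \<otimes> (D y \<oplus> E y)"
    unfolding derivation_mult[OF D x y] derivation_mult[OF E x y] using c x y by algebra
qed (use D E in \<open>simp_all add: derivation_simps smult_add_right\<close>)

lemma derivation_smult:
  assumes D: "D \<in> derivations A"
  shows "(\<lambda>x\<in>carrier A. c \<odot> D x) \<in> derivations A"
  using D by (intro derivation_restrictI)
    (simp_all add: derivation_simps smult_add_right smult_smult smult_mult_left smult_mult_right mult.commute)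

lemma derivation_bracket:
  assumes D: "D \<in> derivations A" and E: "E \<in> derivations A"
  shows "(\<lambda>x\<in>carrier A. D (E x) \<ominus> E (D x)) \<in> derivations A"
proof (rule derivation_restrictI)
  fix x y assume x: "x \<in> carrier A" and y: "y \<in> carrier A"
  have c: "D (E x) \<in> carrier A" "E (D x) \<in> carrier A" "D (E y) \<in> carrier A" "E (D y) \<in> carrier A"
      "D x \<in> carrier A" "D y \<in> carrier A" "E x \<in> carrier A" "E y \<in> carrier A"
      using D E x y by simp_all
  have 1: "D (E (x \<oplus> y)) = D (E x) \<oplus> D (E y)" "E (D (x \<oplus> y)) = E (D x) \<oplus> E (D y)"
    using D E x y by (simp_all add: derivation_simps)
  show "D (E (x \<oplus> y)) \<ominus> E (D (x \<oplus> y)) = D (E x) \<ominus> E (D x) \<oplus> (D (E y) \<ominus> E (D y))"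
    unfolding 1 using c by algebra
  have 2: "D (E (x \<otimes> y)) = (D (E x) \<otimes> y \<oplus> E x \<otimes> D y) \<oplus> (D x \<otimes> E y \<oplus> x \<otimes> D (E y))"
      "E (D (x \<otimes> y)) = (E (D x) \<otimes> y \<oplus> D x \<otimes> E y) \<oplus> (E x \<otimes> D y \<oplus> x \<otimes> E (D y))"
    using D E x y by (simp_all add: derivation_simps)
  show "D (E (x \<otimes> y)) \<ominus> E (D (x \<otimes> y)) =
      (D (E x) \<ominus> E (D x)) \<otimes> y \<oplus> x \<otimes> (D (E y) \<ominus> E (D y))"
    unfolding 2 using c x y by algebra
next
  fix c x assume x: "x \<in> carrier A"
  show "D (E (c \<odot> x)) \<ominus> E (D (c \<odot> x)) = c \<odot> (D (E x) \<ominus> E (D x))"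
    using D E x by (simp add: derivation_simps smult_diff_right)
qed (use D E in simp_all)

sublocale Der: kspace "Der A"
proof -
  have "abelian_group (Der A)"
  proof (rule abelian_groupI)
    fix D assume D: "D \<in> carrier (Der A)"
    have "(\<lambda>x\<in>carrier A. (-1) \<odot> D x) \<oplus>\<^bsub>Der A\<^esub> D = \<zero>\<^bsub>Der A\<^esub>"
      using D by (auto simp: smult_neg_one l_neg intro!: restrict_ext)
    then show "\<exists>E\<in>carrier (Der A). E \<oplus>\<^bsub>Der A\<^esub> D = \<zero>\<^bsub>Der A\<^esub>"
      using derivation_smult[of D "-1"] D by (intro bexI[of _ "\<lambda>x\<in>carrier A. (-1) \<odot> D x"]) simp_all
  next
    fix D assume D: "D \<in> carrier (Der A)"
    then show "\<zero>\<^bsub>Der A\<^esub> \<oplus>\<^bsub>Der A\<^esub> D = D"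
      by (intro extensionalityI[of _ "carrier A"]) (auto simp: derivations_iff)
  qed (auto simp: derivation_zero_map derivation_add a_ac intro!: restrict_ext)
  then have "vectorspace class_ring (Der A)"
  proof (rule vectorspace_class_ringI)
    fix D assume D: "D \<in> carrier (Der A)"
    then show "1 \<odot>\<^bsub>Der A\<^esub> D = D"
      by (intro extensionalityI[of _ "carrier A"]) (auto simp: derivations_iff)
  qed (auto simp: derivation_smult smult_add_left smult_add_right smult_smult intro!: restrict_ext)
  then show "kspace (Der A)" by (simp add: kspace_def)
qed

definition ad :: "'a => 'a => 'a" where
  "ad a = (\<lambda>x\<in>carrier A. a \<otimes> x \<ominus> x \<otimes> a)"

lemma inner_derivations_eq: "inner_derivations A = ad ` carrier A"
  by (auto simp: inner_derivations_def ad_def)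

lemma ad_apply [simp]: "x \<in> carrier A ==> ad a x = a \<otimes> x \<ominus> x \<otimes> a"
  by (simp add: ad_def)

lemma ad_derivation: "a \<in> carrier A ==> ad a \<in> derivations A"
  unfolding ad_def
proof (rule derivation_restrictI)
  fix x y assume a: "a \<in> carrier A" and x: "x \<in> carrier A" and y: "y \<in> carrier A"
  show "a \<otimes> (x \<oplus> y) \<ominus> (x \<oplus> y) \<otimes> a = a \<otimes> x \<ominus> x \<otimes> a \<oplus> (a \<otimes> y \<ominus> y \<otimes> a)"
    using a x y by algebra
  show "a \<otimes> (x \<otimes> y) \<ominus> x \<otimes> y \<otimes> a = (a \<otimes> x \<ominus> x \<otimes> a) \<otimes> y \<oplus> x \<otimes> (a \<otimes> y \<ominus> y \<otimes> a)"
    using a x y by algebra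
qed (simp_all add: smult_mult_left smult_mult_right smult_diff_right)

lemma ad_add:
  assumes a: "a \<in> carrier A" and b: "b \<in> carrier A"
  shows "ad (a \<oplus> b) = ad a \<oplus>\<^bsub>Der A\<^esub> ad b"
proof -
  have "(a \<oplus> b) \<otimes> x \<ominus> x \<otimes> (a \<oplus> b) = a \<otimes> x \<ominus> x \<otimes> a \<oplus> (b \<otimes> x \<ominus> x \<otimes> b)"
    if "x \<in> carrier A" for x
    using that a b by algebra
  then show ?thesis by (auto simp: ad_def intro!: restrict_ext)
qed

lemma ad_smult: "a \<in> carrier A ==> ad (c \<odot> a) = c \<odot>\<^bsub>Der A\<^esub> ad a"
  by (simp add: ad_def smult_mult_left smult_mult_right smult_diff_right cong: restrict_cong)

lemma inner_submodule: "submodule class_ring (inner_derivations A) (Der A)"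
proof -
  have "ad \<zero> = \<zero>\<^bsub>Der A\<^esub>"
    by (auto simp: ad_def minus_eq intro!: restrict_ext)
  then have "\<zero>\<^bsub>Der A\<^esub> \<in> inner_derivations A" by (metis inner_derivations_eq imageI zero_closed)
  then show ?thesis
    unfolding inner_derivations_eq
    by (intro submodule.intro Der.module_axioms)
      (auto simp: ad_derivation ad_add[symmetric] ad_smult[symmetric] simp del: Der_simps(2-))
qed

sublocale H: quotient_space "Der A" "inner_derivations A"
  by (intro quotient_space.intro quotient_space_axioms.intro Der.kspace_axioms inner_submodule)

sublocale HH1: kspace "HH1 A"
  unfolding HH1_def by (rule H.quotient_vectorspace)

lemma HH1_carrier: "carrier (HH1 A) = H.cls ` derivations A"
  by (simp add: HH1_def H.quotient_carrier)

lemma HH1_zero: "\<zero>\<^bsub>HH1 A\<^esub> = inner_derivations A"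
  by (simp add: HH1_def H.quotient_zero)

lemma HH1_add: "D \<in> derivations A ==> E \<in> derivations A ==>
    H.cls D \<oplus>\<^bsub>HH1 A\<^esub> H.cls E = H.cls (D \<oplus>\<^bsub>Der A\<^esub> E)"
  using H.quotient_add[of D E] by (simp add: HH1_def)

lemma HH1_smult: "D \<in> derivations A ==> c \<odot>\<^bsub>HH1 A\<^esub> H.cls D = H.cls (c \<odot>\<^bsub>Der A\<^esub> D)"
  using H.quotient_smult[of D c] by (simp add: HH1_def)

lemma mem_cls:
  assumes D: "D \<in> derivations A"
  shows "E \<in> H.cls D \<longleftrightarrow> (\<exists>a\<in>carrier A. E = D \<oplus>\<^bsub>Der A\<^esub> ad a)"
  using H.mem_cls_iff_add[of D E] D by (auto simp: inner_derivations_eq simp del: Der_simps(2-))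

text \<open>Inner derivations form a Lie ideal, which makes the bracket of \<open>HH1 A\<close>
  independent of representatives.\<close>

lemma bracket_inner:
  assumes D: "D \<in> derivations A" and a: "a \<in> carrier A"
  shows "D \<otimes>\<^bsub>Der A\<^esub> ad a = ad (D a)" and "ad a \<otimes>\<^bsub>Der A\<^esub> D = ad (\<ominus> D a)"
proof -
  have "D (ad a x) \<ominus> ad a (D x) = ad (D a) x" "ad a (D x) \<ominus> D (ad a x) = ad (\<ominus> D a) x"
    if x: "x \<in> carrier A" for x
  proof -
    have 1: "D (ad a x) = (D a \<otimes> x \<oplus> a \<otimes> D x) \<ominus> (D x \<otimes> a \<oplus> x \<otimes> D a)"
      using D a x by (simp add: derivation_simps)
    have 2: "D a \<in> carrier A" "D x \<in> carrier A" using D a x by auto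
    show "D (ad a x) \<ominus> ad a (D x) = ad (D a) x" unfolding 1 using 2 a x by simp algebra
    show "ad a (D x) \<ominus> D (ad a x) = ad (\<ominus> D a) x" unfolding 1 using 2 a x by simp algebra
  qed
  then show "D \<otimes>\<^bsub>Der A\<^esub> ad a = ad (D a)" "ad a \<otimes>\<^bsub>Der A\<^esub> D = ad (\<ominus> D a)"
    by (auto simp: ad_def intro!: restrict_ext)
qed

lemma bracket_add_left:
  assumes D: "D \<in> derivations A" "D' \<in> derivations A" and E: "E \<in> derivations A"
  shows "(D \<oplus>\<^bsub>Der A\<^esub> D') \<otimes>\<^bsub>Der A\<^esub> E = D \<otimes>\<^bsub>Der A\<^esub> E \<oplus>\<^bsub>Der A\<^esub> D' \<otimes>\<^bsub>Der A\<^esub> E"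
proof -
  have "(D (E x) \<oplus> D' (E x)) \<ominus> E (D x \<oplus> D' x) = (D (E x) \<ominus> E (D x)) \<oplus> (D' (E x) \<ominus> E (D' x))"
    if x: "x \<in> carrier A" for x
  proof -
    have "D (E x) \<in> carrier A" "E (D x) \<in> carrier A" "D' (E x) \<in> carrier A" "E (D' x) \<in> carrier A"
      using D E x by auto
    moreover have "E (D x \<oplus> D' x) = E (D x) \<oplus> E (D' x)" using D E x by (simp add: derivation_simps)
    ultimately show ?thesis by algebra
  qed
  then show ?thesis using E by (auto intro!: restrict_ext)
qed

lemma bracket_add_right:
  assumes D: "D \<in> derivations A" and E: "E \<in> derivations A" "E' \<in> derivations A"
  shows "D \<otimes>\<^bsub>Der A\<^esub> (E \<oplus>\<^bsub>Der A\<^esub> E') = D \<otimes>\<^bsub>Der A\<^esub> E \<oplus>\<^bsub>Der A\<^esub> D \<otimes>\<^bsub>Der A\<^esub> E'"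
proof -
  have "D (E x \<oplus> E' x) \<ominus> (E (D x) \<oplus> E' (D x)) = (D (E x) \<ominus> E (D x)) \<oplus> (D (E' x) \<ominus> E' (D x))"
    if x: "x \<in> carrier A" for x
  proof -
    have "D (E x) \<in> carrier A" "E (D x) \<in> carrier A" "D (E' x) \<in> carrier A" "E' (D x) \<in> carrier A"
      using D E x by auto
    moreover have "D (E x \<oplus> E' x) = D (E x) \<oplus> D (E' x)" using D E x by (simp add: derivation_simps)
    ultimately show ?thesis by algebra
  qed
  then show ?thesis using D by (auto intro!: restrict_ext)
qed

lemma bracket_congruence:
  assumes D: "D \<in> derivations A" and E: "E \<in> derivations A"
    and a: "a \<in> carrier A" and b: "b \<in> carrier A"
  shows "(D \<oplus>\<^bsub>Der A\<^esub> ad a) \<otimes>\<^bsub>Der A\<^esub> (E \<oplus>\<^bsub>Der A\<^esub> ad b) =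
    D \<otimes>\<^bsub>Der A\<^esub> E \<oplus>\<^bsub>Der A\<^esub> ad (D b \<oplus> (\<ominus> E a \<oplus> ad a b))"
proof -
  have DE: "D \<otimes>\<^bsub>Der A\<^esub> E \<in> carrier (Der A)" using derivation_bracket[OF D E] by simp
  have E': "E \<oplus>\<^bsub>Der A\<^esub> ad b \<in> derivations A" using derivation_add[OF E ad_derivation[OF b]] by simp
  have c: "D b \<in> carrier A" "\<ominus> E a \<in> carrier A" "ad a b \<in> carrier A" using D E a b by auto
  have "(D \<oplus>\<^bsub>Der A\<^esub> ad a) \<otimes>\<^bsub>Der A\<^esub> (E \<oplus>\<^bsub>Der A\<^esub> ad b) =
    (D \<otimes>\<^bsub>Der A\<^esub> E \<oplus>\<^bsub>Der A\<^esub> ad (D b)) \<oplus>\<^bsub>Der A\<^esub> (ad (\<ominus> E a) \<oplus>\<^bsub>Der A\<^esub> ad (ad a b))"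
    unfolding bracket_add_left[OF D ad_derivation[OF a] E'] bracket_add_right[OF D E ad_derivation[OF b]]
      bracket_add_right[OF ad_derivation[OF a] E ad_derivation[OF b]] bracket_inner[OF D b]
      bracket_inner[OF E a] bracket_inner(1)[OF ad_derivation[OF a] b] ..
  also have "\<dots> = D \<otimes>\<^bsub>Der A\<^esub> E \<oplus>\<^bsub>Der A\<^esub> (ad (D b) \<oplus>\<^bsub>Der A\<^esub> (ad (\<ominus> E a) \<oplus>\<^bsub>Der A\<^esub> ad (ad a b)))"
    by (rule Der.M.a_assoc[OF DE]) (use c ad_derivation in \<open>auto simp only: Der_simps(1) ad_add[symmetric] add.m_closed\<close>)
  also have "\<dots> = D \<otimes>\<^bsub>Der A\<^esub> E \<oplus>\<^bsub>Der A\<^esub> ad (D b \<oplus> (\<ominus> E a \<oplus> ad a b))"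
    using c by (simp only: ad_add add.m_closed)
  finally show ?thesis .
qed

lemma HH1_bracket:
  assumes D: "D \<in> derivations A" and E: "E \<in> derivations A"
  shows "H.cls D \<otimes>\<^bsub>HH1 A\<^esub> H.cls E = H.cls (D \<otimes>\<^bsub>Der A\<^esub> E)"
  unfolding HH1_def
proof (rule H.quotient_mult)
  show DE: "D \<otimes>\<^bsub>Der A\<^esub> E \<in> carrier (Der A)" using derivation_bracket[OF D E] by simp
  fix D' E' assume D': "D' \<in> H.cls D" and E': "E' \<in> H.cls E"
  obtain a b where ab: "a \<in> carrier A" "b \<in> carrier A" "D' = D \<oplus>\<^bsub>Der A\<^esub> ad a" "E' = E \<oplus>\<^bsub>Der A\<^esub> ad b"
    using mem_cls[OF D] mem_cls[OF E] D' E' by blast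
  have "D' \<otimes>\<^bsub>Der A\<^esub> E' \<in> H.cls (D \<otimes>\<^bsub>Der A\<^esub> E)"
    unfolding ab(3,4) bracket_congruence[OF D E ab(1,2)]
    using ab D E DE by (subst mem_cls) (auto simp del: Der_simps(2-))
  then show "D' \<otimes>\<^bsub>Der A\<^esub> E' \<in> carrier (Der A) \<and>
    D' \<otimes>\<^bsub>Der A\<^esub> E' \<ominus>\<^bsub>Der A\<^esub> D \<otimes>\<^bsub>Der A\<^esub> E \<in> inner_derivations A"
    using H.mem_cls_iff[OF DE] by blast
qed (use D E in auto)

text \<open>Duality is meant in the weak sense of an expansion formula; no relation between
  \<open>f i (u j)\<close> and a Kronecker delta is claimed.\<close>

lemma dual_basis:
  obtains I :: "'a set" and f u where "finite I" "\<And>i. i \<in> I ==> functional (f i)"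
    "\<And>x. x \<in> carrier A ==> (\<And>i. i \<in> I ==> f i x = 0) ==> x = \<zero>"
    "\<And>i. i \<in> I ==> u i \<in> carrier A" "\<And>a. a \<in> carrier A ==> a = (\<Oplus>i\<in>I. f i a \<odot> u i)"
proof (rule coordinate_functionals[OF fin_dim])
  fix I :: "'a set" and f
  assume I: "finite I" and f: "\<And>i. i \<in> I ==> functional (f i)"
    and sep: "\<And>x. x \<in> carrier A ==> (\<And>i. i \<in> I ==> f i x = 0) ==> x = \<zero>"
  show thesis
  proof (rule separating_expansion[of I f, OF I f sep])
    fix u assume u: "\<And>i. i \<in> I ==> u i \<in> carrier A" "\<And>a. a \<in> carrier A ==> a = (\<Oplus>i\<in>I. f i a \<odot> u i)"
    show thesis by (rule that[OF I f sep u])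
  qed
qed

lemma Der_fin_dim: "Der.fin_dim"
proof (rule dual_basis)
  fix I :: "'a set" and f u
  assume I: "finite I" "\<And>i. i \<in> I ==> functional (f i)"
    and sep: "\<And>x. x \<in> carrier A ==> (\<And>i. i \<in> I ==> f i x = 0) ==> x = \<zero>"
    and u: "\<And>i. i \<in> I ==> u i \<in> carrier A"
    and ue: "\<And>a. a \<in> carrier A ==> a = (\<Oplus>i\<in>I. f i a \<odot> u i)"
  show ?thesis
  proof (rule Der.fin_dim_of_separating(1)[of "I \<times> I" "\<lambda>(i, j) D. f i (D (u j))"])
    show "finite (I \<times> I)" using I by simp
    show "Der.functional (case ij of (i, j) => \<lambda>D. f i (D (u j)))" if "ij \<in> I \<times> I" for ij
      using that I(2) u by (auto simp: Der.functional_def functional_simps)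
    fix D assume D: "D \<in> carrier (Der A)"
      and z: "\<And>ij. ij \<in> I \<times> I ==> (case ij of (i, j) => \<lambda>D. f i (D (u j))) D = 0"
    have Du: "D (u j) = \<zero>" if "j \<in> I" for j
      using z D that u by (intro sep) fastforce+
    have "D x = \<zero>" if x: "x \<in> carrier A" for x
    proof -
      have "D x = D (\<Oplus>i\<in>I. f i x \<odot> u i)" using ue[OF x] by simp
      also have "\<dots> = (\<Oplus>i\<in>I. D (f i x \<odot> u i))"
        using D u I by (intro linear_map_sum derivation_linear) auto
      also have "\<dots> = (\<Oplus>i\<in>I. \<zero>)"
        using D u Du by (intro finsum_cong') (auto simp: derivation_simps)
      finally show ?thesis by simp
    qed
    then show "D = \<zero>\<^bsub>Der A\<^esub>"
      using D by (intro extensionalityI[of _ "carrier A"]) (auto simp: derivations_iff)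
  qed
qed

lemma HH1_fin_dim: "HH1.fin_dim"
  unfolding HH1_def by (rule H.quotient_fin_dim[OF Der_fin_dim])

lemma torus_subspace: "torus A T ==> subspace class_ring T (HH1 A)"
  by (auto simp: torus_def torus_char_0_def torus_char_p_def restricted_subalgebra_def
      lie_subalgebra_def split: if_splits)

text \<open>The \<open>Max\<close> in \<open>mt_rank\<close> says something only for a finite set;
  the bound on dimensions of subspaces of \<open>HH1 A\<close> provides this.\<close>

lemma finite_torus_dims:
  "finite {vectorspace.dim class_ring (HH1 A\<lparr>carrier := T\<rparr>) |T. torus A T}"
proof -
  obtain N where N: "\<And>T. subspace class_ring T (HH1 A) ==>
      vectorspace.dim class_ring (HH1 A\<lparr>carrier := T\<rparr>) \<le> N"
    using HH1.subspace_dim_le[OF HH1_fin_dim] by metis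
  then have "{vectorspace.dim class_ring (HH1 A\<lparr>carrier := T\<rparr>) |T. torus A T} \<subseteq> {..N}"
    using torus_subspace by auto
  then show ?thesis by (rule finite_subset) simp
qed

lemma mt_rank_pos:
  assumes T: "torus A T" and x: "x \<in> T" "x \<noteq> \<zero>\<^bsub>HH1 A\<^esub>"
  shows "mt_rank A \<noteq> 0"
proof -
  have sub: "subspace class_ring T (HH1 A)" by (rule torus_subspace[OF T])
  interpret T: kspace "HH1 A\<lparr>carrier := T\<rparr>" by (rule HH1.kspace_subspace[OF sub])
  have "T.fin_dim" using HH1.subspace_dim_le[OF HH1_fin_dim] sub by metis
  then have "T.dim > 0" using x by (intro T.dim_pos[of x]) auto
  moreover have "T.dim \<le> mt_rank A"
    unfolding mt_rank_def using finite_torus_dims T by (intro Max_ge) auto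
  ultimately show ?thesis by simp
qed

text \<open>A torus has to be supplied although all dimensions vanish: without one, the
  \<open>Max\<close> would be taken over the empty set.\<close>

lemma mt_rank_zero:
  assumes "carrier (HH1 A) = {\<zero>\<^bsub>HH1 A\<^esub>}" and T: "torus A T"
  shows "mt_rank A = 0"
proof -
  have "vectorspace.dim class_ring (HH1 A\<lparr>carrier := S\<rparr>) = 0" if "torus A S" for S
  proof -
    have sub: "subspace class_ring S (HH1 A)" by (rule torus_subspace[OF that])
    interpret S: kspace "HH1 A\<lparr>carrier := S\<rparr>" by (rule HH1.kspace_subspace[OF sub])
    have "S = {\<zero>\<^bsub>HH1 A\<^esub>}"
      using sub assms(1) S.M.zero_closed by (auto simp: subspace_def submodule_def)
    then show ?thesis using S.dim_trivial by simp
  qed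
  then have "{vectorspace.dim class_ring (HH1 A\<lparr>carrier := S\<rparr>) |S. torus A S} = {0}"
    using T by (auto intro: exI[of _ T])
  then show ?thesis by (simp add: mt_rank_def)
qed

end

section \<open>Tori in positive characteristic\<close>

text \<open>Pascal's rule in the shape of a Leibniz step: each term with total index
  \<open>n\<close> contributes once with the first and once with the second index of
  \<open>g\<close> raised.\<close>

lemma pascal_sum:
  fixes g :: "nat => nat => 'b::comm_ring_1"
  shows "(\<Sum>k\<le>Suc n. of_nat (Suc n choose k) * g k (Suc n - k)) =
    (\<Sum>k\<le>n. of_nat (n choose k) * g (Suc k) (n - k)) + (\<Sum>k\<le>n. of_nat (n choose k) * g k (Suc n - k))"
proof -
  have "(\<Sum>k\<le>Suc n. of_nat (Suc n choose k) * g k (Suc n - k)) =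
    g 0 (Suc n) + (\<Sum>k\<le>n. of_nat (Suc n choose Suc k) * g (Suc k) (n - k))"
    by (subst sum.atMost_Suc_shift) simp
  also have "(\<Sum>k\<le>n. of_nat (Suc n choose Suc k) * g (Suc k) (n - k)) =
    (\<Sum>k\<le>n. of_nat (n choose k) * g (Suc k) (n - k)) + (\<Sum>k\<le>n. of_nat (n choose Suc k) * g (Suc k) (n - k))"
    by (simp add: sum.distrib distrib_right)
  also have "g 0 (Suc n) + (\<dots>) = (\<Sum>k\<le>n. of_nat (n choose k) * g (Suc k) (n - k)) +
    (g 0 (Suc n) + (\<Sum>k\<le>n. of_nat (n choose Suc k) * g (Suc k) (n - k)))" by simp
  also have "g 0 (Suc n) + (\<Sum>k\<le>n. of_nat (n choose Suc k) * g (Suc k) (n - k)) =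
    (\<Sum>k\<le>Suc n. of_nat (n choose k) * g k (Suc n - k))"
    by (subst sum.atMost_Suc_shift) simp
  also have "\<dots> = (\<Sum>k\<le>n. of_nat (n choose k) * g k (Suc n - k))" by (simp add: binomial_eq_0)
  finally show ?thesis .
qed

context kalg
begin

text \<open>Three maps are allowed since Jacobson's formula uses one operator with two different
  pairs of partners. Applying a functional turns the identity into one in the field, where the
  binomial coefficients live.\<close>

lemma leibniz_power:
  assumes X: "linear_map X" and Y: "linear_map Y" and Z: "linear_map Z"
    and XYZ: "\<And>x y. x \<in> carrier A ==> y \<in> carrier A ==> X (x \<otimes> y) = Y x \<otimes> y \<oplus> x \<otimes> Z y"
    and "functional l" and x: "x \<in> carrier A" and y: "y \<in> carrier A"
  shows "l ((X ^^ n) (x \<otimes> y)) = (\<Sum>k\<le>n. of_nat (n choose k) * l ((Y ^^ k) x \<otimes> (Z ^^ (n - k)) y))"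
  using assms(5)
proof (induction n arbitrary: l)
  case 0
  then show ?case by simp
next
  case (Suc n)
  note Yk = linear_map_closed[OF linear_map_funpow[OF Y] x]
    and Zk = linear_map_closed[OF linear_map_funpow[OF Z] y]
  have "l ((X ^^ Suc n) (x \<otimes> y)) = (\<lambda>a. l (X a)) ((X ^^ n) (x \<otimes> y))" by simp
  also have "\<dots> = (\<Sum>k\<le>n. of_nat (n choose k) * l (X ((Y ^^ k) x \<otimes> (Z ^^ (n - k)) y)))"
    by (rule Suc.IH[OF functional_comp[OF Suc.prems X]])
  also have "\<dots> = (\<Sum>k\<le>n. of_nat (n choose k) * (l ((Y ^^ Suc k) x \<otimes> (Z ^^ (n - k)) y) +
      l ((Y ^^ k) x \<otimes> (Z ^^ (Suc n - k)) y)))"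
  proof (rule sum.cong)
    fix k assume "k \<in> {..n}"
    then have "(Z ^^ (Suc n - k)) y = Z ((Z ^^ (n - k)) y)" by (simp add: Suc_diff_le)
    moreover have "l (X ((Y ^^ k) x \<otimes> (Z ^^ (n - k)) y)) =
      l (Y ((Y ^^ k) x) \<otimes> (Z ^^ (n - k)) y) + l ((Y ^^ k) x \<otimes> Z ((Z ^^ (n - k)) y))"
      using Suc.prems Y Z Yk Zk by (simp add: XYZ functional_add)
    ultimately show "of_nat (n choose k) * l (X ((Y ^^ k) x \<otimes> (Z ^^ (n - k)) y)) =
      of_nat (n choose k) * (l ((Y ^^ Suc k) x \<otimes> (Z ^^ (n - k)) y) +
      l ((Y ^^ k) x \<otimes> (Z ^^ (Suc n - k)) y))" by simp
  qed simp
  also have "\<dots> = (\<Sum>k\<le>Suc n. of_nat (Suc n choose k) * l ((Y ^^ k) x \<otimes> (Z ^^ (Suc n - k)) y))"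
    by (simp only: pascal_sum[where g = "\<lambda>i j. l ((Y ^^ i) x \<otimes> (Z ^^ j) y)"] sum.distrib distrib_left)
  finally show ?case .
qed

text \<open>In characteristic \<open>p\<close> all binomial coefficients strictly between the two
  ends vanish.\<close>

lemma leibniz_CHAR:
  assumes p: "CHAR('k) > 0" and X: "linear_map X" and Y: "linear_map Y" and Z: "linear_map Z"
    and XYZ: "\<And>x y. x \<in> carrier A ==> y \<in> carrier A ==> X (x \<otimes> y) = Y x \<otimes> y \<oplus> x \<otimes> Z y"
    and x: "x \<in> carrier A" and y: "y \<in> carrier A"
  shows "(X ^^ CHAR('k)) (x \<otimes> y) = (Y ^^ CHAR('k)) x \<otimes> y \<oplus> x \<otimes> (Z ^^ CHAR('k)) y"
proof (rule functionals_separate)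
  let ?p = "CHAR('k)"
  have prime: "prime ?p" using p by (rule prime_CHAR_semidom)
  note Xn = linear_map_closed[OF linear_map_funpow[OF X]]
    and Yn = linear_map_closed[OF linear_map_funpow[OF Y]]
    and Zn = linear_map_closed[OF linear_map_funpow[OF Z]]
  show "(X ^^ ?p) (x \<otimes> y) \<in> carrier A" "(Y ^^ ?p) x \<otimes> y \<oplus> x \<otimes> (Z ^^ ?p) y \<in> carrier A"
    using Xn Yn Zn x y by auto
  fix l assume l: "functional l"
  have "l ((X ^^ ?p) (x \<otimes> y)) = (\<Sum>k\<le>?p. of_nat (?p choose k) * l ((Y ^^ k) x \<otimes> (Z ^^ (?p - k)) y))"
    by (rule leibniz_power[OF X Y Z XYZ l x y])
  also have "\<dots> = (\<Sum>k\<in>{0, ?p}. of_nat (?p choose k) * l ((Y ^^ k) x \<otimes> (Z ^^ (?p - k)) y))"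
  proof (rule sum.mono_neutral_right)
    show "\<forall>k\<in>{..?p} - {0, ?p}. of_nat (?p choose k) * l ((Y ^^ k) x \<otimes> (Z ^^ (?p - k)) y) = 0"
    proof
      fix k assume "k \<in> {..?p} - {0, ?p}"
      then have "?p dvd (?p choose k)" using prime by (intro dvd_choose_prime) auto
      then have "(of_nat (?p choose k) :: 'k) = 0" by (simp add: of_nat_eq_0_iff_char_dvd)
      then show "of_nat (?p choose k) * l ((Y ^^ k) x \<otimes> (Z ^^ (?p - k)) y) = 0" by simp
    qed
  qed auto
  also have "\<dots> = l (x \<otimes> (Z ^^ ?p) y) + l ((Y ^^ ?p) x \<otimes> y)" using p by simp
  also have "\<dots> = l ((Y ^^ ?p) x \<otimes> y \<oplus> x \<otimes> (Z ^^ ?p) y)"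
    using l Yn Zn x y by (simp add: functional_add)
  finally show "l ((X ^^ ?p) (x \<otimes> y)) = l ((Y ^^ ?p) x \<otimes> y \<oplus> x \<otimes> (Z ^^ ?p) y)" .
qed

definition p_power :: "('a => 'a) => 'a => 'a" where
  "p_power D = restrict (D ^^ CHAR('k)) (carrier A)"

lemma p_power_derivation:
  assumes p: "CHAR('k) > 0" and D: "D \<in> derivations A"
  shows "p_power D \<in> derivations A"
  unfolding p_power_def
proof (rule derivation_restrictI)
  note lin = linear_map_funpow[OF derivation_linear[OF D], of "CHAR('k)"]
  show "(D ^^ CHAR('k)) (x \<otimes> y) = (D ^^ CHAR('k)) x \<otimes> y \<oplus> x \<otimes> (D ^^ CHAR('k)) y"
    if "x \<in> carrier A" "y \<in> carrier A" for x y
    using leibniz_CHAR[OF p derivation_linear[OF D] derivation_linear[OF D] derivation_linear[OF D]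
        derivation_mult[OF D] that] .
qed (use linear_map_funpow[OF derivation_linear[OF D], of "CHAR('k)"] in
    \<open>simp_all add: linear_map_add linear_map_smult\<close>)

text \<open>
  Jacobson's formula modulo inner derivations: with \<open>P x = D x \<oplus> a \<otimes> x\<close> one has both
  \<open>P (x \<otimes> y) = P x \<otimes> y \<oplus> x \<otimes> D y\<close> and \<open>P (x \<otimes> y) = (D + ad a) x \<otimes> y \<oplus> x \<otimes> P y\<close>,
  and comparing the two \<open>p\<close>-th powers at \<open>\<one>\<close> gives \<open>(D + ad a)^p = D^p + ad (P^p \<one>)\<close>.
\<close>

lemma p_power_add_ad:
  assumes p: "CHAR('k) > 0" and D: "D \<in> derivations A" and a: "a \<in> carrier A"
  obtains b where "b \<in> carrier A" "p_power (D \<oplus>\<^bsub>Der A\<^esub> ad a) = p_power D \<oplus>\<^bsub>Der A\<^esub> ad b"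
proof -
  let ?p = "CHAR('k)"
  define E where "E = D \<oplus>\<^bsub>Der A\<^esub> ad a"
  have E: "E \<in> derivations A" unfolding E_def using derivation_add[OF D ad_derivation[OF a]] by simp
  define P where "P x = D x \<oplus> a \<otimes> x" for x
  have P: "linear_map P"
    unfolding linear_map_def
  proof (intro conjI ballI allI)
    fix x y assume x: "x \<in> carrier A" and y: "y \<in> carrier A"
    have c: "D x \<in> carrier A" "D y \<in> carrier A" using D x y by auto
    show "P (x \<oplus> y) = P x \<oplus> P y"
      unfolding P_def derivation_simps(1)[OF D x y] using c a x y by algebra
  next
    fix c x assume x: "x \<in> carrier A"
    then show "P (c \<odot> x) = c \<odot> P x"
      using D a by (simp add: P_def derivation_simps smult_add_right smult_mult_right)
  next
    fix x assume "x \<in> carrier A"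
    then show "P x \<in> carrier A" using D a by (simp add: P_def)
  qed
  have P1: "P (x \<otimes> y) = P x \<otimes> y \<oplus> x \<otimes> D y" and P2: "P (x \<otimes> y) = E x \<otimes> y \<oplus> x \<otimes> P y"
    if x: "x \<in> carrier A" and y: "y \<in> carrier A" for x y
  proof -
    have c: "D x \<in> carrier A" "D y \<in> carrier A" using D x y by auto
    show "P (x \<otimes> y) = P x \<otimes> y \<oplus> x \<otimes> D y"
      unfolding P_def derivation_mult[OF D x y] using c a x y by algebra
    have Ex: "E x = D x \<oplus> (a \<otimes> x \<ominus> x \<otimes> a)" using x by (simp add: E_def)
    show "P (x \<otimes> y) = E x \<otimes> y \<oplus> x \<otimes> P y"
      unfolding P_def Ex derivation_mult[OF D x y] using c a x y by algebra
  qed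
  define b where "b = (P ^^ ?p) \<one>"
  have b: "b \<in> carrier A" using linear_map_closed[OF linear_map_funpow[OF P]] by (simp add: b_def)
  have pw: "(E ^^ ?p) x = (D ^^ ?p) x \<oplus> (b \<otimes> x \<ominus> x \<otimes> b)" if x: "x \<in> carrier A" for x
  proof -
    have c: "(E ^^ ?p) x \<in> carrier A" "(D ^^ ?p) x \<in> carrier A"
      using linear_map_closed[OF linear_map_funpow[OF derivation_linear] x] D E by auto
    have "(P ^^ ?p) (\<one> \<otimes> x) = b \<otimes> x \<oplus> \<one> \<otimes> (D ^^ ?p) x"
      unfolding b_def by (rule leibniz_CHAR[OF p P P derivation_linear[OF D] P1 one_closed x])
    moreover have "(P ^^ ?p) (x \<otimes> \<one>) = (E ^^ ?p) x \<otimes> \<one> \<oplus> x \<otimes> b"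
      unfolding b_def by (rule leibniz_CHAR[OF p P derivation_linear[OF E] P P2 x one_closed])
    ultimately have eq: "b \<otimes> x \<oplus> (D ^^ ?p) x = (E ^^ ?p) x \<oplus> x \<otimes> b" using x c by simp
    have "(E ^^ ?p) x = ((E ^^ ?p) x \<oplus> x \<otimes> b) \<ominus> x \<otimes> b" using c x b by algebra
    also have "\<dots> = (D ^^ ?p) x \<oplus> (b \<otimes> x \<ominus> x \<otimes> b)" unfolding eq[symmetric] using c x b by algebra
    finally show ?thesis .
  qed
  have "p_power E = p_power D \<oplus>\<^bsub>Der A\<^esub> ad b"
    by (auto simp: p_power_def pw intro!: restrict_ext)
  then show thesis using b that by (simp add: E_def)
qed

lemma HH1_p_power_cls:
  assumes p: "CHAR('k) > 0" and D: "D \<in> derivations A"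
  shows "HH1_p_power A (H.cls D) = H.cls (p_power D)"
proof -
  have *: "H.cls (p_power E) = H.cls (p_power D)" if "E \<in> H.cls D" for E
  proof -
    have "\<exists>a\<in>carrier A. E = D \<oplus>\<^bsub>Der A\<^esub> ad a" using that by (simp only: mem_cls[OF D])
    then obtain a where a: "a \<in> carrier A" "E = D \<oplus>\<^bsub>Der A\<^esub> ad a" ..
    obtain b where b: "b \<in> carrier A" "p_power E = p_power D \<oplus>\<^bsub>Der A\<^esub> ad b"
      unfolding a(2) by (rule p_power_add_ad[OF p D a(1)])
    have "p_power E \<in> H.cls (p_power D)"
      unfolding mem_cls[OF p_power_derivation[OF p D]] by (rule bexI[of _ b]) (rule b)+
    then show ?thesis
      using H.a_repr_independence'[of "p_power E" "p_power D"] p_power_derivation[OF p D] by simp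
  qed
  have "H.cls D \<noteq> {}" using H.cls_self[of D] D by (metis Der_simps(1) empty_iff)
  moreover have "(\<Union>E\<in>H.cls D. H.cls (p_power E)) = (\<Union>E\<in>H.cls D. H.cls (p_power D))"
    by (rule SUP_cong[OF refl *])
  ultimately have "(\<Union>E\<in>H.cls D. H.cls (p_power E)) = H.cls (p_power D)"
    by (simp only: UN_constant if_False)
  then show ?thesis unfolding HH1_p_power_def p_power_def .
qed

lemma smult_derivation_power:
  assumes D: "D \<in> derivations A" and x: "x \<in> carrier A"
  shows "((c \<odot>\<^bsub>Der A\<^esub> D) ^^ n) x = c ^ n \<odot> (D ^^ n) x"
proof (induction n)
  case 0
  then show ?case using x by simp
next
  case (Suc n)
  have "(D ^^ n) x \<in> carrier A" using linear_map_closed[OF linear_map_funpow[OF derivation_linear[OF D]] x] .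
  then show ?case using Suc D by (simp add: derivation_simps smult_smult)
qed

lemma HH1_smult_cls_zero: "D \<in> derivations A ==> H.cls (0 \<odot>\<^bsub>Der A\<^esub> D) = \<zero>\<^bsub>HH1 A\<^esub>"
proof -
  assume D: "D \<in> derivations A"
  have "H.cls (0 \<odot>\<^bsub>Der A\<^esub> D) = 0 \<odot>\<^bsub>HH1 A\<^esub> H.cls D" by (rule HH1_smult[OF D, symmetric])
  also have "\<dots> = \<zero>\<^bsub>HH1 A\<^esub>" using D by (intro HH1.smult_0) (auto simp: HH1_carrier)
  finally show ?thesis .
qed

lemma subspaceI:
  assumes "T \<subseteq> carrier (HH1 A)" "\<zero>\<^bsub>HH1 A\<^esub> \<in> T"
    and "\<And>x y. x \<in> T ==> y \<in> T ==> x \<oplus>\<^bsub>HH1 A\<^esub> y \<in> T"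
    and "\<And>c x. x \<in> T ==> c \<odot>\<^bsub>HH1 A\<^esub> x \<in> T"
  shows "subspace class_ring T (HH1 A)"
  using assms HH1.vectorspace_axioms HH1.module_axioms
  by (intro subspace.intro submodule.intro) auto

lemma toral_line_torus:
  assumes p: "CHAR('k) > 0" and D: "D \<in> derivations A" and DD: "p_power D = D"
  shows "torus A {H.cls (c \<odot>\<^bsub>Der A\<^esub> D) |c. True}" (is "torus A ?T")
proof -
  have cD: "c \<odot>\<^bsub>Der A\<^esub> D \<in> derivations A" for c using derivation_smult[OF D] by simp
  have pow: "HH1_p_power A (H.cls (c \<odot>\<^bsub>Der A\<^esub> D)) = H.cls (c ^ CHAR('k) \<odot>\<^bsub>Der A\<^esub> D)" for c
  proof -
    have "p_power (c \<odot>\<^bsub>Der A\<^esub> D) = c ^ CHAR('k) \<odot>\<^bsub>Der A\<^esub> p_power D"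
      unfolding p_power_def
      by (auto simp: smult_derivation_power[OF D, simplified] intro!: restrict_ext)
    then show ?thesis using HH1_p_power_cls[OF p cD] DD by simp
  qed
  have smult: "d \<odot>\<^bsub>HH1 A\<^esub> H.cls (c \<odot>\<^bsub>Der A\<^esub> D) = H.cls ((d * c) \<odot>\<^bsub>Der A\<^esub> D)" for c d
    using HH1_smult[OF cD] Der.smult_smult[of D d c] D by simp
  have add: "H.cls (c \<odot>\<^bsub>Der A\<^esub> D) \<oplus>\<^bsub>HH1 A\<^esub> H.cls (d \<odot>\<^bsub>Der A\<^esub> D) = H.cls ((c + d) \<odot>\<^bsub>Der A\<^esub> D)" for c d
    using HH1_add[OF cD cD] Der.smult_add_left[of D c d] D by simp
  have bracket: "H.cls (c \<odot>\<^bsub>Der A\<^esub> D) \<otimes>\<^bsub>HH1 A\<^esub> H.cls (d \<odot>\<^bsub>Der A\<^esub> D) = \<zero>\<^bsub>HH1 A\<^esub>" for c d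
  proof -
    have "(c \<odot>\<^bsub>Der A\<^esub> D) \<otimes>\<^bsub>Der A\<^esub> (d \<odot>\<^bsub>Der A\<^esub> D) = \<zero>\<^bsub>Der A\<^esub>"
      using D by (auto simp: derivation_simps smult_smult mult.commute intro!: restrict_ext)
    then show ?thesis using HH1_bracket[OF cD cD] H.cls_zero HH1_zero by simp
  qed
  have zero: "\<zero>\<^bsub>HH1 A\<^esub> \<in> ?T" 
    by (rule CollectI, rule exI[of _ 0]) (simp only: HH1_smult_cls_zero[OF D] simp_thms)
  have sub: "subspace class_ring ?T (HH1 A)"
  proof (rule subspaceI)
    show "?T \<subseteq> carrier (HH1 A)" using cD by (auto simp: HH1_carrier)
    show "x \<oplus>\<^bsub>HH1 A\<^esub> y \<in> ?T" if "x \<in> ?T" "y \<in> ?T" for x y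
    proof -
      obtain c d where "x = H.cls (c \<odot>\<^bsub>Der A\<^esub> D)" "y = H.cls (d \<odot>\<^bsub>Der A\<^esub> D)" using \<open>x \<in> ?T\<close> \<open>y \<in> ?T\<close> by blast
      then show ?thesis using add by blast
    qed
    show "c \<odot>\<^bsub>HH1 A\<^esub> x \<in> ?T" if "x \<in> ?T" for c x
    proof -
      obtain d where "x = H.cls (d \<odot>\<^bsub>Der A\<^esub> D)" using \<open>x \<in> ?T\<close> by blast
      then show ?thesis using smult by blast
    qed
  qed (rule zero)
  have "x \<in> generated_restricted_subalgebra A {HH1_p_power A x}" if x: "x \<in> ?T" for x
    unfolding generated_restricted_subalgebra_def
  proof (rule InterI, clarify)
    fix T' assume T': "restricted_subalgebra A T'" and "{HH1_p_power A x} \<subseteq> T'"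
    then have in_T': "HH1_p_power A x \<in> T'" by simp
    have s: "submodule class_ring T' (HH1 A)"
      using T' by (simp add: restricted_subalgebra_def lie_subalgebra_def subspace_def)
    obtain c where c: "x = H.cls (c \<odot>\<^bsub>Der A\<^esub> D)" using x by blast
    show "x \<in> T'"
    proof (cases "c = 0")
      case True
      then show ?thesis using HH1_smult_cls_zero[OF D] c submodule.zero_closed[OF s] by simp
    next
      case False
      \<comment> \<open>The \<open>p\<close>-power of \<open>x\<close> is the class of
        \<open>c ^ p\<close> times \<open>D\<close>, so this scalar multiple of it is
        \<open>x\<close> itself, which makes \<open>x\<close> semisimple.\<close>
      have "(c / c ^ CHAR('k)) \<odot>\<^bsub>HH1 A\<^esub> HH1_p_power A x \<in> T'"
        using submodule.smult_closed[OF s _ in_T'] by simp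
      then show ?thesis using False c pow smult by simp
    qed
  qed
  then have "torus_char_p A ?T"
    unfolding torus_char_p_def restricted_subalgebra_def lie_subalgebra_def
    using sub bracket pow zero by auto
  then show ?thesis using p by (simp add: torus_def)
qed

lemma trivial_torus_char_p:
  assumes p: "CHAR('k) > 0" and triv: "carrier (HH1 A) = {\<zero>\<^bsub>HH1 A\<^esub>}"
  shows "torus A {\<zero>\<^bsub>HH1 A\<^esub>}"
proof -
  let ?O = "\<zero>\<^bsub>HH1 A\<^esub>"
  have O: "\<zero>\<^bsub>Der A\<^esub> \<in> derivations A" using derivation_zero_map by simp
  have "?O = H.cls \<zero>\<^bsub>Der A\<^esub>" using H.cls_zero HH1_zero by simp
  then have "HH1_p_power A ?O = H.cls (p_power \<zero>\<^bsub>Der A\<^esub>)" "?O \<otimes>\<^bsub>HH1 A\<^esub> ?O = H.cls (\<zero>\<^bsub>Der A\<^esub> \<otimes>\<^bsub>Der A\<^esub> \<zero>\<^bsub>Der A\<^esub>)"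
    using HH1_p_power_cls[OF p O] HH1_bracket[OF O O] by simp_all
  then have "HH1_p_power A ?O \<in> carrier (HH1 A)" "?O \<otimes>\<^bsub>HH1 A\<^esub> ?O \<in> carrier (HH1 A)"
    using p_power_derivation[OF p O] derivation_bracket[OF O O] by (auto simp: HH1_carrier)
  then have pw: "HH1_p_power A ?O = ?O" "?O \<otimes>\<^bsub>HH1 A\<^esub> ?O = ?O" using triv by auto
  have "subspace class_ring {?O} (HH1 A)" by (rule subspaceI) auto
  moreover have "?O \<in> generated_restricted_subalgebra A {HH1_p_power A ?O}"
    unfolding generated_restricted_subalgebra_def pw by blast
  ultimately show ?thesis
    using p pw by (simp add: torus_def torus_char_p_def restricted_subalgebra_def lie_subalgebra_def)
qed

end

section \<open>Automorphisms and regular functions\<close>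

context kalg
begin

abbreviation G :: "('a => 'a) set" where "G \<equiv> algebra_automorphisms A"

lemma automorphism_iff:
  "phi \<in> G \<longleftrightarrow> phi \<in> extensional (carrier A) \<and> bij_betw phi (carrier A) (carrier A) \<and> linear_map phi \<and>
    (\<forall>x\<in>carrier A. \<forall>y\<in>carrier A. phi (x \<otimes> y) = phi x \<otimes> phi y) \<and> phi \<one> = \<one>"
  by (auto simp: algebra_automorphisms_def Bij_def Ring.ring_hom_def linear_map_module_hom linear_map_add)

lemma aut_linear: "phi \<in> G ==> linear_map phi"
  by (simp add: automorphism_iff)
lemma aut_closed [simp]: "phi \<in> G ==> x \<in> carrier A ==> phi x \<in> carrier A"
  using aut_linear by simp
lemma aut_mult: "phi \<in> G ==> x \<in> carrier A ==> y \<in> carrier A ==> phi (x \<otimes> y) = phi x \<otimes> phi y"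
  by (simp add: automorphism_iff)
lemma aut_one: "phi \<in> G ==> phi \<one> = \<one>"
  by (simp add: automorphism_iff)
lemmas aut_simps = linear_map_simps[OF aut_linear] aut_mult aut_one

lemma aut_eqI: "phi \<in> G ==> psi \<in> G ==> (\<And>x. x \<in> carrier A ==> phi x = psi x) ==> phi = psi"
  by (auto simp: automorphism_iff intro: extensionalityI)

lemma autI:
  assumes "linear_map F" "\<And>x y. x \<in> carrier A ==> y \<in> carrier A ==> F (x \<otimes> y) = F x \<otimes> F y" "F \<one> = \<one>"
    and "\<And>x. x \<in> carrier A ==> F' x \<in> carrier A"
    and "\<And>x. x \<in> carrier A ==> F (F' x) = x" "\<And>x. x \<in> carrier A ==> F' (F x) = x"
  shows "restrict F (carrier A) \<in> G"
proof -
  have "bij_betw F (carrier A) (carrier A)"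
    by (rule bij_betwI[where g = F']) (use assms in auto)
  then show ?thesis
    using assms linear_map_restrict[OF assms(1)] by (simp add: automorphism_iff)
qed

lemma G_subset_Bij: "G \<subseteq> Bij (carrier A)"
  by (auto simp: algebra_automorphisms_def)

lemma compose_aut:
  assumes phi: "phi \<in> G" and psi: "psi \<in> G"
  shows "compose (carrier A) phi psi \<in> G"
proof -
  have "bij_betw (compose (carrier A) phi psi) (carrier A) (carrier A)"
    using phi psi by (intro bij_betw_compose[of psi "carrier A" "carrier A"]) (simp_all add: automorphism_iff)
  then show ?thesis
    unfolding automorphism_iff[of "compose (carrier A) phi psi"] linear_map_def
    using phi psi by (simp add: compose_eq aut_simps)
qed

lemma inverse_aut:
  assumes phi: "phi \<in> G" shows "restrict (inv_into (carrier A) phi) (carrier A) \<in> G"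
proof (rule autI[where F' = phi])
  let ?i = "inv_into (carrier A) phi"
  have b: "bij_betw phi (carrier A) (carrier A)" using phi by (simp add: automorphism_iff)
  have ic: "?i x \<in> carrier A" "phi (?i x) = x" if "x \<in> carrier A" for x
    using b that by (auto simp: bij_betw_def f_inv_into_f inv_into_into)
  have ii: "?i y = x" if "x \<in> carrier A" "phi x = y" for x y
    using b that by (auto simp: bij_betw_def)
  show "linear_map ?i"
    unfolding linear_map_def
    by (intro conjI ballI allI ii ic(1)) (use phi ic in \<open>simp_all add: aut_simps\<close>)
  show "?i (x \<otimes> y) = ?i x \<otimes> ?i y" if "x \<in> carrier A" "y \<in> carrier A" for x y
    by (rule ii) (use that phi ic in \<open>simp_all add: aut_simps\<close>)
  show "?i \<one> = \<one>" by (rule ii) (use phi in \<open>simp_all add: aut_simps\<close>)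
  show "?i (phi x) = x" if "x \<in> carrier A" for x by (rule ii) (use that in simp_all)
qed (use phi in \<open>auto simp: automorphism_iff bij_betw_def f_inv_into_f\<close>)

lemma carrier_Aut [simp]: "carrier (Aut A) = G"
  by (simp add: Aut_def)

lemma subgroup_Aut: "subgroup G (BijGroup (carrier A))"
proof (rule group.subgroupI[OF group_BijGroup])
  show "G \<subseteq> carrier (BijGroup (carrier A))" using G_subset_Bij by (simp add: BijGroup_def)
  have "(\<lambda>x\<in>carrier A. x) \<in> G" by (rule autI[where F' = "\<lambda>x. x"]) (auto simp: linear_map_def)
  then show "G \<noteq> {}" by auto
  show "inv\<^bsub>BijGroup (carrier A)\<^esub> phi \<in> G" if "phi \<in> G" for phi
    using inverse_aut[OF that] inv_BijGroup[of phi "carrier A"] that G_subset_Bij by auto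
  show "phi \<otimes>\<^bsub>BijGroup (carrier A)\<^esub> psi \<in> G" if "phi \<in> G" "psi \<in> G" for phi psi
    using compose_aut[OF that] that G_subset_Bij by (auto simp: BijGroup_def)
qed

sublocale Aut: group "Aut A"
  unfolding Aut_def by (rule subgroup.subgroup_is_group[OF subgroup_Aut group_BijGroup])

abbreviation aut_comp :: "('a => 'a) => ('a => 'a) => 'a => 'a" (infixl "\<circ>\<^sub>A" 70) where
  "phi \<circ>\<^sub>A psi \<equiv> phi \<otimes>\<^bsub>Aut A\<^esub> psi"

abbreviation idA :: "'a => 'a" where "idA \<equiv> \<one>\<^bsub>Aut A\<^esub>"

abbreviation aut_inv :: "('a => 'a) => 'a => 'a" where "aut_inv phi \<equiv> inv\<^bsub>Aut A\<^esub> phi"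

lemma comp_in_G [simp]: "phi \<in> G ==> psi \<in> G ==> phi \<circ>\<^sub>A psi \<in> G"
  using Aut.m_closed by simp

lemma inv_in_G [simp]: "phi \<in> G ==> aut_inv phi \<in> G"
  using Aut.inv_closed by simp

lemma comp_apply [simp]: "phi \<in> G ==> psi \<in> G ==> x \<in> carrier A ==> (phi \<circ>\<^sub>A psi) x = phi (psi x)"
  using G_subset_Bij by (auto simp: Aut_def BijGroup_def compose_def)

lemma one_Aut_apply [simp]: "x \<in> carrier A ==> idA x = x"
  by (simp add: Aut_def BijGroup_def)

lemma one_in_G [simp]: "idA \<in> G"
  using Aut.one_closed by simp

lemma apply_inv [simp]: "phi \<in> G ==> x \<in> carrier A ==> phi (aut_inv phi x) = x"
  using comp_apply[of phi "aut_inv phi" x] Aut.r_inv[of phi] by simp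

lemma inv_apply [simp]: "phi \<in> G ==> x \<in> carrier A ==> aut_inv phi (phi x) = x"
  using comp_apply[of "aut_inv phi" phi x] Aut.l_inv[of phi] by simp

lemma aut_inj: "phi \<in> G ==> x \<in> carrier A ==> y \<in> carrier A ==> phi x = phi y ==> x = y"
  by (metis inv_apply)

section \<open>Inner automorphisms and the outer automorphism group\<close>

definition inn :: "'a => 'a => 'a" where
  "inn u = (\<lambda>x\<in>carrier A. u \<otimes> x \<otimes> inv u)"

lemma inner_automorphisms_eq: "inner_automorphisms A = inn ` Units A"
  by (auto simp: inner_automorphisms_def inn_def)

lemma inn_apply [simp]: "x \<in> carrier A ==> inn u x = u \<otimes> x \<otimes> inv u"
  by (simp add: inn_def)

lemma inn_in_G [simp]:
  assumes u: "u \<in> Units A" shows "inn u \<in> G"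
  unfolding inn_def
proof (rule autI[where F' = "\<lambda>x. inv u \<otimes> x \<otimes> u"])
  have c: "u \<in> carrier A" "inv u \<in> carrier A" and i: "inv u \<otimes> u = \<one>" "u \<otimes> inv u = \<one>"
    by (rule Units_closed[OF u] Units_closed[OF Units_inv_Units[OF u]] Units_l_inv[OF u] Units_r_inv[OF u])+
  show "linear_map (\<lambda>x. u \<otimes> x \<otimes> inv u)"
    using linear_map_comp[OF linear_map_mult_right[OF c(2)] linear_map_mult_left[OF c(1)]] .
  have k1: "inv u \<otimes> (u \<otimes> x) = x" and k2: "u \<otimes> (inv u \<otimes> x) = x" if "x \<in> carrier A" for x
    using that c i by (simp_all add: m_assoc[symmetric])
  show "u \<otimes> (x \<otimes> y) \<otimes> inv u = u \<otimes> x \<otimes> inv u \<otimes> (u \<otimes> y \<otimes> inv u)"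
    if "x \<in> carrier A" "y \<in> carrier A" for x y
    using that c k1 by (simp add: m_assoc)
  show "u \<otimes> \<one> \<otimes> inv u = \<one>" using c i by simp
  show "u \<otimes> (inv u \<otimes> x \<otimes> u) \<otimes> inv u = x" if "x \<in> carrier A" for x
    using that c k2 i by (simp add: m_assoc)
  show "inv u \<otimes> (u \<otimes> x \<otimes> inv u) \<otimes> u = x" if "x \<in> carrier A" for x
    using that c k1 i by (simp add: m_assoc)
  show "inv u \<otimes> x \<otimes> u \<in> carrier A" if "x \<in> carrier A" for x using that c by simp
qed

lemma inv_eqI: "x \<in> carrier A ==> y \<in> carrier A ==> x \<otimes> y = \<one> ==> y \<otimes> x = \<one> ==> inv x = y"
  using inv_char[of x y] by simp

lemma inn_mult:
  assumes u: "u \<in> Units A" and v: "v \<in> Units A"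
  shows "inn (u \<otimes> v) = inn u \<circ>\<^sub>A inn v"
proof (rule aut_eqI)
  have c: "u \<in> carrier A" "v \<in> carrier A" "inv u \<in> carrier A" "inv v \<in> carrier A"
    by (rule Units_closed[OF u] Units_closed[OF Units_inv_Units[OF u]]
      Units_closed[OF v] Units_closed[OF Units_inv_Units[OF v]])+
  have "(u \<otimes> v) \<otimes> (inv v \<otimes> inv u) = \<one>" "(inv v \<otimes> inv u) \<otimes> (u \<otimes> v) = \<one>"
  proof -
    have "(u \<otimes> v) \<otimes> (inv v \<otimes> inv u) = u \<otimes> ((v \<otimes> inv v) \<otimes> inv u)"
      "(inv v \<otimes> inv u) \<otimes> (u \<otimes> v) = inv v \<otimes> ((inv u \<otimes> u) \<otimes> v)"
      using c by (simp_all only: m_assoc m_closed)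
    then show "(u \<otimes> v) \<otimes> (inv v \<otimes> inv u) = \<one>" "(inv v \<otimes> inv u) \<otimes> (u \<otimes> v) = \<one>"
      using c by (simp_all only: Units_r_inv[OF u] Units_r_inv[OF v] Units_l_inv[OF u] Units_l_inv[OF v] l_one)
  qed
  then have "inv (u \<otimes> v) = inv v \<otimes> inv u" using c by (intro inv_eqI) auto
  then show "inn (u \<otimes> v) x = (inn u \<circ>\<^sub>A inn v) x" if "x \<in> carrier A" for x
    using that u v c by (simp add: m_assoc)
qed (use u v in simp_all)

lemma inn_one: "inn \<one> = idA"
  by (rule aut_eqI) simp_all

lemma inn_inv:
  assumes u: "u \<in> Units A" shows "aut_inv (inn u) = inn (inv u)"
proof -
  have "inn (inv u) \<circ>\<^sub>A inn u = idA"
    using u by (simp add: inn_mult[symmetric] inn_one Units_l_inv)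
  then show ?thesis using Aut.inv_equality[of "inn (inv u)" "inn u"] u by simp
qed

lemma aut_Units:
  assumes phi: "phi \<in> G" and u: "u \<in> Units A"
  shows "phi u \<in> Units A" and "phi (inv u) = inv (phi u)"
proof -
  have uc: "u \<in> carrier A" "inv u \<in> carrier A" using u by auto
  have 1: "phi u \<otimes> phi (inv u) = \<one>" "phi (inv u) \<otimes> phi u = \<one>"
    using phi u uc by (simp_all add: aut_mult[symmetric] aut_one Units_l_inv Units_r_inv)
  then show U: "phi u \<in> Units A" using phi uc unfolding Units_def by auto
  show "phi (inv u) = inv (phi u)" using 1 phi uc by (intro inv_eqI[symmetric]) auto
qed

lemma inn_commute:
  assumes phi: "phi \<in> G" and u: "u \<in> Units A"
  shows "phi \<circ>\<^sub>A inn u = inn (phi u) \<circ>\<^sub>A phi"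
  using aut_Units[OF assms] assms Units_closed[OF u] Units_closed[OF Units_inv_Units[OF u]]
  by (intro aut_eqI) (simp_all add: aut_simps)

sublocale Inn: normal "inner_automorphisms A" "Aut A"
proof -
  have "subgroup (inner_automorphisms A) (Aut A)"
    unfolding inner_automorphisms_eq
  proof (rule Aut.subgroupI)
    show "inn ` Units A \<noteq> {}" using Units_one_closed by blast
  qed (auto simp: inn_inv inn_mult[symmetric])
  moreover have "phi \<circ>\<^sub>A \<nu> \<circ>\<^sub>A aut_inv phi \<in> inner_automorphisms A"
    if phi: "phi \<in> G" and \<nu>: "\<nu> \<in> inner_automorphisms A" for phi \<nu>
  proof -
    obtain u where u: "u \<in> Units A" "\<nu> = inn u" using \<nu> by (auto simp: inner_automorphisms_eq)
    have "phi \<circ>\<^sub>A \<nu> \<circ>\<^sub>A aut_inv phi = inn (phi u)"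
      using phi u aut_Units[OF phi u(1)] by (simp add: inn_commute Aut.m_assoc)
    then show ?thesis using aut_Units[OF phi u(1)] by (auto simp: inner_automorphisms_eq)
  qed
  ultimately show "normal (inner_automorphisms A) (Aut A)" by (simp add: Aut.normal_inv_iff)
qed

sublocale Out: group "Out A"
  unfolding Out_def by (rule Inn.factorgroup_is_group)

abbreviation out :: "('a => 'a) => ('a => 'a) set" where
  "out phi \<equiv> inner_automorphisms A #>\<^bsub>Aut A\<^esub> phi"

lemma carrier_Out: "carrier (Out A) = out ` G"
  by (auto simp: Out_def FactGroup_def RCOSETS_def)

lemma out_in [simp]: "phi \<in> G ==> out phi \<in> carrier (Out A)"
  by (auto simp: carrier_Out)

lemma out_mult: "phi \<in> G ==> psi \<in> G ==> out phi \<otimes>\<^bsub>Out A\<^esub> out psi = out (phi \<circ>\<^sub>A psi)"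
  by (simp add: Out_def FactGroup_def Inn.rcos_sum)

lemma one_Out: "\<one>\<^bsub>Out A\<^esub> = out idA"
  using Aut.coset_mult_one[of "inner_automorphisms A"] Inn.subset by (simp add: Out_def FactGroup_def)

text \<open>The definition uses multiplication by inner automorphisms on the other side. The form
  with \<open>inn u\<close> on the right is the one in which all later invariance statements are
  phrased.\<close>

lemma mem_out:
  assumes phi: "phi \<in> G"
  shows "psi \<in> out phi \<longleftrightarrow> (\<exists>u\<in>Units A. psi = phi \<circ>\<^sub>A inn u)"
proof
  assume "psi \<in> out phi"
  then obtain u where u: "u \<in> Units A" "psi = inn u \<circ>\<^sub>A phi"
    by (auto simp: r_coset_def inner_automorphisms_eq)
  have v: "aut_inv phi u \<in> Units A" using aut_Units[of "aut_inv phi"] u phi by simp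
  have "phi \<circ>\<^sub>A inn (aut_inv phi u) = inn u \<circ>\<^sub>A phi"
    using inn_commute[OF phi v] u(1) phi Units_closed[OF u(1)] by simp
  then show "\<exists>u\<in>Units A. psi = phi \<circ>\<^sub>A inn u" using u v by metis
next
  assume "\<exists>u\<in>Units A. psi = phi \<circ>\<^sub>A inn u"
  then obtain u where u: "u \<in> Units A" "psi = phi \<circ>\<^sub>A inn u" by blast
  then have "psi = inn (phi u) \<circ>\<^sub>A phi" using inn_commute[OF phi] by simp
  then show "psi \<in> out phi"
    using aut_Units[OF phi u(1)] by (auto simp: r_coset_def inner_automorphisms_eq)
qed

lemma out_eqI: "phi \<in> G ==> psi \<in> out phi ==> out psi = out phi"
  using Aut.repr_independence[of psi "inner_automorphisms A" phi] Inn.subgroup_axioms by simp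

lemma out_self: "phi \<in> G ==> phi \<in> out phi"
  using Aut.rcos_self[of phi "inner_automorphisms A"] Inn.subgroup_axioms by simp

lemma out_eq_iff: "phi \<in> G ==> psi \<in> G ==> out psi = out phi \<longleftrightarrow> (\<exists>u\<in>Units A. psi = phi \<circ>\<^sub>A inn u)"
  using out_eqI[of phi psi] out_self[of psi] mem_out[of phi psi] by metis

text \<open>Values outside \<open>G\<close> are ignored, so that arbitrary lambda terms can be
  treated as regular functions without restricting them first.\<close>

definition reg :: "(('a => 'a) => 'k) => bool" where
  "reg f \<longleftrightarrow> restrict f G \<in> Aut_functions A"

lemma reg_cong: "(\<And>phi. phi \<in> G ==> f phi = g phi) ==> reg f \<longleftrightarrow> reg g"
  using restrict_ext[of G f g] by (simp add: reg_def)

lemma reg_const: "reg (\<lambda>phi. c)"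
  unfolding reg_def Aut_functions_def carrier_Aut by (rule function_algebra.const)

lemma reg_add: "reg f ==> reg g ==> reg (\<lambda>phi. f phi + g phi)"
  unfolding reg_def Aut_functions_def carrier_Aut
  by (drule (1) function_algebra.add) (simp cong: restrict_cong)

lemma reg_mult: "reg f ==> reg g ==> reg (\<lambda>phi. f phi * g phi)"
  unfolding reg_def Aut_functions_def carrier_Aut
  by (drule (1) function_algebra.mult) (simp cong: restrict_cong)

lemma reg_coeff: "functional l ==> a \<in> carrier A ==> reg (\<lambda>phi. l (phi a))"
  unfolding reg_def Aut_functions_def carrier_Aut
  by (rule function_algebra.gen) (auto simp: linear_functionals_iff)

lemma reg_inv_coeff: "functional l ==> a \<in> carrier A ==> reg (\<lambda>phi. l (aut_inv phi a))"
  unfolding reg_def Aut_functions_def carrier_Aut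
  by (rule function_algebra.gen) (auto simp: linear_functionals_iff)

lemma reg_restrict: "reg (restrict f G) \<longleftrightarrow> reg f"
  by (rule reg_cong) simp

lemma reg_induct [consumes 1, case_names cong const coeff inv_coeff add mult]:
  assumes "reg f"
    and cong: "\<And>f g. P f ==> (\<And>phi. phi \<in> G ==> f phi = g phi) ==> P g"
    and const: "\<And>c. P (\<lambda>phi. c)"
    and coeff: "\<And>l a. functional l ==> a \<in> carrier A ==> P (\<lambda>phi. l (phi a))"
    and inv_coeff: "\<And>l a. functional l ==> a \<in> carrier A ==> P (\<lambda>phi. l (aut_inv phi a))"
    and add: "\<And>f g. reg f ==> reg g ==> P f ==> P g ==> P (\<lambda>phi. f phi + g phi)"
    and mult: "\<And>f g. reg f ==> reg g ==> P f ==> P g ==> P (\<lambda>phi. f phi * g phi)"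
  shows "P f"
proof -
  have res: "P (restrict f G) \<and> reg (restrict f G)" if "P f" "reg f" for f
    by (rule conjI, rule cong[OF that(1)]) (simp_all only: reg_restrict that restrict_apply')
  have fa: "restrict f G \<in> function_algebra G ({(\<lambda>phi. l (phi a)) |l a. l \<in> linear_functionals A \<and> a \<in> carrier A} \<union>
      {(\<lambda>phi. l (aut_inv phi a)) |l a. l \<in> linear_functionals A \<and> a \<in> carrier A})"
    using assms(1) by (simp add: reg_def Aut_functions_def)
  have "P f' \<and> reg f'"
    if "f' \<in> function_algebra G ({(\<lambda>phi. l (phi a)) |l a. l \<in> linear_functionals A \<and> a \<in> carrier A} \<union>
      {(\<lambda>phi. l (aut_inv phi a)) |l a. l \<in> linear_functionals A \<and> a \<in> carrier A})" for f'
    using that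
  proof (induction rule: function_algebra.induct)
    case (const c)
    show ?case by (rule res[OF assms(3)[of c] reg_const])
  next
    case (gen f)
    then consider (1) l a where "f = (\<lambda>phi. l (phi a))" "functional l" "a \<in> carrier A"
      | (2) l a where "f = (\<lambda>phi. l (aut_inv phi a))" "functional l" "a \<in> carrier A"
      by (auto simp: linear_functionals_iff)
    then show ?case
    proof cases
      case 1
      show ?thesis unfolding 1(1) by (rule res[OF coeff[OF 1(2,3)] reg_coeff[OF 1(2,3)]])
    next
      case 2
      show ?thesis unfolding 2(1) by (rule res[OF inv_coeff[OF 2(2,3)] reg_inv_coeff[OF 2(2,3)]])
    qed
  next
    case (add f g)
    then have "P f" "P g" "reg f" "reg g" by simp_all
    then show ?case by (intro res assms(6) reg_add)
  next
    case (mult f g)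
    then have "P f" "P g" "reg f" "reg g" by simp_all
    then show ?case by (intro res assms(7) reg_mult)
  qed
  from this[OF fa] have "P (restrict f G)" ..
  then show ?thesis by (rule cong) simp
qed

lemma reg_sum: "finite I ==> (\<And>i. i \<in> I ==> reg (f i)) ==> reg (\<lambda>phi. \<Sum>i\<in>I. f i phi)"
  by (induction I rule: finite_induct) (auto simp: reg_const reg_add)

lemma reg_prod: "finite I ==> (\<And>i. i \<in> I ==> reg (f i)) ==> reg (\<lambda>phi. \<Prod>i\<in>I. f i phi)"
  by (induction I rule: finite_induct) (auto simp: reg_const reg_mult)

lemma reg_power: "reg f ==> reg (\<lambda>phi. f phi ^ n)"
  by (induction n) (auto simp: reg_const reg_mult)

text \<open>Morphisms of varieties from the automorphism group to the vector space \<open>A\<close>.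
  The normal form is assembled from such maps.\<close>

definition reg_elem :: "(('a => 'a) => 'a) => bool" where
  "reg_elem p \<longleftrightarrow> (\<forall>phi\<in>G. p phi \<in> carrier A) \<and> (\<forall>l. functional l \<longrightarrow> reg (\<lambda>phi. l (p phi)))"

lemma reg_elemI:
  "(\<And>phi. phi \<in> G ==> p phi \<in> carrier A) ==> (\<And>l. functional l ==> reg (\<lambda>phi. l (p phi))) ==> reg_elem p"
  by (simp add: reg_elem_def)
lemma reg_elem_closed [simp]: "reg_elem p ==> phi \<in> G ==> p phi \<in> carrier A"
  by (simp add: reg_elem_def)
lemma reg_elemD: "reg_elem p ==> functional l ==> reg (\<lambda>phi. l (p phi))"
  by (simp add: reg_elem_def)
lemma reg_elem_cong: "reg_elem p ==> (\<And>phi. phi \<in> G ==> p phi = q phi) ==> reg_elem q"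
  unfolding reg_elem_def using reg_cong[of "\<lambda>phi. l (p phi)" "\<lambda>phi. l (q phi)" for l] by metis

lemma reg_elem_const: "a \<in> carrier A ==> reg_elem (\<lambda>phi. a)"
  by (auto intro: reg_elemI reg_const)
lemma reg_elem_apply: "a \<in> carrier A ==> reg_elem (\<lambda>phi. phi a)"
  by (auto intro: reg_elemI reg_coeff)
lemma reg_elem_inv_apply: "a \<in> carrier A ==> reg_elem (\<lambda>phi. aut_inv phi a)"
  by (auto intro: reg_elemI reg_inv_coeff)

lemma reg_elem_linear: "linear_map X ==> reg_elem p ==> reg_elem (\<lambda>phi. X (p phi))"
  by (intro reg_elemI) (auto intro: reg_elemD functional_comp)

lemma reg_elem_add:
  assumes "reg_elem p" "reg_elem q" shows "reg_elem (\<lambda>phi. p phi \<oplus> q phi)"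
proof (rule reg_elemI)
  fix l assume "functional l"
  then have "reg (\<lambda>phi. l (p phi) + l (q phi))" using assms by (intro reg_add reg_elemD)
  then show "reg (\<lambda>phi. l (p phi \<oplus> q phi))"
    using assms \<open>functional l\<close> by (subst reg_cong) (auto simp: functional_add)
qed (use assms in simp)

lemma reg_elem_smult:
  assumes "reg c" "reg_elem q" shows "reg_elem (\<lambda>phi. c phi \<odot> q phi)"
proof (rule reg_elemI)
  fix l assume "functional l"
  then have "reg (\<lambda>phi. c phi * l (q phi))" using assms by (intro reg_mult reg_elemD)
  then show "reg (\<lambda>phi. l (c phi \<odot> q phi))"
    using assms \<open>functional l\<close> by (subst reg_cong) (auto simp: functional_smult)
qed (use assms in simp)

lemma reg_elem_neg: "reg_elem p ==> reg_elem (\<lambda>phi. \<ominus> p phi)"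
  using reg_elem_smult[OF reg_const[of "-1"], of p]
  by (rule reg_elem_cong) (simp_all add: smult_neg_one)

lemma reg_elem_diff: "reg_elem p ==> reg_elem q ==> reg_elem (\<lambda>phi. p phi \<ominus> q phi)"
  using reg_elem_add[OF _ reg_elem_neg] by (simp add: minus_eq)

lemma reg_elem_sum:
  assumes "finite I" "\<And>i. i \<in> I ==> reg_elem (p i)"
  shows "reg_elem (\<lambda>phi. \<Oplus>i\<in>I. p i phi)"
proof (rule reg_elemI)
  fix l assume l: "functional l"
  have "reg (\<lambda>phi. \<Sum>i\<in>I. l (p i phi))" using assms l by (intro reg_sum reg_elemD)
  then show "reg (\<lambda>phi. l (\<Oplus>i\<in>I. p i phi))"
    using assms l by (subst reg_cong) (auto simp: functional_sum)
qed (use assms in \<open>auto intro!: finsum_closed\<close>)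

text \<open>Expanding the vector in a fixed spanning family writes the result as a finite sum of
  regular scalars times regular vectors.\<close>

lemma reg_elem_operator:
  assumes \<Phi>: "\<And>phi. phi \<in> G ==> linear_map (\<Phi> phi)" and \<Phi>r: "\<And>a. a \<in> carrier A ==> reg_elem (\<lambda>phi. \<Phi> phi a)"
    and p: "reg_elem p"
  shows "reg_elem (\<lambda>phi. \<Phi> phi (p phi))"
proof (rule dual_basis)
  fix I :: "'a set" and f u
  assume I: "finite I" "\<And>i. i \<in> I ==> functional (f i)"
    and u: "\<And>i. i \<in> I ==> u i \<in> carrier A"
    and ue: "\<And>a. a \<in> carrier A ==> a = (\<Oplus>i\<in>I. f i a \<odot> u i)"
  have "reg_elem (\<lambda>phi. \<Oplus>i\<in>I. f i (p phi) \<odot> \<Phi> phi (u i))"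
    by (intro reg_elem_sum reg_elem_smult reg_elemD[OF p] \<Phi>r u I)
  then show ?thesis
  proof (rule reg_elem_cong)
    fix phi assume phi: "phi \<in> G"
    have "\<Phi> phi (p phi) = \<Phi> phi (\<Oplus>i\<in>I. f i (p phi) \<odot> u i)" using ue[of "p phi"] p phi by simp
    also have "\<dots> = (\<Oplus>i\<in>I. \<Phi> phi (f i (p phi) \<odot> u i))"
      using u I by (intro linear_map_sum \<Phi> phi) auto
    also have "\<dots> = (\<Oplus>i\<in>I. f i (p phi) \<odot> \<Phi> phi (u i))"
      using u \<Phi>[OF phi] by (intro finsum_cong') (auto simp: linear_map_smult)
    finally show "(\<Oplus>i\<in>I. f i (p phi) \<odot> \<Phi> phi (u i)) = \<Phi> phi (p phi)" by simp
  qed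
qed

lemma reg_elem_mult:
  assumes p: "reg_elem p" and q: "reg_elem q"
  shows "reg_elem (\<lambda>phi. p phi \<otimes> q phi)"
proof (rule reg_elem_operator[where \<Phi> = "\<lambda>phi x. p phi \<otimes> x", OF _ _ q])
  show "linear_map (\<lambda>x. p phi \<otimes> x)" if "phi \<in> G" for phi using that p by (simp add: linear_map_mult_left)
  show "reg_elem (\<lambda>phi. p phi \<otimes> a)" if "a \<in> carrier A" for a
    using reg_elem_linear[OF linear_map_mult_right[OF that] p] .
qed

end

section \<open>Lie algebras of subgroups of the outer automorphism group\<close>

context kalg
begin

lemma pullback_eq: "pullback_to_Aut A F = restrict (\<lambda>phi. F (out phi)) G"
  by (simp add: pullback_to_Aut_def)

lemma Out_functions_iff:
  "F \<in> Out_functions A \<longleftrightarrow> F \<in> extensional (carrier (Out A)) \<and> reg (\<lambda>phi. F (out phi))"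
  by (simp add: Out_functions_def pullback_eq reg_def)

text \<open>Functions on \<open>Out A\<close> are defined by their pullback to \<open>Aut A\<close>,
  so regularity together with invariance under inner automorphisms is exactly what descent
  requires.\<close>

lemma invariant_descends:
  assumes f: "reg f" and inv: "\<And>phi u. phi \<in> G ==> u \<in> Units A ==> f (phi \<circ>\<^sub>A inn u) = f phi"
  obtains F where "F \<in> Out_functions A" "\<And>phi. phi \<in> G ==> F (out phi) = f phi"
proof -
  define F where "F = (\<lambda>X\<in>carrier (Out A). f (SOME phi. phi \<in> G \<and> out phi = X))"
  have F: "F (out phi) = f phi" if phi: "phi \<in> G" for phi
  proof -
    define psi where "psi = (SOME psi. psi \<in> G \<and> out psi = out phi)"
    have psi: "psi \<in> G \<and> out psi = out phi"
      unfolding psi_def by (rule someI[of _ phi]) (use phi in simp)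
    have "\<exists>u\<in>Units A. psi = phi \<circ>\<^sub>A inn u"
      by (rule iffD1[OF out_eq_iff[OF phi conjunct1[OF psi]] conjunct2[OF psi]])
    then obtain u where "u \<in> Units A" "psi = phi \<circ>\<^sub>A inn u" ..
    then have "f psi = f phi" using inv[OF phi] by simp
    then show ?thesis using phi by (simp add: F_def psi_def)
  qed
  have "reg (\<lambda>phi. F (out phi))" using f F by (subst reg_cong[where g = f]) simp_all
  then have "F \<in> Out_functions A" by (simp add: Out_functions_iff F_def)
  then show thesis using F that by simp
qed

section \<open>Tangent vectors of the automorphism group at the identity\<close>

definition ev :: "((('a => 'a) => 'k) => 'k) => (('a => 'a) => 'k) => 'k" where
  "ev eps f = eps (restrict f G)"

abbreviation tangent :: "((('a => 'a) => 'k) => 'k) => bool" where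
  "tangent eps \<equiv> eps \<in> tangent_space G (Aut_functions A) idA"

lemma ev_cong: "(\<And>phi. phi \<in> G ==> f phi = g phi) ==> ev eps f = ev eps g"
  using restrict_ext[of G f g] by (simp add: ev_def)

lemma ev_add: "tangent eps ==> reg f ==> reg g ==> ev eps (\<lambda>phi. f phi + g phi) = ev eps f + ev eps g"
proof -
  assume "tangent eps" "reg f" "reg g"
  then have "eps (\<lambda>x\<in>G. restrict f G x + restrict g G x) = eps (restrict f G) + eps (restrict g G)"
    unfolding tangent_space_def reg_def by blast
  moreover have "(\<lambda>x\<in>G. restrict f G x + restrict g G x) = restrict (\<lambda>phi. f phi + g phi) G"
    by (rule restrict_ext) simp
  ultimately show ?thesis by (simp only: ev_def)
qed

lemma ev_cmult: "tangent eps ==> reg f ==> ev eps (\<lambda>phi. c * f phi) = c * ev eps f"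
proof -
  assume "tangent eps" "reg f"
  then have "eps (\<lambda>x\<in>G. c * restrict f G x) = c * eps (restrict f G)"
    unfolding tangent_space_def reg_def by blast
  moreover have "(\<lambda>x\<in>G. c * restrict f G x) = restrict (\<lambda>phi. c * f phi) G"
    by (rule restrict_ext) simp
  ultimately show ?thesis by (simp only: ev_def)
qed

lemma ev_mult:
  "tangent eps ==> reg f ==> reg g ==>
    ev eps (\<lambda>phi. f phi * g phi) = f idA * ev eps g + ev eps f * g idA"
proof -
  assume "tangent eps" "reg f" "reg g"
  then have "eps (\<lambda>x\<in>G. restrict f G x * restrict g G x) =
    restrict f G idA * eps (restrict g G) + eps (restrict f G) * restrict g G idA"
    unfolding tangent_space_def reg_def by blast
  moreover have "(\<lambda>x\<in>G. restrict f G x * restrict g G x) = restrict (\<lambda>phi. f phi * g phi) G"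
    by (rule restrict_ext) simp
  ultimately show ?thesis by (simp add: ev_def)
qed

lemma ev_const: assumes eps: "tangent eps" shows "ev eps (\<lambda>phi. c) = 0"
proof -
  have "ev eps (\<lambda>phi. 1) = ev eps (\<lambda>phi. 1) + ev eps (\<lambda>phi. 1)"
    using ev_mult[OF eps reg_const[of 1] reg_const[of 1]] by (simp only: mult_1_left mult_1_right)
  then have "ev eps (\<lambda>phi. 1) = 0" by (simp only: add_cancel_right_right)
  then show ?thesis using ev_cmult[OF eps reg_const[of 1], of c] by simp
qed

lemma ev_sum:
  assumes eps: "tangent eps" and "finite I" "\<And>i. i \<in> I ==> reg (f i)"
  shows "ev eps (\<lambda>phi. \<Sum>i\<in>I. f i phi) = (\<Sum>i\<in>I. ev eps (f i))"
  using assms(2,3)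
proof (induction I rule: finite_induct)
  case empty
  then show ?case by (simp add: ev_const[OF eps])
next
  case (insert i I)
  have "reg (f i)" "reg (\<lambda>phi. \<Sum>i\<in>I. f i phi)" using insert.prems insert.hyps by (auto intro: reg_sum)
  then show ?case using insert by (simp add: ev_add[OF eps])
qed

lemma tangentI:
  assumes ext: "eps \<in> extensional (Aut_functions A)"
    and add: "\<And>f g. reg f ==> reg g ==> ev eps (\<lambda>phi. f phi + g phi) = ev eps f + ev eps g"
    and cmult: "\<And>c f. reg f ==> ev eps (\<lambda>phi. c * f phi) = c * ev eps f"
    and mult: "\<And>f g. reg f ==> reg g ==>
      ev eps (\<lambda>phi. f phi * g phi) = f idA * ev eps g + ev eps f * g idA"
  shows "tangent eps"
proof -
  have *: "restrict f G = f" if "f \<in> Aut_functions A" for f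
  proof -
    have "f \<in> extensional G"
      using that unfolding Aut_functions_def carrier_Aut by cases simp_all
    then show ?thesis by (rule extensional_restrict)
  qed
  then have reg: "reg f" "ev eps f = eps f" if "f \<in> Aut_functions A" for f
    using that by (simp_all add: reg_def ev_def)
  show ?thesis
    unfolding tangent_space_def mem_Collect_eq
  proof (intro conjI ballI allI ext)
    fix f g assume fg: "f \<in> Aut_functions A" "g \<in> Aut_functions A"
    show "eps (\<lambda>x\<in>G. f x + g x) = eps f + eps g" using add[of f g] reg[OF fg(1)] reg[OF fg(2)] by (simp add: ev_def)
    show "eps (\<lambda>x\<in>G. f x * g x) = f idA * eps g + eps f * g idA"
      using mult[of f g] reg[OF fg(1)] reg[OF fg(2)] by (simp add: ev_def)
  next
    fix c f assume f: "f \<in> Aut_functions A"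
    show "eps (\<lambda>x\<in>G. c * f x) = c * eps f" using cmult[of f c] reg[OF f] by (simp add: ev_def)
  qed
qed

lemma derivation_tangent_iff:
  "derivation_tangent A D eps \<longleftrightarrow> tangent eps \<and>
    (\<forall>l. functional l \<longrightarrow> (\<forall>a\<in>carrier A. ev eps (\<lambda>phi. l (phi a)) = l (D a)))"
  by (simp add: derivation_tangent_def ev_def linear_functionals_iff Ball_def)

text \<open>The coordinate ring is also generated by coefficients of inverses. Their derivative
  follows by differentiating the constant \<open>l a\<close>, written through \<open>phi\<close>
  applied to the expansion of \<open>aut_inv phi a\<close>.\<close>

lemma derivation_tangent_inv:
  assumes t: "derivation_tangent A D eps" and D: "D \<in> derivations A" and l: "functional l" and a: "a \<in> carrier A"
  shows "ev eps (\<lambda>phi. l (aut_inv phi a)) = - l (D a)"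
proof (rule dual_basis)
  fix I :: "'a set" and f u
  assume I: "finite I" "\<And>i. i \<in> I ==> functional (f i)"
    and u: "\<And>i. i \<in> I ==> u i \<in> carrier A"
    and ue: "\<And>a. a \<in> carrier A ==> a = (\<Oplus>i\<in>I. f i a \<odot> u i)"
  have eps: "tangent eps" and epsD: "ev eps (\<lambda>phi. l (phi b)) = l (D b)" if "functional l" "b \<in> carrier A" for l b
    using t that by (auto simp: derivation_tangent_iff)
  then have eps: "tangent eps" using l a by blast
  have le: "l' b = (\<Sum>i\<in>I. f i b * l' (u i))" if "functional l'" "b \<in> carrier A" for l' b
  proof -
    have "l' b = l' (\<Oplus>i\<in>I. f i b \<odot> u i)" using ue[OF that(2)] by simp
    also have "\<dots> = (\<Sum>i\<in>I. l' (f i b \<odot> u i))" by (rule functional_sum[OF that(1) I(1)]) (simp add: u)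
    also have "\<dots> = (\<Sum>i\<in>I. f i b * l' (u i))" by (rule sum.cong) (simp_all add: functional_smult[OF that(1)] u)
    finally show ?thesis .
  qed
  have ri: "reg (\<lambda>phi. f i (aut_inv phi a))" "reg (\<lambda>phi. l (phi (u i)))" if "i \<in> I" for i
    using reg_inv_coeff[OF I(2)[OF that] a] reg_coeff[OF l u[OF that]] by simp_all
  have "ev eps (\<lambda>phi. l (aut_inv phi a)) = ev eps (\<lambda>phi. \<Sum>i\<in>I. l (u i) * f i (aut_inv phi a))"
    by (rule ev_cong) (simp add: le[OF l] a mult.commute)
  also have "\<dots> = (\<Sum>i\<in>I. ev eps (\<lambda>phi. l (u i) * f i (aut_inv phi a)))"
    by (rule ev_sum[OF eps I(1)]) (intro reg_mult reg_const ri)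
  also have "\<dots> = (\<Sum>i\<in>I. l (u i) * ev eps (\<lambda>phi. f i (aut_inv phi a)))"
    by (rule sum.cong) (simp_all add: ev_cmult[OF eps ri(1)])
  finally have 1: "ev eps (\<lambda>phi. l (aut_inv phi a)) = (\<Sum>i\<in>I. l (u i) * ev eps (\<lambda>phi. f i (aut_inv phi a)))" .
  have "0 = ev eps (\<lambda>phi. l a)" by (simp add: ev_const[OF eps])
  also have "\<dots> = ev eps (\<lambda>phi. \<Sum>i\<in>I. f i (aut_inv phi a) * l (phi (u i)))"
  proof (rule ev_cong)
    fix phi assume phi: "phi \<in> G"
    have "l a = (\<lambda>x. l (phi x)) (aut_inv phi a)" using phi a by simp
    also have "\<dots> = (\<Sum>i\<in>I. f i (aut_inv phi a) * l (phi (u i)))"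
      by (rule le[OF functional_comp[OF l aut_linear[OF phi]]]) (use phi a in simp)
    finally show "l a = (\<Sum>i\<in>I. f i (aut_inv phi a) * l (phi (u i)))" .
  qed
  also have "\<dots> = (\<Sum>i\<in>I. ev eps (\<lambda>phi. f i (aut_inv phi a) * l (phi (u i))))"
    by (rule ev_sum[OF eps I(1)]) (intro reg_mult ri)
  also have "\<dots> = (\<Sum>i\<in>I. f i a * l (D (u i)) + l (u i) * ev eps (\<lambda>phi. f i (aut_inv phi a)))"
  proof (rule sum.cong)
    fix i assume i: "i \<in> I"
    have one: "aut_inv idA a = a" "idA (u i) = u i" using a u[OF i] by (simp_all add: Aut.inv_one)
    show "ev eps (\<lambda>phi. f i (aut_inv phi a) * l (phi (u i))) =
      f i a * l (D (u i)) + l (u i) * ev eps (\<lambda>phi. f i (aut_inv phi a))"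
      unfolding ev_mult[OF eps ri[OF i]] one epsD[OF l u[OF i]] by simp
  qed simp
  also have "\<dots> = l (D a) + ev eps (\<lambda>phi. l (aut_inv phi a))"
    unfolding 1 sum.distrib le[OF functional_comp[OF l derivation_linear[OF D]] a] ..
  finally show ?thesis by (simp add: eq_neg_iff_add_eq_0 add.commute)
qed

lemma aut_inv_comp_apply:
  "phi \<in> G ==> psi \<in> G ==> a \<in> carrier A ==> aut_inv (phi \<circ>\<^sub>A psi) a = aut_inv psi (aut_inv phi a)"
  using Aut.inv_mult_group[of phi psi] by simp

lemma reg_translate:
  assumes "reg f" and psi: "psi \<in> G" shows "reg (\<lambda>phi. f (phi \<circ>\<^sub>A psi))"
  using assms(1)
proof (induction rule: reg_induct)
  case (cong f g)
  then show ?case using psi by (subst reg_cong[where g = "\<lambda>phi. f (phi \<circ>\<^sub>A psi)"]) simp_all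
next
  case (const c)
  show ?case by (rule reg_const)
next
  case (coeff l a)
  then show ?case
    using psi reg_coeff[of l "psi a"] by (subst reg_cong[where g = "\<lambda>phi. l (phi (psi a))"]) simp_all
next
  case (inv_coeff l a)
  have "functional (\<lambda>x. l (aut_inv psi x))"
    using functional_comp[OF inv_coeff(1) aut_linear[of "aut_inv psi"]] psi by simp
  then show ?case
    using inv_coeff psi reg_inv_coeff[of "\<lambda>x. l (aut_inv psi x)" a]
    by (subst reg_cong[where g = "\<lambda>phi. l (aut_inv psi (aut_inv phi a))"]) (simp_all add: aut_inv_comp_apply)
next
  case (add f g)
  then show ?case by (intro reg_add)
next
  case (mult f g)
  then show ?case by (intro reg_mult)
qed

text \<open>The right-invariant vector field defined by \<open>eps\<close> preserves the coordinate
  ring. On generators it replaces \<open>l (psi a)\<close> by \<open>l (D (psi a))\<close> and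
  \<open>l (aut_inv psi a)\<close> by minus \<open>l (aut_inv psi (D a))\<close>; sums and products
  follow from linearity and the product rule.\<close>

lemma reg_tangent_translate:
  assumes "reg f" and t: "derivation_tangent A D eps" and D: "D \<in> derivations A"
  shows "reg (\<lambda>psi. ev eps (\<lambda>phi. f (phi \<circ>\<^sub>A psi)))"
  using assms(1)
proof (induction rule: reg_induct)
  case (cong f g)
  have "ev eps (\<lambda>phi. g (phi \<circ>\<^sub>A psi)) = ev eps (\<lambda>phi. f (phi \<circ>\<^sub>A psi))" if "psi \<in> G" for psi
    using that cong(2) by (intro ev_cong) simp
  then show ?case using cong(1) by (subst reg_cong[where g = "\<lambda>psi. ev eps (\<lambda>phi. f (phi \<circ>\<^sub>A psi))"]) simp_all
next
  case (const c)
  show ?case by (rule reg_const)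
next
  case (coeff l a)
  have "ev eps (\<lambda>phi. l ((phi \<circ>\<^sub>A psi) a)) = l (D (psi a))" if "psi \<in> G" for psi
  proof -
    have "ev eps (\<lambda>phi. l ((phi \<circ>\<^sub>A psi) a)) = ev eps (\<lambda>phi. l (phi (psi a)))"
      using that coeff by (intro ev_cong) simp
    then show ?thesis using t that coeff by (simp add: derivation_tangent_iff)
  qed
  moreover have "reg (\<lambda>psi. l (D (psi a)))"
    by (rule reg_coeff[OF functional_comp[OF coeff(1) derivation_linear[OF D]] coeff(2)])
  ultimately show ?case by (subst reg_cong[where g = "\<lambda>psi. l (D (psi a))"]) simp_all
next
  case (inv_coeff l a)
  have "ev eps (\<lambda>phi. l (aut_inv (phi \<circ>\<^sub>A psi) a)) = - l (aut_inv psi (D a))" if psi: "psi \<in> G" for psi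
  proof -
    have "functional (\<lambda>x. l (aut_inv psi x))"
      using functional_comp[OF inv_coeff(1) aut_linear[of "aut_inv psi"]] psi by simp
    moreover have "ev eps (\<lambda>phi. l (aut_inv (phi \<circ>\<^sub>A psi) a)) = ev eps (\<lambda>phi. l (aut_inv psi (aut_inv phi a)))"
      using psi inv_coeff by (intro ev_cong) (simp add: aut_inv_comp_apply)
    ultimately show ?thesis using derivation_tangent_inv[OF t D _ inv_coeff(2)] by simp
  qed
  moreover have "reg (\<lambda>psi. - 1 * l (aut_inv psi (D a)))"
    using inv_coeff D by (intro reg_mult reg_const reg_inv_coeff) simp_all
  ultimately show ?case by (subst reg_cong[where g = "\<lambda>psi. - 1 * l (aut_inv psi (D a))"]) simp_all
next
  case (add f g)
  have "ev eps (\<lambda>phi. f (phi \<circ>\<^sub>A psi) + g (phi \<circ>\<^sub>A psi)) = ev eps (\<lambda>phi. f (phi \<circ>\<^sub>A psi)) + ev eps (\<lambda>phi. g (phi \<circ>\<^sub>A psi))"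
    if "psi \<in> G" for psi
    using t reg_translate[OF add(1) that] reg_translate[OF add(2) that]
    by (intro ev_add) (simp_all add: derivation_tangent_iff)
  then show ?case using reg_add[OF add(3,4)] by (subst reg_cong) simp_all
next
  case (mult f g)
  have "ev eps (\<lambda>phi. f (phi \<circ>\<^sub>A psi) * g (phi \<circ>\<^sub>A psi)) = f psi * ev eps (\<lambda>phi. g (phi \<circ>\<^sub>A psi)) + ev eps (\<lambda>phi. f (phi \<circ>\<^sub>A psi)) * g psi"
    if "psi \<in> G" for psi
    using t reg_translate[OF mult(1) that] reg_translate[OF mult(2) that] that
    by (subst ev_mult) (simp_all add: derivation_tangent_iff Aut.l_one)
  then show ?case
    using reg_add[OF reg_mult[OF mult(1,4)] reg_mult[OF mult(3,2)]] by (subst reg_cong) simp_all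
qed

text \<open>Product of two distributions supported at the identity. On matrix coefficients it
  composes the two derivations, so its commutator realises the Lie bracket.\<close>

definition convolution ::
  "((('a => 'a) => 'k) => 'k) => ((('a => 'a) => 'k) => 'k) => (('a => 'a) => 'k) => 'k" where
  "convolution eps1 eps2 f = ev eps2 (\<lambda>psi. ev eps1 (\<lambda>phi. f (phi \<circ>\<^sub>A psi)))"

context
  fixes D1 D2 eps1 eps2
  assumes t1: "derivation_tangent A D1 eps1" and D1: "D1 \<in> derivations A"
    and t2: "derivation_tangent A D2 eps2" and D2: "D2 \<in> derivations A"
begin

private lemma e1: "tangent eps1" and e2: "tangent eps2"
  using t1 t2 by (simp_all add: derivation_tangent_iff)

lemma convolution_cong: "(\<And>phi. phi \<in> G ==> f phi = g phi) ==> convolution eps1 eps2 f = convolution eps1 eps2 g"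
  unfolding convolution_def by (intro ev_cong) simp

lemma convolution_add:
  assumes f: "reg f" and g: "reg g"
  shows "convolution eps1 eps2 (\<lambda>phi. f phi + g phi) = convolution eps1 eps2 f + convolution eps1 eps2 g"
proof -
  have "convolution eps1 eps2 (\<lambda>phi. f phi + g phi) =
    ev eps2 (\<lambda>psi. ev eps1 (\<lambda>phi. f (phi \<circ>\<^sub>A psi)) + ev eps1 (\<lambda>phi. g (phi \<circ>\<^sub>A psi)))"
    unfolding convolution_def by (intro ev_cong ev_add[OF e1] reg_translate f g)
  then show ?thesis
    unfolding convolution_def
    using ev_add[OF e2 reg_tangent_translate[OF f t1 D1] reg_tangent_translate[OF g t1 D1]] by simp
qed

lemma convolution_cmult:
  assumes f: "reg f"
  shows "convolution eps1 eps2 (\<lambda>phi. c * f phi) = c * convolution eps1 eps2 f"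
proof -
  have "convolution eps1 eps2 (\<lambda>phi. c * f phi) = ev eps2 (\<lambda>psi. c * ev eps1 (\<lambda>phi. f (phi \<circ>\<^sub>A psi)))"
    unfolding convolution_def by (intro ev_cong ev_cmult[OF e1] reg_translate f)
  then show ?thesis
    unfolding convolution_def using ev_cmult[OF e2 reg_tangent_translate[OF f t1 D1]] by simp
qed

text \<open>Convolution is an operator of second order: the two middle terms spoil the product rule,
  but they are symmetric in \<open>eps1\<close> and \<open>eps2\<close> and cancel in the
  commutator.\<close>

lemma convolution_mult:
  assumes f: "reg f" and g: "reg g"
  shows "convolution eps1 eps2 (\<lambda>phi. f phi * g phi) =
    f idA * convolution eps1 eps2 g + ev eps2 f * ev eps1 g + ev eps1 f * ev eps2 g +
    convolution eps1 eps2 f * g idA"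
proof -
  note rf = reg_tangent_translate[OF f t1 D1] and rg = reg_tangent_translate[OF g t1 D1]
  have one: "ev eps1 (\<lambda>phi. h (phi \<circ>\<^sub>A idA)) = ev eps1 h" for h
    by (rule ev_cong) (simp add: Aut.r_one)
  have "convolution eps1 eps2 (\<lambda>phi. f phi * g phi) =
    ev eps2 (\<lambda>psi. f psi * ev eps1 (\<lambda>phi. g (phi \<circ>\<^sub>A psi)) + ev eps1 (\<lambda>phi. f (phi \<circ>\<^sub>A psi)) * g psi)"
    unfolding convolution_def
  proof (rule ev_cong)
    fix psi assume psi: "psi \<in> G"
    show "ev eps1 (\<lambda>phi. f (phi \<circ>\<^sub>A psi) * g (phi \<circ>\<^sub>A psi)) =
      f psi * ev eps1 (\<lambda>phi. g (phi \<circ>\<^sub>A psi)) + ev eps1 (\<lambda>phi. f (phi \<circ>\<^sub>A psi)) * g psi"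
      using psi ev_mult[OF e1 reg_translate[OF f psi] reg_translate[OF g psi]] by (simp add: Aut.l_one)
  qed
  also have "\<dots> = ev eps2 (\<lambda>psi. f psi * ev eps1 (\<lambda>phi. g (phi \<circ>\<^sub>A psi))) + ev eps2 (\<lambda>psi. ev eps1 (\<lambda>phi. f (phi \<circ>\<^sub>A psi)) * g psi)"
    by (rule ev_add[OF e2 reg_mult[OF f rg] reg_mult[OF rf g]])
  finally show ?thesis
    unfolding ev_mult[OF e2 f rg] ev_mult[OF e2 rf g] one convolution_def by (simp add: algebra_simps)
qed

lemma convolution_coeff:
  assumes l: "functional l" and a: "a \<in> carrier A"
  shows "convolution eps1 eps2 (\<lambda>phi. l (phi a)) = l (D1 (D2 a))"
proof -
  have "convolution eps1 eps2 (\<lambda>phi. l (phi a)) = ev eps2 (\<lambda>psi. (\<lambda>x. l (D1 x)) (psi a))"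
    unfolding convolution_def
  proof (rule ev_cong)
    fix psi assume psi: "psi \<in> G"
    have "ev eps1 (\<lambda>phi. l ((phi \<circ>\<^sub>A psi) a)) = ev eps1 (\<lambda>phi. l (phi (psi a)))"
      using psi a by (intro ev_cong) simp
    then show "ev eps1 (\<lambda>phi. l ((phi \<circ>\<^sub>A psi) a)) = (\<lambda>x. l (D1 x)) (psi a)"
      using t1 l a psi by (simp add: derivation_tangent_iff)
  qed
  also have "\<dots> = l (D1 (D2 a))"
    by (rule conjunct2[OF t2[unfolded derivation_tangent_iff], rule_format,
          OF functional_comp[OF l derivation_linear[OF D1]] a])
  finally show ?thesis .
qed

end

text \<open>The image of \<open>eps\<close> on \<open>Out A\<close> kills the vanishing ideal of
  \<open>H\<close>, that is, it is tangent to \<open>H\<close> at the identity.\<close>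

definition annihilates :: "('a => 'a) set set => ((('a => 'a) => 'k) => 'k) => bool" where
  "annihilates H eps \<longleftrightarrow> (\<forall>F\<in>Out_functions A. (\<forall>X\<in>H. F X = 0) \<longrightarrow> ev eps (\<lambda>phi. F (out phi)) = 0)"

lemma HH1_lie_algebra_of_memI:
  assumes D: "D \<in> derivations A" and t: "derivation_tangent A D eps" and z: "annihilates H eps"
  shows "H.cls D \<in> HH1_lie_algebra_of A H"
proof -
  define \<delta> where "\<delta> = (\<lambda>F\<in>Out_functions A. eps (pullback_to_Aut A F))"
  have eps: "tangent eps" using t by (simp add: derivation_tangent_iff)
  have \<delta>: "\<delta> F = ev eps (\<lambda>phi. F (out phi))" if "F \<in> Out_functions A" for F
    using that by (simp add: \<delta>_def ev_def pullback_eq)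
  have O: "(\<lambda>X\<in>carrier (Out A). h X) \<in> Out_functions A" if "reg (\<lambda>phi. h (out phi))" for h
    unfolding Out_functions_iff
  proof
    show "reg (\<lambda>phi. (\<lambda>X\<in>carrier (Out A). h X) (out phi))"
      using that by (subst reg_cong[where g = "\<lambda>phi. h (out phi)"]) simp_all
  qed simp
  have \<delta>O: "\<delta> (\<lambda>X\<in>carrier (Out A). h X) = ev eps (\<lambda>phi. h (out phi))" if "reg (\<lambda>phi. h (out phi))" for h
    unfolding \<delta>[OF O[OF that]] by (rule ev_cong) simp
  have "\<delta> \<in> tangent_space (carrier (Out A)) (Out_functions A) \<one>\<^bsub>Out A\<^esub>"
    unfolding tangent_space_def mem_Collect_eq
  proof (intro conjI ballI allI)
    show "\<delta> \<in> extensional (Out_functions A)" by (simp add: \<delta>_def)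
  next
    fix f g assume fg: "f \<in> Out_functions A" "g \<in> Out_functions A"
    then have r: "reg (\<lambda>phi. f (out phi))" "reg (\<lambda>phi. g (out phi))" by (simp_all add: Out_functions_iff)
    show "\<delta> (\<lambda>X\<in>carrier (Out A). f X + g X) = \<delta> f + \<delta> g"
      using \<delta>O[of "\<lambda>X. f X + g X"] reg_add[OF r] ev_add[OF eps r] \<delta> fg by simp
    show "\<delta> (\<lambda>X\<in>carrier (Out A). f X * g X) = f \<one>\<^bsub>Out A\<^esub> * \<delta> g + \<delta> f * g \<one>\<^bsub>Out A\<^esub>"
      using \<delta>O[of "\<lambda>X. f X * g X"] reg_mult[OF r] ev_mult[OF eps r] \<delta> fg by (simp add: one_Out)
  next
    fix c f assume f: "f \<in> Out_functions A"
    then have r: "reg (\<lambda>phi. f (out phi))" by (simp add: Out_functions_iff)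
    show "\<delta> (\<lambda>X\<in>carrier (Out A). c * f X) = c * \<delta> f"
      using \<delta>O[of "\<lambda>X. c * f X"] reg_mult[OF reg_const r] ev_cmult[OF eps r] \<delta> f by simp
  qed
  then have "\<delta> \<in> lie_algebra_of (Out A) (Out_functions A) H"
    using z \<delta> unfolding lie_algebra_of_def annihilates_def by simp
  moreover have "HH1_tangent A (H.cls D) \<delta>"
    unfolding HH1_tangent_def using H.cls_self[of D] D t \<delta>_def by auto
  moreover have "H.cls D \<in> carrier (HH1 A)" using D by (simp add: HH1_carrier)
  ultimately show ?thesis unfolding HH1_lie_algebra_of_def by blast
qed

lemma HH1_lie_algebra_of_memE:
  assumes "x \<in> HH1_lie_algebra_of A H"
  obtains D eps where "x = H.cls D" "D \<in> derivations A" "derivation_tangent A D eps" "annihilates H eps"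
proof -
  obtain \<delta> where x: "x \<in> carrier (HH1 A)" and \<delta>: "\<delta> \<in> lie_algebra_of (Out A) (Out_functions A) H"
    and "HH1_tangent A x \<delta>"
    using assms unfolding HH1_lie_algebra_of_def by blast
  then obtain D eps where D: "D \<in> x" and t: "derivation_tangent A D eps"
    and \<delta>eps: "\<delta> = (\<lambda>F\<in>Out_functions A. eps (pullback_to_Aut A F))"
    unfolding HH1_tangent_def by blast
  obtain E where E: "E \<in> derivations A" "x = H.cls E" using x unfolding HH1_carrier by blast
  have Dd: "D \<in> derivations A" using D E H.mem_cls_iff[of E D] by simp
  have "x = H.cls D" using H.a_repr_independence'[of D E] D E by simp
  moreover have "annihilates H eps"
    unfolding annihilates_def
  proof (intro ballI impI)
    fix F assume F: "F \<in> Out_functions A" and "\<forall>X\<in>H. F X = 0"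
    then have "\<delta> F = 0" using \<delta> unfolding lie_algebra_of_def by simp
    then show "ev eps (\<lambda>phi. F (out phi)) = 0" using F by (simp add: \<delta>eps ev_def pullback_eq)
  qed
  ultimately show thesis using that Dd t by simp
qed

text \<open>
  Translates of invariant functions vanishing on \<open>H\<close> by elements over \<open>H\<close> again vanish on \<open>H\<close>, so
  convolution preserves annihilation.
\<close>

lemma convolution_annihilates:
  assumes t1: "derivation_tangent A D1 eps1" and D1: "D1 \<in> derivations A" and z1: "annihilates H eps1"
    and z2: "annihilates H eps2" and H: "subgroup H (Out A)"
    and F: "F \<in> Out_functions A" and F0: "\<And>X. X \<in> H ==> F X = 0"
  shows "convolution eps1 eps2 (\<lambda>phi. F (out phi)) = 0"
proof -
  have r: "reg (\<lambda>phi. F (out phi))" using F by (simp add: Out_functions_iff)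
  define h where "h psi = ev eps1 (\<lambda>phi. F (out (phi \<circ>\<^sub>A psi)))" for psi
  have rh: "reg h" unfolding h_def by (rule reg_tangent_translate[OF r t1 D1])
  have h_inv: "h (psi \<circ>\<^sub>A inn u) = h psi" if "psi \<in> G" "u \<in> Units A" for psi u
    unfolding h_def
  proof (rule ev_cong)
    fix phi assume phi: "phi \<in> G"
    have "phi \<circ>\<^sub>A (psi \<circ>\<^sub>A inn u) = (phi \<circ>\<^sub>A psi) \<circ>\<^sub>A inn u"
      using phi that by (simp add: Aut.m_assoc)
    then have "out (phi \<circ>\<^sub>A (psi \<circ>\<^sub>A inn u)) = out (phi \<circ>\<^sub>A psi)"
      using phi that out_eq_iff[of "phi \<circ>\<^sub>A psi" "phi \<circ>\<^sub>A (psi \<circ>\<^sub>A inn u)"] by auto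
    then show "F (out (phi \<circ>\<^sub>A (psi \<circ>\<^sub>A inn u))) = F (out (phi \<circ>\<^sub>A psi))" by simp
  qed
  obtain F2 where F2: "F2 \<in> Out_functions A" "\<And>phi. phi \<in> G ==> F2 (out phi) = h phi"
    by (rule invariant_descends[OF rh h_inv]) (assumption | rule that)+
  have "F2 X = 0" if X: "X \<in> H" for X
  proof -
    have "X \<in> carrier (Out A)" using subgroup.subset[OF H] X by blast
    then obtain psi where psi: "psi \<in> G" "X = out psi" unfolding carrier_Out by blast
    have rpsi: "reg (\<lambda>phi. F (out (phi \<circ>\<^sub>A psi)))" by (rule reg_translate[OF r psi(1)])
    have invpsi: "F (out (phi \<circ>\<^sub>A inn u \<circ>\<^sub>A psi)) = F (out (phi \<circ>\<^sub>A psi))" if "phi \<in> G" "u \<in> Units A" for phi u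
    proof -
      have "out (phi \<circ>\<^sub>A inn u) = out phi"
        using that out_eq_iff[of phi "phi \<circ>\<^sub>A inn u"] by auto
      then have "out (phi \<circ>\<^sub>A inn u \<circ>\<^sub>A psi) = out (phi \<circ>\<^sub>A psi)"
        using that psi(1) out_mult[of "phi \<circ>\<^sub>A inn u" psi] out_mult[of phi psi] by simp
      then show ?thesis by simp
    qed
    obtain F' where F': "F' \<in> Out_functions A" "\<And>phi. phi \<in> G ==> F' (out phi) = F (out (phi \<circ>\<^sub>A psi))"
      by (rule invariant_descends[OF rpsi invpsi]) (assumption | rule that)+
    have "F' Y = 0" if Y: "Y \<in> H" for Y
    proof -
      have "Y \<in> carrier (Out A)" using subgroup.subset[OF H] Y by blast
      then obtain phi where phi: "phi \<in> G" "Y = out phi" unfolding carrier_Out by blast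
      have "out (phi \<circ>\<^sub>A psi) \<in> H"
        using subgroup.m_closed[OF H Y X] out_mult[of phi psi] phi psi by simp
      then show ?thesis using F'(2)[OF phi(1)] F0 phi(2) by simp
    qed
    then have "ev eps1 (\<lambda>phi. F' (out phi)) = 0" using z1 F'(1) by (simp add: annihilates_def)
    then have "h psi = 0" unfolding h_def using ev_cong[of "\<lambda>phi. F' (out phi)" "\<lambda>phi. F (out (phi \<circ>\<^sub>A psi))" eps1] F'(2) by simp
    then show ?thesis using F2(2)[OF psi(1)] psi(2) by simp
  qed
  then have "ev eps2 (\<lambda>phi. F2 (out phi)) = 0" using z2 F2(1) by (simp add: annihilates_def)
  then show ?thesis
    unfolding convolution_def using ev_cong[of "\<lambda>phi. F2 (out phi)" h eps2] F2(2) by (simp add: h_def[abs_def])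
qed

lemma bracket_tangent:
  assumes t1: "derivation_tangent A D1 eps1" and D1: "D1 \<in> derivations A" and z1: "annihilates H eps1"
    and t2: "derivation_tangent A D2 eps2" and D2: "D2 \<in> derivations A" and z2: "annihilates H eps2"
    and H: "subgroup H (Out A)"
  shows "\<exists>eps. derivation_tangent A (D1 \<otimes>\<^bsub>Der A\<^esub> D2) eps \<and> annihilates H eps"
proof -
  define X where "X f = convolution eps1 eps2 f - convolution eps2 eps1 f" for f
  define eps where "eps = restrict X (Aut_functions A)"
  have ev: "ev eps f = X f" if "reg f" for f
  proof -
    have "convolution eps1 eps2 (restrict f G) = convolution eps1 eps2 f"
      by (rule convolution_cong[OF t1 D1 t2 D2]) simp
    moreover have "convolution eps2 eps1 (restrict f G) = convolution eps2 eps1 f"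
      by (rule convolution_cong[OF t2 D2 t1 D1]) simp
    ultimately show ?thesis using that by (simp add: eps_def ev_def reg_def X_def)
  qed
  have "tangent eps"
  proof (rule tangentI)
    show "eps \<in> extensional (Aut_functions A)" by (simp add: eps_def)
    show "ev eps (\<lambda>phi. f phi + g phi) = ev eps f + ev eps g" if "reg f" "reg g" for f g
      unfolding ev[OF reg_add[OF that]] ev[OF that(1)] ev[OF that(2)] X_def
        convolution_add[OF t1 D1 t2 D2 that] convolution_add[OF t2 D2 t1 D1 that] by simp
    show "ev eps (\<lambda>phi. c * f phi) = c * ev eps f" if "reg f" for c f
      unfolding ev[OF reg_mult[OF reg_const that]] ev[OF that] X_def
        convolution_cmult[OF t1 D1 t2 D2 that] convolution_cmult[OF t2 D2 t1 D1 that]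
      by (simp add: algebra_simps)
    show "ev eps (\<lambda>phi. f phi * g phi) = f idA * ev eps g + ev eps f * g idA" if "reg f" "reg g" for f g
      unfolding ev[OF reg_mult[OF that]] ev[OF that(1)] ev[OF that(2)] X_def
        convolution_mult[OF t1 D1 t2 D2 that] convolution_mult[OF t2 D2 t1 D1 that]
      by (simp add: algebra_simps)
  qed
  moreover have "ev eps (\<lambda>phi. l (phi a)) = l ((D1 \<otimes>\<^bsub>Der A\<^esub> D2) a)" if l: "functional l" and a: "a \<in> carrier A" for l a
    unfolding ev[OF reg_coeff[OF l a]] X_def convolution_coeff[OF t1 D1 t2 D2 l a]
      convolution_coeff[OF t2 D2 t1 D1 l a]
    using a D1 D2 by (simp add: functional_diff[OF l])
  ultimately have "derivation_tangent A (D1 \<otimes>\<^bsub>Der A\<^esub> D2) eps" unfolding derivation_tangent_iff by blast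
  moreover have "annihilates H eps"
    unfolding annihilates_def
  proof (intro ballI impI)
    fix F assume F: "F \<in> Out_functions A" and "\<forall>X\<in>H. F X = 0"
    then have F0: "\<And>Y. Y \<in> H ==> F Y = 0" by blast
    have r: "reg (\<lambda>phi. F (out phi))" using F by (simp add: Out_functions_iff)
    show "ev eps (\<lambda>phi. F (out phi)) = 0"
    proof -
      have "convolution eps1 eps2 (\<lambda>phi. F (out phi)) = 0" by (rule convolution_annihilates[OF t1 D1 z1 z2 H F F0])
      moreover have "convolution eps2 eps1 (\<lambda>phi. F (out phi)) = 0" by (rule convolution_annihilates[OF t2 D2 z2 z1 H F F0])
      ultimately show ?thesis unfolding ev[OF r] X_def by simp
    qed
  qed
  ultimately show ?thesis by blast
qed

lemma add_tangent:
  assumes t1: "derivation_tangent A D1 eps1" and D1: "D1 \<in> derivations A" and z1: "annihilates H eps1"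
    and t2: "derivation_tangent A D2 eps2" and D2: "D2 \<in> derivations A" and z2: "annihilates H eps2"
  shows "\<exists>eps. derivation_tangent A (c \<odot>\<^bsub>Der A\<^esub> D1 \<oplus>\<^bsub>Der A\<^esub> D2) eps \<and> annihilates H eps"
proof -
  have e1: "tangent eps1" and e2: "tangent eps2" using t1 t2 by (simp_all add: derivation_tangent_iff)
  define eps where "eps = (\<lambda>f\<in>Aut_functions A. c * eps1 f + eps2 f)"
  have ev: "ev eps f = c * ev eps1 f + ev eps2 f" if "reg f" for f
    using that by (simp add: eps_def ev_def reg_def)
  have "tangent eps"
  proof (rule tangentI)
    show "eps \<in> extensional (Aut_functions A)" by (simp add: eps_def)
    show "ev eps (\<lambda>phi. f phi + g phi) = ev eps f + ev eps g" if "reg f" "reg g" for f g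
      unfolding ev[OF reg_add[OF that]] ev[OF that(1)] ev[OF that(2)] ev_add[OF e1 that] ev_add[OF e2 that]
      by (simp add: algebra_simps)
    show "ev eps (\<lambda>phi. d * f phi) = d * ev eps f" if "reg f" for d f
      unfolding ev[OF reg_mult[OF reg_const that]] ev[OF that] ev_cmult[OF e1 that] ev_cmult[OF e2 that]
      by (simp add: algebra_simps)
    show "ev eps (\<lambda>phi. f phi * g phi) = f idA * ev eps g + ev eps f * g idA" if "reg f" "reg g" for f g
      unfolding ev[OF reg_mult[OF that]] ev[OF that(1)] ev[OF that(2)] ev_mult[OF e1 that] ev_mult[OF e2 that]
      by (simp add: algebra_simps)
  qed
  moreover have "ev eps (\<lambda>phi. l (phi a)) = l ((c \<odot>\<^bsub>Der A\<^esub> D1 \<oplus>\<^bsub>Der A\<^esub> D2) a)"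
    if l: "functional l" and a: "a \<in> carrier A" for l a
    unfolding ev[OF reg_coeff[OF l a]]
    using a D1 D2 t1 t2 l by (simp add: functional_add[OF l] functional_smult[OF l] derivation_tangent_iff)
  ultimately have "derivation_tangent A (c \<odot>\<^bsub>Der A\<^esub> D1 \<oplus>\<^bsub>Der A\<^esub> D2) eps" unfolding derivation_tangent_iff by blast
  moreover have "annihilates H eps"
    using z1 z2 unfolding annihilates_def by (simp add: ev Out_functions_iff)
  ultimately show ?thesis by blast
qed

lemma zero_tangent: "\<exists>eps. derivation_tangent A \<zero>\<^bsub>Der A\<^esub> eps \<and> annihilates H eps"
proof -
  define eps where "eps = (\<lambda>f\<in>Aut_functions A. 0 :: 'k)"
  have ev: "ev eps f = 0" if "reg f" for f using that by (simp add: eps_def ev_def reg_def)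
  have "tangent eps"
    by (rule tangentI) (simp_all add: ev reg_add reg_mult reg_const eps_def[THEN arg_cong, of "\<lambda>e. e \<in> extensional _"])
  moreover have "ev eps (\<lambda>phi. l (phi a)) = l (\<zero>\<^bsub>Der A\<^esub> a)" if l: "functional l" and a: "a \<in> carrier A" for l a
    using a by (simp add: ev[OF reg_coeff[OF l a]] functional_zero[OF l])
  ultimately have "derivation_tangent A \<zero>\<^bsub>Der A\<^esub> eps" unfolding derivation_tangent_iff by blast
  moreover have "annihilates H eps"
    unfolding annihilates_def by (simp add: ev Out_functions_iff)
  ultimately show ?thesis by blast
qed

text \<open>Sums, multiples and brackets are formed on representing derivations together with
  tangent vectors of \<open>Aut A\<close>; \<open>HH1_tangent\<close> enters only as a relation,
  through these pairs.\<close>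

lemma HH1_lie_algebra_of_lie_subalgebra:
  assumes H: "subgroup H (Out A)"
  shows "lie_subalgebra (HH1 A) (HH1_lie_algebra_of A H)" (is "lie_subalgebra _ ?T")
proof -
  have Z: "\<zero>\<^bsub>Der A\<^esub> \<in> derivations A" using derivation_zero_map by simp
  obtain eps0 where "derivation_tangent A \<zero>\<^bsub>Der A\<^esub> eps0" and z0: "annihilates H eps0" using zero_tangent by blast
  note t0 = this(1)
  have zero: "\<zero>\<^bsub>HH1 A\<^esub> \<in> ?T"
    using HH1_lie_algebra_of_memI[OF Z t0 z0] H.cls_zero HH1_zero by simp
  have add: "c \<odot>\<^bsub>HH1 A\<^esub> x \<oplus>\<^bsub>HH1 A\<^esub> y \<in> ?T" if x: "x \<in> ?T" and y: "y \<in> ?T" for c x y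
  proof -
    obtain D1 eps1 where 1: "x = H.cls D1" "D1 \<in> derivations A" "derivation_tangent A D1 eps1" "annihilates H eps1"
      by (rule HH1_lie_algebra_of_memE[OF x])
    obtain D2 eps2 where 2: "y = H.cls D2" "D2 \<in> derivations A" "derivation_tangent A D2 eps2" "annihilates H eps2"
      by (rule HH1_lie_algebra_of_memE[OF y])
    obtain eps where eps: "derivation_tangent A (c \<odot>\<^bsub>Der A\<^esub> D1 \<oplus>\<^bsub>Der A\<^esub> D2) eps" "annihilates H eps"
      using add_tangent[OF 1(3,2,4) 2(3,2,4)] by blast
    have cD: "c \<odot>\<^bsub>Der A\<^esub> D1 \<in> derivations A" using derivation_smult[OF 1(2)] by simp
    then have "c \<odot>\<^bsub>Der A\<^esub> D1 \<oplus>\<^bsub>Der A\<^esub> D2 \<in> derivations A" using derivation_add[OF cD 2(2)] by simp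
    then have "H.cls (c \<odot>\<^bsub>Der A\<^esub> D1 \<oplus>\<^bsub>Der A\<^esub> D2) \<in> ?T" using eps by (rule HH1_lie_algebra_of_memI)
    then show ?thesis unfolding 1(1) 2(1) HH1_smult[OF 1(2)] HH1_add[OF cD 2(2)] .
  qed
  have bracket: "x \<otimes>\<^bsub>HH1 A\<^esub> y \<in> ?T" if x: "x \<in> ?T" and y: "y \<in> ?T" for x y
  proof -
    obtain D1 eps1 where 1: "x = H.cls D1" "D1 \<in> derivations A" "derivation_tangent A D1 eps1" "annihilates H eps1"
      by (rule HH1_lie_algebra_of_memE[OF x])
    obtain D2 eps2 where 2: "y = H.cls D2" "D2 \<in> derivations A" "derivation_tangent A D2 eps2" "annihilates H eps2"
      by (rule HH1_lie_algebra_of_memE[OF y])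
    obtain eps where eps: "derivation_tangent A (D1 \<otimes>\<^bsub>Der A\<^esub> D2) eps" "annihilates H eps"
      using bracket_tangent[OF 1(3,2,4) 2(3,2,4) H] by blast
    have "D1 \<otimes>\<^bsub>Der A\<^esub> D2 \<in> derivations A" using derivation_bracket[OF 1(2) 2(2)] by simp
    then have "H.cls (D1 \<otimes>\<^bsub>Der A\<^esub> D2) \<in> ?T" using eps by (rule HH1_lie_algebra_of_memI)
    then show ?thesis unfolding 1(1) 2(1) HH1_bracket[OF 1(2) 2(2)] .
  qed
  have carrier: "?T \<subseteq> carrier (HH1 A)" by (auto simp: HH1_lie_algebra_of_def)
  have "subspace class_ring ?T (HH1 A)"
  proof (rule subspaceI[OF carrier zero])
    show "x \<oplus>\<^bsub>HH1 A\<^esub> y \<in> ?T" if "x \<in> ?T" "y \<in> ?T" for x y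
    proof -
      have "1 \<odot>\<^bsub>HH1 A\<^esub> x = x" using carrier that by (intro HH1.smult_1) blast
      then show ?thesis using add[OF that, of 1] by simp
    qed
    show "c \<odot>\<^bsub>HH1 A\<^esub> x \<in> ?T" if "x \<in> ?T" for c x
    proof -
      have "c \<odot>\<^bsub>HH1 A\<^esub> x \<in> carrier (HH1 A)" using carrier that by (intro HH1.smult_in) blast
      then have "c \<odot>\<^bsub>HH1 A\<^esub> x \<oplus>\<^bsub>HH1 A\<^esub> \<zero>\<^bsub>HH1 A\<^esub> = c \<odot>\<^bsub>HH1 A\<^esub> x" by simp
      then show ?thesis using add[OF that zero, of c] by simp
    qed
  qed
  then show ?thesis using bracket unfolding lie_subalgebra_def by blast
qed

lemma zariski_closed_OutI:
  assumes H: "H \<subseteq> carrier (Out A)"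
    and R: "\<And>f. f \<in> S ==> reg f"
    and inv: "\<And>f phi u. f \<in> S ==> phi \<in> G ==> u \<in> Units A ==> f (phi \<circ>\<^sub>A inn u) = f phi"
    and zero: "\<And>phi. phi \<in> G ==> out phi \<in> H \<longleftrightarrow> (\<forall>f\<in>S. f phi = 0)"
  shows "zariski_closed (carrier (Out A)) (Out_functions A) H"
proof -
  have "\<exists>F\<in>Out_functions A. \<forall>phi\<in>G. F (out phi) = f phi" if f: "f \<in> S" for f
  proof (rule invariant_descends[OF R[OF f] inv[OF f]])
    fix F assume a: "F \<in> Out_functions A" "\<And>phi. phi \<in> G ==> F (out phi) = f phi"
    show "\<exists>F\<in>Out_functions A. \<forall>phi\<in>G. F (out phi) = f phi"
      by (rule bexI[OF _ a(1)]) (simp add: a(2))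
  qed
  then obtain F where F: "\<And>f. f \<in> S ==> F f \<in> Out_functions A"
    "\<And>f phi. f \<in> S ==> phi \<in> G ==> F f (out phi) = f phi" by metis
  have "H = {X \<in> carrier (Out A). \<forall>F'\<in>F ` S. F' X = 0}"
  proof (intro equalityI subsetI)
    fix X assume X: "X \<in> H"
    then obtain phi where phi: "phi \<in> G" "X = out phi" using H unfolding carrier_Out by blast
    then show "X \<in> {X \<in> carrier (Out A). \<forall>F'\<in>F ` S. F' X = 0}"
      using X zero[OF phi(1)] F(2)[OF _ phi(1)] by simp
  next
    fix X assume X: "X \<in> {X \<in> carrier (Out A). \<forall>F'\<in>F ` S. F' X = 0}"
    then obtain phi where phi: "phi \<in> G" "X = out phi" unfolding carrier_Out by blast
    then show "X \<in> H" using X zero[OF phi(1)] F(2)[OF _ phi(1)] by simp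
  qed
  then show ?thesis unfolding zariski_closed_def using F(1) by blast
qed

end

section \<open>Multigraded quotients of path algebras\<close>

context kalg
begin

lemma linear_map_zero_map: "linear_map (\<lambda>a. \<zero>)"
  by (simp add: linear_map_def)

lemma linear_map_id: "linear_map (\<lambda>a. a)"
  by (simp add: linear_map_def)

lemma linear_map_plus:
  assumes X: "linear_map X" and Y: "linear_map Y" shows "linear_map (\<lambda>a. X a \<oplus> Y a)"
  unfolding linear_map_def
proof (intro conjI ballI allI)
  fix x y assume x: "x \<in> carrier A" and y: "y \<in> carrier A"
  have c: "X x \<in> carrier A" "X y \<in> carrier A" "Y x \<in> carrier A" "Y y \<in> carrier A" using X Y x y by simp_all
  show "X (x \<oplus> y) \<oplus> Y (x \<oplus> y) = X x \<oplus> Y x \<oplus> (X y \<oplus> Y y)"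
    unfolding linear_map_add[OF X x y] linear_map_add[OF Y x y] using c by algebra
qed (use X Y in \<open>simp_all add: linear_map_smult smult_add_right\<close>)

lemma linear_map_scale: "linear_map X ==> linear_map (\<lambda>a. c \<odot> X a)"
  by (simp add: linear_map_def smult_add_right smult_smult mult.commute)

lemma linear_map_minus: "linear_map X ==> linear_map Y ==> linear_map (\<lambda>a. X a \<ominus> Y a)"
  using linear_map_plus[of X "\<lambda>a. (-1) \<odot> Y a"] linear_map_scale[of Y "-1"]
  by (simp add: linear_map_def minus_eq smult_neg_one)

lemma linear_map_rank_one:
  "functional f ==> z \<in> carrier A ==> linear_map (\<lambda>a. f a \<odot> z)"
  by (simp add: linear_map_def functional_def smult_add_left smult_smult)

lemma linear_map_finsum:
  assumes "finite I" "\<And>i. i \<in> I ==> linear_map (X i)"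
  shows "linear_map (\<lambda>a. \<Oplus>i\<in>I. X i a)"
proof -
  have *: "(\<Oplus>i\<in>I. X i (x \<oplus> y)) = (\<Oplus>i\<in>I. X i x) \<oplus> (\<Oplus>i\<in>I. X i y)"
    if "x \<in> carrier A" "y \<in> carrier A" for x y
  proof -
    have "(\<Oplus>i\<in>I. X i (x \<oplus> y)) = (\<Oplus>i\<in>I. X i x \<oplus> X i y)"
      by (rule finsum_cong') (use assms that in \<open>simp_all add: linear_map_add\<close>)
    also have "\<dots> = (\<Oplus>i\<in>I. X i x) \<oplus> (\<Oplus>i\<in>I. X i y)"
      by (rule finsum_addf) (use assms that in simp_all)
    finally show ?thesis .
  qed
  have **: "(\<Oplus>i\<in>I. X i (c \<odot> x)) = c \<odot> (\<Oplus>i\<in>I. X i x)" if "x \<in> carrier A" for c x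
  proof -
    have "(\<Oplus>i\<in>I. X i (c \<odot> x)) = (\<Oplus>i\<in>I. c \<odot> X i x)"
      by (rule finsum_cong') (use assms that in \<open>simp_all add: linear_map_smult\<close>)
    also have "\<dots> = c \<odot> (\<Oplus>i\<in>I. X i x)"
      by (rule finsum_smult[symmetric]) (use assms that in simp_all)
    finally show ?thesis .
  qed
  show ?thesis
    unfolding linear_map_def using * ** assms by (simp add: finsum_closed)
qed

end

text \<open>An interface to quotients by a multigraded admissible ideal. \<open>cl p\<close> is the
  class of a path, \<open>T chi\<close> rescales by a function of the multiset of arrows, which
  expresses the multigrading, and paths of length at least \<open>N\<close> vanish. Coordinates
  \<open>co p\<close> are provided only for vertices and arrows, since classes of longer paths may
  vanish or be dependent; for the same reason \<open>span_induct\<close> replaces a basis.\<close>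

locale path_quotient = kalg A + Q: fin_digraph Q
  for A :: "('k::field, 'a) module" (structure) and Q :: "('v, 'e) pre_digraph" +
  fixes cl :: "('v, 'e) qpath => 'a" and T :: "('e multiset => 'k) => 'a => 'a"
    and co :: "('v, 'e) qpath => 'a => 'k" and N :: nat
  assumes cl_in: "p \<in> qpaths Q ==> cl p \<in> carrier A"
    and cl_mult: "(u, ps, v) \<in> qpaths Q ==> (w, qs, z) \<in> qpaths Q ==>
      cl (u, ps, v) \<otimes> cl (w, qs, z) = (if v = w then cl (u, ps @ qs, z) else \<zero>)"
    and cl_one: "\<one> = (\<Oplus>v\<in>verts Q. cl (v, [], v))"
    and span_induct: "\<And>P x. x \<in> carrier A ==> P \<zero> ==>
      (\<And>x y. x \<in> carrier A ==> y \<in> carrier A ==> P x ==> P y ==> P (x \<oplus> y)) ==>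
      (\<And>c x. x \<in> carrier A ==> P x ==> P (c \<odot> x)) ==> (\<And>p. p \<in> qpaths Q ==> P (cl p)) ==> P x"
    and T_linear: "linear_map (T chi)"
    and T_cl: "p \<in> qpaths Q ==> T chi (cl p) = chi (mset (path_arrows p)) \<odot> cl p"
    and co_functional: "p \<in> qpaths Q ==> length (path_arrows p) \<le> 1 ==> functional (co p)"
    and co_cl: "p \<in> qpaths Q ==> length (path_arrows p) \<le> 1 ==> q \<in> qpaths Q ==> co p (cl q) = of_bool (q = p)"
    and cl_long: "p \<in> qpaths Q ==> N \<le> length (path_arrows p) ==> cl p = \<zero>"
begin

lemma linear_eqI:
  assumes X: "linear_map X" and Y: "linear_map Y" and "\<And>p. p \<in> qpaths Q ==> X (cl p) = Y (cl p)"
    and "a \<in> carrier A"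
  shows "X a = Y a"
  using assms(4)
proof (rule span_induct[where P = "\<lambda>a. X a = Y a"])
qed (use assms(3) in \<open>simp_all add: linear_map_simps[OF X] linear_map_simps[OF Y]\<close>)

lemma functional_eqI:
  assumes l: "functional l" and m: "functional m" and "\<And>p. p \<in> qpaths Q ==> l (cl p) = m (cl p)"
    and "a \<in> carrier A"
  shows "l a = m a"
  using assms(4)
proof (rule span_induct[where P = "\<lambda>a. l a = m a"])
qed (use assms(3) in \<open>simp_all add: functional_simps[OF l] functional_simps[OF m]\<close>)

lemma bilinear_eqI:
  assumes "\<And>b. b \<in> carrier A ==> linear_map (\<lambda>a. X a b)" "\<And>b. b \<in> carrier A ==> linear_map (\<lambda>a. Y a b)"
    and "\<And>a. a \<in> carrier A ==> linear_map (X a)" "\<And>a. a \<in> carrier A ==> linear_map (Y a)"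
    and "\<And>p q. p \<in> qpaths Q ==> q \<in> qpaths Q ==> X (cl p) (cl q) = Y (cl p) (cl q)"
    and a: "a \<in> carrier A" and b: "b \<in> carrier A"
  shows "X a b = Y a b"
proof (rule linear_eqI[OF assms(1)[OF b] assms(2)[OF b] _ a])
  fix p assume p: "p \<in> qpaths Q"
  show "X (cl p) b = Y (cl p) b"
    by (rule linear_eqI[OF assms(3)[OF cl_in[OF p]] assms(4)[OF cl_in[OF p]] _ b]) (rule assms(5)[OF p])
qed

lemma T_closed [simp]: "a \<in> carrier A ==> T chi a \<in> carrier A"
  using T_linear by simp

lemma T_mult:
  assumes "\<And>M M'. chi (M + M') = chi M * chi M'" and a: "a \<in> carrier A" and b: "b \<in> carrier A"
  shows "T chi (a \<otimes> b) = T chi a \<otimes> T chi b"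
proof (rule bilinear_eqI[OF _ _ _ _ _ a b])
  fix b assume b: "b \<in> carrier A"
  show "linear_map (\<lambda>a. T chi (a \<otimes> b))" using linear_map_comp[OF T_linear linear_map_mult_right[OF b]] .
  show "linear_map (\<lambda>a. T chi a \<otimes> T chi b)"
    using linear_map_comp[OF linear_map_mult_right T_linear] b by simp
  show "linear_map (\<lambda>a. T chi (b \<otimes> a))" using linear_map_comp[OF T_linear linear_map_mult_left[OF b]] .
  show "linear_map (\<lambda>a. T chi b \<otimes> T chi a)"
    using linear_map_comp[OF linear_map_mult_left T_linear] b by simp
next
  fix p q assume pq: "p \<in> qpaths Q" "q \<in> qpaths Q"
  obtain u p' v w q' z where [simp]: "p = (u, p', v)" "q = (w, q', z)" by (metis prod_cases3)
  have pqin: "(u, p' @ q', z) \<in> qpaths Q" if "v = w" using pq that by (auto simp: qpaths_def)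
  have pqc: "cl (u, p' @ q', z) \<in> carrier A" if "v = w" using pqin[OF that] by (rule cl_in)
  show "T chi (cl p \<otimes> cl q) = T chi (cl p) \<otimes> T chi (cl q)"
    using pq pqin pqc cl_in[OF pq(1)] cl_in[OF pq(2)] cl_mult[of u p' v w q' z] assms(1)[of "mset p'" "mset q'"]
    by (simp add: T_cl path_arrows_def smult_mult_left smult_mult_right smult_smult
        linear_map_zero[OF T_linear] mult.commute)
qed

definition vertex :: "'v => 'a" where "vertex v = cl (v, [], v)"
definition arrow :: "'e => 'a" where "arrow alpha = cl (tail Q alpha, [alpha], head Q alpha)"
definition vco :: "'v => 'a => 'k" where "vco v = co (v, [], v)"
definition aco :: "'e => 'a => 'k" where "aco alpha = co (tail Q alpha, [alpha], head Q alpha)"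

lemma vertex_path: "v \<in> verts Q ==> (v, [], v) \<in> qpaths Q"
  by (simp add: qpaths_def Q.awalk_Nil_iff)

lemma arrow_path: "alpha \<in> arcs Q ==> (tail Q alpha, [alpha], head Q alpha) \<in> qpaths Q"
  by (simp add: qpaths_def Q.arc_implies_awalk)

lemma vertex_in [simp]: "v \<in> verts Q ==> vertex v \<in> carrier A"
  unfolding vertex_def by (rule cl_in[OF vertex_path])

lemma arrow_in [simp]: "alpha \<in> arcs Q ==> arrow alpha \<in> carrier A"
  unfolding arrow_def by (rule cl_in[OF arrow_path])

lemma path_ends: "(u, p, w) \<in> qpaths Q ==> u \<in> verts Q \<and> w \<in> verts Q"
  by (auto simp: qpaths_def)

lemma path_Nil: "(u, [], w) \<in> qpaths Q \<longleftrightarrow> u = w \<and> u \<in> verts Q"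
  by (auto simp: qpaths_def Q.awalk_Nil_iff)

lemma path_Cons: "(u, alpha # p, w) \<in> qpaths Q \<longleftrightarrow> alpha \<in> arcs Q \<and> u = tail Q alpha \<and> (head Q alpha, p, w) \<in> qpaths Q"
  by (auto simp: qpaths_def Q.awalk_Cons_iff)

lemma vertex_cl: "v \<in> verts Q ==> (u, p, w) \<in> qpaths Q ==>
    vertex v \<otimes> cl (u, p, w) = (if u = v then cl (u, p, w) else \<zero>)"
  unfolding vertex_def by (subst cl_mult[OF vertex_path]) auto

lemma cl_vertex: "v \<in> verts Q ==> (u, p, w) \<in> qpaths Q ==>
    cl (u, p, w) \<otimes> vertex v = (if w = v then cl (u, p, w) else \<zero>)"
  unfolding vertex_def by (subst cl_mult[OF _ vertex_path]) auto

lemma arrow_cl: "(u, alpha # p, w) \<in> qpaths Q ==> cl (u, alpha # p, w) = arrow alpha \<otimes> cl (head Q alpha, p, w)"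
  unfolding arrow_def path_Cons by (subst cl_mult[OF arrow_path]) auto

lemma vertex_vertex: "v \<in> verts Q ==> w \<in> verts Q ==> vertex v \<otimes> vertex w = (if v = w then vertex v else \<zero>)"
  using vertex_cl[of v w "[]" w] by (auto simp: vertex_def path_Nil)

lemma vertex_arrow: "alpha \<in> arcs Q ==> v \<in> verts Q ==> vertex v \<otimes> arrow alpha = (if tail Q alpha = v then arrow alpha else \<zero>)"
  unfolding arrow_def by (rule vertex_cl[OF _ arrow_path])

lemma arrow_vertex: "alpha \<in> arcs Q ==> v \<in> verts Q ==> arrow alpha \<otimes> vertex v = (if head Q alpha = v then arrow alpha else \<zero>)"
  unfolding arrow_def by (rule cl_vertex[OF _ arrow_path])

lemma one_sum: "\<one> = (\<Oplus>v\<in>verts Q. vertex v)"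
  using cl_one by (simp add: vertex_def)

lemma vco_functional: "v \<in> verts Q ==> functional (vco v)"
  unfolding vco_def by (rule co_functional[OF vertex_path]) (simp_all add: path_arrows_def)

lemma aco_functional: "alpha \<in> arcs Q ==> functional (aco alpha)"
  unfolding aco_def by (rule co_functional[OF arrow_path]) (simp_all add: path_arrows_def)

lemma vco_cl: "v \<in> verts Q ==> p \<in> qpaths Q ==> vco v (cl p) = of_bool (p = (v, [], v))"
  unfolding vco_def by (rule co_cl[OF vertex_path]) (simp_all add: path_arrows_def)

lemma aco_cl: "alpha \<in> arcs Q ==> p \<in> qpaths Q ==> aco alpha (cl p) = of_bool (p = (tail Q alpha, [alpha], head Q alpha))"
  unfolding aco_def by (rule co_cl[OF arrow_path]) (simp_all add: path_arrows_def)

lemma vco_vertex: "v \<in> verts Q ==> w \<in> verts Q ==> vco v (vertex w) = of_bool (w = v)"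
  unfolding vertex_def by (subst vco_cl[OF _ vertex_path]) auto

lemma aco_arrow: "alpha \<in> arcs Q ==> beta \<in> arcs Q ==> aco alpha (arrow beta) = of_bool (beta = alpha)"
  unfolding arrow_def by (subst aco_cl[OF _ arrow_path]) auto

lemma vco_arrow: "v \<in> verts Q ==> beta \<in> arcs Q ==> vco v (arrow beta) = 0"
  unfolding arrow_def by (subst vco_cl[OF _ arrow_path]) auto

lemma vertex_neq_zero: "v \<in> verts Q ==> vertex v \<noteq> \<zero>"
  using vco_vertex[of v v] functional_zero[OF vco_functional[of v]] by auto

lemma arrow_neq_zero: "alpha \<in> arcs Q ==> arrow alpha \<noteq> \<zero>"
  using aco_arrow[of alpha alpha] functional_zero[OF aco_functional[of alpha]] by auto

lemma functional_mult_left: "functional l ==> a \<in> carrier A ==> functional (\<lambda>x. l (a \<otimes> x))"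
  by (rule functional_comp[OF _ linear_map_mult_left])
lemma functional_mult_right: "functional l ==> a \<in> carrier A ==> functional (\<lambda>x. l (x \<otimes> a))"
  by (rule functional_comp[OF _ linear_map_mult_right])
lemma functional_scale: "functional l ==> functional (\<lambda>x. c * l x)"
  by (simp add: functional_def algebra_simps)
lemma functional_plus: "functional l ==> functional m ==> functional (\<lambda>x. l x + m x)"
  by (simp add: functional_def algebra_simps)

text \<open>\<open>vco v\<close> is the character of \<open>A\<close> on the simple module at
  \<open>v\<close>: a product of two paths is the trivial path at \<open>v\<close> only if both
  factors are.\<close>

lemma vco_mult:
  assumes v: "v \<in> verts Q" and a: "a \<in> carrier A" and b: "b \<in> carrier A"
  shows "vco v (a \<otimes> b) = vco v a * vco v b"
proof -
  note f = vco_functional[OF v]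
  have A1: "vco v (cl p \<otimes> b) = vco v (cl p) * vco v b" if p: "p \<in> qpaths Q" for p
  proof (rule functional_eqI[OF functional_mult_left[OF f cl_in[OF p]] functional_scale[OF f] _ b])
    fix q assume q: "q \<in> qpaths Q"
    obtain u p' v' w q' z where [simp]: "p = (u, p', v')" "q = (w, q', z)" by (metis prod_cases3)
    have pqin: "(u, p' @ q', z) \<in> qpaths Q" if "v' = w" using p q that by (auto simp: qpaths_def)
    show "vco v (cl p \<otimes> cl q) = vco v (cl p) * vco v (cl q)"
      using p q v pqin cl_mult[of u p' v' w q' z]
      by (auto simp: vco_cl functional_zero[OF f] path_Nil)
  qed
  have A2: "functional (\<lambda>a. vco v a * vco v b)" using functional_scale[OF f, of "vco v b"] by (simp add: mult.commute)
  show ?thesis by (rule functional_eqI[OF functional_mult_right[OF f b] A2 A1 a])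
qed

text \<open>A single arrow arises as a product of paths only as vertex times arrow or arrow times
  vertex, so \<open>aco alpha\<close> is a derivation relative to the characters at the two ends of
  \<open>alpha\<close>.\<close>

lemma aco_mult:
  assumes alpha: "alpha \<in> arcs Q" and a: "a \<in> carrier A" and b: "b \<in> carrier A"
  shows "aco alpha (a \<otimes> b) = vco (tail Q alpha) a * aco alpha b + aco alpha a * vco (head Q alpha) b"
proof -
  have V: "tail Q alpha \<in> verts Q" "head Q alpha \<in> verts Q" using alpha by auto
  note f = aco_functional[OF alpha] and ft = vco_functional[OF V(1)] and fh = vco_functional[OF V(2)]
  have A1: "aco alpha (cl p \<otimes> b) = vco (tail Q alpha) (cl p) * aco alpha b + aco alpha (cl p) * vco (head Q alpha) b"
    if p: "p \<in> qpaths Q" for p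
  proof (rule functional_eqI[OF functional_mult_left[OF f cl_in[OF p]]
        functional_plus[OF functional_scale[OF f] functional_scale[OF fh]] _ b])
    fix q assume q: "q \<in> qpaths Q"
    obtain u p' v' w q' z where [simp]: "p = (u, p', v')" "q = (w, q', z)" by (metis prod_cases3)
    have pqin: "(u, p' @ q', z) \<in> qpaths Q" if "v' = w" using p q that by (auto simp: qpaths_def)
    show "aco alpha (cl p \<otimes> cl q) = vco (tail Q alpha) (cl p) * aco alpha (cl q) + aco alpha (cl p) * vco (head Q alpha) (cl q)"
      using p q alpha V pqin cl_mult[of u p' v' w q' z]
      by (cases p'; cases q') (auto simp: aco_cl vco_cl functional_zero[OF f] path_Nil path_Cons)
  qed
  have A2: "functional (\<lambda>a. vco (tail Q alpha) a * aco alpha b + aco alpha a * vco (head Q alpha) b)"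
    using functional_plus[OF functional_scale[OF ft, of "aco alpha b"] functional_scale[OF f, of "vco (head Q alpha) b"]]
    by (simp add: mult.commute)
  show ?thesis by (rule functional_eqI[OF functional_mult_right[OF f b] A2 A1 a])
qed

lemma vco_one: "v \<in> verts Q ==> vco v \<one> = 1"
proof -
  assume v: "v \<in> verts Q"
  have "vco v (vertex v \<otimes> \<one>) = vco v (vertex v) * vco v \<one>"
    by (rule vco_mult[OF v vertex_in[OF v] one_closed])
  then have "1 = 1 * vco v \<one>" unfolding r_one[OF vertex_in[OF v]] vco_vertex[OF v v] by simp
  then show ?thesis by simp
qed

subsection \<open>Diagonal elements\<close>

definition diag :: "('v => 'k) => 'a" where
  "diag tau = (\<Oplus>v\<in>verts Q. tau v \<odot> vertex v)"

lemma diag_in [simp]: "diag tau \<in> carrier A"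
  unfolding diag_def by (rule finsum_closed) auto

lemma finsum_single:
  assumes "finite I" "i \<in> I" "\<And>j. j \<in> I ==> g j = (if j = i then b else \<zero>)" "b \<in> carrier A"
  shows "(\<Oplus>j\<in>I. g j) = b"
proof -
  have "(\<Oplus>j\<in>I. g j) = (\<Oplus>j\<in>I. if i = j then b else \<zero>)"
    by (rule finsum_cong') (use assms in auto)
  also have "\<dots> = b"
    using assms by (subst add.finprod_singleton[of i I "\<lambda>_. b"]) auto
  finally show ?thesis .
qed

lemma diag_vertex: "w \<in> verts Q ==> diag tau \<otimes> vertex w = tau w \<odot> vertex w"
proof -
  assume w: "w \<in> verts Q"
  have "diag tau \<otimes> vertex w = (\<Oplus>v\<in>verts Q. (tau v \<odot> vertex v) \<otimes> vertex w)"
    unfolding diag_def by (rule finsum_ldistr) (use w in auto)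
  also have "\<dots> = tau w \<odot> vertex w"
    by (rule finsum_single[of _ w]) (use w in \<open>simp_all add: smult_mult_left vertex_vertex\<close>)
  finally show ?thesis .
qed

lemma vertex_diag: "w \<in> verts Q ==> vertex w \<otimes> diag tau = tau w \<odot> vertex w"
proof -
  assume w: "w \<in> verts Q"
  have "vertex w \<otimes> diag tau = (\<Oplus>v\<in>verts Q. vertex w \<otimes> (tau v \<odot> vertex v))"
    unfolding diag_def by (rule finsum_rdistr) (use w in auto)
  also have "\<dots> = tau w \<odot> vertex w"
    by (rule finsum_single[of _ w]) (use w in \<open>simp_all add: smult_mult_right vertex_vertex\<close>)
  finally show ?thesis .
qed

lemma diag_cl:
  assumes p: "(u, p, w) \<in> qpaths Q" shows "diag tau \<otimes> cl (u, p, w) = tau u \<odot> cl (u, p, w)"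
proof -
  have u: "u \<in> verts Q" using path_ends[OF p] by simp
  have "cl (u, p, w) = vertex u \<otimes> cl (u, p, w)" using vertex_cl[OF u p] by simp
  then have "diag tau \<otimes> cl (u, p, w) = (diag tau \<otimes> vertex u) \<otimes> cl (u, p, w)"
    using u cl_in[OF p] by (metis m_assoc diag_in vertex_in)
  then show ?thesis using u cl_in[OF p] by (simp add: diag_vertex smult_mult_left vertex_cl[OF u p])
qed

lemma cl_diag:
  assumes p: "(u, p, w) \<in> qpaths Q" shows "cl (u, p, w) \<otimes> diag tau = tau w \<odot> cl (u, p, w)"
proof -
  have w: "w \<in> verts Q" using path_ends[OF p] by simp
  have "cl (u, p, w) = cl (u, p, w) \<otimes> vertex w" using cl_vertex[OF w p] by simp
  then have "cl (u, p, w) \<otimes> diag tau = cl (u, p, w) \<otimes> (vertex w \<otimes> diag tau)"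
    using w cl_in[OF p] by (metis m_assoc diag_in vertex_in)
  then show ?thesis using w cl_in[OF p] by (simp add: vertex_diag smult_mult_right cl_vertex[OF w p])
qed

lemma diag_arrow: "alpha \<in> arcs Q ==> diag tau \<otimes> arrow alpha = tau (tail Q alpha) \<odot> arrow alpha"
  unfolding arrow_def by (rule diag_cl[OF arrow_path])

lemma arrow_diag: "alpha \<in> arcs Q ==> arrow alpha \<otimes> diag tau = tau (head Q alpha) \<odot> arrow alpha"
  unfolding arrow_def by (rule cl_diag[OF arrow_path])

lemma diag_one: "diag (\<lambda>v. 1) = \<one>"
  unfolding one_sum diag_def by (rule finsum_cong') auto

lemma vco_diag:
  assumes v: "v \<in> verts Q" shows "vco v (diag tau) = tau v"
proof -
  have "vco v (diag tau) = vco v (diag tau \<otimes> vertex v)"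
    using vco_mult[OF v, of "diag tau" "vertex v"] v by (simp add: vco_vertex)
  then show ?thesis using v by (simp add: diag_vertex functional_smult[OF vco_functional[OF v]] vco_vertex)
qed

lemma diag_mult: "diag tau \<otimes> diag \<sigma> = diag (\<lambda>v. tau v * \<sigma> v)"
proof -
  have "diag tau \<otimes> diag \<sigma> = (\<Oplus>v\<in>verts Q. diag tau \<otimes> (\<sigma> v \<odot> vertex v))"
    unfolding diag_def[of \<sigma>] by (rule finsum_rdistr) auto
  also have "\<dots> = diag (\<lambda>v. tau v * \<sigma> v)"
    unfolding diag_def[of "\<lambda>v. tau v * \<sigma> v"]
    by (rule finsum_cong') (simp_all add: smult_mult_right diag_vertex smult_smult mult.commute)
  finally show ?thesis .
qed

lemma diag_Units:
  assumes "\<And>v. tau v \<noteq> 0"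
  shows "diag tau \<in> Units A" and "inv (diag tau) = diag (\<lambda>v. inverse (tau v))"
proof -
  have 1: "diag tau \<otimes> diag (\<lambda>v. inverse (tau v)) = \<one>" "diag (\<lambda>v. inverse (tau v)) \<otimes> diag tau = \<one>"
    using assms by (simp_all add: diag_mult diag_one)
  show "diag tau \<in> Units A" unfolding Units_def using 1 by (auto intro: bexI[of _ "diag (\<lambda>v. inverse (tau v))"])
  show "inv (diag tau) = diag (\<lambda>v. inverse (tau v))" by (rule inv_eqI) (simp_all add: 1)
qed

subsection \<open>Generators\<close>

lemma aut_generators:
  assumes phi: "phi \<in> G" and psi: "psi \<in> G"
    and v: "\<And>v. v \<in> verts Q ==> phi (vertex v) = psi (vertex v)"
    and x: "\<And>alpha. alpha \<in> arcs Q ==> phi (arrow alpha) = psi (arrow alpha)"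
  shows "phi = psi"
proof (rule aut_eqI[OF phi psi])
  have path: "(u, p, w) \<in> qpaths Q ==> phi (cl (u, p, w)) = psi (cl (u, p, w))" for u p w
  proof (induction p arbitrary: u)
    case Nil
    then show ?case using v[of u] by (auto simp: path_Nil vertex_def)
  next
    case (Cons alpha p)
    then have alpha: "alpha \<in> arcs Q" and p: "(head Q alpha, p, w) \<in> qpaths Q" by (simp_all add: path_Cons)
    show ?case
      unfolding arrow_cl[OF Cons.prems]
      using alpha cl_in[OF p] Cons.IH[OF p] x[OF alpha] phi psi by (simp add: aut_mult)
  qed
  fix a assume "a \<in> carrier A"
  then show "phi a = psi a"
    by (rule linear_eqI[OF aut_linear[OF phi] aut_linear[OF psi], rotated]) (metis path prod_cases3)
qed

lemma derivation_generators:
  assumes D: "D \<in> derivations A" and E: "E \<in> derivations A"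
    and v: "\<And>v. v \<in> verts Q ==> D (vertex v) = E (vertex v)"
    and x: "\<And>alpha. alpha \<in> arcs Q ==> D (arrow alpha) = E (arrow alpha)"
  shows "D = E"
proof (rule derivation_eqI[OF D E])
  have path: "(u, p, w) \<in> qpaths Q ==> D (cl (u, p, w)) = E (cl (u, p, w))" for u p w
  proof (induction p arbitrary: u)
    case Nil
    then show ?case using v[of u] by (auto simp: path_Nil vertex_def)
  next
    case (Cons alpha p)
    then have alpha: "alpha \<in> arcs Q" and p: "(head Q alpha, p, w) \<in> qpaths Q" by (simp_all add: path_Cons)
    show ?case
      unfolding arrow_cl[OF Cons.prems]
      using alpha cl_in[OF p] Cons.IH[OF p] x[OF alpha] D E by (simp add: derivation_mult)
  qed
  fix a assume "a \<in> carrier A"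
  then show "D a = E a"
    by (rule linear_eqI[OF derivation_linear[OF D] derivation_linear[OF E], rotated]) (metis path prod_cases3)
qed

definition scaling :: "('e => 'k) => 'a => 'a" where
  "scaling c = restrict (T (\<lambda>M. \<Prod>alpha\<in>#M. c alpha)) (carrier A)"

lemma T_const_one: "a \<in> carrier A ==> (\<And>M. chi M = 1) ==> T chi a = a"
  by (rule linear_eqI[OF T_linear linear_map_id]) (simp_all add: T_cl cl_in)

lemma T_T: "a \<in> carrier A ==> T chi (T chi' a) = T (\<lambda>M. chi M * chi' M) a"
proof (rule linear_eqI[of "\<lambda>a. T chi (T chi' a)" "T (\<lambda>M. chi M * chi' M)"])
  show "linear_map (\<lambda>a. T chi (T chi' a))" by (rule linear_map_comp[OF T_linear T_linear])
  fix p assume p: "p \<in> qpaths Q"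
  show "T chi (T chi' (cl p)) = T (\<lambda>M. chi M * chi' M) (cl p)"
    unfolding T_cl[OF p] linear_map_smult[OF T_linear cl_in[OF p]] smult_smult[OF cl_in[OF p]]
    by (simp only: mult.commute)
qed (rule T_linear, assumption)

lemma scaling_in_G:
  assumes c: "\<And>alpha. c alpha \<noteq> 0" shows "scaling c \<in> G"
  unfolding scaling_def
proof (rule autI[where F' = "T (\<lambda>M. \<Prod>alpha\<in>#M. inverse (c alpha))"])
  let ?T = "T (\<lambda>M. \<Prod>alpha\<in>#M. c alpha)" and ?T' = "T (\<lambda>M. \<Prod>alpha\<in>#M. inverse (c alpha))"
  show "?T (x \<otimes> y) = ?T x \<otimes> ?T y" if "x \<in> carrier A" "y \<in> carrier A" for x y
    by (rule T_mult[OF _ that]) simp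
  have "(\<Prod>alpha\<in>#M. c alpha) * (\<Prod>alpha\<in>#M. inverse (c alpha)) = 1" for M
    using c by (simp add: prod_mset.distrib[symmetric])
  then have i: "?T (?T' x) = x" "?T' (?T x) = x" if "x \<in> carrier A" for x
    using that by (simp_all add: T_T T_const_one mult.commute)
  then show "x \<in> carrier A ==> ?T (?T' x) = x" "x \<in> carrier A ==> ?T' (?T x) = x" for x by auto
  have "?T \<one> = (\<Oplus>v\<in>verts Q. ?T (vertex v))"
    unfolding one_sum by (rule linear_map_sum[OF T_linear]) auto
  also have "\<dots> = \<one>"
    unfolding one_sum by (rule finsum_cong') (simp_all add: vertex_def T_cl vertex_path path_arrows_def cl_in)
  finally show "?T \<one> = \<one>" .
qed (simp_all add: T_linear)

lemma scaling_cl: "p \<in> qpaths Q ==> scaling c (cl p) = (\<Prod>alpha\<in>#mset (path_arrows p). c alpha) \<odot> cl p"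
  by (simp add: scaling_def T_cl cl_in)

lemma scaling_vertex: "v \<in> verts Q ==> scaling c (vertex v) = vertex v"
  unfolding vertex_def by (simp add: scaling_cl vertex_path path_arrows_def cl_in)

lemma scaling_arrow: "alpha \<in> arcs Q ==> scaling c (arrow alpha) = c alpha \<odot> arrow alpha"
  unfolding arrow_def by (simp add: scaling_cl arrow_path path_arrows_def)

lemma scaling_comp:
  assumes c: "\<And>alpha. c alpha \<noteq> 0" and d: "\<And>alpha. d alpha \<noteq> 0"
  shows "scaling c \<circ>\<^sub>A scaling d = scaling (\<lambda>alpha. c alpha * d alpha)"
proof (rule aut_generators)
  have G: "scaling c \<in> G" "scaling d \<in> G" using scaling_in_G c d by auto
  show "scaling c \<circ>\<^sub>A scaling d \<in> G" using G by simp
  show "scaling (\<lambda>alpha. c alpha * d alpha) \<in> G" using c d by (intro scaling_in_G) simp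
  show "(scaling c \<circ>\<^sub>A scaling d) (vertex v) = scaling (\<lambda>alpha. c alpha * d alpha) (vertex v)" if "v \<in> verts Q" for v
    using that G by (simp add: scaling_vertex)
  show "(scaling c \<circ>\<^sub>A scaling d) (arrow alpha) = scaling (\<lambda>alpha. c alpha * d alpha) (arrow alpha)" if "alpha \<in> arcs Q" for alpha
    using that G by (simp add: scaling_arrow linear_map_smult[OF aut_linear[OF G(1)]] smult_smult mult.commute)
qed

lemma scaling_one: "scaling (\<lambda>alpha. 1) = idA"
  by (rule aut_generators) (simp_all add: scaling_in_G scaling_vertex scaling_arrow)

lemma scaling_inv:
  assumes c: "\<And>alpha. c alpha \<noteq> 0" shows "aut_inv (scaling c) = scaling (\<lambda>alpha. inverse (c alpha))"
proof -
  have G: "scaling c \<in> G" "scaling (\<lambda>alpha. inverse (c alpha)) \<in> G" using scaling_in_G c by auto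
  have "scaling (\<lambda>alpha. inverse (c alpha)) \<circ>\<^sub>A scaling c = idA"
    using c by (simp add: scaling_comp scaling_one)
  then show ?thesis using G by (intro Aut.inv_equality) simp_all
qed

text \<open>Conjugations by diagonal units are precisely the rescalings by multiplicative
  coboundaries; this connects inner automorphisms with the potentials on the graph.\<close>

lemma inn_diag:
  assumes tau: "\<And>v. tau v \<noteq> 0"
  shows "inn (diag tau) = scaling (\<lambda>alpha. tau (tail Q alpha) / tau (head Q alpha))"
proof (rule aut_generators)
  show "inn (diag tau) \<in> G" using diag_Units[OF tau] by simp
  show "scaling (\<lambda>alpha. tau (tail Q alpha) / tau (head Q alpha)) \<in> G" using tau by (intro scaling_in_G) simp
  show "inn (diag tau) (vertex v) = scaling (\<lambda>alpha. tau (tail Q alpha) / tau (head Q alpha)) (vertex v)"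
    if "v \<in> verts Q" for v
    using that tau by (simp add: scaling_vertex diag_Units[OF tau] diag_vertex vertex_diag smult_mult_left smult_smult)
  show "inn (diag tau) (arrow alpha) = scaling (\<lambda>alpha. tau (tail Q alpha) / tau (head Q alpha)) (arrow alpha)"
    if "alpha \<in> arcs Q" for alpha
    using that tau by (simp add: scaling_arrow diag_Units[OF tau] diag_arrow arrow_diag smult_mult_left smult_smult divide_inverse)
qed

subsection \<open>Derivations counting an arrow\<close>

definition counting :: "'e => 'a => 'a" where
  "counting alpha = restrict (T (\<lambda>M. of_nat (count M alpha))) (carrier A)"

lemma counting_cl: "p \<in> qpaths Q ==> counting alpha (cl p) = of_nat (count (mset (path_arrows p)) alpha) \<odot> cl p"
  by (simp add: counting_def T_cl cl_in)

lemma counting_derivation: "counting alpha \<in> derivations A"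
  unfolding counting_def
proof (rule derivation_restrictI)
  let ?T = "T (\<lambda>M. of_nat (count M alpha))"
  fix x y assume x: "x \<in> carrier A" and y: "y \<in> carrier A"
  show "?T (x \<otimes> y) = ?T x \<otimes> y \<oplus> x \<otimes> ?T y"
  proof (rule bilinear_eqI[OF _ _ _ _ _ x y])
    fix b assume b: "b \<in> carrier A"
    show "linear_map (\<lambda>a. ?T (a \<otimes> b))" using linear_map_comp[OF T_linear linear_map_mult_right[OF b]] .
    show "linear_map (\<lambda>a. ?T (b \<otimes> a))" using linear_map_comp[OF T_linear linear_map_mult_left[OF b]] .
    show "linear_map (\<lambda>a. ?T a \<otimes> b \<oplus> a \<otimes> ?T b)"
      using linear_map_plus[OF linear_map_comp[OF linear_map_mult_right[OF b] T_linear] linear_map_mult_right[OF T_closed[OF b]]] .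
    show "linear_map (\<lambda>a. ?T b \<otimes> a \<oplus> b \<otimes> ?T a)"
      using linear_map_plus[OF linear_map_mult_left[OF T_closed[OF b]] linear_map_comp[OF linear_map_mult_left[OF b] T_linear]] .
  next
    fix p q assume pq: "p \<in> qpaths Q" "q \<in> qpaths Q"
    obtain u p' v w q' z where [simp]: "p = (u, p', v)" "q = (w, q', z)" by (metis prod_cases3)
    have pqin: "(u, p' @ q', z) \<in> qpaths Q" if "v = w" using pq that by (auto simp: qpaths_def)
    show "?T (cl p \<otimes> cl q) = ?T (cl p) \<otimes> cl q \<oplus> cl p \<otimes> ?T (cl q)"
      using pq pqin cl_in[OF pq(1)] cl_in[OF pq(2)] cl_mult[of u p' v w q' z]
      by (simp add: T_cl path_arrows_def smult_mult_left smult_mult_right smult_add_left[symmetric]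
          linear_map_zero[OF T_linear] cl_in)
  qed
qed (simp_all add: T_linear linear_map_add linear_map_smult)

lemma counting_vertex: "v \<in> verts Q ==> counting alpha (vertex v) = \<zero>"
  unfolding vertex_def by (simp add: counting_cl vertex_path path_arrows_def cl_in)

lemma counting_arrow: "beta \<in> arcs Q ==> counting alpha (arrow beta) = of_bool (beta = alpha) \<odot> arrow beta"
  unfolding arrow_def by (simp add: counting_cl arrow_path path_arrows_def cl_in)

lemma counting_not_inner:
  assumes z: "z \<in> Q.cycles" "z alpha = 1" and alpha: "alpha \<in> arcs Q"
  shows "counting alpha \<notin> inner_derivations A"
proof
  assume "counting alpha \<in> inner_derivations A"
  then obtain a where a: "a \<in> carrier A" "counting alpha = ad a" by (auto simp: inner_derivations_eq)
  \<comment> \<open>The coefficient of \<open>beta\<close> in \<open>ad a (arrow beta)\<close> is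
    the coboundary of the vertex coefficients of \<open>a\<close>, whatever the radical part of
    \<open>a\<close> may be.\<close>
  have d: "of_bool (beta = alpha) = vco (tail Q beta) a - vco (head Q beta) a" if beta: "beta \<in> arcs Q" for beta
  proof -
    have V: "tail Q beta \<in> verts Q" "head Q beta \<in> verts Q" using beta by auto
    have "of_bool (beta = alpha) = aco beta (counting alpha (arrow beta))"
      using beta by (simp add: counting_arrow functional_smult[OF aco_functional[OF beta]] aco_arrow)
    also have "\<dots> = aco beta (a \<otimes> arrow beta) - aco beta (arrow beta \<otimes> a)"
      using a beta by (simp add: functional_diff[OF aco_functional[OF beta]])
    also have "\<dots> = vco (tail Q beta) a - vco (head Q beta) a"
      using a beta V by (simp add: aco_mult aco_arrow vco_arrow)
    finally show ?thesis .
  qed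
  have "(\<Sum>beta\<in>arcs Q. of_int (z beta) * of_bool (beta = alpha)) =
    (\<Sum>beta\<in>arcs Q. of_int (z beta) * (vco (tail Q beta) a - vco (head Q beta) a))"
    by (rule sum.cong[OF refl]) (simp only: d)
  also have "\<dots> = 0" by (rule Q.sum_additive_coboundary[OF z(1)])
  finally have "(\<Sum>beta\<in>arcs Q. of_int (z beta) * of_bool (beta = alpha)) = (0 :: 'k)" .
  moreover have "(\<Sum>beta\<in>arcs Q. of_int (z beta) * of_bool (beta = alpha)) = (\<Sum>beta\<in>arcs Q. if beta = alpha then 1 else (0 :: 'k))"
    by (rule sum.cong) (simp_all add: z)
  ultimately show False using alpha by simp
qed

text \<open>On vertices and arrows the derivation has eigenvalues 0 and 1, which are their own
  \<open>p\<close>-th powers, and derivations are determined by these generators.\<close>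

lemma counting_p_power:
  assumes p: "CHAR('k) > 0"
  shows "p_power (counting alpha) = counting alpha"
proof (rule derivation_generators[OF p_power_derivation[OF p counting_derivation] counting_derivation])
  have e: "(counting alpha ^^ n) x = c ^ n \<odot> x" if x: "x \<in> carrier A" and "counting alpha x = c \<odot> x" for c n x
  proof (induction n)
    case 0
    then show ?case using x by simp
  next
    case (Suc n)
    then show ?case
      using that by (simp add: linear_map_smult[OF derivation_linear[OF counting_derivation]] smult_smult mult.commute)
  qed
  show "p_power (counting alpha) (vertex v) = counting alpha (vertex v)" if "v \<in> verts Q" for v
    using that e[of "vertex v" 0 "CHAR('k)"] p by (simp add: p_power_def counting_vertex zero_power)
  show "p_power (counting alpha) (arrow beta) = counting alpha (arrow beta)" if "beta \<in> arcs Q" for beta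
    using that e[of "arrow beta" "of_bool (beta = alpha)" "CHAR('k)"] p
    by (cases "beta = alpha") (simp_all add: p_power_def counting_arrow zero_power)
qed

lemma cls_counting_nonzero:
  assumes z: "z \<in> Q.cycles" "z alpha = 1" and alpha: "alpha \<in> arcs Q"
  shows "H.cls (counting alpha) \<noteq> \<zero>\<^bsub>HH1 A\<^esub>"
proof
  assume "H.cls (counting alpha) = \<zero>\<^bsub>HH1 A\<^esub>"
  then have "counting alpha \<in> inner_derivations A"
    using H.cls_self[of "counting alpha"] counting_derivation by (simp add: HH1_zero)
  then show False using counting_not_inner[OF assms] by simp
qed

lemma mt_rank_nonforest_char_p:
  assumes p: "CHAR('k) > 0" and z: "z \<in> Q.cycles" "z alpha = 1" and alpha: "alpha \<in> arcs Q"
  shows "mt_rank A \<noteq> 0"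
proof (rule mt_rank_pos[OF toral_line_torus[OF p counting_derivation counting_p_power[OF p]]])
  show "H.cls (counting alpha) \<noteq> \<zero>\<^bsub>HH1 A\<^esub>" by (rule cls_counting_nonzero[OF z alpha])
  have "1 \<odot>\<^bsub>Der A\<^esub> counting alpha = counting alpha" using counting_derivation by (intro Der.smult_1) simp
  then show "H.cls (counting alpha) \<in> {H.cls (c \<odot>\<^bsub>Der A\<^esub> counting alpha) |c. True}"
    by (intro CollectI exI[of _ 1]) simp
qed

subsection \<open>Forests\<close>

lemma boundary_path:
  "(u, p, w) \<in> qpaths Q ==> Q.boundary (\<lambda>e. int (count (mset p) e)) v = of_bool (w = v) - of_bool (u = v)"
proof (induction p arbitrary: u)
  case Nil
  then show ?case by (simp add: path_Nil Q.boundary_def)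
next
  case (Cons alpha p)
  then have alpha: "alpha \<in> arcs Q" "u = tail Q alpha" and p: "(head Q alpha, p, w) \<in> qpaths Q" by (simp_all add: path_Cons)
  have "(\<lambda>e. int (count (mset (alpha # p)) e)) = (\<lambda>e. int (count (mset p) e) + of_bool (e = alpha))"
    by (auto simp: fun_eq_iff)
  then show ?case using Cons.IH[OF p] alpha by (simp add: Q.boundary_add Q.boundary_arrow)
qed

text \<open>The arrow counts of two parallel paths differ by a cycle, hence agree on a
  forest.\<close>

lemma forest_unique_path:
  assumes forest: "\<forall>z\<in>Q.cycles. \<forall>e\<in>arcs Q. z e = 0"
    and alpha: "alpha \<in> arcs Q" and p: "(tail Q alpha, p, head Q alpha) \<in> qpaths Q"
  shows "p = [alpha]"
proof -
  have "(\<lambda>e. int (count (mset p) e) - of_bool (e = alpha)) \<in> Q.cycles"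
    unfolding Q.cycles_def using boundary_path[OF p] alpha by (simp add: Q.boundary_diff Q.boundary_arrow)
  then have "count (mset p) e = of_bool (e = alpha)" if "e \<in> arcs Q" for e
    using forest that by fastforce
  moreover have "count (mset p) e = of_bool (e = alpha)" if "e \<notin> arcs Q" for e
  proof -
    have "set p \<subseteq> arcs Q" using p by (auto simp: qpaths_def)
    then have "e \<notin> set p" "e \<noteq> alpha" using that alpha by auto
    then show ?thesis by (simp add: count_mset_0_iff)
  qed
  ultimately have "mset p = {#alpha#}" by (intro multiset_eqI) (metis count_single of_bool_def)
  then show ?thesis by simp
qed

text \<open>A derivation is determined by vertices and arrows. It is corrected by
  \<open>ad a\<close> on the vertices and then matched with \<open>ad (diag tau)\<close> on the
  arrows.\<close>

lemma forest_HH1_trivial: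
  assumes forest: "\<forall>z\<in>Q.cycles. \<forall>e\<in>arcs Q. z e = 0"
  shows "carrier (HH1 A) = {\<zero>\<^bsub>HH1 A\<^esub>}"
proof -
  have "D \<in> inner_derivations A" if D: "D \<in> derivations A" for D
  proof -
    \<comment> \<open>The span of the vertices is a separable subalgebra, with separability
      idempotent the sum of the tensors of each vertex with itself. Applying \<open>D\<close> to the
      first factor and multiplying gives an element whose inner derivation agrees with
      \<open>D\<close> on vertices.\<close>
    define a where "a = (\<Oplus>v\<in>verts Q. D (vertex v) \<otimes> vertex v)"
    have Dv: "D (vertex v) \<in> carrier A" if "v \<in> verts Q" for v using D that by simp
    have a: "a \<in> carrier A" unfolding a_def using Dv by (intro finsum_closed) auto
    have aw: "ad a (vertex w) = D (vertex w)" if w: "w \<in> verts Q" for w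
    proof -
      have 1: "a \<otimes> vertex w = D (vertex w) \<otimes> vertex w"
      proof -
        have "a \<otimes> vertex w = (\<Oplus>v\<in>verts Q. (D (vertex v) \<otimes> vertex v) \<otimes> vertex w)"
          unfolding a_def by (rule finsum_ldistr) (use w Dv in auto)
        also have "\<dots> = D (vertex w) \<otimes> vertex w"
          by (rule finsum_single[of _ w]) (use w Dv in \<open>simp_all add: m_assoc vertex_vertex\<close>)
        finally show ?thesis .
      qed
      have 2: "vertex w \<otimes> a \<oplus> D (vertex w) = D (vertex w) \<otimes> vertex w"
      proof -
        have "vertex w \<otimes> a = (\<Oplus>v\<in>verts Q. vertex w \<otimes> (D (vertex v) \<otimes> vertex v))"
          unfolding a_def by (rule finsum_rdistr) (use w Dv in auto)
        moreover have "D (vertex w) = (\<Oplus>v\<in>verts Q. D (vertex w) \<otimes> vertex v)"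
        proof -
          have "D (vertex w) = D (vertex w) \<otimes> (\<Oplus>v\<in>verts Q. vertex v)"
            using Dv[OF w] by (simp add: one_sum[symmetric])
          also have "\<dots> = (\<Oplus>v\<in>verts Q. D (vertex w) \<otimes> vertex v)"
            by (rule finsum_rdistr) (use w Dv in auto)
          finally show ?thesis .
        qed
        ultimately have "vertex w \<otimes> a \<oplus> D (vertex w) =
          (\<Oplus>v\<in>verts Q. vertex w \<otimes> (D (vertex v) \<otimes> vertex v)) \<oplus> (\<Oplus>v\<in>verts Q. D (vertex w) \<otimes> vertex v)"
          by metis
        also have "\<dots> = (\<Oplus>v\<in>verts Q. vertex w \<otimes> (D (vertex v) \<otimes> vertex v) \<oplus> D (vertex w) \<otimes> vertex v)"
          by (rule finsum_addf[symmetric]) (use w Dv in auto)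
        also have "\<dots> = D (vertex w) \<otimes> vertex w"
        proof (rule finsum_single[of _ w])
          fix v assume v: "v \<in> verts Q"
          have "vertex w \<otimes> (D (vertex v) \<otimes> vertex v) \<oplus> D (vertex w) \<otimes> vertex v =
            (D (vertex w) \<otimes> vertex v \<oplus> vertex w \<otimes> D (vertex v)) \<otimes> vertex v"
            using v w Dv[OF v] Dv[OF w] vertex_in[OF v] vertex_in[OF w]
            by (simp add: l_distr m_assoc a_comm vertex_vertex)
          also have "\<dots> = D (vertex w \<otimes> vertex v) \<otimes> vertex v"
            using D v w by (simp add: derivation_mult)
          also have "\<dots> = (if v = w then D (vertex w) \<otimes> vertex w else \<zero>)"
            using D v w by (simp add: vertex_vertex linear_map_zero[OF derivation_linear[OF D]])
          finally show "vertex w \<otimes> (D (vertex v) \<otimes> vertex v) \<oplus> D (vertex w) \<otimes> vertex v =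
            (if v = w then D (vertex w) \<otimes> vertex w else \<zero>)" .
        qed (use w Dv in auto)
        finally show ?thesis .
      qed
      have c: "vertex w \<otimes> a \<in> carrier A" "D (vertex w) \<in> carrier A" using a w Dv by auto
      have "ad a (vertex w) = (vertex w \<otimes> a \<oplus> D (vertex w)) \<ominus> vertex w \<otimes> a"
        using w 1 2 by simp
      also have "\<dots> = D (vertex w)" using c by algebra
      finally show ?thesis .
    qed
    have Da: "ad a \<in> derivations A" by (rule ad_derivation[OF a])
    define B where "B = (\<lambda>x\<in>carrier A. D x \<oplus> ((-1) \<odot>\<^bsub>Der A\<^esub> ad a) x)"
    have mDa: "(-1) \<odot>\<^bsub>Der A\<^esub> ad a \<in> derivations A" using derivation_smult[OF Da] by simp
    have B: "B \<in> derivations A" unfolding B_def by (rule derivation_add[OF D mDa])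
    have Bv: "B (vertex v) = \<zero>" if v: "v \<in> verts Q" for v
    proof -
      have "B (vertex v) = D (vertex v) \<oplus> (-1) \<odot> ad a (vertex v)" using v by (simp add: B_def)
      then show ?thesis using Dv[OF v] unfolding aw[OF v] by (simp add: smult_neg_one r_neg)
    qed
    \<comment> \<open>As \<open>B\<close> kills the vertices, it maps an arrow into the corner
      between its two ends, and on a forest this corner is spanned by the arrow alone.\<close>
    have Bx: "B (arrow alpha) = aco alpha (B (arrow alpha)) \<odot> arrow alpha" if alpha: "alpha \<in> arcs Q" for alpha
    proof -
      have V: "tail Q alpha \<in> verts Q" "head Q alpha \<in> verts Q" using alpha by auto
      have ev: "vertex (tail Q alpha) \<otimes> (b \<otimes> vertex (head Q alpha)) = aco alpha b \<odot> arrow alpha" if b: "b \<in> carrier A" for b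
      proof (rule linear_eqI[OF _ _ _ b])
        show "linear_map (\<lambda>b. vertex (tail Q alpha) \<otimes> (b \<otimes> vertex (head Q alpha)))"
          using linear_map_comp[OF linear_map_mult_left linear_map_mult_right] V by simp
        show "linear_map (\<lambda>b. aco alpha b \<odot> arrow alpha)"
          by (rule linear_map_rank_one[OF aco_functional[OF alpha] arrow_in[OF alpha]])
        fix q assume q: "q \<in> qpaths Q"
        obtain u p w where [simp]: "q = (u, p, w)" by (metis prod_cases3)
        have "u = tail Q alpha \<and> w = head Q alpha ==> p = [alpha]"
          using forest_unique_path[OF forest alpha] q by simp
        then show "vertex (tail Q alpha) \<otimes> (cl q \<otimes> vertex (head Q alpha)) = aco alpha (cl q) \<odot> arrow alpha"
          using q V alpha cl_in[OF q] cl_in[OF arrow_path[OF alpha]] by (auto simp: cl_vertex vertex_cl aco_cl arrow_def)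
      qed
      have "arrow alpha = vertex (tail Q alpha) \<otimes> (arrow alpha \<otimes> vertex (head Q alpha))"
        using alpha V by (simp add: arrow_vertex vertex_arrow)
      then have "B (arrow alpha) = B (vertex (tail Q alpha) \<otimes> (arrow alpha \<otimes> vertex (head Q alpha)))" by simp
      also have "\<dots> = vertex (tail Q alpha) \<otimes> (B (arrow alpha) \<otimes> vertex (head Q alpha))"
        using B alpha V by (simp add: derivation_mult Bv)
      finally show ?thesis using ev[of "B (arrow alpha)"] B alpha by simp
    qed
    \<comment> \<open>All cycles vanish on the arrows, so every family of scalars on the arrows of a
      forest is a coboundary.\<close>
    have zero: "(\<Sum>e\<in>arcs Q. of_int (z e) * aco e (B (arrow e))) = 0" if z: "z \<in> Q.cycles" for z
    proof (rule sum.neutral, rule ballI)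
      fix e assume "e \<in> arcs Q"
      then have "z e = 0" using forest z by blast
      then show "of_int (z e) * aco e (B (arrow e)) = 0" by simp
    qed
    obtain tau where tau: "\<And>e. e \<in> arcs Q ==> aco e (B (arrow e)) = tau (tail Q e) - tau (head Q e)"
    proof (rule Q.additive_potential[of "\<lambda>e. aco e (B (arrow e))"])
      show "(\<Sum>e\<in>arcs Q. of_int (z e) * aco e (B (arrow e))) = 0" if "z \<in> Q.cycles" for z
        by (rule zero[OF that])
    qed (rule that)
    have B_eq: "B = ad (diag tau)"
    proof (rule derivation_generators[OF B ad_derivation[OF diag_in]])
      show "B (vertex v) = ad (diag tau) (vertex v)" if "v \<in> verts Q" for v
        using that by (simp add: Bv diag_vertex vertex_diag minus_eq r_neg)
      show "B (arrow alpha) = ad (diag tau) (arrow alpha)" if alpha: "alpha \<in> arcs Q" for alpha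
      proof -
        have "B (arrow alpha) = (tau (tail Q alpha) + (-1) * tau (head Q alpha)) \<odot> arrow alpha"
          using Bx[OF alpha] tau[OF alpha] by simp
        also have "\<dots> = tau (tail Q alpha) \<odot> arrow alpha \<ominus> tau (head Q alpha) \<odot> arrow alpha"
          using arrow_in[OF alpha] unfolding smult_add_left[OF arrow_in[OF alpha]] minus_eq smult_smult[OF arrow_in[OF alpha], symmetric]
          by (simp add: smult_neg_one)
        finally show ?thesis using alpha by (simp add: diag_arrow arrow_diag)
      qed
    qed
    have "D = ad (diag tau \<oplus> a)"
    proof (rule derivation_eqI[OF D ad_derivation])
      fix x assume x: "x \<in> carrier A"
      have c: "D x \<in> carrier A" "ad a x \<in> carrier A" using D Da x by (simp_all only: derivation_closed)
      have "ad (diag tau \<oplus> a) x = ad (diag tau) x \<oplus> ad a x"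
        using x unfolding ad_add[OF diag_in a] by simp
      also have "ad (diag tau) x = D x \<oplus> (-1) \<odot> ad a x"
        unfolding B_eq[symmetric] B_def using x by simp
      also have "\<dots> = D x \<oplus> \<ominus> ad a x" using smult_neg_one[OF c(2)] by simp
      finally show "D x = ad (diag tau \<oplus> a) x" using c by (simp add: a_assoc l_neg)
    qed (use a in simp)
    then show ?thesis unfolding inner_derivations_eq by (rule image_eqI) (use a in simp)
  qed
  then have "H.cls D = \<zero>\<^bsub>HH1 A\<^esub>" if "D \<in> derivations A" for D
    using H.a_rcos_const[of D] that by (simp add: HH1_zero)
  moreover have "derivations A \<noteq> {}" using derivation_zero_map by blast
  ultimately show ?thesis unfolding HH1_carrier by auto
qed

end

section \<open>The length filtration and the associated graded automorphism\<close>

context path_quotient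
begin

text \<open>The length grading is read off from the multigrading by indicator functions of the size.
  The resulting \<open>filt m\<close> is the \<open>m\<close>-th power of the radical, the span of
  the paths of length at least \<open>m\<close>.\<close>

definition pr :: "nat => 'a => 'a" where "pr m = T (\<lambda>M. of_bool (size M = m))"
definition tr :: "nat => 'a => 'a" where "tr m = T (\<lambda>M. of_bool (m \<le> size M))"
definition filt :: "nat => 'a set" where "filt m = {a \<in> carrier A. \<forall>j<m. pr j a = \<zero>}"

abbreviation len :: "('v, 'e) qpath => nat" where "len p \<equiv> length (path_arrows p)"

lemma pr_linear: "linear_map (pr m)" unfolding pr_def by (rule T_linear)
lemma tr_linear: "linear_map (tr m)" unfolding tr_def by (rule T_linear)
lemma pr_closed [simp]: "a \<in> carrier A ==> pr m a \<in> carrier A" using pr_linear by simp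
lemma tr_closed [simp]: "a \<in> carrier A ==> tr m a \<in> carrier A" using tr_linear by simp

lemma pr_cl: "p \<in> qpaths Q ==> pr m (cl p) = (if len p = m then cl p else \<zero>)"
  using cl_in[of p] by (simp add: pr_def T_cl)

lemma tr_cl: "p \<in> qpaths Q ==> tr m (cl p) = (if m \<le> len p then cl p else \<zero>)"
  using cl_in[of p] by (simp add: tr_def T_cl)

lemma pr_pr: "a \<in> carrier A ==> pr m (pr n a) = (if m = n then pr m a else \<zero>)"
proof (rule linear_eqI[OF linear_map_comp[OF pr_linear pr_linear], of "\<lambda>a. if m = n then pr m a else \<zero>"])
  show "linear_map (\<lambda>a. if m = n then pr m a else \<zero>)"
    by (cases "m = n") (simp_all add: pr_linear linear_map_zero_map)
qed (simp_all add: pr_cl linear_map_zero[OF pr_linear])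

lemma pr_tr_less: "a \<in> carrier A ==> j < m ==> pr j (tr m a) = \<zero>"
  by (rule linear_eqI[OF linear_map_comp[OF pr_linear tr_linear] linear_map_zero_map])
    (simp_all add: pr_cl tr_cl linear_map_zero[OF pr_linear])

lemma tr_0: "a \<in> carrier A ==> tr 0 a = a"
  by (rule linear_eqI[OF tr_linear linear_map_id]) (simp_all add: tr_cl)

lemma tr_Suc: "a \<in> carrier A ==> tr m a = pr m a \<oplus> tr (Suc m) a"
  by (rule linear_eqI[OF tr_linear linear_map_plus[OF pr_linear tr_linear]])
    (auto simp: tr_cl pr_cl cl_in)

lemma filt_tr: "a \<in> filt m ==> tr m a = a"
proof (induction m)
  case 0
  then show ?case by (simp add: filt_def tr_0)
next
  case (Suc m)
  then have "a \<in> filt m" "a \<in> carrier A" "pr m a = \<zero>" by (simp_all add: filt_def)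
  then show ?case using Suc.IH tr_Suc[of a m] by simp
qed

lemma filt_closed: "a \<in> filt m ==> a \<in> carrier A"
  by (simp add: filt_def)

lemma tr_in_filt: "a \<in> carrier A ==> tr m a \<in> filt m"
  by (simp add: filt_def pr_tr_less)

lemma filtI: "a \<in> carrier A ==> tr m a = a ==> a \<in> filt m"
  using tr_in_filt[of a m] by simp

lemma filt_0 [simp]: "a \<in> filt 0 \<longleftrightarrow> a \<in> carrier A"
  by (simp add: filt_def)

lemma filt_mono: "a \<in> filt n ==> m \<le> n ==> a \<in> filt m"
  by (simp add: filt_def)

lemma filt_add: "a \<in> filt m ==> b \<in> filt m ==> a \<oplus> b \<in> filt m"
  by (simp add: filt_def linear_map_add[OF pr_linear])
lemma filt_neg: "a \<in> filt m ==> \<ominus> a \<in> filt m"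
  by (simp add: filt_def linear_map_neg[OF pr_linear])
lemma filt_diff: "a \<in> filt m ==> b \<in> filt m ==> a \<ominus> b \<in> filt m"
  using filt_add filt_neg by (simp add: minus_eq)

lemma filt_decompose: "a \<in> filt m ==> a = pr m a \<oplus> tr (Suc m) a"
  using filt_tr[of a m] tr_Suc[of a m] filt_closed[of a m] by simp

lemma pr_in_filt: "a \<in> carrier A ==> pr m a \<in> filt m"
  by (simp add: filt_def pr_pr)

lemma pr_filt_Suc: "a \<in> filt (Suc m) ==> pr m a = \<zero>"
  by (simp add: filt_def)

declare filt_closed [simp]

lemma filt_diff_pr: "a \<in> filt m ==> a \<ominus> pr m a \<in> filt (Suc m)"
proof -
  assume a: "a \<in> filt m"
  have c: "pr m a \<in> carrier A" "tr (Suc m) a \<in> carrier A" using a by simp_all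
  have "a \<ominus> pr m a = (pr m a \<oplus> tr (Suc m) a) \<ominus> pr m a" using filt_decompose[OF a] by simp
  also have "\<dots> = tr (Suc m) a" using c by algebra
  finally show ?thesis using a tr_in_filt by simp
qed

lemma filt_SucI: "a \<in> filt m ==> pr m a = \<zero> ==> a \<in> filt (Suc m)"
  using filt_diff_pr[of a m] by (simp add: minus_eq)

lemma filt_N: "a \<in> filt N ==> a = \<zero>"
proof -
  assume a: "a \<in> filt N"
  have "tr N a = \<zero>"
    by (rule linear_eqI[OF tr_linear linear_map_zero_map _ filt_closed[OF a]]) (simp add: tr_cl cl_long)
  then show ?thesis using filt_tr[OF a] by simp
qed

lemma cl_in_filt: "p \<in> qpaths Q ==> m \<le> len p ==> cl p \<in> filt m"
  by (rule filtI) (simp_all add: cl_in tr_cl)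

lemma arrow_in_filt: "alpha \<in> arcs Q ==> arrow alpha \<in> filt 1"
  unfolding arrow_def by (rule cl_in_filt[OF arrow_path]) (simp_all add: path_arrows_def)

text \<open>Inserting the truncations \<open>tr m\<close> and \<open>tr n\<close> makes both sides
  bilinear on all of \<open>A\<close>, so that the claim can be checked on path classes; on the
  filtration itself the truncations act as the identity.\<close>

lemma filt_pr_mult:
  assumes a: "a \<in> filt m" and b: "b \<in> filt n"
  shows "a \<otimes> b \<in> filt (m + n)" and "pr (m + n) (a \<otimes> b) = pr m a \<otimes> pr n b"
proof -
  have *: "tr (m + n) (tr m x \<otimes> tr n y) = tr m x \<otimes> tr n y \<and> pr (m + n) (tr m x \<otimes> tr n y) = pr m x \<otimes> pr n y"
    if x: "x \<in> carrier A" and y: "y \<in> carrier A" for x y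
  proof
    have L: "linear_map (\<lambda>x. tr m x \<otimes> tr n y)" "linear_map (\<lambda>x. pr m x \<otimes> pr n y)" if "y \<in> carrier A" for y
      using linear_map_comp[OF linear_map_mult_right tr_linear] linear_map_comp[OF linear_map_mult_right pr_linear] that
      by simp_all
    have R: "linear_map (\<lambda>y. tr m x \<otimes> tr n y)" "linear_map (\<lambda>y. pr m x \<otimes> pr n y)" if "x \<in> carrier A" for x
      using linear_map_comp[OF linear_map_mult_left tr_linear] linear_map_comp[OF linear_map_mult_left pr_linear] that
      by simp_all
    have prod: "cl p \<otimes> cl q = \<zero> \<or> (\<exists>r\<in>qpaths Q. len r = len p + len q \<and> cl p \<otimes> cl q = cl r)"
      if "p \<in> qpaths Q" "q \<in> qpaths Q" for p q
    proof -
      obtain u p' v w q' z where pq: "p = (u, p', v)" "q = (w, q', z)" by (metis prod_cases3)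
      have "(u, p' @ q', z) \<in> qpaths Q" if "v = w"
        using \<open>p \<in> qpaths Q\<close> \<open>q \<in> qpaths Q\<close> that pq by (auto simp: qpaths_def)
      then show ?thesis using that pq cl_mult[of u p' v w q' z]
        by (cases "v = w") (auto simp: path_arrows_def intro!: bexI[of _ "(u, p' @ q', z)"])
    qed
    show "tr (m + n) (tr m x \<otimes> tr n y) = tr m x \<otimes> tr n y"
    proof (rule bilinear_eqI[OF _ _ _ _ _ x y])
      fix p q assume pq: "p \<in> qpaths Q" "q \<in> qpaths Q"
      then show "tr (m + n) (tr m (cl p) \<otimes> tr n (cl q)) = tr m (cl p) \<otimes> tr n (cl q)"
        using prod[OF pq] cl_in[OF pq(1)] cl_in[OF pq(2)]
        by (auto simp: tr_cl linear_map_zero[OF tr_linear])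
    qed (use L R linear_map_comp[OF tr_linear] in \<open>auto\<close>)
    show "pr (m + n) (tr m x \<otimes> tr n y) = pr m x \<otimes> pr n y"
    proof (rule bilinear_eqI[OF _ _ _ _ _ x y])
      fix p q assume pq: "p \<in> qpaths Q" "q \<in> qpaths Q"
      then show "pr (m + n) (tr m (cl p) \<otimes> tr n (cl q)) = pr m (cl p) \<otimes> pr n (cl q)"
        using prod[OF pq] cl_in[OF pq(1)] cl_in[OF pq(2)]
        by (auto simp: tr_cl pr_cl linear_map_zero[OF pr_linear])
    qed (use L R linear_map_comp[OF pr_linear] in \<open>auto\<close>)
  qed
  show "a \<otimes> b \<in> filt (m + n)"
    using *[of a b] a b by (intro filtI) (simp_all add: filt_tr)
  show "pr (m + n) (a \<otimes> b) = pr m a \<otimes> pr n b"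
    using *[of a b] a b by (simp add: filt_tr)
qed

lemma filt_mult: "a \<in> filt m ==> b \<in> filt n ==> a \<otimes> b \<in> filt (m + n)"
  by (rule filt_pr_mult)
lemma pr_mult: "a \<in> filt m ==> b \<in> filt n ==> pr (m + n) (a \<otimes> b) = pr m a \<otimes> pr n b"
  by (rule filt_pr_mult)

lemma pr_0_one: "pr 0 \<one> = \<one>"
proof -
  have "pr 0 \<one> = (\<Oplus>v\<in>verts Q. pr 0 (vertex v))"
    unfolding one_sum by (rule linear_map_sum[OF pr_linear]) auto
  also have "\<dots> = \<one>"
    unfolding one_sum by (rule finsum_cong') (simp_all add: vertex_def pr_cl vertex_path path_arrows_def cl_in)
  finally show ?thesis .
qed

lemma diag_cong: "(\<And>v. v \<in> verts Q ==> tau v = \<sigma> v) ==> diag tau = diag \<sigma>"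
  unfolding diag_def by (rule finsum_cong') auto

lemma diag_zero: "diag (\<lambda>v. 0) = \<zero>"
proof -
  have "diag (\<lambda>v. 0) = (\<Oplus>v\<in>verts Q. \<zero>)" unfolding diag_def by (rule finsum_cong') auto
  then show ?thesis by simp
qed

lemma pr_0_eq: "a \<in> carrier A ==> pr 0 a = diag (\<lambda>v. vco v a)"
proof (rule linear_eqI[OF pr_linear, of "\<lambda>a. diag (\<lambda>v. vco v a)"])
  show "linear_map (\<lambda>a. diag (\<lambda>v. vco v a))"
    unfolding diag_def by (rule linear_map_finsum) (auto intro: linear_map_rank_one vco_functional)
  fix p assume p: "p \<in> qpaths Q"
  obtain u ps w where [simp]: "p = (u, ps, w)" by (metis prod_cases3)
  show "pr 0 (cl p) = diag (\<lambda>v. vco v (cl p))"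
  proof (cases ps)
    case Nil
    then have u: "u \<in> verts Q" "w = u" using p by (auto simp: path_Nil)
    have "diag (\<lambda>v. vco v (cl p)) = vertex u"
      unfolding diag_def
      by (rule finsum_single[of _ u]) (use u p Nil in \<open>auto simp: vco_cl\<close>)
    then show ?thesis using p Nil u by (simp add: pr_cl path_arrows_def vertex_def)
  next
    case (Cons alpha qs)
    then have "diag (\<lambda>v. vco v (cl p)) = diag (\<lambda>v. 0)"
      using p by (intro diag_cong) (simp add: vco_cl)
    then show ?thesis using p Cons by (simp add: pr_cl path_arrows_def diag_zero)
  qed
qed

lemma filt_1_iff: "a \<in> carrier A ==> a \<in> filt 1 \<longleftrightarrow> (\<forall>v\<in>verts Q. vco v a = 0)"
proof
  assume a: "a \<in> carrier A" and f: "a \<in> filt 1"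
  then have "diag (\<lambda>v. vco v a) = \<zero>" using pr_0_eq[OF a] by (simp add: filt_def del: filt_closed)
  then show "\<forall>v\<in>verts Q. vco v a = 0"
    using vco_diag[where tau = "\<lambda>v. vco v a"] functional_zero[OF vco_functional] by metis
next
  assume a: "a \<in> carrier A" and "\<forall>v\<in>verts Q. vco v a = 0"
  then have "pr 0 a = diag (\<lambda>v. 0)" unfolding pr_0_eq[OF a] by (intro diag_cong) simp
  then show "a \<in> filt 1" using a by (simp add: filt_def diag_zero del: filt_closed)
qed

lemma pr_1_eq: "a \<in> carrier A ==> pr 1 a = (\<Oplus>alpha\<in>arcs Q. aco alpha a \<odot> arrow alpha)"
proof (rule linear_eqI[OF pr_linear, of "\<lambda>a. \<Oplus>alpha\<in>arcs Q. aco alpha a \<odot> arrow alpha"])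
  show "linear_map (\<lambda>a. \<Oplus>alpha\<in>arcs Q. aco alpha a \<odot> arrow alpha)"
    by (rule linear_map_finsum) (auto intro: linear_map_rank_one aco_functional)
  fix p assume p: "p \<in> qpaths Q"
  obtain u ps w where [simp]: "p = (u, ps, w)" by (metis prod_cases3)
  show "pr 1 (cl p) = (\<Oplus>alpha\<in>arcs Q. aco alpha (cl p) \<odot> arrow alpha)"
  proof (cases "\<exists>alpha. ps = [alpha]")
    case True
    then obtain beta where beta: "ps = [beta]" ..
    then have b: "beta \<in> arcs Q" "u = tail Q beta" "w = head Q beta" using p by (auto simp: path_Cons path_Nil)
    have "(\<Oplus>alpha\<in>arcs Q. aco alpha (cl p) \<odot> arrow alpha) = arrow beta"
      by (rule finsum_single[of _ beta]) (use b p beta in \<open>auto simp: aco_cl\<close>)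
    then show ?thesis using p beta b by (simp add: pr_cl path_arrows_def arrow_def)
  next
    case False
    have "(\<Oplus>alpha\<in>arcs Q. aco alpha (cl p) \<odot> arrow alpha) = (\<Oplus>alpha\<in>arcs Q. \<zero>)"
      by (rule finsum_cong') (use p False in \<open>auto simp: aco_cl\<close>)
    moreover have "len p \<noteq> 1" using False by (auto simp: path_arrows_def length_Suc_conv)
    ultimately show ?thesis using p by (simp add: pr_cl)
  qed
qed

subsection \<open>Unipotent units\<close>

text \<open>Partial sums of the geometric series for the inverse of
  \<open>\<one> \<oplus> a\<close>, in Horner form. A polynomial formula is wanted because the
  inverse must depend regularly on \<open>a\<close>.\<close>

primrec geo :: "'a => nat => 'a" where
  "geo a 0 = \<one>"
| "geo a (Suc n) = \<one> \<ominus> a \<otimes> geo a n"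

lemma geo_closed [simp]: "a \<in> carrier A ==> geo a n \<in> carrier A"
  by (induction n) simp_all

lemma geo_comm: "a \<in> carrier A ==> a \<otimes> geo a n = geo a n \<otimes> a"
proof (induction n)
  case (Suc n)
  have c: "geo a n \<in> carrier A" using Suc.prems by simp
  have "a \<otimes> geo a (Suc n) = a \<ominus> a \<otimes> (a \<otimes> geo a n)"
    using Suc.prems c by (simp add: r_distr minus_eq r_minus)
  also have "\<dots> = a \<ominus> a \<otimes> (geo a n \<otimes> a)" using Suc by simp
  also have "\<dots> = geo a (Suc n) \<otimes> a"
    using Suc.prems c by (simp add: l_distr minus_eq l_minus m_assoc)
  finally show ?case .
qed simp

lemma geo_inverse: "a \<in> filt 1 ==> (\<one> \<oplus> a) \<otimes> geo a n \<ominus> \<one> \<in> filt (Suc n)"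
proof (induction n)
  case 0
  then have "(\<one> \<oplus> a) \<otimes> geo a 0 \<ominus> \<one> = a"
    unfolding geo.simps(1) r_one[OF add.m_closed[OF one_closed filt_closed[OF 0]]] using filt_closed[OF 0] by algebra
  then show ?case using 0 by simp
next
  case (Suc n)
  have a: "a \<in> carrier A" and g: "geo a n \<in> carrier A" using filt_closed[OF Suc.prems] by simp_all
  have "(\<one> \<oplus> a) \<otimes> geo a (Suc n) \<ominus> \<one> = \<ominus> (a \<otimes> ((\<one> \<oplus> a) \<otimes> geo a n \<ominus> \<one>))"
  proof -
    define x y where "x = a \<otimes> geo a n" and "y = a \<otimes> (a \<otimes> geo a n)"
    have c: "x \<in> carrier A" "y \<in> carrier A" using a g by (simp_all add: x_def y_def)
    have "(\<one> \<oplus> a) \<otimes> geo a (Suc n) = \<one> \<oplus> a \<ominus> (x \<oplus> y)"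
      using a g by (simp add: x_def y_def l_distr r_distr minus_eq r_minus)
    moreover have "a \<otimes> ((\<one> \<oplus> a) \<otimes> geo a n \<ominus> \<one>) = x \<oplus> y \<ominus> a"
      using a g by (simp add: x_def y_def l_distr r_distr minus_eq r_minus)
    moreover have "\<one> \<oplus> a \<ominus> (x \<oplus> y) \<ominus> \<one> = \<ominus> (x \<oplus> y \<ominus> a)" using c a by algebra
    ultimately show ?thesis by simp
  qed
  moreover have "a \<otimes> ((\<one> \<oplus> a) \<otimes> geo a n \<ominus> \<one>) \<in> filt (1 + Suc n)"
    by (rule filt_mult[OF Suc.prems Suc.IH[OF Suc.prems]])
  ultimately show ?case using filt_neg by simp
qed

lemma unipotent_unit:
  assumes a: "a \<in> filt 1"
  shows "\<one> \<oplus> a \<in> Units A" and "inv (\<one> \<oplus> a) = geo a N"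
proof -
  have c: "a \<in> carrier A" "geo a N \<in> carrier A" using filt_closed[OF a] by simp_all
  have "(\<one> \<oplus> a) \<otimes> geo a N \<ominus> \<one> \<in> filt N" using filt_mono[OF geo_inverse[OF a]] by simp
  then have "(\<one> \<oplus> a) \<otimes> geo a N \<ominus> \<one> = \<zero>" by (rule filt_N)
  then have 1: "(\<one> \<oplus> a) \<otimes> geo a N = \<one>" using c by simp
  then have 2: "geo a N \<otimes> (\<one> \<oplus> a) = \<one>" using c geo_comm[OF c(1), of N] by (simp add: l_distr r_distr)
  show "\<one> \<oplus> a \<in> Units A" unfolding Units_def using 1 2 c by (auto intro: bexI[of _ "geo a N"])
  show "inv (\<one> \<oplus> a) = geo a N" by (rule inv_eqI) (use 1 2 c in simp_all)
qed

lemma vco_unit: "u \<in> Units A ==> v \<in> verts Q ==> vco v u * vco v (inv u) = 1"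
  using vco_mult[of v u "inv u"] Units_closed[of u] Units_closed[OF Units_inv_Units[of u]]
  by (simp add: vco_one Units_r_inv)

text \<open>Membership in the radical is tested by units: \<open>\<one> \<oplus> b\<close> is a unit
  for \<open>b\<close> in \<open>filt 1\<close>, automorphisms preserve units, and a unit has no
  vanishing vertex coefficient.\<close>

lemma aut_filt_1:
  assumes phi: "phi \<in> G" and a: "a \<in> filt 1"
  shows "phi a \<in> filt 1"
proof -
  have ac: "a \<in> carrier A" using a by simp
  have "vco v (phi a) = 0" if v: "v \<in> verts Q" for v
  proof (rule ccontr)
    assume nz: "vco v (phi a) \<noteq> 0"
    \<comment> \<open>Scaled so that the coefficient of \<open>phi (\<one> \<oplus> b)\<close> at
      \<open>v\<close> becomes 1 - 1 = 0.\<close>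
    define b where "b = (- inverse (vco v (phi a))) \<odot> a"
    have b: "b \<in> filt 1"
      using a by (simp add: b_def filt_def linear_map_smult[OF pr_linear] del: filt_closed)
    have "phi (\<one> \<oplus> b) \<in> Units A" by (rule aut_Units(1)[OF phi unipotent_unit(1)[OF b]])
    then have "vco v (phi (\<one> \<oplus> b)) \<noteq> 0" using vco_unit[of "phi (\<one> \<oplus> b)" v] v by auto
    moreover have "vco v (phi (\<one> \<oplus> b)) = 0"
      using phi ac v nz filt_closed[OF b]
      by (simp add: aut_simps functional_simps[OF vco_functional[OF v]] vco_one b_def)
    ultimately show False by simp
  qed
  then show ?thesis by (intro iffD2[OF filt_1_iff[OF aut_closed[OF phi ac]]] ballI)
qed

lemma aut_filt:
  assumes phi: "phi \<in> G" and a: "a \<in> filt m"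
  shows "phi a \<in> filt m"
proof -
  have path: "(u, p, w) \<in> qpaths Q ==> phi (cl (u, p, w)) \<in> filt (length p)" for u p w
  proof (induction p arbitrary: u)
    case Nil
    then show ?case using phi by (simp add: cl_in)
  next
    case (Cons alpha p)
    then have alpha: "alpha \<in> arcs Q" and p: "(head Q alpha, p, w) \<in> qpaths Q" by (simp_all add: path_Cons)
    have "phi (arrow alpha) \<otimes> phi (cl (head Q alpha, p, w)) \<in> filt (1 + length p)"
      by (rule filt_mult[OF aut_filt_1[OF phi arrow_in_filt[OF alpha]] Cons.IH[OF p]])
    then show ?case using phi alpha cl_in[OF p] unfolding arrow_cl[OF Cons.prems] by (simp add: aut_mult)
  qed
  have "tr m (phi (tr m a)) = phi (tr m a)"
  proof (rule linear_eqI[of "\<lambda>a. tr m (phi (tr m a))" "\<lambda>a. phi (tr m a)"])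
    show "linear_map (\<lambda>a. phi (tr m a))" by (rule linear_map_comp[OF aut_linear[OF phi] tr_linear])
    then show "linear_map (\<lambda>a. tr m (phi (tr m a)))" by (rule linear_map_comp[OF tr_linear])
    fix p assume p: "p \<in> qpaths Q"
    obtain u ps w where [simp]: "p = (u, ps, w)" by (metis prod_cases3)
    show "tr m (phi (tr m (cl p))) = phi (tr m (cl p))"
    proof (cases "m \<le> len p")
      case True
      then have "phi (cl p) \<in> filt m" using path[of u ps w] p filt_mono by (simp add: path_arrows_def)
      then show ?thesis using True p by (simp add: tr_cl filt_tr)
    next
      case False
      then show ?thesis using p phi by (simp add: tr_cl linear_map_zero[OF aut_linear[OF phi]] linear_map_zero[OF tr_linear])
    qed
  qed (use a in simp)
  then show ?thesis using phi a by (intro filtI) (simp_all add: filt_tr)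
qed

subsection \<open>The associated graded automorphism\<close>

text \<open>The part of \<open>phi\<close> that preserves path length. Because \<open>A\<close> is
  itself graded by length, the associated graded automorphism acts on \<open>A\<close>; degrees from
  \<open>N\<close> on vanish.\<close>

definition grf :: "('a => 'a) => 'a => 'a" where
  "grf phi a = (\<Oplus>m\<in>{..<N}. pr m (phi (pr m a)))"

definition gr :: "('a => 'a) => 'a => 'a" where "gr phi = restrict (grf phi) (carrier A)"

lemma grf_linear: assumes phi: "phi \<in> G" shows "linear_map (grf phi)"
  unfolding grf_def
  by (rule linear_map_finsum) (auto intro!: linear_map_comp[OF pr_linear] linear_map_comp[OF aut_linear[OF phi]] pr_linear)

lemma grf_homogeneous:
  assumes phi: "phi \<in> G" and a: "a \<in> carrier A" and h: "pr m a = a"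
  shows "grf phi a = pr m (phi a)"
proof (cases "m < N")
  case True
  have "pr j a = \<zero>" if "j \<noteq> m" for j using pr_pr[OF a, of j m] h that by simp
  then show ?thesis
    unfolding grf_def using True a h phi
    by (intro finsum_single[of _ m]) (auto simp: linear_map_zero[OF aut_linear[OF phi]] linear_map_zero[OF pr_linear])
next
  case False
  have "a \<in> filt N" using pr_in_filt[OF a, of m] h False filt_mono by simp
  then have "a = \<zero>" by (rule filt_N)
  then show ?thesis using grf_linear[OF phi] phi
    by (simp add: linear_map_zero linear_map_zero[OF aut_linear[OF phi]] linear_map_zero[OF pr_linear])
qed

lemma grf_cl: "phi \<in> G ==> p \<in> qpaths Q ==> grf phi (cl p) = pr (len p) (phi (cl p))"
  by (rule grf_homogeneous) (simp_all add: cl_in pr_cl)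

lemma grf_mult:
  assumes phi: "phi \<in> G" and a: "a \<in> carrier A" and b: "b \<in> carrier A"
  shows "grf phi (a \<otimes> b) = grf phi a \<otimes> grf phi b"
proof (rule bilinear_eqI[OF _ _ _ _ _ a b])
  note L = grf_linear[OF phi]
  fix b assume b: "b \<in> carrier A"
  show "linear_map (\<lambda>a. grf phi (a \<otimes> b))" by (rule linear_map_comp[OF L linear_map_mult_right[OF b]])
  show "linear_map (\<lambda>a. grf phi (b \<otimes> a))" by (rule linear_map_comp[OF L linear_map_mult_left[OF b]])
  show "linear_map (\<lambda>a. grf phi a \<otimes> grf phi b)"
    by (rule linear_map_comp[OF linear_map_mult_right[OF linear_map_closed[OF L b]] L])
  show "linear_map (\<lambda>a. grf phi b \<otimes> grf phi a)"
    by (rule linear_map_comp[OF linear_map_mult_left[OF linear_map_closed[OF L b]] L])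
next
  fix p q assume pq: "p \<in> qpaths Q" "q \<in> qpaths Q"
  have c: "cl p \<in> carrier A" "cl q \<in> carrier A" using pq cl_in by auto
  have f: "cl p \<in> filt (len p)" "cl q \<in> filt (len q)" using cl_in_filt pq by auto
  have "pr (len p + len q) (cl p \<otimes> cl q) = cl p \<otimes> cl q"
    unfolding pr_mult[OF f] using pq by (simp add: pr_cl)
  then have "grf phi (cl p \<otimes> cl q) = pr (len p + len q) (phi (cl p \<otimes> cl q))"
    using c by (intro grf_homogeneous[OF phi]) simp_all
  also have "\<dots> = pr (len p) (phi (cl p)) \<otimes> pr (len q) (phi (cl q))"
    unfolding aut_mult[OF phi c] by (rule pr_mult[OF aut_filt[OF phi f(1)] aut_filt[OF phi f(2)]])
  finally show "grf phi (cl p \<otimes> cl q) = grf phi (cl p) \<otimes> grf phi (cl q)" using pq phi by (simp add: grf_cl)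
qed

text \<open>The components of \<open>psi (cl p)\<close> beyond the length of \<open>p\<close> stay
  beyond it under \<open>phi\<close>, so they contribute nothing to the leading part.\<close>

lemma grf_comp:
  assumes phi: "phi \<in> G" and psi: "psi \<in> G" and a: "a \<in> carrier A"
  shows "grf (phi \<circ>\<^sub>A psi) a = grf phi (grf psi a)"
proof (rule linear_eqI[OF grf_linear linear_map_comp[OF grf_linear grf_linear] _ a])
  fix p assume p: "p \<in> qpaths Q"
  let ?m = "len p"
  have b: "psi (cl p) \<in> filt ?m" by (rule aut_filt[OF psi cl_in_filt[OF p order.refl]])
  have bc: "psi (cl p) \<in> carrier A" using b by simp
  have "phi (psi (cl p)) = phi (pr ?m (psi (cl p)) \<oplus> tr (Suc ?m) (psi (cl p)))" using filt_decompose[OF b] by simp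
  also have "\<dots> = phi (pr ?m (psi (cl p))) \<oplus> phi (tr (Suc ?m) (psi (cl p)))" using phi bc by (simp add: aut_simps)
  finally have "pr ?m (phi (psi (cl p))) = pr ?m (phi (pr ?m (psi (cl p)))) \<oplus> pr ?m (phi (tr (Suc ?m) (psi (cl p))))"
    using phi bc by (simp add: linear_map_add[OF pr_linear])
  also have "pr ?m (phi (tr (Suc ?m) (psi (cl p)))) = \<zero>"
    by (rule pr_filt_Suc[OF aut_filt[OF phi tr_in_filt[OF bc]]])
  finally have "pr ?m (phi (psi (cl p))) = pr ?m (phi (pr ?m (psi (cl p))))" using phi bc by simp
  moreover have "grf phi (pr ?m (psi (cl p))) = pr ?m (phi (pr ?m (psi (cl p))))"
    by (rule grf_homogeneous[OF phi]) (use bc in \<open>simp_all add: pr_pr\<close>)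
  ultimately show "grf (phi \<circ>\<^sub>A psi) (cl p) = grf phi (grf psi (cl p))"
    using phi psi p by (simp add: grf_cl cl_in)
qed (use phi psi in simp_all)

lemma grf_one_Aut: "a \<in> carrier A ==> grf idA a = a"
  by (rule linear_eqI[OF grf_linear linear_map_id]) (simp_all add: grf_cl pr_cl cl_in)

lemma gr_in_G [simp]:
  assumes phi: "phi \<in> G" shows "gr phi \<in> G"
  unfolding gr_def
proof (rule autI[where F' = "grf (aut_inv phi)"])
  have i: "aut_inv phi \<in> G" using phi by simp
  show "grf phi (grf (aut_inv phi) x) = x" if x: "x \<in> carrier A" for x
    using grf_comp[OF phi i x] phi x by (simp add: Aut.r_inv grf_one_Aut)
  show "grf (aut_inv phi) (grf phi x) = x" if x: "x \<in> carrier A" for x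
    using grf_comp[OF i phi x] phi x by (simp add: Aut.l_inv grf_one_Aut)
  show "grf phi \<one> = \<one>"
    using grf_homogeneous[OF phi one_closed pr_0_one] phi by (simp add: aut_one pr_0_one)
  show "grf (aut_inv phi) x \<in> carrier A" if "x \<in> carrier A" for x
    using linear_map_closed[OF grf_linear[OF i] that] .
qed (use grf_mult[OF phi] grf_linear[OF phi] in simp_all)

lemma gr_apply [simp]: "a \<in> carrier A ==> gr phi a = grf phi a"
  by (simp add: gr_def)

lemma gr_comp: "phi \<in> G ==> psi \<in> G ==> gr (phi \<circ>\<^sub>A psi) = gr phi \<circ>\<^sub>A gr psi"
  by (rule aut_eqI) (simp_all add: grf_comp linear_map_closed[OF grf_linear])

lemma gr_one: "gr idA = idA"
  by (rule aut_eqI) (simp_all add: grf_one_Aut)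

lemma gr_inv: "phi \<in> G ==> gr (aut_inv phi) = aut_inv (gr phi)"
  using Aut.inv_equality[of "gr (aut_inv phi)" "gr phi"] by (simp add: gr_comp[symmetric] Aut.l_inv gr_one)

lemma gr_eqI:
  assumes phi: "phi \<in> G" and psi: "psi \<in> G" and "\<And>p. p \<in> qpaths Q ==> pr (len p) (phi (cl p)) = psi (cl p)"
  shows "gr phi = psi"
proof (rule aut_eqI[OF gr_in_G[OF phi] psi])
  fix a assume a: "a \<in> carrier A"
  show "gr phi a = psi a"
    by (rule linear_eqI[OF aut_linear[OF gr_in_G[OF phi]] aut_linear[OF psi] _ a]) (simp add: cl_in grf_cl phi assms(3))
qed

lemma gr_gr:
  assumes phi: "phi \<in> G" shows "gr (gr phi) = gr phi"
  by (rule gr_eqI) (simp_all add: phi cl_in grf_cl pr_pr)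

lemma gr_scaling: "(\<And>alpha. c alpha \<noteq> 0) ==> gr (scaling c) = scaling c"
  by (rule gr_eqI) (simp_all add: scaling_in_G scaling_cl linear_map_smult[OF pr_linear] cl_in pr_cl)

text \<open>In the leading degree only the degree-zero parts of \<open>u\<close> and of its inverse
  act, and these are diagonal.\<close>

lemma gr_inn:
  assumes u: "u \<in> Units A"
  obtains tau where "\<And>v. tau v \<noteq> 0" "\<And>v. v \<in> verts Q ==> tau v = vco v u" "gr (inn u) = inn (diag tau)"
proof -
  \<comment> \<open>The value 1 off the vertex set makes \<open>tau\<close> nowhere zero, as
    \<open>diag_Units\<close> demands.\<close>
  define tau where "tau v = (if v \<in> verts Q then vco v u else 1)" for v
  have nz: "tau v \<noteq> 0" for v using vco_unit[OF u, of v] by (auto simp: tau_def)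
  have c: "u \<in> carrier A" "inv u \<in> carrier A" by (rule Units_closed[OF u], rule Units_closed[OF Units_inv_Units[OF u]])
  have 1: "pr 0 u = diag tau" unfolding pr_0_eq[OF c(1)] by (rule diag_cong) (simp add: tau_def)
  have "pr 0 (inv u) = diag (\<lambda>v. inverse (tau v))"
    unfolding pr_0_eq[OF c(2)]
    by (rule diag_cong) (use vco_unit[OF u] in \<open>auto simp: tau_def intro!: inverse_unique[symmetric]\<close>)
  then have 2: "pr 0 (inv u) = inv (diag tau)" using diag_Units(2)[OF nz] by simp
  have "gr (inn u) = inn (diag tau)"
  proof (rule gr_eqI)
    fix p assume p: "p \<in> qpaths Q"
    have f: "u \<in> filt 0" "inv u \<in> filt 0" "cl p \<in> filt (len p)" using c cl_in_filt[OF p] by simp_all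
    have "pr (0 + len p + 0) (u \<otimes> cl p \<otimes> inv u) = pr 0 u \<otimes> pr (len p) (cl p) \<otimes> pr 0 (inv u)"
      unfolding pr_mult[OF filt_mult[OF f(1,3)] f(2)] pr_mult[OF f(1,3)] ..
    then show "pr (len p) (inn u (cl p)) = inn (diag tau) (cl p)"
      using p cl_in[OF p] 1 2 by (simp add: pr_cl)
  qed (use u diag_Units(1)[OF nz] in simp_all)
  then show thesis using that[of tau] nz by (simp add: tau_def)
qed

lemma gr_trivial_filt:
  assumes psi: "psi \<in> G" "gr psi = idA" and a: "a \<in> filt m"
  shows "psi a \<ominus> a \<in> filt (Suc m)" and "pr m (psi a) = pr m a"
proof -
  have ac: "a \<in> carrier A" using a by simp
  have pa: "psi (pr m a) \<in> carrier A" "psi (tr (Suc m) a) \<in> carrier A" using ac psi by simp_all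
  have "pr m (psi (pr m a)) = grf psi (pr m a)"
    by (rule grf_homogeneous[symmetric, OF psi(1)]) (use ac in \<open>simp_all add: pr_pr\<close>)
  also have "\<dots> = pr m a" using psi(2) ac gr_apply[of "pr m a" psi] by simp
  finally have 1: "pr m (psi (pr m a)) = pr m a" .
  have "psi a = psi (pr m a \<oplus> tr (Suc m) a)" using filt_decompose[OF a] by simp
  then have 2: "psi a = psi (pr m a) \<oplus> psi (tr (Suc m) a)" using psi ac by (simp add: aut_simps)
  have 3: "pr m (psi (tr (Suc m) a)) = \<zero>"
    by (rule pr_filt_Suc[OF aut_filt[OF psi(1) tr_in_filt[OF ac]]])
  show 4: "pr m (psi a) = pr m a" unfolding 2 linear_map_add[OF pr_linear pa] 1 3 using ac by simp
  have "pr m (psi a \<ominus> a) = pr m (psi a) \<ominus> pr m a"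
    by (rule linear_map_diff[OF pr_linear aut_closed[OF psi(1) ac] ac])
  then have "pr m (psi a \<ominus> a) = \<zero>"
    unfolding 4 minus_eq[of "pr m a" "pr m a"] r_neg[OF pr_closed[OF ac]] .
  then show "psi a \<ominus> a \<in> filt (Suc m)"
    by (rule filt_SucI[OF filt_diff[OF aut_filt[OF psi(1) a] a]])
qed

lemma gr_inn_unipotent:
  assumes a: "a \<in> filt 1" shows "gr (inn (\<one> \<oplus> a)) = idA"
proof -
  have ac: "a \<in> carrier A" using a by simp
  obtain tau where tau: "\<And>v. tau v \<noteq> 0" "\<And>v. v \<in> verts Q ==> tau v = vco v (\<one> \<oplus> a)"
    "gr (inn (\<one> \<oplus> a)) = inn (diag tau)"
    by (rule gr_inn[OF unipotent_unit(1)[OF a]]) (rule that)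
  have "vco v a = 0" if "v \<in> verts Q" for v
    using iffD1[OF filt_1_iff[OF ac] a] that by blast
  then have "diag tau = diag (\<lambda>v. 1)"
    by (intro diag_cong) (use ac tau(2) in \<open>simp add: functional_add[OF vco_functional] vco_one\<close>)
  then show ?thesis using tau(3) by (simp add: diag_one inn_one)
qed

text \<open>The unipotent factor in \<open>phi = gr phi \<circ>\<^sub>A upart phi\<close>. It is
  written with \<open>gr (aut_inv phi)\<close>, whose entries are visibly regular in those of the
  inverse of \<open>phi\<close>.\<close>

definition upart :: "('a => 'a) => 'a => 'a" where
  "upart phi = gr (aut_inv phi) \<circ>\<^sub>A phi"

lemma upart_in_G [simp]: "phi \<in> G ==> upart phi \<in> G"
  by (simp add: upart_def)

lemma gr_upart: "phi \<in> G ==> gr (upart phi) = idA"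
  by (simp add: upart_def gr_comp gr_gr gr_inv Aut.l_inv)

lemma gr_comp_upart: "phi \<in> G ==> gr phi \<circ>\<^sub>A upart phi = phi"
  by (simp add: upart_def gr_inv Aut.m_assoc[symmetric] Aut.r_inv)

text \<open>Centraliser of the vertices; its units are exactly those whose conjugations fix every
  vertex.\<close>

definition Cent :: "'a set" where
  "Cent = {a \<in> carrier A. \<forall>v\<in>verts Q. vertex v \<otimes> a = a \<otimes> vertex v}"

lemma Cent_closed [simp]: "a \<in> Cent ==> a \<in> carrier A"
  by (simp add: Cent_def)
lemma CentD: "a \<in> Cent ==> v \<in> verts Q ==> vertex v \<otimes> a = a \<otimes> vertex v"
  unfolding Cent_def by blast
lemma CentI: "a \<in> carrier A ==> (\<And>v. v \<in> verts Q ==> vertex v \<otimes> a = a \<otimes> vertex v) ==> a \<in> Cent"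
  unfolding Cent_def by blast

lemma Cent_add: "a \<in> Cent ==> b \<in> Cent ==> a \<oplus> b \<in> Cent"
  by (rule CentI) (simp_all add: l_distr r_distr CentD)
lemma Cent_smult: "a \<in> Cent ==> c \<odot> a \<in> Cent"
  by (rule CentI) (simp_all add: smult_mult_left smult_mult_right CentD)
lemma Cent_neg: "a \<in> Cent ==> \<ominus> a \<in> Cent"
  using Cent_smult[of a "-1"] by (simp add: smult_neg_one)
lemma Cent_diff: "a \<in> Cent ==> b \<in> Cent ==> a \<ominus> b \<in> Cent"
  using Cent_add Cent_neg by (simp add: minus_eq)
lemma Cent_one: "\<one> \<in> Cent"
  by (rule CentI) simp_all
lemma Cent_mult: "a \<in> Cent ==> b \<in> Cent ==> a \<otimes> b \<in> Cent"
proof (rule CentI)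
  fix v assume a: "a \<in> Cent" and b: "b \<in> Cent" and v: "v \<in> verts Q"
  note c = vertex_in[OF v] Cent_closed[OF a] Cent_closed[OF b]
  have "vertex v \<otimes> (a \<otimes> b) = a \<otimes> vertex v \<otimes> b"
    unfolding m_assoc[OF c, symmetric] CentD[OF a v] ..
  also have "\<dots> = a \<otimes> (b \<otimes> vertex v)"
    unfolding m_assoc[OF c(2,1,3)] CentD[OF b v] ..
  also have "\<dots> = a \<otimes> b \<otimes> vertex v" by (rule m_assoc[OF c(2,3,1), symmetric])
  finally show "vertex v \<otimes> (a \<otimes> b) = a \<otimes> b \<otimes> vertex v" .
qed simp
lemma Cent_geo: "a \<in> Cent ==> geo a n \<in> Cent"
  by (induction n) (simp_all add: Cent_one Cent_diff Cent_mult)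

lemma inn_Cent_vertex:
  assumes u: "u \<in> Units A" "u \<in> Cent" and v: "v \<in> verts Q"
  shows "inn u (vertex v) = vertex v"
proof -
  have c: "u \<in> carrier A" "inv u \<in> carrier A" by (rule Units_closed[OF u(1)], rule Units_closed[OF Units_inv_Units[OF u(1)]])
  have "u \<otimes> vertex v \<otimes> inv u = vertex v \<otimes> (u \<otimes> inv u)"
    unfolding CentD[OF u(2) v, symmetric] using c v by (simp add: m_assoc)
  then show ?thesis using v by (simp add: Units_r_inv[OF u(1)])
qed

lemma Cent_of_inn:
  assumes u: "u \<in> Units A" and fix_v: "\<And>v. v \<in> verts Q ==> inn u (vertex v) = vertex v"
  shows "u \<in> Cent"
proof (rule CentI)
  have c: "u \<in> carrier A" "inv u \<in> carrier A" by (rule Units_closed[OF u], rule Units_closed[OF Units_inv_Units[OF u]])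
  show "u \<in> carrier A" by (rule c)
  fix v assume v: "v \<in> verts Q"
  have "vertex v \<otimes> u = (u \<otimes> vertex v \<otimes> inv u) \<otimes> u" using fix_v[OF v] v by simp
  also have "\<dots> = u \<otimes> vertex v \<otimes> (inv u \<otimes> u)" using c v by (simp add: m_assoc)
  finally show "vertex v \<otimes> u = u \<otimes> vertex v" using c v by (simp add: Units_l_inv[OF u])
qed

lemma fixes_vertices_commute:
  assumes phi: "phi \<in> G" and f: "\<And>v. v \<in> verts Q ==> phi (vertex v) = vertex v" and tau: "\<And>v. tau v \<noteq> 0"
  shows "phi \<circ>\<^sub>A inn (diag tau) = inn (diag tau) \<circ>\<^sub>A phi"
proof -
  have "phi (diag tau) = (\<Oplus>v\<in>verts Q. phi (tau v \<odot> vertex v))"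
    unfolding diag_def by (rule linear_map_sum[OF aut_linear[OF phi]]) auto
  also have "\<dots> = diag tau"
    unfolding diag_def by (rule finsum_cong') (simp_all add: linear_map_smult[OF aut_linear[OF phi]] f)
  finally show ?thesis using inn_commute[OF phi diag_Units(1)[OF tau]] by simp
qed

end

section \<open>A normal form modulo inner automorphisms\<close>

context path_quotient
begin

lemma reg_elem_grf:
  assumes Y: "\<And>phi. phi \<in> G ==> Y phi \<in> G" "\<And>b. b \<in> carrier A ==> reg_elem (\<lambda>phi. Y phi b)" and p: "reg_elem p"
  shows "reg_elem (\<lambda>phi. grf (Y phi) (p phi))"
  unfolding grf_def
proof (rule reg_elem_sum[OF finite_lessThan])
  show "reg_elem (\<lambda>phi. pr m (Y phi (pr m (p phi))))" for m
    by (rule reg_elem_linear[OF pr_linear reg_elem_operator[OF aut_linear[OF Y(1)] Y(2) reg_elem_linear[OF pr_linear p]]])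
qed

lemma upart_apply: "phi \<in> G ==> a \<in> carrier A ==> upart phi a = grf (aut_inv phi) (phi a)"
  by (simp add: upart_def)

lemma reg_elem_upart: "a \<in> carrier A ==> reg_elem (\<lambda>phi. upart phi a)"
  by (rule reg_elem_cong[OF reg_elem_grf[where Y = aut_inv and p = "\<lambda>phi. phi a"]])
    (simp_all add: reg_elem_inv_apply reg_elem_apply upart_apply)

lemma upart_inv_apply:
  assumes phi: "phi \<in> G" and a: "a \<in> carrier A"
  shows "aut_inv (upart phi) a = aut_inv phi (grf phi a)"
proof -
  have "aut_inv (upart phi) = aut_inv phi \<circ>\<^sub>A gr phi"
    unfolding upart_def using phi by (simp add: Aut.inv_mult_group gr_inv)
  then show ?thesis using phi a by simp
qed

lemma pr_vertex:
  assumes v: "v \<in> verts Q" and a: "a \<in> carrier A"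
  shows "pr m (vertex v \<otimes> a) = vertex v \<otimes> pr m a" and "pr m (a \<otimes> vertex v) = pr m a \<otimes> vertex v"
proof -
  note vc = vertex_in[OF v]
  show "pr m (vertex v \<otimes> a) = vertex v \<otimes> pr m a"
  proof (rule linear_eqI[OF linear_map_comp[OF pr_linear linear_map_mult_left[OF vc]]
        linear_map_comp[OF linear_map_mult_left[OF vc] pr_linear] _ a])
    fix p assume p: "p \<in> qpaths Q"
    obtain u ps w where q: "p = (u, ps, w)" by (metis prod_cases3)
    show "pr m (vertex v \<otimes> cl p) = vertex v \<otimes> pr m (cl p)"
      using p v cl_in[OF p] unfolding q by (auto simp: vertex_cl pr_cl linear_map_zero[OF pr_linear])
  qed
  show "pr m (a \<otimes> vertex v) = pr m a \<otimes> vertex v"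
  proof (rule linear_eqI[OF linear_map_comp[OF pr_linear linear_map_mult_right[OF vc]]
        linear_map_comp[OF linear_map_mult_right[OF vc] pr_linear] _ a])
    fix p assume p: "p \<in> qpaths Q"
    obtain u ps w where q: "p = (u, ps, w)" by (metis prod_cases3)
    show "pr m (cl p \<otimes> vertex v) = pr m (cl p) \<otimes> vertex v"
      using p v cl_in[OF p] unfolding q by (auto simp: cl_vertex pr_cl linear_map_zero[OF pr_linear])
  qed
qed

lemma pr_Cent:
  assumes a: "a \<in> Cent" shows "pr m a \<in> Cent"
proof (rule CentI)
  fix v assume v: "v \<in> verts Q"
  show "vertex v \<otimes> pr m a = pr m a \<otimes> vertex v"
    unfolding pr_vertex[OF v Cent_closed[OF a], symmetric] CentD[OF a v] ..
qed (use a in simp)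

text \<open>Linear projection to the degree-\<open>m\<close> part of \<open>Cent\<close>, by
  compressing to the diagonal corners; on \<open>Cent\<close> it agrees with
  \<open>pr m\<close>.\<close>

definition cproj :: "nat => 'a => 'a" where
  "cproj m a = pr m (\<Oplus>v\<in>verts Q. vertex v \<otimes> (a \<otimes> vertex v))"

lemma corner_linear: "v \<in> verts Q ==> linear_map (\<lambda>a. vertex v \<otimes> (a \<otimes> vertex v))"
  by (rule linear_map_comp[OF linear_map_mult_left linear_map_mult_right]) simp_all

lemma cproj_linear: "linear_map (cproj m)"
  unfolding cproj_def by (rule linear_map_comp[OF pr_linear linear_map_finsum]) (simp_all add: corner_linear)

lemma cproj_closed [simp]: "a \<in> carrier A ==> cproj m a \<in> carrier A"
  using cproj_linear by simp

lemma cproj_in_filt: "a \<in> carrier A ==> cproj m a \<in> filt m"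
  unfolding cproj_def by (rule pr_in_filt[OF finsum_closed]) auto

lemma cproj_Cent:
  assumes a: "a \<in> carrier A" shows "cproj m a \<in> Cent"
  unfolding cproj_def
proof (rule pr_Cent[OF CentI])
  show "(\<Oplus>v\<in>verts Q. vertex v \<otimes> (a \<otimes> vertex v)) \<in> carrier A" using a by (intro finsum_closed) auto
  fix w assume w: "w \<in> verts Q"
  have "vertex w \<otimes> (\<Oplus>v\<in>verts Q. vertex v \<otimes> (a \<otimes> vertex v)) =
    (\<Oplus>v\<in>verts Q. vertex w \<otimes> (vertex v \<otimes> (a \<otimes> vertex v)))"
    by (rule finsum_rdistr) (use a w in auto)
  also have "\<dots> = vertex w \<otimes> (a \<otimes> vertex w)"
  proof (rule finsum_single[of _ w])
    fix v assume v: "v \<in> verts Q"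
    have "vertex w \<otimes> (vertex v \<otimes> (a \<otimes> vertex v)) = (vertex w \<otimes> vertex v) \<otimes> (a \<otimes> vertex v)"
      by (rule m_assoc[symmetric]) (use a v w in auto)
    then show "vertex w \<otimes> (vertex v \<otimes> (a \<otimes> vertex v)) = (if v = w then vertex w \<otimes> (a \<otimes> vertex w) else \<zero>)"
      unfolding vertex_vertex[OF w v] using a v w by auto
  qed (use a w in auto)
  finally have 1: "vertex w \<otimes> (\<Oplus>v\<in>verts Q. vertex v \<otimes> (a \<otimes> vertex v)) = vertex w \<otimes> (a \<otimes> vertex w)" .
  have "(\<Oplus>v\<in>verts Q. vertex v \<otimes> (a \<otimes> vertex v)) \<otimes> vertex w =
    (\<Oplus>v\<in>verts Q. (vertex v \<otimes> (a \<otimes> vertex v)) \<otimes> vertex w)"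
    by (rule finsum_ldistr) (use a w in auto)
  also have "\<dots> = vertex w \<otimes> (a \<otimes> vertex w)"
  proof (rule finsum_single[of _ w])
    fix v assume v: "v \<in> verts Q"
    have "(vertex v \<otimes> (a \<otimes> vertex v)) \<otimes> vertex w = vertex v \<otimes> (a \<otimes> (vertex v \<otimes> vertex w))"
      using a v w by (simp add: m_assoc)
    then show "(vertex v \<otimes> (a \<otimes> vertex v)) \<otimes> vertex w = (if v = w then vertex w \<otimes> (a \<otimes> vertex w) else \<zero>)"
      unfolding vertex_vertex[OF v w] using a v w by auto
  qed (use a w in auto)
  finally show "vertex w \<otimes> (\<Oplus>v\<in>verts Q. vertex v \<otimes> (a \<otimes> vertex v)) =
    (\<Oplus>v\<in>verts Q. vertex v \<otimes> (a \<otimes> vertex v)) \<otimes> vertex w" unfolding 1 ..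
qed

lemma cproj_eq:
  assumes a: "a \<in> Cent" shows "cproj m a = pr m a"
proof -
  have c: "a \<in> carrier A" using a by simp
  have "(\<Oplus>v\<in>verts Q. vertex v \<otimes> (a \<otimes> vertex v)) = (\<Oplus>v\<in>verts Q. a \<otimes> vertex v)"
  proof (rule finsum_cong')
    fix v assume v: "v \<in> verts Q"
    show "vertex v \<otimes> (a \<otimes> vertex v) = a \<otimes> vertex v"
      unfolding CentD[OF a v, symmetric] using c v by (simp add: m_assoc[symmetric] vertex_vertex)
  qed (use c in auto)
  also have "\<dots> = a \<otimes> \<one>" unfolding one_sum by (rule finsum_rdistr[symmetric]) (use c in auto)
  finally show ?thesis using c by (simp add: cproj_def)
qed

definition central :: "'a => bool" where
  "central z \<longleftrightarrow> z \<in> carrier A \<and> (\<forall>b\<in>carrier A. z \<otimes> b = b \<otimes> z)"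

lemma centralI:
  assumes z: "z \<in> Cent" and x: "\<And>alpha. alpha \<in> arcs Q ==> z \<otimes> arrow alpha = arrow alpha \<otimes> z"
  shows "central z"
  unfolding central_def
proof (intro conjI ballI)
  show c: "z \<in> carrier A" using z by simp
  have path: "(u, p, w) \<in> qpaths Q ==> z \<otimes> cl (u, p, w) = cl (u, p, w) \<otimes> z" for u p w
  proof (induction p arbitrary: u)
    case Nil
    then show ?case using CentD[OF z, of u] by (auto simp: path_Nil vertex_def)
  next
    case (Cons alpha p)
    then have alpha: "alpha \<in> arcs Q" and p: "(head Q alpha, p, w) \<in> qpaths Q" by (simp_all add: path_Cons)
    note k = c arrow_in[OF alpha] cl_in[OF p]
    show ?case
      unfolding arrow_cl[OF Cons.prems] m_assoc[OF k, symmetric] x[OF alpha]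
      unfolding m_assoc[OF k(2,1,3)] m_assoc[OF k(2,3,1)] Cons.IH[OF p] ..
  qed
  fix b assume b: "b \<in> carrier A"
  show "z \<otimes> b = b \<otimes> z"
    by (rule linear_eqI[OF linear_map_mult_left[OF c] linear_map_mult_right[OF c] _ b]) (metis path prod_cases3)
qed

text \<open>
  Conjugation by \<open>\<one> \<oplus> a\<close> with \<open>a\<close> of filtration degree \<open>m\<close> changes the leading part of an automorphism by
  the commutator with \<open>pr m a\<close>. A linear section of the commutator map therefore recovers \<open>pr m a\<close> up to a
  central element.
\<close>

lemma commutator_section:
  assumes m: "1 \<le> m"
  obtains q :: "('a => 'a) => 'a" where
    "\<And>X. X \<in> G ==> q X \<in> filt m \<and> q X \<in> Cent" "q idA = \<zero>"
    "\<And>X a. X \<in> G ==> gr X = idA ==> a \<in> filt m ==> a \<in> Cent ==>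
      \<exists>z\<in>filt m. z \<in> Cent \<and> central z \<and> q (X \<circ>\<^sub>A inn (\<one> \<oplus> a)) = q X \<oplus> pr m a \<oplus> z"
    "\<And>Y. (\<And>phi. phi \<in> G ==> Y phi \<in> G) ==> (\<And>b. b \<in> carrier A ==> reg_elem (\<lambda>phi. Y phi b)) ==> reg_elem (\<lambda>phi. q (Y phi))"
proof (rule dual_basis)
  fix J :: "'a set" and f g
  assume J: "finite J" "\<And>j. j \<in> J ==> functional (f j)"
    and sep: "\<And>x. x \<in> carrier A ==> (\<And>j. j \<in> J ==> f j x = 0) ==> x = \<zero>"
  define I where "I = arcs Q \<times> J"
  have I: "finite I" using J by (simp add: I_def)
  \<comment> \<open>Coordinates of the commutators of the degree-\<open>m\<close> centralising part
    of \<open>a\<close> with all arrows; their joint kernel is the set of \<open>a\<close> whose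
    projection is central.\<close>
  define F where "F = (\<lambda>(alpha, j) a. f j (cproj m a \<otimes> arrow alpha \<ominus> arrow alpha \<otimes> cproj m a))"
  have F: "functional (F i)" if i: "i \<in> I" for i
  proof -
    obtain alpha j where ij: "i = (alpha, j)" "alpha \<in> arcs Q" "j \<in> J" using i by (auto simp: I_def)
    note x = arrow_in[OF ij(2)]
    have "functional (\<lambda>a. f j (cproj m a \<otimes> arrow alpha \<ominus> arrow alpha \<otimes> cproj m a))"
      by (rule functional_comp[OF J(2)[OF ij(3)] linear_map_minus[OF
            linear_map_comp[OF linear_map_mult_right[OF x] cproj_linear]
            linear_map_comp[OF linear_map_mult_left[OF x] cproj_linear]]])
    then show ?thesis by (simp add: F_def ij(1))
  qed
  obtain u where u: "\<And>i. i \<in> I ==> u i \<in> carrier A"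
    and uF: "\<And>a k. a \<in> carrier A ==> k \<in> I ==> (\<Sum>i\<in>I. F i a * F k (u i)) = F k a"
    using evaluation_section[of I F, OF I F] by blast
  \<comment> \<open>Degree \<open>m + 1\<close> on arrows is where conjugation by
    \<open>\<one> \<oplus> a\<close>, with \<open>a\<close> in \<open>filt m\<close>, first becomes
    visible.\<close>
  define h where "h = (\<lambda>X (alpha, j). f j (pr (m + 1) (X (arrow alpha))))"
  define q where "q X = cproj m (\<Oplus>i\<in>I. h X i \<odot> u i)" for X
  have s: "(\<Oplus>i\<in>I. k i \<odot> u i) \<in> carrier A" for k using u by (intro finsum_closed) auto
  show thesis
  proof (rule that[of q])
    show "q X \<in> filt m \<and> q X \<in> Cent" for X
      unfolding q_def using cproj_in_filt[OF s] cproj_Cent[OF s] by blast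
    have "h idA i = 0" if i: "i \<in> I" for i
    proof -
      obtain alpha j where ij: "i = (alpha, j)" "alpha \<in> arcs Q" "j \<in> J" using i by (auto simp: I_def)
      have "pr (m + 1) (arrow alpha) = \<zero>"
        unfolding arrow_def pr_cl[OF arrow_path[OF ij(2)]] using m by (simp add: path_arrows_def)
      then show ?thesis using ij by (simp add: h_def functional_zero[OF J(2)])
    qed
    then have "(\<Oplus>i\<in>I. h idA i \<odot> u i) = (\<Oplus>i\<in>I. \<zero>)" using u by (intro finsum_cong') auto
    then show "q idA = \<zero>" by (simp add: q_def linear_map_zero[OF cproj_linear])
    show "reg_elem (\<lambda>phi. q (Y phi))"
      if Y: "\<And>phi. phi \<in> G ==> Y phi \<in> G" "\<And>b. b \<in> carrier A ==> reg_elem (\<lambda>phi. Y phi b)" for Y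
      unfolding q_def
    proof (intro reg_elem_linear[OF cproj_linear] reg_elem_sum I reg_elem_smult reg_elem_const u)
      fix i assume i: "i \<in> I"
      then obtain alpha j where ij: "i = (alpha, j)" "alpha \<in> arcs Q" "j \<in> J" by (auto simp: I_def)
      have "reg (\<lambda>phi. f j (pr (m + 1) (Y phi (arrow alpha))))"
        by (rule reg_elemD[OF reg_elem_linear[OF pr_linear Y(2)[OF arrow_in[OF ij(2)]]] J(2)[OF ij(3)]])
      then show "reg (\<lambda>phi. h (Y phi) i)" by (simp add: h_def ij(1))
    qed
    show "\<exists>z\<in>filt m. z \<in> Cent \<and> central z \<and> q (X \<circ>\<^sub>A inn (\<one> \<oplus> a)) = q X \<oplus> pr m a \<oplus> z"
      if X: "X \<in> G" "gr X = idA" and a: "a \<in> filt m" "a \<in> Cent" for X a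
    proof -
      have ac: "a \<in> carrier A" using a by simp
      have a1: "a \<in> filt 1" by (rule filt_mono[OF a(1) m])
      define \<nu> where "\<nu> = inn (\<one> \<oplus> a)"
      have \<nu>: "\<nu> \<in> G" "gr \<nu> = idA"
        unfolding \<nu>_def by (rule inn_in_G[OF unipotent_unit(1)[OF a1]]) (rule gr_inn_unipotent[OF a1])
      have hX: "h (X \<circ>\<^sub>A \<nu>) i = h X i + F i a" if i: "i \<in> I" for i
      proof -
        obtain alpha j where ij: "i = (alpha, j)" "alpha \<in> arcs Q" "j \<in> J" using i by (auto simp: I_def)
        define x where "x = arrow alpha"
        have x: "x \<in> carrier A" "x \<in> filt 1" "pr 1 x = x"
          unfolding x_def using arrow_in_filt[OF ij(2)] arrow_in[OF ij(2)]
          by (simp_all add: arrow_def pr_cl arrow_path ij(2) path_arrows_def)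
        have nx: "\<nu> x \<in> carrier A" "\<nu> x \<in> filt 1" "pr 1 (\<nu> x) = x"
          using \<nu>(1) x(1) aut_filt[OF \<nu>(1) x(2)] gr_trivial_filt(2)[OF \<nu> x(2)] x(3) by simp_all
        \<comment> \<open>The exact displacement of \<open>x\<close> under the conjugation, taken
          from \<open>\<nu> x \<otimes> (\<one> \<oplus> a) = (\<one> \<oplus> a) \<otimes>
          x\<close>; in this way the inverse need not be expanded. Its leading part is the
          commutator of \<open>a\<close> and \<open>x\<close>.\<close>
        define y where "y = a \<otimes> x \<ominus> \<nu> x \<otimes> a"
        have ax: "a \<otimes> x \<in> filt (m + 1)" "\<nu> x \<otimes> a \<in> filt (m + 1)"
          using filt_mult[OF a(1) x(2)] filt_mult[OF nx(2) a(1)] by (simp_all add: add.commute)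
        have y: "y \<in> filt (m + 1)" unfolding y_def by (rule filt_diff[OF ax])
        note oac = add.m_closed[OF one_closed ac]
        have "\<nu> x \<otimes> (\<one> \<oplus> a) = (\<one> \<oplus> a) \<otimes> x"
        proof -
          have i': "inv (\<one> \<oplus> a) \<in> carrier A" by (rule Units_closed[OF Units_inv_Units[OF unipotent_unit(1)[OF a1]]])
          have "\<nu> x \<otimes> (\<one> \<oplus> a) = (\<one> \<oplus> a) \<otimes> x \<otimes> (inv (\<one> \<oplus> a) \<otimes> (\<one> \<oplus> a))"
            unfolding \<nu>_def inn_apply[OF x(1)] by (rule m_assoc) (use oac x(1) i' in auto)
          then show ?thesis unfolding Units_l_inv[OF unipotent_unit(1)[OF a1]] using oac x(1) by simp
        qed
        then have e: "\<nu> x \<oplus> \<nu> x \<otimes> a = x \<oplus> a \<otimes> x"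
          using nx(1) x(1) ac by (simp add: l_distr r_distr)
        have "\<nu> x = (\<nu> x \<oplus> \<nu> x \<otimes> a) \<ominus> \<nu> x \<otimes> a" using nx(1) ac by algebra
        also have "\<dots> = x \<oplus> y"
          unfolding e y_def using nx(1) x(1) ac filt_closed[OF ax(1)] filt_closed[OF ax(2)] by algebra
        finally have nxe: "\<nu> x = x \<oplus> y" .
        have yc: "y \<in> carrier A" using y by simp
        have "X (\<nu> x) = X x \<oplus> X y" unfolding nxe by (rule linear_map_add[OF aut_linear[OF X(1)] x(1) yc])
        then have "pr (m + 1) (X (\<nu> x)) = pr (m + 1) (X x) \<oplus> pr (m + 1) (X y)"
          using linear_map_add[OF pr_linear aut_closed[OF X(1) x(1)] aut_closed[OF X(1) yc]] by simp
        also have "pr (m + 1) (X y) = pr (m + 1) y" by (rule gr_trivial_filt(2)[OF X y])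
        also have "pr (m + 1) y = pr (m + 1) (a \<otimes> x) \<ominus> pr (m + 1) (\<nu> x \<otimes> a)"
          unfolding y_def by (rule linear_map_diff[OF pr_linear filt_closed[OF ax(1)] filt_closed[OF ax(2)]])
        also have "pr (m + 1) (a \<otimes> x) = cproj m a \<otimes> x"
          unfolding pr_mult[OF a(1) x(2)] x(3) cproj_eq[OF a(2)] ..
        also have "pr (m + 1) (\<nu> x \<otimes> a) = x \<otimes> cproj m a"
          using pr_mult[OF nx(2) a(1)] unfolding nx(3) cproj_eq[OF a(2)] add.commute[of m 1] .
        finally have "pr (m + 1) (X (\<nu> x)) = pr (m + 1) (X x) \<oplus> (cproj m a \<otimes> x \<ominus> x \<otimes> cproj m a)" .
        then have "f j (pr (m + 1) (X (\<nu> x))) = f j (pr (m + 1) (X x)) + f j (cproj m a \<otimes> x \<ominus> x \<otimes> cproj m a)"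
          using functional_add[OF J(2)[OF ij(3)], of "pr (m + 1) (X x)" "cproj m a \<otimes> x \<ominus> x \<otimes> cproj m a"] X(1) x(1) ac
          by simp
        then show ?thesis using X(1) \<nu>(1) x(1) by (simp add: h_def F_def ij(1) x_def)
      qed
      \<comment> \<open>\<open>t\<close> has the same values under all \<open>F k\<close> as
        \<open>a\<close> without being equal to it; the projection of the difference is the central
        error \<open>z\<close>.\<close>
      define t where "t = (\<Oplus>i\<in>I. F i a \<odot> u i)"
      have t: "t \<in> carrier A" unfolding t_def by (rule s)
      define z where "z = cproj m (t \<ominus> a)"
      have tac: "t \<ominus> a \<in> carrier A" using t ac by simp
      have "(\<Oplus>i\<in>I. h (X \<circ>\<^sub>A \<nu>) i \<odot> u i) = (\<Oplus>i\<in>I. h X i \<odot> u i \<oplus> F i a \<odot> u i)"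
        using u by (intro finsum_cong') (auto simp: hX smult_add_left)
      also have "\<dots> = (\<Oplus>i\<in>I. h X i \<odot> u i) \<oplus> t"
        unfolding t_def using u I by (intro finsum_addf) auto
      finally have "q (X \<circ>\<^sub>A \<nu>) = q X \<oplus> cproj m t"
        unfolding q_def by (simp add: linear_map_add[OF cproj_linear s t])
      moreover have "cproj m t = pr m a \<oplus> z"
      proof -
        have "z = cproj m t \<ominus> cproj m a" unfolding z_def by (rule linear_map_diff[OF cproj_linear t ac])
        then show ?thesis
          unfolding cproj_eq[OF a(2), symmetric] using cproj_closed[OF t, of m] cproj_closed[OF ac, of m] by algebra
      qed
      moreover have "q X \<in> carrier A" unfolding q_def by (rule cproj_closed[OF s])
      moreover have zc: "z \<in> carrier A" unfolding z_def by (rule cproj_closed[OF tac])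
      ultimately have "q (X \<circ>\<^sub>A \<nu>) = q X \<oplus> pr m a \<oplus> z"
        using pr_closed[OF ac, of m] by (simp add: a_assoc)
      moreover have "central z"
      proof (rule centralI)
        show "z \<in> Cent" unfolding z_def by (rule cproj_Cent[OF tac])
        fix alpha assume alpha: "alpha \<in> arcs Q"
        have F0: "F k (t \<ominus> a) = 0" if k: "k \<in> I" for k
        proof -
          have "F k t = (\<Sum>i\<in>I. F k (F i a \<odot> u i))"
            unfolding t_def by (rule functional_sum[OF F[OF k] I]) (use u in auto)
          also have "\<dots> = (\<Sum>i\<in>I. F i a * F k (u i))"
            by (rule sum.cong[OF refl]) (simp add: functional_smult[OF F[OF k]] u)
          also have "\<dots> = F k a" by (rule uF[OF ac k])
          finally show ?thesis using functional_diff[OF F[OF k] t ac] by simp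
        qed
        have "z \<otimes> arrow alpha \<ominus> arrow alpha \<otimes> z = \<zero>"
        proof (rule sep)
          show "z \<otimes> arrow alpha \<ominus> arrow alpha \<otimes> z \<in> carrier A" using zc alpha by simp
          show "f j (z \<otimes> arrow alpha \<ominus> arrow alpha \<otimes> z) = 0" if "j \<in> J" for j
            using F0[of "(alpha, j)"] that alpha by (simp add: I_def F_def z_def)
        qed
        then show "z \<otimes> arrow alpha = arrow alpha \<otimes> z" using zc alpha by simp
      qed
      ultimately show ?thesis
        unfolding \<nu>_def[symmetric] using cproj_in_filt[OF tac, of m] cproj_Cent[OF tac, of m] z_def by blast
    qed
  qed
qed

text \<open>A partial normal form of the unipotent part. It is obtained from
  \<open>upart phi\<close> by an inner automorphism, and replacing \<open>phi\<close> by another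
  element of its coset changes it only by conjugation with \<open>\<one> \<oplus> a\<close>, where
  \<open>a\<close> is in \<open>filt m\<close> and centralises the vertices. The clause on
  \<open>upart phi = idA\<close> keeps the value at rescalings trivial, so that the resulting
  equations hold on the subgroup.\<close>

definition stage :: "nat => (('a => 'a) => 'a => 'a) => bool" where
  "stage m Psi \<longleftrightarrow>
     (\<forall>phi\<in>G. Psi phi \<in> G \<and> gr (Psi phi) = idA \<and> (\<forall>v\<in>verts Q. Psi phi (vertex v) = vertex v)) \<and>
     (\<forall>phi\<in>G. \<exists>u\<in>Units A. Psi phi = upart phi \<circ>\<^sub>A inn u) \<and>
     (\<forall>phi\<in>G. \<forall>u\<in>Units A. \<exists>a\<in>filt m. a \<in> Cent \<and> Psi (phi \<circ>\<^sub>A inn u) = Psi phi \<circ>\<^sub>A inn (\<one> \<oplus> a)) \<and>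
     (\<forall>phi\<in>G. upart phi = idA \<longrightarrow> Psi phi = idA) \<and>
     (\<forall>a\<in>carrier A. reg_elem (\<lambda>phi. Psi phi a))"

lemma inn_central: "u \<in> Units A ==> central u ==> inn u = idA"
proof (rule aut_eqI)
  assume u: "u \<in> Units A" and z: "central u"
  show "inn u x = idA x" if x: "x \<in> carrier A" for x
  proof -
    have c: "u \<in> carrier A" "inv u \<in> carrier A" by (rule Units_closed[OF u], rule Units_closed[OF Units_inv_Units[OF u]])
    have "u \<otimes> x = x \<otimes> u" using z x by (simp add: central_def)
    then have "u \<otimes> x \<otimes> inv u = x \<otimes> (u \<otimes> inv u)" using c x by (simp add: m_assoc)
    then show ?thesis using x by (simp add: Units_r_inv[OF u])
  qed
qed simp_all

lemma reg_elem_geo: "reg_elem p ==> reg_elem (\<lambda>phi. geo (p phi) n)"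
  by (induction n) (simp_all add: reg_elem_const reg_elem_diff reg_elem_mult)

text \<open>The vertices and their preimages under \<open>upart phi\<close> are two complete systems
  of orthogonal idempotents that agree modulo the radical; a conjugation given by a regular formula
  moves one to the other.\<close>

lemma stage_0:
  obtains Psi where "stage 1 Psi"
proof -
  \<comment> \<open>The usual intertwiner of two systems of idempotents: both
    \<open>w phi \<otimes> vertex v\<close> and the product of the preimage of
    \<open>vertex v\<close> with \<open>w phi\<close> equal the \<open>v\<close>-th summand. It is a
    unit because it is 1 modulo the radical.\<close>
  define w where "w phi = (\<Oplus>v\<in>verts Q. aut_inv (upart phi) (vertex v) \<otimes> vertex v)" for phi
  define Psi where "Psi phi = upart phi \<circ>\<^sub>A inn (w phi)" for phi
  have ic: "aut_inv (upart phi) (vertex v) \<in> carrier A" if "phi \<in> G" "v \<in> verts Q" for phi v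
    using that by simp
  have wc: "w phi \<in> carrier A" if "phi \<in> G" for phi
    unfolding w_def using ic[OF that] by (intro finsum_closed) auto
  have w_right: "w phi \<otimes> vertex v = aut_inv (upart phi) (vertex v) \<otimes> vertex v"
    if phi: "phi \<in> G" and v: "v \<in> verts Q" for phi v
  proof -
    have "w phi \<otimes> vertex v = (\<Oplus>x\<in>verts Q. (aut_inv (upart phi) (vertex x) \<otimes> vertex x) \<otimes> vertex v)"
      unfolding w_def by (rule finsum_ldistr) (use ic[OF phi] v in auto)
    also have "\<dots> = aut_inv (upart phi) (vertex v) \<otimes> vertex v"
    proof (rule finsum_single[of _ v])
      fix x assume x: "x \<in> verts Q"
      show "(aut_inv (upart phi) (vertex x) \<otimes> vertex x) \<otimes> vertex v =
        (if x = v then aut_inv (upart phi) (vertex v) \<otimes> vertex v else \<zero>)"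
        unfolding m_assoc[OF ic[OF phi x] vertex_in[OF x] vertex_in[OF v]] vertex_vertex[OF x v]
        using ic[OF phi x] by simp
    qed (use ic[OF phi] v in auto)
    finally show ?thesis .
  qed
  have w_left: "aut_inv (upart phi) (vertex v) \<otimes> w phi = aut_inv (upart phi) (vertex v) \<otimes> vertex v"
    if phi: "phi \<in> G" and v: "v \<in> verts Q" for phi v
  proof -
    have "aut_inv (upart phi) (vertex v) \<otimes> w phi =
      (\<Oplus>x\<in>verts Q. aut_inv (upart phi) (vertex v) \<otimes> (aut_inv (upart phi) (vertex x) \<otimes> vertex x))"
      unfolding w_def by (rule finsum_rdistr) (use ic[OF phi] v in auto)
    also have "\<dots> = aut_inv (upart phi) (vertex v) \<otimes> vertex v"
    proof (rule finsum_single[of _ v])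
      fix x assume x: "x \<in> verts Q"
      have "aut_inv (upart phi) (vertex v) \<otimes> aut_inv (upart phi) (vertex x) = aut_inv (upart phi) (vertex v \<otimes> vertex x)"
        by (rule aut_mult[symmetric]) (use phi v x in auto)
      also have "\<dots> = (if x = v then aut_inv (upart phi) (vertex v) else \<zero>)"
        unfolding vertex_vertex[OF v x] using phi by (auto simp: linear_map_zero[OF aut_linear])
      finally show "aut_inv (upart phi) (vertex v) \<otimes> (aut_inv (upart phi) (vertex x) \<otimes> vertex x) =
        (if x = v then aut_inv (upart phi) (vertex v) \<otimes> vertex v else \<zero>)"
        unfolding m_assoc[OF ic[OF phi v] ic[OF phi x] vertex_in[OF x], symmetric] using x by simp
    qed (use ic[OF phi] v in auto)
    finally show ?thesis .
  qed
  have w1: "w phi \<ominus> \<one> \<in> filt 1" if phi: "phi \<in> G" for phi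
  proof (intro iffD2[OF filt_1_iff] ballI)
    show "w phi \<ominus> \<one> \<in> carrier A" using wc[OF phi] by simp
    fix v assume v: "v \<in> verts Q"
    note fv = vco_functional[OF v]
    have g: "gr (aut_inv (upart phi)) = idA" using phi by (simp add: gr_inv gr_upart)
    have "aut_inv (upart phi) (vertex v) \<ominus> vertex v \<in> filt (Suc 0)"
      by (rule gr_trivial_filt(1)[OF _ g]) (use phi v in auto)
    then have "vco v (aut_inv (upart phi) (vertex v) \<ominus> vertex v) = 0"
      using filt_1_iff[of "aut_inv (upart phi) (vertex v) \<ominus> vertex v"] ic[OF phi v] v by simp
    then have "vco v (aut_inv (upart phi) (vertex v)) = 1"
      unfolding functional_diff[OF fv ic[OF phi v] vertex_in[OF v]] vco_vertex[OF v v] by simp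
    moreover have "vco v (w phi) = vco v (w phi \<otimes> vertex v)"
      unfolding vco_mult[OF v wc[OF phi] vertex_in[OF v]] vco_vertex[OF v v] by simp
    ultimately have "vco v (w phi) = 1"
      unfolding w_right[OF phi v] vco_mult[OF v ic[OF phi v] vertex_in[OF v]] vco_vertex[OF v v] by simp
    then show "vco v (w phi \<ominus> \<one>) = 0"
      unfolding functional_diff[OF fv wc[OF phi] one_closed] vco_one[OF v] by simp
  qed
  have w_eq: "\<one> \<oplus> (w phi \<ominus> \<one>) = w phi" if "phi \<in> G" for phi using wc[OF that] by algebra
  have wU: "w phi \<in> Units A" "inv (w phi) = geo (w phi \<ominus> \<one>) N" if phi: "phi \<in> G" for phi
    using unipotent_unit[OF w1[OF phi]] unfolding w_eq[OF phi] .
  have wi: "inv (w phi) \<in> carrier A" if "phi \<in> G" for phi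
    by (rule Units_closed[OF Units_inv_Units[OF wU(1)[OF that]]])
  have PsiG: "Psi phi \<in> G" if "phi \<in> G" for phi using that wU(1)[OF that] by (simp add: Psi_def)
  have Psigr: "gr (Psi phi) = idA" if phi: "phi \<in> G" for phi
  proof -
    have "gr (inn (w phi)) = idA"
      using gr_inn_unipotent[OF w1[OF phi]] unfolding w_eq[OF phi] .
    then show ?thesis using phi wU(1)[OF phi] by (simp add: Psi_def gr_comp gr_upart)
  qed
  have Psiv: "Psi phi (vertex v) = vertex v" if phi: "phi \<in> G" and v: "v \<in> verts Q" for phi v
  proof -
    have "inn (w phi) (vertex v) = aut_inv (upart phi) (vertex v) \<otimes> w phi \<otimes> inv (w phi)"
      unfolding inn_apply[OF vertex_in[OF v]] w_right[OF phi v] w_left[OF phi v] ..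
    also have "\<dots> = aut_inv (upart phi) (vertex v)"
      unfolding m_assoc[OF ic[OF phi v] wc[OF phi] wi[OF phi]] Units_r_inv[OF wU(1)[OF phi]] using ic[OF phi v] by simp
    finally show ?thesis
      unfolding Psi_def using phi v comp_apply[OF upart_in_G[OF phi] inn_in_G[OF wU(1)[OF phi]] vertex_in[OF v]]
        apply_inv[OF upart_in_G[OF phi] vertex_in[OF v]] by simp
  qed
  have conj: "\<exists>a\<in>filt 1. a \<in> Cent \<and> Psi (phi \<circ>\<^sub>A inn u) = Psi phi \<circ>\<^sub>A inn (\<one> \<oplus> a)"
    if phi: "phi \<in> G" and u: "u \<in> Units A" for phi u
  proof -
    define phi' where "phi' = phi \<circ>\<^sub>A inn u"
    have phi': "phi' \<in> G" using phi u by (simp add: phi'_def)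
    obtain tau where tau: "\<And>v. tau v \<noteq> 0" "\<And>v. v \<in> verts Q ==> tau v = vco v u" "gr (inn u) = inn (diag tau)"
      by (rule gr_inn[OF u]) (rule that)
    define d where "d = diag tau"
    have d: "d \<in> Units A" "inn d \<in> G" unfolding d_def using diag_Units(1)[OF tau(1)] by simp_all
    note W = wU(1)[OF phi] and W' = wU(1)[OF phi']
    \<comment> \<open>Passing to \<open>phi'\<close> multiplies the unipotent part by
      \<open>inn u\<close> on the right and by the inverse of \<open>inn d\<close> on the left. The
      latter commutes with \<open>Psi phi\<close>, which fixes the vertices, so all conjugations can
      be collected in \<open>y\<close> on the right.\<close>
    define y where "y = inv d \<otimes> (inv (w phi) \<otimes> (u \<otimes> w phi'))"
    have yU: "y \<in> Units A" unfolding y_def using d(1) W W' u by simp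
    have yc: "y \<in> carrier A" using yU by (rule Units_closed)
    have cy: "inn y = aut_inv (inn d) \<circ>\<^sub>A (aut_inv (inn (w phi)) \<circ>\<^sub>A (inn u \<circ>\<^sub>A inn (w phi')))"
      unfolding y_def using d(1) W W' u by (simp add: inn_mult inn_inv)
    have "upart phi' = aut_inv (inn d) \<circ>\<^sub>A upart phi \<circ>\<^sub>A inn u"
    proof -
      have "gr (aut_inv phi') = aut_inv (inn d) \<circ>\<^sub>A gr (aut_inv phi)"
        unfolding gr_inv[OF phi'] gr_inv[OF phi] unfolding phi'_def
        using phi u d by (simp add: gr_comp tau(3) d_def[symmetric] Aut.inv_mult_group)
      then show ?thesis
        unfolding upart_def unfolding phi'_def using phi u d by (simp add: Aut.m_assoc)
    qed
    then have "Psi phi' = aut_inv (inn d) \<circ>\<^sub>A (upart phi \<circ>\<^sub>A (inn u \<circ>\<^sub>A inn (w phi')))"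
      unfolding Psi_def[of phi'] using phi u d W' by (simp add: Aut.m_assoc)
    also have "upart phi = Psi phi \<circ>\<^sub>A aut_inv (inn (w phi))"
      unfolding Psi_def using phi W by (simp add: Aut.m_assoc Aut.r_inv)
    finally have "Psi phi' = aut_inv (inn d) \<circ>\<^sub>A Psi phi \<circ>\<^sub>A
        (aut_inv (inn (w phi)) \<circ>\<^sub>A (inn u \<circ>\<^sub>A inn (w phi')))"
      using phi u d W W' PsiG[OF phi] by (simp add: Aut.m_assoc)
    also have "aut_inv (inn d) \<circ>\<^sub>A Psi phi = Psi phi \<circ>\<^sub>A aut_inv (inn d)"
    proof -
      have cc: "inn d \<circ>\<^sub>A Psi phi = Psi phi \<circ>\<^sub>A inn d"
        unfolding d_def by (rule fixes_vertices_commute[OF PsiG[OF phi] Psiv[OF phi] tau(1), symmetric])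
      have "aut_inv (inn d) \<circ>\<^sub>A (inn d \<circ>\<^sub>A Psi phi) \<circ>\<^sub>A aut_inv (inn d) =
        aut_inv (inn d) \<circ>\<^sub>A (Psi phi \<circ>\<^sub>A inn d) \<circ>\<^sub>A aut_inv (inn d)"
        unfolding cc ..
      moreover have "aut_inv (inn d) \<circ>\<^sub>A (inn d \<circ>\<^sub>A Psi phi) = Psi phi"
        using d(2) PsiG[OF phi] by (simp add: Aut.m_assoc[symmetric] Aut.l_inv)
      moreover have "aut_inv (inn d) \<circ>\<^sub>A (Psi phi \<circ>\<^sub>A inn d) \<circ>\<^sub>A aut_inv (inn d) =
        aut_inv (inn d) \<circ>\<^sub>A Psi phi"
        using d(2) PsiG[OF phi] by (simp add: Aut.m_assoc Aut.r_inv)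
      ultimately show ?thesis by simp
    qed
    finally have Psi': "Psi phi' = Psi phi \<circ>\<^sub>A inn y"
      unfolding cy using phi u d W W' PsiG[OF phi] by (simp add: Aut.m_assoc)
    have "y \<in> Cent"
    proof (rule Cent_of_inn[OF yU])
      fix v assume v: "v \<in> verts Q"
      have "Psi phi (inn y (vertex v)) = Psi phi (vertex v)"
        using Psiv[OF phi' v] Psiv[OF phi v] comp_apply[OF PsiG[OF phi] inn_in_G[OF yU] vertex_in[OF v]]
        unfolding Psi' by simp
      then show "inn y (vertex v) = vertex v"
        by (rule aut_inj[OF PsiG[OF phi] aut_closed[OF inn_in_G[OF yU] vertex_in[OF v]] vertex_in[OF v]])
    qed
    then have yC: "y \<ominus> \<one> \<in> Cent" by (rule Cent_diff[OF _ Cent_one])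
    \<comment> \<open>The vertex coefficients of \<open>w phi\<close> and \<open>w phi'\<close> are
      1, and \<open>d\<close> carries exactly those of \<open>u\<close>, so the product of
      coefficients is 1 at every vertex.\<close>
    have "y \<ominus> \<one> \<in> filt 1"
    proof (intro iffD2[OF filt_1_iff] ballI)
      show "y \<ominus> \<one> \<in> carrier A" using yc by simp
      fix v assume v: "v \<in> verts Q"
      note fv = vco_functional[OF v]
      have c: "inv d \<in> carrier A" "inv (w phi) \<in> carrier A" "u \<in> carrier A" "w phi' \<in> carrier A"
        using Units_closed[OF Units_inv_Units[OF d(1)]] wi[OF phi] Units_closed[OF u] wc[OF phi'] .
      have vw: "vco v (w phi) = 1" if "phi \<in> G" for phi
        using iffD1[OF filt_1_iff w1[OF that]] wc[OF that] v functional_diff[OF fv wc[OF that] one_closed] vco_one[OF v] by simp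
      have 1: "vco v (inv (w phi)) = 1" using vco_unit[OF W v] vw[OF phi] by simp
      have 2: "tau v * vco v (inv d) = 1" using vco_unit[OF d(1) v] unfolding d_def vco_diag[OF v] .
      have "vco v y = vco v (inv d) * (vco v (inv (w phi)) * (vco v u * vco v (w phi')))"
        unfolding y_def using c v by (simp add: vco_mult)
      then have "vco v y = 1" using 1 2 vw[OF phi'] tau(2)[OF v] by (simp add: mult.commute)
      then show "vco v (y \<ominus> \<one>) = 0" unfolding functional_diff[OF fv yc one_closed] vco_one[OF v] by simp
    qed
    moreover have "\<one> \<oplus> (y \<ominus> \<one>) = y" using yc by algebra
    ultimately show ?thesis using yC Psi' unfolding phi'_def by (intro bexI[of _ "y \<ominus> \<one>"]) simp_all
  qed
  have one: "Psi phi = idA" if phi: "phi \<in> G" and e: "upart phi = idA" for phi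
  proof -
    have "w phi = (\<Oplus>v\<in>verts Q. vertex v)"
      unfolding w_def e Aut.inv_one by (rule finsum_cong') (simp_all add: vertex_vertex)
    then show ?thesis unfolding Psi_def e one_sum[symmetric] by (simp add: inn_one)
  qed
  have wr: "reg_elem w"
    unfolding w_def
  proof (intro reg_elem_sum reg_elem_mult reg_elem_const)
    fix v assume v: "v \<in> verts Q"
    show "reg_elem (\<lambda>phi. aut_inv (upart phi) (vertex v))"
    proof (rule reg_elem_cong)
      show "reg_elem (\<lambda>phi. aut_inv phi (grf phi (vertex v)))"
        by (rule reg_elem_operator[where \<Phi> = aut_inv, OF _ _ reg_elem_grf[where Y = "\<lambda>phi. phi"]])
          (use v in \<open>simp_all add: aut_linear reg_elem_inv_apply reg_elem_apply reg_elem_const\<close>)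
      show "aut_inv phi (grf phi (vertex v)) = aut_inv (upart phi) (vertex v)" if "phi \<in> G" for phi
        using upart_inv_apply[OF that vertex_in[OF v]] by simp
    qed
  qed simp_all
  have reg: "reg_elem (\<lambda>phi. Psi phi a)" if a: "a \<in> carrier A" for a
  proof (rule reg_elem_cong)
    show "reg_elem (\<lambda>phi. upart phi (w phi \<otimes> a \<otimes> geo (w phi \<ominus> \<one>) N))"
      by (rule reg_elem_operator[where \<Phi> = upart])
        (use a in \<open>simp_all add: aut_linear reg_elem_upart reg_elem_mult wr reg_elem_const reg_elem_geo reg_elem_diff\<close>)
    show "upart phi (w phi \<otimes> a \<otimes> geo (w phi \<ominus> \<one>) N) = Psi phi a" if phi: "phi \<in> G" for phi
      unfolding Psi_def comp_apply[OF upart_in_G[OF phi] inn_in_G[OF wU(1)[OF phi]] a]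
        inn_apply[OF a] wU(2)[OF phi] ..
  qed
  have "\<exists>u\<in>Units A. Psi phi = upart phi \<circ>\<^sub>A inn u" if "phi \<in> G" for phi
    using wU(1)[OF that] Psi_def by blast
  then have "stage 1 Psi"
    unfolding stage_def using PsiG Psigr Psiv conj one reg by blast
  then show thesis by (rule that)
qed

text \<open>The element \<open>q (Psi phi)\<close> shifts by the leading part of the remaining
  ambiguity \<open>a\<close>, up to a central term. Undoing the conjugation by
  \<open>\<one> \<oplus> q (Psi phi)\<close> therefore removes that ambiguity in degree
  \<open>m\<close>.\<close>

lemma stage_Suc:
  assumes m: "1 \<le> m" and st: "stage m Psi"
  obtains Psi' where "stage (Suc m) Psi'"
proof (rule commutator_section[OF m])
  fix q :: "('a => 'a) => 'a"
  assume q: "\<And>X. X \<in> G ==> q X \<in> filt m \<and> q X \<in> Cent" and q1: "q idA = \<zero>"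
    and qa: "\<And>X a. X \<in> G ==> gr X = idA ==> a \<in> filt m ==> a \<in> Cent ==>
      \<exists>z\<in>filt m. z \<in> Cent \<and> central z \<and> q (X \<circ>\<^sub>A inn (\<one> \<oplus> a)) = q X \<oplus> pr m a \<oplus> z"
    and qr: "\<And>Y. (\<And>phi. phi \<in> G ==> Y phi \<in> G) ==> (\<And>b. b \<in> carrier A ==> reg_elem (\<lambda>phi. Y phi b)) ==> reg_elem (\<lambda>phi. q (Y phi))"
  have PsiG: "Psi phi \<in> G" and Psigr: "gr (Psi phi) = idA" and Psiv: "v \<in> verts Q ==> Psi phi (vertex v) = vertex v"
    if "phi \<in> G" for phi v using st that unfolding stage_def by blast+
  have Psiu: "\<exists>u\<in>Units A. Psi phi = upart phi \<circ>\<^sub>A inn u" if "phi \<in> G" for phi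
    using st that unfolding stage_def by blast
  have Psic: "\<exists>a\<in>filt m. a \<in> Cent \<and> Psi (phi \<circ>\<^sub>A inn u) = Psi phi \<circ>\<^sub>A inn (\<one> \<oplus> a)"
    if "phi \<in> G" "u \<in> Units A" for phi u using st that unfolding stage_def by blast
  have Psi1: "Psi phi = idA" if "phi \<in> G" "upart phi = idA" for phi
    using st that unfolding stage_def by blast
  have Psir: "reg_elem (\<lambda>phi. Psi phi a)" if "a \<in> carrier A" for a
    using st that unfolding stage_def by blast
  define p where "p phi = q (Psi phi)" for phi
  have pm: "p phi \<in> filt m" "p phi \<in> Cent" "p phi \<in> carrier A" "p phi \<in> filt 1" if "phi \<in> G" for phi
    using q[OF PsiG[OF that]] filt_mono[OF _ m] by (auto simp: p_def)
  have U: "\<one> \<oplus> p phi \<in> Units A" "inv (\<one> \<oplus> p phi) = geo (p phi) N" if "phi \<in> G" for phi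
    using unipotent_unit[OF pm(4)[OF that]] .
  have gC: "geo (p phi) N \<in> Cent" "geo (p phi) N \<in> carrier A" if "phi \<in> G" for phi
    using Cent_geo[OF pm(2)[OF that]] by simp_all
  have gU: "geo (p phi) N \<in> Units A" "inv (geo (p phi) N) = \<one> \<oplus> p phi" if "phi \<in> G" for phi
    unfolding U(2)[OF that, symmetric] using U(1)[OF that] by simp_all
  define Psi' where "Psi' phi = Psi phi \<circ>\<^sub>A inn (geo (p phi) N)" for phi
  have Psi'G: "Psi' phi \<in> G" if "phi \<in> G" for phi using PsiG[OF that] gU(1)[OF that] by (simp add: Psi'_def)
  have Psi'gr: "gr (Psi' phi) = idA" if phi: "phi \<in> G" for phi
  proof -
    have "gr (aut_inv (inn (\<one> \<oplus> p phi))) = idA"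
      using gr_inv[OF inn_in_G[OF U(1)[OF phi]]] gr_inn_unipotent[OF pm(4)[OF phi]] by simp
    then have "gr (inn (geo (p phi) N)) = idA"
      unfolding inn_inv[OF U(1)[OF phi]] U(2)[OF phi] .
    then show ?thesis using PsiG[OF phi] Psigr[OF phi] gU(1)[OF phi] by (simp add: Psi'_def gr_comp)
  qed
  have Psi'v: "Psi' phi (vertex v) = vertex v" if phi: "phi \<in> G" and v: "v \<in> verts Q" for phi v
    unfolding Psi'_def comp_apply[OF PsiG[OF phi] inn_in_G[OF gU(1)[OF phi]] vertex_in[OF v]]
      inn_Cent_vertex[OF gU(1)[OF phi] gC(1)[OF phi] v] by (rule Psiv[OF phi v])
  have Psi'u: "\<exists>u\<in>Units A. Psi' phi = upart phi \<circ>\<^sub>A inn u" if phi: "phi \<in> G" for phi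
  proof -
    obtain u where u: "u \<in> Units A" "Psi phi = upart phi \<circ>\<^sub>A inn u" using Psiu[OF phi] by blast
    have "Psi' phi = upart phi \<circ>\<^sub>A inn (u \<otimes> geo (p phi) N)"
      unfolding Psi'_def u(2) inn_mult[OF u(1) gU(1)[OF phi]] using phi u(1) gU(1)[OF phi] by (simp add: Aut.m_assoc)
    then show ?thesis using u(1) gU(1)[OF phi] by blast
  qed
  have Psi'c: "\<exists>a\<in>filt (Suc m). a \<in> Cent \<and> Psi' (phi \<circ>\<^sub>A inn u) = Psi' phi \<circ>\<^sub>A inn (\<one> \<oplus> a)"
    if phi: "phi \<in> G" and u: "u \<in> Units A" for phi u
  proof -
    define phi' where "phi' = phi \<circ>\<^sub>A inn u"
    have phi': "phi' \<in> G" using phi u by (simp add: phi'_def)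
    obtain a where a: "a \<in> filt m" "a \<in> Cent" and Psia: "Psi phi' = Psi phi \<circ>\<^sub>A inn (\<one> \<oplus> a)"
      using Psic[OF phi u] unfolding phi'_def by blast
    obtain z where z: "z \<in> filt m" "z \<in> Cent" "central z" and pz: "p phi' = p phi \<oplus> pr m a \<oplus> z"
      using qa[OF PsiG[OF phi] Psigr[OF phi] a] unfolding p_def Psia by blast
    note P = pm[OF phi] and P' = pm[OF phi'] and g = gC[OF phi']
    have c: "a \<in> carrier A" "z \<in> carrier A" using a z by simp_all
    have f1: "a \<in> filt 1" "z \<in> filt 1" using filt_mono[OF a(1) m] filt_mono[OF z(1) m] .
    note Ua = unipotent_unit(1)[OF f1(1)] and Uz = unipotent_unit(1)[OF f1(2)]
    \<comment> \<open>The factor \<open>\<one> \<oplus> z\<close> is central and acts trivially by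
      conjugation; it is inserted so that \<open>x\<close> agrees with
      \<open>\<one> \<oplus> p phi'\<close> modulo \<open>filt (Suc m)\<close>.\<close>
    define x where "x = (\<one> \<oplus> p phi) \<otimes> (\<one> \<oplus> a) \<otimes> (\<one> \<oplus> z)"
    define y where "y = x \<otimes> geo (p phi') N"
    have xU: "x \<in> Units A" unfolding x_def using U(1)[OF phi] Ua Uz by simp
    have xc: "x \<in> carrier A" using xU by (rule Units_closed)
    have yc: "y \<in> carrier A" unfolding y_def using xc g(2) by simp
    have oz: "central (\<one> \<oplus> z)"
      unfolding central_def using z(3) c(2) by (simp add: central_def l_distr r_distr)
    have cz: "inn (\<one> \<oplus> z) = idA" by (rule inn_central[OF Uz oz])
    have gi: "geo (p phi) N \<otimes> (\<one> \<oplus> p phi) = \<one>"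
      using Units_l_inv[OF U(1)[OF phi]] unfolding U(2)[OF phi] .
    have ci: "inn (geo (p phi) N) \<circ>\<^sub>A inn (\<one> \<oplus> p phi) = idA"
      unfolding inn_mult[OF gU(1)[OF phi] U(1)[OF phi], symmetric] gi
      by (rule inn_one)
    have cx: "inn x = inn (\<one> \<oplus> p phi) \<circ>\<^sub>A inn (\<one> \<oplus> a)"
      unfolding x_def using U(1)[OF phi] Ua Uz by (simp add: inn_mult cz)
    have cy: "inn y = inn x \<circ>\<^sub>A inn (geo (p phi') N)"
      unfolding y_def by (rule inn_mult[OF xU gU(1)[OF phi']])
    have "Psi' phi \<circ>\<^sub>A inn y = Psi phi \<circ>\<^sub>A (inn (geo (p phi) N) \<circ>\<^sub>A inn (\<one> \<oplus> p phi)) \<circ>\<^sub>A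
        inn (\<one> \<oplus> a) \<circ>\<^sub>A inn (geo (p phi') N)"
      unfolding Psi'_def cy cx
      using PsiG[OF phi] gU(1)[OF phi] gU(1)[OF phi'] U(1)[OF phi] Ua by (simp add: Aut.m_assoc)
    also have "\<dots> = Psi' phi'" unfolding ci Psi'_def[of phi'] Psia using PsiG[OF phi] by simp
    finally have eq: "Psi' phi' = Psi' phi \<circ>\<^sub>A inn y" ..
    have yC: "y \<ominus> \<one> \<in> Cent"
      unfolding y_def x_def
      by (intro Cent_diff Cent_mult Cent_add Cent_one P(2) a(2) z(2) g(1))
    have "x \<ominus> (\<one> \<oplus> p phi') \<in> filt (Suc m)"
    proof -
      \<comment> \<open>The terms of order at least two; a product of two elements of
        \<open>filt m\<close> lies in \<open>filt (m + m)\<close>, which is inside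
        \<open>filt (Suc m)\<close> because \<open>m\<close> is at least 1.\<close>
      define r where "r = p phi \<otimes> a \<oplus> (p phi \<oplus> a \<oplus> p phi \<otimes> a) \<otimes> z"
      have k: "b \<otimes> b' \<in> filt (Suc m)" if "b \<in> filt m" "b' \<in> filt m" for b b'
        by (rule filt_mono[OF filt_mult[OF that]]) (use m in simp)
      have pa: "p phi \<otimes> a \<in> filt (Suc m)" by (rule k[OF P(1) a(1)])
      have r: "r \<in> filt (Suc m)"
        unfolding r_def
        by (rule filt_add[OF pa k[OF filt_add[OF filt_add[OF P(1) a(1)] filt_mono[OF pa]] z(1)]]) simp
      have pac: "p phi \<otimes> a \<in> carrier A" "pr m a \<in> carrier A" using P(3) c by simp_all
      have "x = \<one> \<oplus> p phi \<oplus> a \<oplus> z \<oplus> r"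
      proof -
        have e: "(\<one> \<oplus> p phi) \<otimes> (\<one> \<oplus> a) = \<one> \<oplus> (p phi \<oplus> a \<oplus> p phi \<otimes> a)"
          using P(3) c(1) by (simp add: l_distr r_distr a_ac)
        define s where "s = p phi \<oplus> a \<oplus> p phi \<otimes> a"
        have sc: "s \<in> carrier A" "s \<otimes> z \<in> carrier A" using P(3) c by (simp_all add: s_def)
        have "x = \<one> \<oplus> s \<oplus> z \<oplus> s \<otimes> z"
          unfolding x_def e s_def[symmetric] using sc c(2) by (simp add: l_distr r_distr a_ac)
        also have "\<dots> = \<one> \<oplus> p phi \<oplus> a \<oplus> z \<oplus> (p phi \<otimes> a \<oplus> s \<otimes> z)"
          unfolding s_def using sc(2)[unfolded s_def] pac P(3) c by (simp only: a_ac one_closed add.m_closed)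
        finally show ?thesis unfolding r_def s_def .
      qed
      then have "x \<ominus> (\<one> \<oplus> p phi') = (a \<ominus> pr m a) \<oplus> r"
        unfolding pz using P(3) c filt_closed[OF r] pac(2) by algebra
      then show ?thesis using filt_add[OF filt_diff_pr[OF a(1)] r] by simp
    qed
    then have "(x \<ominus> (\<one> \<oplus> p phi')) \<otimes> geo (p phi') N \<in> filt (Suc m + 0)"
      by (rule filt_mult) (use g(2) in simp)
    moreover have "(x \<ominus> (\<one> \<oplus> p phi')) \<otimes> geo (p phi') N = y \<ominus> \<one>"
    proof -
      have "(\<one> \<oplus> p phi') \<otimes> geo (p phi') N = \<one>" using Units_r_inv[OF U(1)[OF phi']] unfolding U(2)[OF phi'] .
      then show ?thesis
        unfolding y_def minus_eq using xc g(2) P'(3)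
        by (simp only: l_distr l_minus add.m_closed one_closed a_inv_closed)
    qed
    moreover have "\<one> \<oplus> (y \<ominus> \<one>) = y" using yc by algebra
    ultimately show ?thesis
      using yC eq unfolding phi'_def by (intro bexI[of _ "y \<ominus> \<one>"]) simp_all
  qed
  have Psi'1: "Psi' phi = idA" if phi: "phi \<in> G" and e: "upart phi = idA" for phi
  proof -
    have p0: "p phi = \<zero>" unfolding p_def Psi1[OF phi e] by (rule q1)
    have "geo (p phi) N = inv (\<one> \<oplus> p phi)" using U(2)[OF phi] by (rule sym)
    also have "\<dots> = \<one>" unfolding p0 r_zero[OF one_closed] by (rule inv_one)
    finally have "geo (p phi) N = \<one>" .
    then show ?thesis unfolding Psi'_def Psi1[OF phi e] by (simp add: inn_one)
  qed
  have pr: "reg_elem p" unfolding p_def by (rule qr[OF PsiG Psir])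
  have Psi'r: "reg_elem (\<lambda>phi. Psi' phi a)" if a: "a \<in> carrier A" for a
  proof (rule reg_elem_cong)
    show "reg_elem (\<lambda>phi. Psi phi (geo (p phi) N \<otimes> a \<otimes> (\<one> \<oplus> p phi)))"
      by (rule reg_elem_operator[where \<Phi> = Psi])
        (use a in \<open>simp_all add: aut_linear PsiG Psir reg_elem_mult pr reg_elem_const reg_elem_geo reg_elem_add\<close>)
    show "Psi phi (geo (p phi) N \<otimes> a \<otimes> (\<one> \<oplus> p phi)) = Psi' phi a" if phi: "phi \<in> G" for phi
      unfolding Psi'_def comp_apply[OF PsiG[OF phi] inn_in_G[OF gU(1)[OF phi]] a]
        inn_apply[OF a] gU(2)[OF phi] ..
  qed
  have "stage (Suc m) Psi'"
    unfolding stage_def using Psi'G Psi'gr Psi'v Psi'u Psi'c Psi'1 Psi'r by blast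
  then show thesis by (rule that)
qed

text \<open>Stages are numbered from 1. At stage \<open>Suc N\<close> the remaining ambiguity lies
  in \<open>filt (Suc N)\<close>, which is zero, so the normal form is constant on cosets of the
  inner automorphisms.\<close>

lemma unipotent_normal_form:
  obtains Psi where "\<And>phi. phi \<in> G ==> Psi phi \<in> G"
    "\<And>phi u. phi \<in> G ==> u \<in> Units A ==> Psi (phi \<circ>\<^sub>A inn u) = Psi phi"
    "\<And>phi. phi \<in> G ==> Psi phi = idA ==> \<exists>u\<in>Units A. upart phi = inn u"
    "\<And>phi. phi \<in> G ==> upart phi = idA ==> Psi phi = idA"
    "\<And>a. a \<in> carrier A ==> reg_elem (\<lambda>phi. Psi phi a)"
proof -
  have "\<exists>Psi. stage (Suc m) Psi" for m
  proof (induction m)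
    case 0
    show ?case by (rule stage_0) auto
  next
    case (Suc m)
    then obtain Psi where Psi: "stage (Suc m) Psi" ..
    show ?case by (rule stage_Suc[OF _ Psi]) auto
  qed
  then obtain Psi where st: "stage (Suc N) Psi" by blast
  show thesis
  proof (rule that[of Psi])
    show PsiG: "Psi phi \<in> G" if "phi \<in> G" for phi using st that unfolding stage_def by blast
    show "Psi (phi \<circ>\<^sub>A inn u) = Psi phi" if phi: "phi \<in> G" and u: "u \<in> Units A" for phi u
    proof -
      obtain a where a: "a \<in> filt (Suc N)" and e: "Psi (phi \<circ>\<^sub>A inn u) = Psi phi \<circ>\<^sub>A inn (\<one> \<oplus> a)"
        using st phi u unfolding stage_def by blast
      have "a = \<zero>" by (rule filt_N[OF filt_mono[OF a]]) simp
      then show ?thesis unfolding e using PsiG[OF phi] by (simp add: inn_one)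
    qed
    show "\<exists>u\<in>Units A. upart phi = inn u" if phi: "phi \<in> G" and e: "Psi phi = idA" for phi
    proof -
      obtain u where u: "u \<in> Units A" "Psi phi = upart phi \<circ>\<^sub>A inn u"
        using st phi unfolding stage_def by blast
      have "aut_inv (inn u) = upart phi"
        using Aut.inv_equality[of "upart phi" "inn u"] u phi e by simp
      then have "upart phi = inn (inv u)" unfolding inn_inv[OF u(1)] ..
      then show ?thesis using u(1) by blast
    qed
    show "Psi phi = idA" if "phi \<in> G" "upart phi = idA" for phi
      using st that unfolding stage_def by blast
    show "reg_elem (\<lambda>phi. Psi phi a)" if "a \<in> carrier A" for a using st that unfolding stage_def by blast
  qed
qed

end

section \<open>Closed subgroups of scalings\<close>

context path_quotient
begin

section \<open>Invariants of the action on the radical modulo its square\<close>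

lemma aco_pr: "alpha \<in> arcs Q ==> b \<in> carrier A ==> aco alpha (pr 1 b) = aco alpha b"
proof (rule functional_eqI[of "\<lambda>b. aco alpha (pr 1 b)" "aco alpha"])
  assume alpha: "alpha \<in> arcs Q"
  show "functional (\<lambda>b. aco alpha (pr 1 b))" by (rule functional_comp[OF aco_functional[OF alpha] pr_linear])
  show "aco alpha (pr 1 (cl p)) = aco alpha (cl p)" if "p \<in> qpaths Q" for p
    using that alpha by (auto simp: pr_cl aco_cl functional_zero[OF aco_functional[OF alpha]] path_arrows_def)
qed (simp_all add: aco_functional)

lemma aco_cong_pr: "alpha \<in> arcs Q ==> x \<in> carrier A ==> y \<in> carrier A ==> pr 1 x = pr 1 y ==> aco alpha x = aco alpha y"
  using aco_pr[of alpha x] aco_pr[of alpha y] by simp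

text \<open>Automorphisms preserve \<open>filt 2\<close> and hence act on the quotient of
  \<open>filt 1\<close> by it, of which \<open>pr 1\<close> selects representatives.\<close>

lemma pr_aut_cong:
  assumes phi: "phi \<in> G" and x: "x \<in> filt 1" and y: "y \<in> filt 1" and e: "pr 1 x = pr 1 y"
  shows "pr 1 (phi x) = pr 1 (phi y)"
proof -
  have c: "x \<in> carrier A" "y \<in> carrier A" using x y by simp_all
  have "pr 1 (x \<ominus> y) = pr 1 y \<ominus> pr 1 y" unfolding linear_map_diff[OF pr_linear c] e ..
  then have "pr 1 (x \<ominus> y) = \<zero>" unfolding minus_eq r_neg[OF pr_closed[OF c(2)]] .
  then have "x \<ominus> y \<in> filt (Suc 1)" by (rule filt_SucI[OF filt_diff[OF x y]])
  then have "pr 1 (phi (x \<ominus> y)) = \<zero>" by (intro pr_filt_Suc aut_filt[OF phi])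
  then have "pr 1 (phi x) \<ominus> pr 1 (phi y) = \<zero>"
    unfolding linear_map_diff[OF aut_linear[OF phi] c]
      linear_map_diff[OF pr_linear aut_closed[OF phi c(1)] aut_closed[OF phi c(2)]] .
  then show ?thesis using phi c by simp
qed

text \<open>Matrix of \<open>phi\<close> on the radical modulo its square in the basis of arrows:
  coefficient of \<open>beta\<close> in the image of \<open>alpha\<close>.\<close>

definition ac :: "('a => 'a) => 'e => 'e => 'k" where "ac phi alpha beta = aco beta (phi (arrow alpha))"

text \<open>The eigenvalue of conjugation by \<open>u\<close> at the arrow \<open>alpha\<close> of
  the radical modulo its square.\<close>

definition weight :: "'a => 'e => 'k" where "weight u alpha = vco (tail Q alpha) u * vco (head Q alpha) (inv u)"

lemma weight_inv: "u \<in> Units A ==> alpha \<in> arcs Q ==> weight (inv u) alpha * weight u alpha = 1"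
proof -
  assume u: "u \<in> Units A" and alpha: "alpha \<in> arcs Q"
  then have V: "tail Q alpha \<in> verts Q" "head Q alpha \<in> verts Q" by auto
  have "weight (inv u) alpha * weight u alpha =
    (vco (tail Q alpha) u * vco (tail Q alpha) (inv u)) * (vco (head Q alpha) u * vco (head Q alpha) (inv u))"
    unfolding weight_def Units_inv_inv[OF u] by (simp only: ac_simps)
  then show ?thesis unfolding vco_unit[OF u V(1)] vco_unit[OF u V(2)] by simp
qed

lemma aco_inn:
  assumes u: "u \<in> Units A" and alpha: "alpha \<in> arcs Q" and b: "b \<in> filt 1"
  shows "aco alpha (inn u b) = weight u alpha * aco alpha b"
proof -
  have c: "u \<in> carrier A" "inv u \<in> carrier A" "b \<in> carrier A"
    using Units_closed[OF u] Units_closed[OF Units_inv_Units[OF u]] b by simp_all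
  have V: "tail Q alpha \<in> verts Q" "head Q alpha \<in> verts Q" using alpha by auto
  have b0: "vco v b = 0" if "v \<in> verts Q" for v using iffD1[OF filt_1_iff[OF c(3)] b] that by blast
  show ?thesis
    unfolding inn_apply[OF c(3)] aco_mult[OF alpha m_closed[OF c(1,3)] c(2)] aco_mult[OF alpha c(1,3)]
      vco_mult[OF V(1) c(1,3)] b0[OF V(1)] b0[OF V(2)]
    by (simp add: weight_def algebra_simps)
qed

lemma pr_inn_arrow:
  assumes u: "u \<in> Units A" and alpha: "alpha \<in> arcs Q"
  shows "pr 1 (inn u (arrow alpha)) = pr 1 (weight u alpha \<odot> arrow alpha)"
proof -
  have c: "inn u (arrow alpha) \<in> carrier A"
    by (rule aut_closed[OF inn_in_G[OF u] arrow_in[OF alpha]])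
  have "(\<Oplus>beta\<in>arcs Q. aco beta (inn u (arrow alpha)) \<odot> arrow beta) = (\<Oplus>beta\<in>arcs Q. aco beta (weight u alpha \<odot> arrow alpha) \<odot> arrow beta)"
  proof (rule finsum_cong')
    fix beta assume beta: "beta \<in> arcs Q"
    show "aco beta (inn u (arrow alpha)) \<odot> arrow beta = aco beta (weight u alpha \<odot> arrow alpha) \<odot> arrow beta"
      unfolding aco_inn[OF u beta arrow_in_filt[OF alpha]] functional_smult[OF aco_functional[OF beta] arrow_in[OF alpha]]
        aco_arrow[OF beta alpha] by simp
  qed (use alpha in auto)
  then show ?thesis using alpha unfolding pr_1_eq[OF c] by (subst pr_1_eq) simp_all
qed

lemma ac_inn:
  assumes phi: "phi \<in> G" and u: "u \<in> Units A" and alpha: "alpha \<in> arcs Q" and beta: "beta \<in> arcs Q"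
  shows "ac (phi \<circ>\<^sub>A inn u) alpha beta = weight u alpha * ac phi alpha beta"
proof -
  have f: "inn u (arrow alpha) \<in> filt 1" "weight u alpha \<odot> arrow alpha \<in> filt 1"
    using aut_filt[OF inn_in_G[OF u] arrow_in_filt[OF alpha]] arrow_in_filt[OF alpha]
    by (simp_all add: filt_def linear_map_smult[OF pr_linear] del: filt_closed)
  have c: "inn u (arrow alpha) \<in> carrier A" "weight u alpha \<odot> arrow alpha \<in> carrier A" using f by (auto intro: filt_closed)
  have "aco beta (phi (inn u (arrow alpha))) = aco beta (phi (weight u alpha \<odot> arrow alpha))"
    by (rule aco_cong_pr[OF beta aut_closed[OF phi c(1)] aut_closed[OF phi c(2)] pr_aut_cong[OF phi f pr_inn_arrow[OF u alpha]]])
  then show ?thesis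
    unfolding ac_def comp_apply[OF phi inn_in_G[OF u] arrow_in[OF alpha]]
      linear_map_smult[OF aut_linear[OF phi] arrow_in[OF alpha]]
      functional_smult[OF aco_functional[OF beta] aut_closed[OF phi arrow_in[OF alpha]]] .
qed

text \<open>Together with \<open>ac_inn\<close> this shows that the weights at \<open>alpha\<close>
  cancel in the products \<open>ac phi alpha beta * ac (aut_inv phi) \<gamma> alpha\<close>,
  although no single entry need be invariant.\<close>

lemma ac_inv_inn:
  assumes phi: "phi \<in> G" and u: "u \<in> Units A" and alpha: "alpha \<in> arcs Q" and \<gamma>: "\<gamma> \<in> arcs Q"
  shows "ac (aut_inv (phi \<circ>\<^sub>A inn u)) \<gamma> alpha = weight (inv u) alpha * ac (aut_inv phi) \<gamma> alpha"
  unfolding ac_def aut_inv_comp_apply[OF phi inn_in_G[OF u] arrow_in[OF \<gamma>]] inn_inv[OF u]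
  by (rule aco_inn[OF Units_inv_Units[OF u] alpha aut_filt[OF inv_in_G[OF phi] arrow_in_filt[OF \<gamma>]]])

text \<open>Regular extension of \<open>cochain_power\<close> from rescalings to all automorphisms.
  Negative exponents use entries of the inverse automorphism, since inverses of entries need not be
  regular.\<close>

definition circ :: "('e => int) => ('a => 'a) => 'k" where
  "circ z phi = (\<Prod>alpha\<in>arcs Q. ac phi alpha alpha ^ nat (z alpha) * ac (aut_inv phi) alpha alpha ^ nat (- z alpha))"

lemma power_int_nat_split: "(x::'k) powi n = x ^ nat n * inverse x ^ nat (- n)"
  by (cases "0 \<le> n") (simp_all add: power_int_def)

lemma prod_powi: "finite I ==> (\<Prod>i\<in>I. f i powi n) = (\<Prod>i\<in>I. f i :: 'k) powi n"
  by (induction I rule: finite_induct) (simp_all add: power_int_mult_distrib)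

lemma circ_inn:
  assumes phi: "phi \<in> G" and u: "u \<in> Units A" and z: "z \<in> Q.cycles"
  shows "circ z (phi \<circ>\<^sub>A inn u) = circ z phi"
proof -
  define tau where "tau v = (if v \<in> verts Q then vco v u else 1)" for v
  have nz: "tau v \<noteq> 0" for v using vco_unit[OF u, of v] by (auto simp: tau_def)
  have w: "weight u alpha = tau (tail Q alpha) / tau (head Q alpha)" if alpha: "alpha \<in> arcs Q" for alpha
  proof -
    have V: "tail Q alpha \<in> verts Q" "head Q alpha \<in> verts Q" using alpha by auto
    have "vco (head Q alpha) (inv u) = inverse (vco (head Q alpha) u)"
      using vco_unit[OF u V(2)] by (intro inverse_unique[symmetric])
    then show ?thesis using V by (simp add: weight_def tau_def divide_inverse)
  qed
  have wi: "weight (inv u) alpha = inverse (weight u alpha)" if "alpha \<in> arcs Q" for alpha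
    using weight_inv[OF u that] by (intro inverse_unique[symmetric]) (simp add: mult.commute)
  have "circ z (phi \<circ>\<^sub>A inn u) = (\<Prod>alpha\<in>arcs Q. (ac phi alpha alpha ^ nat (z alpha) * ac (aut_inv phi) alpha alpha ^ nat (- z alpha)) *
      ((tau (tail Q alpha) / tau (head Q alpha)) powi z alpha))"
    unfolding circ_def
  proof (rule prod.cong[OF refl])
    fix alpha assume alpha: "alpha \<in> arcs Q"
    show "ac (phi \<circ>\<^sub>A inn u) alpha alpha ^ nat (z alpha) * ac (aut_inv (phi \<circ>\<^sub>A inn u)) alpha alpha ^ nat (- z alpha) =
      (ac phi alpha alpha ^ nat (z alpha) * ac (aut_inv phi) alpha alpha ^ nat (- z alpha)) * ((tau (tail Q alpha) / tau (head Q alpha)) powi z alpha)"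
      unfolding ac_inn[OF phi u alpha alpha] ac_inv_inn[OF phi u alpha alpha] w[OF alpha, symmetric]
        power_int_nat_split wi[OF alpha] power_mult_distrib by (simp add: algebra_simps)
  qed
  also have "\<dots> = circ z phi * Q.cochain_power (\<lambda>alpha. tau (tail Q alpha) / tau (head Q alpha)) z"
    unfolding prod.distrib circ_def Q.cochain_power_def ..
  also have "\<dots> = circ z phi" unfolding Q.cochain_power_coboundary[of z tau, OF z nz] by simp
  finally show ?thesis .
qed

lemma ac_graded:
  assumes phi: "phi \<in> G" and g: "gr phi = scaling c" and alpha: "alpha \<in> arcs Q" and beta: "beta \<in> arcs Q"
  shows "ac phi alpha beta = of_bool (alpha = beta) * c alpha"
proof -
  have "pr 1 (phi (arrow alpha)) = gr phi (arrow alpha)"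
    unfolding gr_apply[OF arrow_in[OF alpha]] unfolding arrow_def grf_cl[OF phi arrow_path[OF alpha]] by (simp add: path_arrows_def)
  also have "\<dots> = c alpha \<odot> arrow alpha" unfolding g scaling_arrow[OF alpha] ..
  finally have "aco beta (phi (arrow alpha)) = aco beta (c alpha \<odot> arrow alpha)"
    using aco_pr[OF beta aut_closed[OF phi arrow_in[OF alpha]]] by simp
  then show ?thesis
    unfolding ac_def functional_smult[OF aco_functional[OF beta] arrow_in[OF alpha]] aco_arrow[OF beta alpha] by simp
qed

lemma circ_graded:
  assumes phi: "phi \<in> G" and c: "\<And>alpha. c alpha \<noteq> 0" and g: "gr phi = scaling c"
  shows "circ z phi = Q.cochain_power c z"
proof -
  have gi: "gr (aut_inv phi) = scaling (\<lambda>alpha. inverse (c alpha))"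
    unfolding gr_inv[OF phi] g by (rule scaling_inv[OF c])
  show ?thesis
    unfolding circ_def Q.cochain_power_def
  proof (rule prod.cong[OF refl])
    fix alpha assume alpha: "alpha \<in> arcs Q"
    show "ac phi alpha alpha ^ nat (z alpha) * ac (aut_inv phi) alpha alpha ^ nat (- z alpha) = c alpha powi z alpha"
      unfolding ac_graded[OF phi g alpha alpha] ac_graded[OF inv_in_G[OF phi] gi alpha alpha] power_int_nat_split by simp
  qed
qed

lemma reg_ac: "alpha \<in> arcs Q ==> beta \<in> arcs Q ==> reg (\<lambda>phi. ac phi alpha beta)"
  unfolding ac_def by (rule reg_coeff[OF aco_functional]) simp_all
lemma reg_ac_inv: "alpha \<in> arcs Q ==> beta \<in> arcs Q ==> reg (\<lambda>phi. ac (aut_inv phi) alpha beta)"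
  unfolding ac_def by (rule reg_inv_coeff[OF aco_functional]) simp_all
lemma reg_circ: "reg (circ z)"
  unfolding circ_def by (intro reg_prod reg_mult reg_power reg_ac reg_ac_inv) auto

text \<open>If the inverse never produced \<open>alpha\<close> modulo the square of the radical, it
  could not send \<open>phi (arrow alpha)\<close> back to \<open>arrow alpha\<close>.\<close>

lemma ac_inv_nonzero:
  assumes phi: "phi \<in> G" and alpha: "alpha \<in> arcs Q"
  shows "\<exists>\<gamma>\<in>arcs Q. ac (aut_inv phi) \<gamma> alpha \<noteq> 0"
proof (rule ccontr)
  assume n: "\<not> (\<exists>\<gamma>\<in>arcs Q. ac (aut_inv phi) \<gamma> alpha \<noteq> 0)"
  have z: "ac (aut_inv phi) \<gamma> alpha = 0" if "\<gamma> \<in> arcs Q" for \<gamma> using n that by blast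
  define b where "b = phi (arrow alpha)"
  have b: "b \<in> filt 1" unfolding b_def by (rule aut_filt[OF phi arrow_in_filt[OF alpha]])
  have bc: "b \<in> carrier A" using b by simp
  have s: "pr 1 b \<in> filt 1" by (rule pr_in_filt[OF bc])
  have i: "aut_inv phi \<in> G" using phi by simp
  have "pr 1 (aut_inv phi b) = pr 1 (aut_inv phi (pr 1 b))"
    by (rule pr_aut_cong[OF i b s]) (simp add: pr_pr[OF bc])
  then have "aco alpha (aut_inv phi b) = aco alpha (aut_inv phi (pr 1 b))"
    by (rule aco_cong_pr[OF alpha aut_closed[OF i bc] aut_closed[OF i pr_closed[OF bc]]])
  also have "aut_inv phi (pr 1 b) = (\<Oplus>\<gamma>\<in>arcs Q. aut_inv phi (aco \<gamma> b \<odot> arrow \<gamma>))"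
    unfolding pr_1_eq[OF bc] by (rule linear_map_sum[OF aut_linear[OF i]]) auto
  also have "aco alpha \<dots> = (\<Sum>\<gamma>\<in>arcs Q. aco alpha (aut_inv phi (aco \<gamma> b \<odot> arrow \<gamma>)))"
    by (rule functional_sum[OF aco_functional[OF alpha]]) (use i in auto)
  also have "\<dots> = 0"
  proof (rule sum.neutral, rule ballI)
    fix \<gamma> assume \<gamma>: "\<gamma> \<in> arcs Q"
    show "aco alpha (aut_inv phi (aco \<gamma> b \<odot> arrow \<gamma>)) = 0"
      unfolding linear_map_smult[OF aut_linear[OF i] arrow_in[OF \<gamma>]]
        functional_smult[OF aco_functional[OF alpha] aut_closed[OF i arrow_in[OF \<gamma>]]]
      using z[OF \<gamma>] by (simp add: ac_def)
  qed
  finally have "aco alpha (arrow alpha) = 0" unfolding b_def inv_apply[OF phi arrow_in[OF alpha]] .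
  then show False unfolding aco_arrow[OF alpha alpha] by simp
qed

text \<open>Since some entry of the inverse at \<open>alpha\<close> is nonzero, vanishing of the
  invariant products forces the entries off the diagonal to vanish. A vertex goes to a nonzero
  idempotent multiple of itself in degree zero, hence to itself.\<close>

lemma graded_scaling:
  assumes phi: "phi \<in> G"
    and v: "\<And>v w. v \<in> verts Q ==> w \<in> verts Q ==> v \<noteq> w ==> vco w (phi (vertex v)) = 0"
    and x: "\<And>alpha beta \<gamma>. alpha \<in> arcs Q ==> beta \<in> arcs Q ==> \<gamma> \<in> arcs Q ==> alpha \<noteq> beta ==>
      ac phi alpha beta * ac (aut_inv phi) \<gamma> alpha = 0"
  obtains c where "\<And>alpha. c alpha \<noteq> 0" "gr phi = scaling c"
proof -
  have g: "gr phi \<in> G" using phi by simp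
  have nz: "gr phi b \<noteq> \<zero>" if "b \<in> carrier A" "b \<noteq> \<zero>" for b
  proof
    assume "gr phi b = \<zero>"
    then have "gr phi b = gr phi \<zero>" by (simp only: linear_map_zero[OF aut_linear[OF g]])
    then show False using aut_inj[OF g that(1) zero_closed] that(2) by blast
  qed
  have gv: "gr phi (vertex v) = vertex v" if vv: "v \<in> verts Q" for v
  proof -
    define t where "t = vco v (phi (vertex v))"
    have c: "phi (vertex v) \<in> carrier A" using phi vv by simp
    have "gr phi (vertex v) = pr 0 (phi (vertex v))"
      unfolding gr_apply[OF vertex_in[OF vv]] unfolding vertex_def grf_cl[OF phi vertex_path[OF vv]] by (simp add: path_arrows_def)
    also have "\<dots> = diag (\<lambda>w. vco w (phi (vertex v)))" by (rule pr_0_eq[OF c])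
    also have "\<dots> = t \<odot> vertex v"
      unfolding diag_def by (rule finsum_single[of _ v]) (use vv v[OF vv] in \<open>auto simp: t_def\<close>)
    finally have e: "gr phi (vertex v) = t \<odot> vertex v" .
    have "t = vco v (phi (vertex v \<otimes> vertex v))" unfolding vertex_vertex[OF vv vv] t_def by simp
    also have "\<dots> = t * t"
      unfolding aut_mult[OF phi vertex_in[OF vv] vertex_in[OF vv]] vco_mult[OF vv c c] t_def ..
    finally have tt: "t * t = t * 1" by simp
    have "t \<noteq> 0" using nz[OF vertex_in[OF vv] vertex_neq_zero[OF vv]] e vv by auto
    then have "t = 1" by (rule iffD1[OF mult_left_cancel tt])
    then show ?thesis using e vv by simp
  qed
  have gx: "gr phi (arrow alpha) = ac phi alpha alpha \<odot> arrow alpha" if alpha: "alpha \<in> arcs Q" for alpha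
  proof -
    have c: "phi (arrow alpha) \<in> carrier A" using phi alpha by simp
    obtain \<gamma> where \<gamma>: "\<gamma> \<in> arcs Q" "ac (aut_inv phi) \<gamma> alpha \<noteq> 0" using ac_inv_nonzero[OF phi alpha] by blast
    have z: "ac phi alpha beta = 0" if "beta \<in> arcs Q" "beta \<noteq> alpha" for beta using x[OF alpha that(1) \<gamma>(1)] that(2) \<gamma>(2) by auto
    have "gr phi (arrow alpha) = pr 1 (phi (arrow alpha))"
      unfolding gr_apply[OF arrow_in[OF alpha]] unfolding arrow_def grf_cl[OF phi arrow_path[OF alpha]] by (simp add: path_arrows_def)
    also have "\<dots> = (\<Oplus>beta\<in>arcs Q. ac phi alpha beta \<odot> arrow beta)" unfolding pr_1_eq[OF c] ac_def ..
    also have "\<dots> = ac phi alpha alpha \<odot> arrow alpha" by (rule finsum_single[of _ alpha]) (use alpha z in auto)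
    finally show ?thesis .
  qed
  \<comment> \<open>The value 1 outside the arrows makes \<open>c\<close> nowhere zero, as
    \<open>scaling_in_G\<close> requires.\<close>
  define c where "c alpha = (if alpha \<in> arcs Q then ac phi alpha alpha else 1)" for alpha
  have c: "c alpha \<noteq> 0" for alpha
    using nz[OF arrow_in arrow_neq_zero, of alpha] gx[of alpha] arrow_in[of alpha] by (auto simp: c_def)
  have "gr phi = scaling c"
  proof (rule aut_generators[OF g scaling_in_G[OF c]])
    show "gr phi (vertex v) = scaling c (vertex v)" if "v \<in> verts Q" for v
      unfolding gv[OF that] scaling_vertex[OF that] ..
    show "gr phi (arrow alpha) = scaling c (arrow alpha)" if "alpha \<in> arcs Q" for alpha
      unfolding gx[OF that] scaling_arrow[OF that] using that by (simp add: c_def)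
  qed
  then show thesis using that c by blast
qed

text \<open>\<open>vco w\<close> composed with \<open>phi\<close> is multiplicative, so the
  contributions of \<open>u\<close> and of its inverse cancel in the field.\<close>

lemma vco_inn:
  assumes phi: "phi \<in> G" and u: "u \<in> Units A" and w: "w \<in> verts Q" and b: "b \<in> carrier A"
  shows "vco w ((phi \<circ>\<^sub>A inn u) b) = vco w (phi b)"
proof -
  have c: "u \<in> carrier A" "inv u \<in> carrier A" by (rule Units_closed[OF u], rule Units_closed[OF Units_inv_Units[OF u]])
  have 1: "vco w (phi u) * vco w (phi (inv u)) = 1"
    unfolding aut_Units(2)[OF phi u] by (rule vco_unit[OF aut_Units(1)[OF phi u] w])
  have "vco w ((phi \<circ>\<^sub>A inn u) b) = vco w (phi u) * vco w (phi b) * vco w (phi (inv u))"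
    using phi u b c w by (simp add: aut_mult vco_mult)
  also have "\<dots> = (vco w (phi u) * vco w (phi (inv u))) * vco w (phi b)" by (simp only: ac_simps)
  finally show ?thesis unfolding 1 by simp
qed

text \<open>The set \<open>\<Gamma>\<close> of imposed cycle conditions makes one closedness proof
  serve twice: with all cycles it gives the trivial subgroup, with the cycles avoiding an arrow the
  one-dimensional torus.\<close>

definition scalings :: "('e => int) set => ('a => 'a) set set" where
  "scalings \<Gamma> = {out (scaling c) |c. (\<forall>alpha. c alpha \<noteq> 0) \<and> (\<forall>z\<in>\<Gamma>. Q.cochain_power c z = 1)}"

lemma inv_Out: "phi \<in> G ==> inv\<^bsub>Out A\<^esub> (out phi) = out (aut_inv phi)"
  by (rule Out.inv_equality) (simp_all add: out_mult Aut.l_inv one_Out)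

lemma scalings_subgroup: "subgroup (scalings \<Gamma>) (Out A)"
proof (rule Out.subgroupI)
  show "scalings \<Gamma> \<subseteq> carrier (Out A)" by (auto simp: scalings_def scaling_in_G)
  have "out (scaling (\<lambda>alpha. 1)) \<in> scalings \<Gamma>"
    unfolding scalings_def by (intro CollectI exI[of _ "\<lambda>alpha. 1"]) (simp add: Q.cochain_power_def)
  then show "scalings \<Gamma> \<noteq> {}" by blast
next
  fix X assume "X \<in> scalings \<Gamma>"
  then obtain c where c: "\<And>alpha. c alpha \<noteq> 0" "\<And>z. z \<in> \<Gamma> ==> Q.cochain_power c z = 1" "X = out (scaling c)"
    by (auto simp: scalings_def)
  have "inv\<^bsub>Out A\<^esub> X = out (scaling (\<lambda>alpha. inverse (c alpha)))"
    unfolding c(3) inv_Out[OF scaling_in_G[OF c(1)]] scaling_inv[OF c(1)] ..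
  moreover have "Q.cochain_power (\<lambda>alpha. inverse (c alpha)) z = 1" if "z \<in> \<Gamma>" for z
  proof -
    have "Q.cochain_power (\<lambda>alpha. inverse (c alpha)) z = inverse (Q.cochain_power c z)"
      unfolding Q.cochain_power_def power_int_inverse
      using prod_inversef[of "\<lambda>e. c e powi z e" "arcs Q"] by (simp only: o_def)
    then show ?thesis using c(2)[OF that] by simp
  qed
  ultimately show "inv\<^bsub>Out A\<^esub> X \<in> scalings \<Gamma>" unfolding scalings_def using c(1) by fastforce
next
  fix X Y assume X: "X \<in> scalings \<Gamma>" and Y: "Y \<in> scalings \<Gamma>"
  obtain c where c: "\<And>alpha. c alpha \<noteq> 0" "\<And>z. z \<in> \<Gamma> ==> Q.cochain_power c z = 1" "X = out (scaling c)"
    using X unfolding scalings_def by blast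
  obtain d where d: "\<And>alpha. d alpha \<noteq> 0" "\<And>z. z \<in> \<Gamma> ==> Q.cochain_power d z = 1" "Y = out (scaling d)"
    using Y unfolding scalings_def by blast
  have "X \<otimes>\<^bsub>Out A\<^esub> Y = out (scaling (\<lambda>alpha. c alpha * d alpha))"
    unfolding c(3) d(3) out_mult[OF scaling_in_G[OF c(1)] scaling_in_G[OF d(1)]] scaling_comp[OF c(1) d(1)] ..
  moreover have "Q.cochain_power (\<lambda>alpha. c alpha * d alpha) z = 1" if "z \<in> \<Gamma>" for z
    using c(2)[OF that] d(2)[OF that] unfolding Q.cochain_power_def power_int_mult_distrib prod.distrib by simp
  ultimately show "X \<otimes>\<^bsub>Out A\<^esub> Y \<in> scalings \<Gamma>"
    unfolding scalings_def using c(1) d(1) by (intro CollectI exI[of _ "\<lambda>alpha. c alpha * d alpha"]) simp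
qed

lemma scalings_closed:
  assumes \<Gamma>: "\<Gamma> \<subseteq> Q.cycles"
  shows "closed_subgroup (Out A) (Out_functions A) (scalings \<Gamma>)"
proof (rule unipotent_normal_form)
  fix Psi
  assume PsiG: "\<And>phi. phi \<in> G ==> Psi phi \<in> G"
    and Psic: "\<And>phi u. phi \<in> G ==> u \<in> Units A ==> Psi (phi \<circ>\<^sub>A inn u) = Psi phi"
    and Psiu: "\<And>phi. phi \<in> G ==> Psi phi = idA ==> \<exists>u\<in>Units A. upart phi = inn u"
    and Psi1: "\<And>phi. phi \<in> G ==> upart phi = idA ==> Psi phi = idA"
    and Psir: "\<And>a. a \<in> carrier A ==> reg_elem (\<lambda>phi. Psi phi a)"
  \<comment> \<open>The four families of equations say in turn that the graded part fixes the
    vertices, that it is diagonal on the arrows, that its values on the cycles of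
    \<open>\<Gamma>\<close> are 1, and that the unipotent part is inner.\<close>
  define S1 where "S1 = {(\<lambda>phi. vco w (phi (vertex v))) |v w. v \<in> verts Q \<and> w \<in> verts Q \<and> v \<noteq> w}"
  define S2 where "S2 = {(\<lambda>phi. ac phi alpha beta * ac (aut_inv phi) \<gamma> alpha) |alpha beta \<gamma>.
    alpha \<in> arcs Q \<and> beta \<in> arcs Q \<and> \<gamma> \<in> arcs Q \<and> alpha \<noteq> beta}"
  define S3 where "S3 = {(\<lambda>phi. circ z phi + - 1) |z. z \<in> \<Gamma>}"
  define S4 where "S4 = {(\<lambda>phi. l (Psi phi a) + - l a) |l a. functional l \<and> a \<in> carrier A}"
  have inv1: "f (phi \<circ>\<^sub>A inn u) = f phi" if f: "f \<in> S1 \<union> S2 \<union> S3 \<union> S4" and phi: "phi \<in> G" and u: "u \<in> Units A" for f phi u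
  proof -
    consider (1) v w where "f = (\<lambda>phi. vco w (phi (vertex v)))" "v \<in> verts Q" "w \<in> verts Q"
      | (2) alpha beta \<gamma> where "f = (\<lambda>phi. ac phi alpha beta * ac (aut_inv phi) \<gamma> alpha)" "alpha \<in> arcs Q" "beta \<in> arcs Q" "\<gamma> \<in> arcs Q"
      | (3) z where "f = (\<lambda>phi. circ z phi + - 1)" "z \<in> \<Gamma>"
      | (4) l a where "f = (\<lambda>phi. l (Psi phi a) + - l a)" "functional l" "a \<in> carrier A"
      using f unfolding S1_def S2_def S3_def S4_def by blast
    then show ?thesis
    proof cases
      case 1
      show ?thesis unfolding 1(1) by (rule vco_inn[OF phi u 1(3) vertex_in[OF 1(2)]])
    next
      case 2
      have "f (phi \<circ>\<^sub>A inn u) = (weight (inv u) alpha * weight u alpha) * f phi"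
        unfolding 2(1) ac_inn[OF phi u 2(2,3)] ac_inv_inn[OF phi u 2(2,4)] by (simp only: ac_simps)
      then show ?thesis unfolding weight_inv[OF u 2(2)] by simp
    next
      case 3
      show ?thesis unfolding 3(1) circ_inn[OF phi u subsetD[OF \<Gamma> 3(2)]] ..
    next
      case 4
      show ?thesis unfolding 4(1) Psic[OF phi u] ..
    qed
  qed
  have reg: "reg f" if f: "f \<in> S1 \<union> S2 \<union> S3 \<union> S4" for f
  proof -
    have "reg (\<lambda>phi. l (Psi phi a) + - l a)" if "functional l" "a \<in> carrier A" for l a
      by (rule reg_add[OF reg_elemD[OF Psir[OF that(2)] that(1)] reg_const])
    moreover have "reg (\<lambda>phi. circ z phi + - 1)" for z by (rule reg_add[OF reg_circ reg_const])
    moreover have "reg (\<lambda>phi. ac phi alpha beta * ac (aut_inv phi) \<gamma> alpha)" if "alpha \<in> arcs Q" "beta \<in> arcs Q" "\<gamma> \<in> arcs Q" for alpha beta \<gamma>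
      by (rule reg_mult[OF reg_ac[OF that(1,2)] reg_ac_inv[OF that(3,1)]])
    moreover have "reg (\<lambda>phi. vco w (phi (vertex v)))" if "v \<in> verts Q" "w \<in> verts Q" for v w
      by (rule reg_coeff[OF vco_functional[OF that(2)] vertex_in[OF that(1)]])
    ultimately show ?thesis using f unfolding S1_def S2_def S3_def S4_def by blast
  qed
  have sub: "scalings \<Gamma> \<subseteq> carrier (Out A)" by (rule subgroup.subset[OF scalings_subgroup])
  have zero: "out phi \<in> scalings \<Gamma> \<longleftrightarrow> (\<forall>f\<in>S1 \<union> S2 \<union> S3 \<union> S4. f phi = 0)" if phi: "phi \<in> G" for phi
  proof
    assume "out phi \<in> scalings \<Gamma>"
    then obtain c where c: "\<And>alpha. c alpha \<noteq> 0" "\<And>z. z \<in> \<Gamma> ==> Q.cochain_power c z = 1" "out phi = out (scaling c)"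
      unfolding scalings_def by blast
    have s: "scaling c \<in> G" by (rule scaling_in_G) (rule c(1))
    have g: "gr (scaling c) = scaling c" by (rule gr_scaling) (rule c(1))
    obtain u where u: "u \<in> Units A" "phi = scaling c \<circ>\<^sub>A inn u"
      using c(3) out_eq_iff[OF s phi] by blast
    show "\<forall>f\<in>S1 \<union> S2 \<union> S3 \<union> S4. f phi = 0"
    proof
      fix f assume f: "f \<in> S1 \<union> S2 \<union> S3 \<union> S4"
      have "f (scaling c) = 0"
      proof -
        have "upart (scaling c) = idA" unfolding upart_def gr_inv[OF s] g using s by (simp add: Aut.l_inv)
        then have "l (Psi (scaling c) a) + - l a = 0" if "a \<in> carrier A" for l :: "'a => 'k" and a
          using Psi1[OF s] that by simp
        moreover have "circ z (scaling c) + - 1 = 0" if "z \<in> \<Gamma>" for z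
          using circ_graded[OF s c(1) g] c(2)[OF that] by simp
        moreover have "ac (scaling c) alpha beta * ac (aut_inv (scaling c)) \<gamma> alpha = 0"
          if "alpha \<in> arcs Q" "beta \<in> arcs Q" "alpha \<noteq> beta" for alpha beta \<gamma>
          using ac_graded[OF s g that(1,2)] that(3) by simp
        moreover have "vco w (scaling c (vertex v)) = 0" if "v \<in> verts Q" "w \<in> verts Q" "v \<noteq> w" for v w
          unfolding scaling_vertex[OF that(1)] vco_vertex[OF that(2,1)] using that(3) by simp
        ultimately show ?thesis using f unfolding S1_def S2_def S3_def S4_def by blast
      qed
      then show "f phi = 0" unfolding u(2) inv1[OF f s u(1)] .
    qed
  next
    assume z: "\<forall>f\<in>S1 \<union> S2 \<union> S3 \<union> S4. f phi = 0"
    obtain c where c: "\<And>alpha. c alpha \<noteq> 0" and g: "gr phi = scaling c"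
    proof (rule graded_scaling[OF phi])
      show "vco w (phi (vertex v)) = 0" if "v \<in> verts Q" "w \<in> verts Q" "v \<noteq> w" for v w
      proof -
        have "(\<lambda>phi. vco w (phi (vertex v))) \<in> S1 \<union> S2 \<union> S3 \<union> S4" unfolding S1_def using that by blast
        from bspec[OF z this] show ?thesis .
      qed
      show "ac phi alpha beta * ac (aut_inv phi) \<gamma> alpha = 0"
        if "alpha \<in> arcs Q" "beta \<in> arcs Q" "\<gamma> \<in> arcs Q" "alpha \<noteq> beta" for alpha beta \<gamma>
      proof -
        have "(\<lambda>phi. ac phi alpha beta * ac (aut_inv phi) \<gamma> alpha) \<in> S1 \<union> S2 \<union> S3 \<union> S4" unfolding S2_def using that by blast
        from bspec[OF z this] show ?thesis .
      qed
    qed (rule that)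
    have p: "Q.cochain_power c y = 1" if "y \<in> \<Gamma>" for y
    proof -
      have "(\<lambda>phi. circ y phi + - 1) \<in> S1 \<union> S2 \<union> S3 \<union> S4" unfolding S3_def using that by blast
      from bspec[OF z this] show ?thesis using circ_graded[OF phi c g, of y] by simp
    qed
    have "Psi phi = idA"
    proof (rule aut_eqI[OF PsiG[OF phi] one_in_G])
      fix a assume a: "a \<in> carrier A"
      have "Psi phi a = a"
      proof (rule functionals_separate[OF aut_closed[OF PsiG[OF phi] a] a])
        fix l assume l: "functional l"
        have "(\<lambda>phi. l (Psi phi a) + - l a) \<in> S1 \<union> S2 \<union> S3 \<union> S4" unfolding S4_def using l a by blast
        from bspec[OF z this] show "l (Psi phi a) = l a" by simp
      qed
      then show "Psi phi a = idA a" using a by simp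
    qed
    then obtain u where u: "u \<in> Units A" "upart phi = inn u" using Psiu[OF phi] by blast
    have "phi = scaling c \<circ>\<^sub>A inn u" using gr_comp_upart[OF phi] unfolding g u(2) by simp
    moreover have "scaling c \<in> G" by (rule scaling_in_G) (rule c)
    ultimately have "out phi = out (scaling c)" using out_eq_iff[OF _ phi, of "scaling c"] u(1) by blast
    then show "out phi \<in> scalings \<Gamma>" unfolding scalings_def using c p by blast
  qed
  show ?thesis
    unfolding closed_subgroup_def
    using scalings_subgroup zariski_closed_OutI[of "scalings \<Gamma>" "S1 \<union> S2 \<union> S3 \<union> S4", OF sub reg inv1 zero] by blast
qed

lemma scaling_cong:
  assumes c: "\<And>alpha. c alpha \<noteq> 0" and d: "\<And>alpha. d alpha \<noteq> 0" and e: "\<And>alpha. alpha \<in> arcs Q ==> c alpha = d alpha"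
  shows "scaling c = scaling d"
  by (rule aut_generators) (simp_all add: scaling_in_G c d e scaling_vertex scaling_arrow)

text \<open>The quotient of the two scalings is a coboundary, hence inner by a diagonal unit.\<close>

lemma out_scaling_eqI:
  assumes c: "\<And>alpha. c alpha \<noteq> 0" and d: "\<And>alpha. d alpha \<noteq> 0"
    and e: "\<And>z. z \<in> Q.cycles ==> Q.cochain_power c z = Q.cochain_power d z"
  shows "out (scaling c) = out (scaling d)"
proof -
  have q: "Q.cochain_power (\<lambda>alpha. c alpha / d alpha) z = 1" if z: "z \<in> Q.cycles" for z
  proof -
    have "Q.cochain_power (\<lambda>alpha. c alpha / d alpha) z = Q.cochain_power c z / Q.cochain_power d z"
      unfolding Q.cochain_power_def power_int_divide_distrib prod_dividef ..
    then show ?thesis using e[OF z] Q.cochain_power_nonzero[of d z] d by simp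
  qed
  have cd: "c alpha / d alpha \<noteq> 0" for alpha using c d by simp
  obtain tau where tau: "\<And>v. tau v \<noteq> 0" and taue: "\<And>e. e \<in> arcs Q ==> c e / d e = tau (tail Q e) / tau (head Q e)"
    by (rule Q.multiplicative_potential[of "\<lambda>alpha. c alpha / d alpha", OF cd q]) (assumption, rule that)
  have t: "tau (tail Q alpha) / tau (head Q alpha) \<noteq> 0" for alpha using tau by simp
  have dt: "d alpha * (tau (tail Q alpha) / tau (head Q alpha)) \<noteq> 0" for alpha using tau d by simp
  have "scaling d \<circ>\<^sub>A inn (diag tau) = scaling (\<lambda>alpha. d alpha * (tau (tail Q alpha) / tau (head Q alpha)))"
    unfolding inn_diag[OF tau] by (rule scaling_comp[OF d t])
  also have "\<dots> = scaling c"
  proof (rule scaling_cong[OF dt c])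
    fix alpha assume "alpha \<in> arcs Q"
    from taue[OF this, symmetric] show "d alpha * (tau (tail Q alpha) / tau (head Q alpha)) = c alpha" using d[of alpha] by simp
  qed
  finally have "scaling c = scaling d \<circ>\<^sub>A inn (diag tau)" ..
  moreover have "scaling c \<in> G" by (rule scaling_in_G) (rule c)
  moreover have "scaling d \<in> G" by (rule scaling_in_G) (rule d)
  moreover have "diag tau \<in> Units A" by (rule diag_Units(1)) (rule tau)
  ultimately show ?thesis using out_eq_iff[of "scaling d" "scaling c"] by blast
qed

text \<open>Exhibits the trivial subgroup as one of the closed subgroups above, so that a torus is
  available also for forests.\<close>

lemma scalings_all: "scalings Q.cycles = {\<one>\<^bsub>Out A\<^esub>}"
proof -
  have one: "\<one>\<^bsub>Out A\<^esub> = out (scaling (\<lambda>alpha. 1))" unfolding one_Out scaling_one ..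
  have "out (scaling c) = out (scaling (\<lambda>alpha. 1))"
    if "\<forall>alpha. c alpha \<noteq> 0" "\<forall>z\<in>Q.cycles. Q.cochain_power c z = 1" for c
    by (rule out_scaling_eqI) (use that in \<open>simp_all add: Q.cochain_power_def\<close>)
  then have "scalings Q.cycles \<subseteq> {\<one>\<^bsub>Out A\<^esub>}" unfolding one scalings_def by blast
  then show ?thesis using subgroup.one_closed[OF scalings_subgroup[of Q.cycles]] by blast
qed

section \<open>Regular functions on the outer automorphism group and the trivial torus\<close>

lemma Out_functionsI: "reg (\<lambda>phi. f (out phi)) ==> (\<lambda>X\<in>carrier (Out A). f X) \<in> Out_functions A"
  unfolding Out_functions_iff
proof
  assume r: "reg (\<lambda>phi. f (out phi))"
  show "reg (\<lambda>phi. restrict f (carrier (Out A)) (out phi))"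
    by (rule iffD2[OF reg_cong r]) simp
qed simp

lemma Out_functions_const: "(\<lambda>X\<in>carrier (Out A). c) \<in> Out_functions A"
  by (rule Out_functionsI[OF reg_const])

lemma Out_functions_add:
  "F \<in> Out_functions A ==> F' \<in> Out_functions A ==> (\<lambda>X\<in>carrier (Out A). F X + F' X) \<in> Out_functions A"
  by (rule Out_functionsI[OF reg_add]) (simp_all add: Out_functions_iff)

lemma Out_functions_mult:
  "F \<in> Out_functions A ==> F' \<in> Out_functions A ==> (\<lambda>X\<in>carrier (Out A). F X * F' X) \<in> Out_functions A"
  by (rule Out_functionsI[OF reg_mult]) (simp_all add: Out_functions_iff)

lemma torus_char_0I:
  assumes "closed_subgroup (Out A) (Out_functions A) H"
    and "algebraic_group_iso (Out A\<lparr>carrier := H\<rparr>) ((\<lambda>f. restrict f H) ` Out_functions A)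
      (diagonal_group n) (diagonal_group_functions n) h"
  shows "torus_char_0 A (HH1_lie_algebra_of A H)"
  unfolding torus_char_0_def
  using assms HH1_lie_algebra_of_lie_subalgebra[of H] unfolding closed_subgroup_def by blast

text \<open>The case of 0 by 0 matrices, a group with one element; it supplies the torus that the
  \<open>Max\<close> in \<open>mt_rank\<close> needs.\<close>

lemma trivial_torus_char_0: "torus_char_0 A (HH1_lie_algebra_of A {\<one>\<^bsub>Out A\<^esub>})"
proof (rule torus_char_0I)
  let ?H = "{\<one>\<^bsub>Out A\<^esub>}" and ?h = "\<lambda>X. 1\<^sub>m 0 :: 'k mat"
  show "closed_subgroup (Out A) (Out_functions A) ?H"
    using scalings_closed[of Q.cycles] unfolding scalings_all by simp
  have D: "carrier (diagonal_group 0) = {1\<^sub>m 0 :: 'k mat}"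
  proof -
    have "inverts_mat (1\<^sub>m 0) (1\<^sub>m 0 :: 'k mat)" by (simp add: inverts_mat_def)
    then have "invertible_mat (1\<^sub>m 0 :: 'k mat)" unfolding invertible_mat_def by auto
    moreover have "diagonal_mat (1\<^sub>m 0 :: 'k mat)" by (simp add: diagonal_mat_def)
    ultimately have "1\<^sub>m 0 \<in> carrier (diagonal_group 0 :: 'k mat monoid)" by (simp add: diagonal_group_def)
    moreover have "M = 1\<^sub>m 0" if "M \<in> carrier (diagonal_group 0)" for M :: "'k mat"
      using that by (intro eq_matI) (auto simp: diagonal_group_def)
    ultimately show ?thesis by blast
  qed
  have mm: "1\<^sub>m 0 \<otimes>\<^bsub>diagonal_group 0\<^esub> 1\<^sub>m 0 = (1\<^sub>m 0 :: 'k mat)" by (simp add: diagonal_group_def)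
  show "algebraic_group_iso (Out A\<lparr>carrier := ?H\<rparr>) ((\<lambda>f. restrict f ?H) ` Out_functions A)
      (diagonal_group 0) (diagonal_group_functions 0) ?h"
    unfolding algebraic_group_iso_def
  proof (intro conjI ballI)
    show "?h \<in> iso (Out A\<lparr>carrier := ?H\<rparr>) (diagonal_group 0)"
      unfolding iso_def hom_def by (simp add: D bij_betw_def mm)
    show "(\<lambda>x\<in>carrier (Out A\<lparr>carrier := ?H\<rparr>). f (?h x)) \<in> (\<lambda>f. restrict f ?H) ` Out_functions A" for f
      by (rule image_eqI[OF _ Out_functions_const[of "f (1\<^sub>m 0)"]]) (auto simp: restrict_def fun_eq_iff)
    show "(\<lambda>y\<in>carrier (diagonal_group 0). f (inv_into (carrier (Out A\<lparr>carrier := ?H\<rparr>)) ?h y)) \<in> diagonal_group_functions 0" for f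
    proof -
      have "(\<lambda>y\<in>carrier (diagonal_group 0). f (inv_into (carrier (Out A\<lparr>carrier := ?H\<rparr>)) ?h y)) =
        (\<lambda>y\<in>carrier (diagonal_group 0). f (inv_into (carrier (Out A\<lparr>carrier := ?H\<rparr>)) ?h (1\<^sub>m 0)))"
        by (rule restrict_ext) (simp add: D)
      then show ?thesis unfolding diagonal_group_functions_def by (simp only: function_algebra.const)
    qed
  qed
qed

lemma mt_rank_forest:
  assumes forest: "\<forall>z\<in>Q.cycles. \<forall>e\<in>arcs Q. z e = 0"
  shows "mt_rank A = 0"
proof (cases "CHAR('k) = 0")
  case True
  then have "torus A (HH1_lie_algebra_of A {\<one>\<^bsub>Out A\<^esub>})"
    unfolding torus_def using trivial_torus_char_0 by simp
  then show ?thesis by (rule mt_rank_zero[OF forest_HH1_trivial[OF forest]])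
next
  case False
  then have "torus A {\<zero>\<^bsub>HH1 A\<^esub>}"
    by (intro trivial_torus_char_p forest_HH1_trivial[OF forest]) simp
  then show ?thesis by (rule mt_rank_zero[OF forest_HH1_trivial[OF forest]])
qed

end

section \<open>Laurent polynomial functions\<close>

text \<open>A presentation of \<open>g\<close> as a polynomial divided by a power of the variable,
  on nonzero arguments only; it is not normalised, so one function has many presentations.\<close>

definition laurent_repr :: "('k::field => 'k) => nat => 'k poly => bool" where
  "laurent_repr g n p \<longleftrightarrow> (\<forall>x. x \<noteq> 0 \<longrightarrow> x ^ n * g x = poly p x)"

definition laurent :: "('k::field => 'k) => bool" where
  "laurent g \<longleftrightarrow> (\<exists>n p. laurent_repr g n p)"

text \<open>Formal derivative at 1 of \<open>p\<close> divided by the \<open>n\<close>-th power of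
  the variable. \<open>THE\<close> is justified over an infinite field, where the value does not
  depend on the presentation.\<close>

definition laurent_deriv :: "('k::field => 'k) => 'k" where
  "laurent_deriv g = (THE d. \<exists>n p. laurent_repr g n p \<and> d = poly (pderiv p) 1 - of_nat n * poly p 1)"

lemma laurent_reprE:
  assumes "laurent g" obtains n p where "laurent_repr g n p"
  using assms unfolding laurent_def by blast

lemma laurent_repr_cong: "(\<And>x. x \<noteq> 0 ==> g x = h x) ==> laurent_repr g n p = laurent_repr h n p"
  by (auto simp: laurent_repr_def)

lemma laurent_cong: "laurent f ==> (\<And>x. x \<noteq> 0 ==> f x = h x) ==> laurent h"
  unfolding laurent_def using laurent_repr_cong[of f h] by blast

lemma laurent_deriv_cong: "(\<And>x. x \<noteq> 0 ==> g x = h x) ==> laurent_deriv g = laurent_deriv h"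
  unfolding laurent_deriv_def using laurent_repr_cong[of g h] by simp

lemma laurent_repr_poly: "(\<And>x. x \<noteq> 0 ==> g x = poly p x) ==> laurent_repr g 0 p"
  by (simp add: laurent_repr_def)

lemma laurent_repr_poly_inverse: "(\<And>x. x \<noteq> 0 ==> g x = poly p (inverse x)) ==> laurent_repr g (degree p) (reflect_poly p)"
  by (simp add: laurent_repr_def poly_reflect_poly_nz)

lemma laurent_repr_add:
  "laurent_repr g n p ==> laurent_repr h m q ==> laurent_repr (\<lambda>x. g x + h x) (n + m) (monom 1 m * p + monom 1 n * q)"
  unfolding laurent_repr_def poly_add poly_mult poly_monom power_add by (simp add: algebra_simps)

lemma laurent_repr_mult:
  "laurent_repr g n p ==> laurent_repr h m q ==> laurent_repr (\<lambda>x. g x * h x) (n + m) (p * q)"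
  unfolding laurent_repr_def poly_mult power_add by (metis (no_types, opaque_lifting) mult.assoc mult.left_commute)

lemma laurent_repr_cmult: "laurent_repr g n p ==> laurent_repr (\<lambda>x. c * g x) n (Polynomial.smult c p)"
  unfolding laurent_repr_def poly_smult by (metis mult.left_commute)

lemma poly_eq_infinite:
  fixes p q :: "'k::field poly"
  assumes inf: "infinite (UNIV :: 'k set)" and e: "\<And>x. poly p x = poly q x"
  shows "p = q"
proof (rule ccontr)
  assume "p \<noteq> q"
  then have "finite {x. poly (p - q) x = 0}" by (intro poly_roots_finite) simp
  then show False using inf e by simp
qed

lemma laurent_deriv_eq:
  assumes inf: "infinite (UNIV :: 'k::field set)" and r: "laurent_repr (g :: 'k => 'k) n p"
  shows "laurent_deriv g = poly (pderiv p) 1 - of_nat n * poly p 1"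
  unfolding laurent_deriv_def
proof (rule the_equality)
  show "\<exists>n' p'. laurent_repr g n' p' \<and> poly (pderiv p) 1 - of_nat n * poly p 1 = poly (pderiv p') 1 - of_nat n' * poly p' 1"
    using r by blast
  fix d assume "\<exists>m q. laurent_repr g m q \<and> d = poly (pderiv q) 1 - of_nat m * poly q 1"
  then obtain m q where q: "laurent_repr g m q" and d: "d = poly (pderiv q) 1 - of_nat m * poly q 1" by blast
  \<comment> \<open>Cross-multiplication of the two presentations. The additional factor of the
    variable makes the identity true at 0 too, so the polynomials agree everywhere and their
    derivatives at 1 can be compared.\<close>
  have "poly (monom 1 (Suc m) * p) x = poly (monom 1 (Suc n) * q) x" for x
  proof (cases "x = 0")
    case False
    have "poly p x = x ^ n * g x" "poly q x = x ^ m * g x" using r q False by (auto simp: laurent_repr_def)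
    then show ?thesis by (simp add: poly_monom algebra_simps)
  qed (simp add: poly_monom)
  then have "monom 1 (Suc m) * p = monom 1 (Suc n) * q" by (rule poly_eq_infinite[OF inf])
  then have "poly (pderiv (monom 1 (Suc m) * p)) 1 = poly (pderiv (monom 1 (Suc n) * q)) 1" by simp
  moreover have "poly p 1 = g 1" "poly q 1 = g 1" using r q by (auto simp: laurent_repr_def dest: spec[of _ 1])
  ultimately show "d = poly (pderiv p) 1 - of_nat n * poly p 1"
    unfolding d by (simp add: pderiv_mult pderiv_monom poly_monom algebra_simps)
qed

lemma laurent_deriv_add:
  assumes inf: "infinite (UNIV :: 'k::field set)" and "laurent (g :: 'k => 'k)" "laurent h"
  shows "laurent_deriv (\<lambda>x. g x + h x) = laurent_deriv g + laurent_deriv h"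
proof -
  obtain n p m q where r: "laurent_repr g n p" "laurent_repr h m q" using assms(2,3) by (blast elim: laurent_reprE)
  show ?thesis
    unfolding laurent_deriv_eq[OF inf r(1)] laurent_deriv_eq[OF inf r(2)] laurent_deriv_eq[OF inf laurent_repr_add[OF r]]
    by (simp add: pderiv_add pderiv_mult pderiv_monom poly_monom algebra_simps)
qed

lemma laurent_deriv_mult:
  assumes inf: "infinite (UNIV :: 'k::field set)" and "laurent (g :: 'k => 'k)" "laurent h"
  shows "laurent_deriv (\<lambda>x. g x * h x) = g 1 * laurent_deriv h + laurent_deriv g * h 1"
proof -
  obtain n p m q where r: "laurent_repr g n p" "laurent_repr h m q" using assms(2,3) by (blast elim: laurent_reprE)
  have v: "poly p 1 = g 1" "poly q 1 = h 1" using r by (auto simp: laurent_repr_def dest: spec[of _ 1])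
  show ?thesis
    unfolding laurent_deriv_eq[OF inf r(1)] laurent_deriv_eq[OF inf r(2)] laurent_deriv_eq[OF inf laurent_repr_mult[OF r]]
    by (simp add: pderiv_mult v algebra_simps)
qed

lemma laurent_deriv_cmult:
  assumes inf: "infinite (UNIV :: 'k::field set)" and "laurent (g :: 'k => 'k)"
  shows "laurent_deriv (\<lambda>x. c * g x) = c * laurent_deriv g"
proof -
  obtain n p where r: "laurent_repr g n p" using assms(2) by (blast elim: laurent_reprE)
  show ?thesis
    unfolding laurent_deriv_eq[OF inf r] laurent_deriv_eq[OF inf laurent_repr_cmult[OF r]]
    by (simp add: pderiv_smult algebra_simps)
qed

lemma infinite_UNIV_CHAR_0:
  assumes "CHAR('k::field) = 0" shows "infinite (UNIV :: 'k set)"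
proof -
  have "inj (of_nat :: nat => 'k)"
  proof (rule linorder_injI)
    fix m n :: nat assume "m < n"
    then have "of_nat n = of_nat m + (of_nat (n - m) :: 'k)" by (simp flip: of_nat_add)
    moreover have "of_nat (n - m) \<noteq> (0 :: 'k)" 
      unfolding of_nat_eq_0_iff_char_dvd assms using \<open>m < n\<close> by simp
    ultimately show "of_nat m \<noteq> (of_nat n :: 'k)" by simp
  qed
  then show ?thesis using finite_subset[OF subset_UNIV, of "range (of_nat :: nat => 'k)"] finite_imageD by blast
qed

section \<open>The one-dimensional torus attached to a cycle\<close>

definition mat1 :: "'k => 'k mat" where "mat1 x = mat 1 1 (\<lambda>_. x)"

lemma mat1_index [simp]: "mat1 x $$ (0, 0) = x" by (simp add: mat1_def)
lemma mat1_in [simp]: "mat1 x \<in> carrier_mat 1 1" by (simp add: mat1_def)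
lemma mat1_eq: "M \<in> carrier_mat 1 1 ==> M = mat1 (M $$ (0, 0))" by (intro eq_matI) (auto simp: mat1_def)
lemma mat1_mult: "mat1 (x::'k::comm_ring_1) * mat1 y = mat1 (x * y)"
  by (intro eq_matI) (auto simp: mat1_def scalar_prod_def)
lemma det_mat1: "det (mat1 (x::'k::comm_ring_1)) = x"
  using det_single[OF mat1_in, of x] by simp
lemma mat1_one: "mat1 1 = (1\<^sub>m 1 :: 'k::comm_ring_1 mat)" by (intro eq_matI) (auto simp: mat1_def)

lemma carrier_diagonal_group_1: "carrier (diagonal_group 1) = mat1 ` (UNIV - {0 :: 'k::field})"
proof (intro equalityI subsetI)
  fix M :: "'k mat" assume "M \<in> carrier (diagonal_group 1)"
  then have M: "M \<in> carrier_mat 1 1" and i: "invertible_mat M" by (simp_all add: diagonal_group_def)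
  obtain B where B: "inverts_mat M B" "inverts_mat B M" using i by (auto simp: invertible_mat_def)
  have "dim_col B = 1" "dim_row B = 1"
    using B M unfolding inverts_mat_def by (metis carrier_matD index_mult_mat(2,3) index_one_mat(2,3))+
  then have Bc: "B \<in> carrier_mat 1 1" by auto
  have "mat1 (M $$ (0, 0) * B $$ (0, 0)) = mat1 1"
    using B(1) M unfolding mat1_mult[symmetric] mat1_eq[OF M, symmetric] mat1_eq[OF Bc, symmetric] mat1_one
    by (simp add: inverts_mat_def)
  then have "M $$ (0, 0) * B $$ (0, 0) = 1" by (metis mat1_index)
  then have "M $$ (0, 0) \<noteq> 0" by auto
  then show "M \<in> mat1 ` (UNIV - {0})" using mat1_eq[OF M] by blast
next
  fix M :: "'k mat" assume "M \<in> mat1 ` (UNIV - {0})"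
  then obtain x where x: "M = mat1 x" "x \<noteq> 0" by blast
  have "inverts_mat (mat1 x) (mat1 (inverse x))" "inverts_mat (mat1 (inverse x)) (mat1 x)"
    using x(2) by (simp_all add: inverts_mat_def mat1_mult mat1_one) (simp_all add: mat1_def)
  then have "invertible_mat (mat1 x)" unfolding invertible_mat_def by (auto simp: mat1_def)
  then show "M \<in> carrier (diagonal_group 1)"
    unfolding x(1) diagonal_group_def by (auto simp: diagonal_mat_def) (simp_all add: mat1_def)
qed

text \<open>The coordinate ring of the multiplicative group is the ring of Laurent polynomials; this
  is the inclusion that the isomorphism needs.\<close>

lemma laurent_diagonal_group_function:
  assumes "laurent (g :: 'k::field => 'k)"
  shows "(\<lambda>M\<in>carrier (diagonal_group 1). g (M $$ (0, 0))) \<in> diagonal_group_functions 1"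
proof -
  let ?D = "carrier (diagonal_group 1) :: 'k mat set" and ?A = "diagonal_group_functions 1 :: ('k mat => 'k) set"
  have cong: "(\<lambda>M\<in>?D. f M) \<in> ?A" if "(\<lambda>M\<in>?D. f' M) \<in> ?A" "\<And>M. M \<in> ?D ==> f' M = f M" for f f'
    using that(1) restrict_ext[of ?D f' f] that(2) by simp
  have mult: "(\<lambda>M\<in>?D. f M * f' M) \<in> ?A" if "(\<lambda>M\<in>?D. f M) \<in> ?A" "(\<lambda>M\<in>?D. f' M) \<in> ?A" for f f'
    by (rule cong[OF function_algebra.mult[OF that[unfolded diagonal_group_functions_def], folded diagonal_group_functions_def]]) simp
  have add: "(\<lambda>M\<in>?D. f M + f' M) \<in> ?A" if "(\<lambda>M\<in>?D. f M) \<in> ?A" "(\<lambda>M\<in>?D. f' M) \<in> ?A" for f f'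
    by (rule cong[OF function_algebra.add[OF that[unfolded diagonal_group_functions_def], folded diagonal_group_functions_def]]) simp
  have const: "(\<lambda>M\<in>?D. c) \<in> ?A" for c unfolding diagonal_group_functions_def by (rule function_algebra.const)
  have x: "(\<lambda>M\<in>?D. M $$ (0, 0)) \<in> ?A"
    unfolding diagonal_group_functions_def by (rule function_algebra.gen) auto
  have "(\<lambda>M\<in>?D. inverse (det M)) \<in> ?A"
    unfolding diagonal_group_functions_def by (rule function_algebra.gen) auto
  then have i: "(\<lambda>M\<in>?D. inverse (M $$ (0, 0))) \<in> ?A"
  proof (rule cong)
    fix M :: "'k mat" assume "M \<in> ?D"
    then obtain x where "M = mat1 x" unfolding carrier_diagonal_group_1 by blast
    then show "inverse (det M) = inverse (M $$ (0, 0))" by (simp add: det_mat1)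
  qed
  have poly: "(\<lambda>M\<in>?D. poly p (M $$ (0, 0))) \<in> ?A" for p
  proof (induction p rule: pCons_induct)
    case 0
    show ?case unfolding poly_0 by (rule const)
  next
    case (pCons a p)
    show ?case unfolding poly_pCons by (rule add[OF const mult[OF x pCons.IH]])
  qed
  have ipow: "(\<lambda>M\<in>?D. inverse (M $$ (0, 0)) ^ n) \<in> ?A" for n
  proof (induction n)
    case 0
    show ?case unfolding power_0 by (rule const)
  next
    case (Suc n)
    show ?case unfolding power_Suc by (rule mult[OF i Suc.IH])
  qed
  obtain n p where r: "laurent_repr g n p" by (rule laurent_reprE[OF assms])
  show ?thesis
  proof (rule cong[OF mult[OF ipow[of n] poly[of p]]])
    fix M :: "'k mat" assume "M \<in> ?D"
    then obtain y where y: "M = mat1 y" "y \<noteq> 0" unfolding carrier_diagonal_group_1 by blast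
    have "poly p y = y ^ n * g y" using r y(2) by (simp add: laurent_repr_def)
    then show "inverse (M $$ (0, 0)) ^ n * poly p (M $$ (0, 0)) = g (M $$ (0, 0))"
      using y by (simp add: power_inverse)
  qed
qed

context path_quotient
begin

definition theta :: "'e => 'k => 'a => 'a" where
  "theta alpha x = scaling (\<lambda>beta. if beta = alpha then x else 1)"

lemma theta_in_G [simp]: "x \<noteq> 0 ==> theta alpha x \<in> G"
  unfolding theta_def by (rule scaling_in_G) simp

lemma theta_comp: "x \<noteq> 0 ==> y \<noteq> 0 ==> theta alpha x \<circ>\<^sub>A theta alpha y = theta alpha (x * y)"
proof -
  assume x: "x \<noteq> 0" and y: "y \<noteq> 0"
  have "(\<lambda>beta. (if beta = alpha then x else 1) * (if beta = alpha then y else 1)) = (\<lambda>beta. if beta = alpha then x * y else 1)"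
    by (rule ext) simp
  then show ?thesis
    unfolding theta_def using scaling_comp[of "\<lambda>beta. if beta = alpha then x else 1" "\<lambda>beta. if beta = alpha then y else 1"] x y by simp
qed

lemma theta_one: "theta alpha 1 = idA"
  unfolding theta_def using scaling_one by simp

lemma theta_inv: "x \<noteq> 0 ==> aut_inv (theta alpha x) = theta alpha (inverse x)"
  by (rule Aut.inv_equality) (simp_all add: theta_comp theta_one)

lemma theta_cochain_power:
  assumes alpha: "alpha \<in> arcs Q"
  shows "Q.cochain_power (\<lambda>beta. if beta = alpha then x else 1) z = x powi z alpha"
proof -
  have "Q.cochain_power (\<lambda>beta. if beta = alpha then x else 1) z = (\<Prod>beta\<in>arcs Q. if beta = alpha then x powi z alpha else 1)"
    unfolding Q.cochain_power_def by (rule prod.cong) auto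
  then show ?thesis using alpha by simp
qed

text \<open>Polynomiality and the value of the derivative are proved in one induction because both
  must concern the same polynomial. On a path containing \<open>alpha\<close> exactly
  \<open>k\<close> times it is a multiple of the \<open>k\<close>-th power of the variable, and the
  derivative at 1 gives the factor \<open>k\<close> of \<open>counting\<close>.\<close>

lemma theta_coefficient:
  assumes a: "a \<in> carrier A"
  shows "\<forall>l. functional l \<longrightarrow> (\<exists>p. (\<forall>x. x \<noteq> 0 \<longrightarrow> l (theta alpha x a) = poly p x) \<and> poly (pderiv p) 1 = l (counting alpha a))"
  using a
proof (rule span_induct)
  note cnt = derivation_linear[OF counting_derivation, of alpha]
  show "\<forall>l. functional l \<longrightarrow> (\<exists>p. (\<forall>x. x \<noteq> 0 \<longrightarrow> l (theta alpha x \<zero>) = poly p x) \<and> poly (pderiv p) 1 = l (counting alpha \<zero>))"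
    by (intro allI impI exI[of _ 0])
      (simp add: linear_map_zero[OF aut_linear[OF theta_in_G]] linear_map_zero[OF cnt] functional_zero)
  fix c x y
  assume x: "x \<in> carrier A"
    and Px: "\<forall>l. functional l \<longrightarrow> (\<exists>p. (\<forall>t. t \<noteq> 0 \<longrightarrow> l (theta alpha t x) = poly p t) \<and> poly (pderiv p) 1 = l (counting alpha x))"
  show "\<forall>l. functional l \<longrightarrow> (\<exists>p. (\<forall>t. t \<noteq> 0 \<longrightarrow> l (theta alpha t (c \<odot> x)) = poly p t) \<and> poly (pderiv p) 1 = l (counting alpha (c \<odot> x)))"
  proof (intro allI impI)
    fix l assume l: "functional l"
    then obtain p where p: "\<forall>t. t \<noteq> 0 \<longrightarrow> l (theta alpha t x) = poly p t" "poly (pderiv p) 1 = l (counting alpha x)"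
      using Px by blast
    show "\<exists>p. (\<forall>t. t \<noteq> 0 \<longrightarrow> l (theta alpha t (c \<odot> x)) = poly p t) \<and> poly (pderiv p) 1 = l (counting alpha (c \<odot> x))"
      by (intro exI[of _ "Polynomial.smult c p"])
        (use p x in \<open>simp add: linear_map_smult[OF aut_linear[OF theta_in_G]] linear_map_smult[OF cnt]
          functional_smult[OF l] linear_map_closed[OF cnt] pderiv_smult\<close>)
  qed
  assume y: "y \<in> carrier A"
    and Py: "\<forall>l. functional l \<longrightarrow> (\<exists>p. (\<forall>t. t \<noteq> 0 \<longrightarrow> l (theta alpha t y) = poly p t) \<and> poly (pderiv p) 1 = l (counting alpha y))"
  show "\<forall>l. functional l \<longrightarrow> (\<exists>p. (\<forall>t. t \<noteq> 0 \<longrightarrow> l (theta alpha t (x \<oplus> y)) = poly p t) \<and> poly (pderiv p) 1 = l (counting alpha (x \<oplus> y)))"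
  proof (intro allI impI)
    fix l assume l: "functional l"
    then obtain p where p: "\<forall>t. t \<noteq> 0 \<longrightarrow> l (theta alpha t x) = poly p t" "poly (pderiv p) 1 = l (counting alpha x)"
      using Px by blast
    obtain q where q: "\<forall>t. t \<noteq> 0 \<longrightarrow> l (theta alpha t y) = poly q t" "poly (pderiv q) 1 = l (counting alpha y)"
      using Py l by blast
    show "\<exists>p. (\<forall>t. t \<noteq> 0 \<longrightarrow> l (theta alpha t (x \<oplus> y)) = poly p t) \<and> poly (pderiv p) 1 = l (counting alpha (x \<oplus> y))"
      by (intro exI[of _ "p + q"])
        (use p q x y in \<open>simp add: linear_map_add[OF aut_linear[OF theta_in_G]] linear_map_add[OF cnt]
          functional_add[OF l] linear_map_closed[OF cnt] pderiv_add\<close>)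
  qed
next
  fix p assume p: "p \<in> qpaths Q"
  define k where "k = count (mset (path_arrows p)) alpha"
  have t: "theta alpha x (cl p) = x ^ k \<odot> cl p" for x
  proof -
    have "(\<Prod>beta\<in>#M. if beta = alpha then x else 1) = x ^ count M alpha" for M by (induction M) auto
    then show ?thesis unfolding theta_def scaling_cl[OF p] k_def by simp
  qed
  show "\<forall>l. functional l \<longrightarrow> (\<exists>q. (\<forall>x. x \<noteq> 0 \<longrightarrow> l (theta alpha x (cl p)) = poly q x) \<and> poly (pderiv q) 1 = l (counting alpha (cl p)))"
  proof (intro allI impI)
    fix l assume l: "functional l"
    show "\<exists>q. (\<forall>x. x \<noteq> 0 \<longrightarrow> l (theta alpha x (cl p)) = poly q x) \<and> poly (pderiv q) 1 = l (counting alpha (cl p))"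
      by (intro exI[of _ "monom (l (cl p)) k"])
        (simp add: t counting_cl[OF p] k_def[symmetric] functional_smult[OF l cl_in[OF p]] poly_monom pderiv_monom)
  qed
qed

lemma theta_laurent: "reg f ==> laurent (\<lambda>x. f (theta alpha x))"
proof (induction rule: reg_induct)
  case (cong f g)
  show ?case by (rule laurent_cong[OF cong(1)]) (simp add: cong(2))
next
  case (const c)
  have "laurent_repr (\<lambda>x. c) 0 [:c:]" by (rule laurent_repr_poly) simp
  then show ?case unfolding laurent_def by blast
next
  case (coeff l a)
  then obtain p where "\<forall>x. x \<noteq> 0 \<longrightarrow> l (theta alpha x a) = poly p x" using theta_coefficient by blast
  then have "laurent_repr (\<lambda>x. l (theta alpha x a)) 0 p" by (intro laurent_repr_poly) simp
  then show ?case unfolding laurent_def by blast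
next
  case (inv_coeff l a)
  then obtain p where "\<forall>x. x \<noteq> 0 \<longrightarrow> l (theta alpha x a) = poly p x" using theta_coefficient by blast
  then have "laurent_repr (\<lambda>x. l (aut_inv (theta alpha x) a)) (degree p) (reflect_poly p)"
    by (intro laurent_repr_poly_inverse) (simp add: theta_inv)
  then show ?case unfolding laurent_def by blast
next
  case (add f g)
  then show ?case unfolding laurent_def using laurent_repr_add by blast
next
  case (mult f g)
  then show ?case unfolding laurent_def using laurent_repr_mult by blast
qed

text \<open>Velocity at 1 of the one-parameter subgroup \<open>theta alpha\<close>.\<close>

definition theta_tangent :: "'e => (('a => 'a) => 'k) => 'k" where
  "theta_tangent alpha = (\<lambda>f\<in>Aut_functions A. laurent_deriv (\<lambda>x. f (theta alpha x)))"

lemma theta_tangent_ev: "reg f ==> ev (theta_tangent alpha) f = laurent_deriv (\<lambda>x. f (theta alpha x))"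
proof -
  assume "reg f"
  then have "ev (theta_tangent alpha) f = laurent_deriv (\<lambda>x. restrict f G (theta alpha x))"
    by (simp only: ev_def theta_tangent_def reg_def restrict_apply')
  also have "\<dots> = laurent_deriv (\<lambda>x. f (theta alpha x))" by (rule laurent_deriv_cong) simp
  finally show ?thesis .
qed

lemma theta_tangent:
  assumes inf: "infinite (UNIV :: 'k set)"
  shows "derivation_tangent A (counting alpha) (theta_tangent alpha)"
  unfolding derivation_tangent_iff
proof (intro conjI allI impI ballI)
  show "tangent (theta_tangent alpha)"
  proof (rule tangentI)
    show "theta_tangent alpha \<in> extensional (Aut_functions A)" unfolding theta_tangent_def by simp
    fix f g assume f: "reg f" and g: "reg g"
    note L = theta_laurent[OF f, of alpha] theta_laurent[OF g, of alpha]
    show "ev (theta_tangent alpha) (\<lambda>phi. f phi + g phi) = ev (theta_tangent alpha) f + ev (theta_tangent alpha) g"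
      unfolding theta_tangent_ev[OF f] theta_tangent_ev[OF g] theta_tangent_ev[OF reg_add[OF f g]]
      by (rule laurent_deriv_add[OF inf L])
    show "ev (theta_tangent alpha) (\<lambda>phi. f phi * g phi) = f idA * ev (theta_tangent alpha) g + ev (theta_tangent alpha) f * g idA"
      unfolding theta_tangent_ev[OF f] theta_tangent_ev[OF g] theta_tangent_ev[OF reg_mult[OF f g]]
      using laurent_deriv_mult[OF inf L] unfolding theta_one .
  next
    fix c f assume f: "reg f"
    show "ev (theta_tangent alpha) (\<lambda>phi. c * f phi) = c * ev (theta_tangent alpha) f"
      unfolding theta_tangent_ev[OF f] theta_tangent_ev[OF reg_mult[OF reg_const f]]
      by (rule laurent_deriv_cmult[OF inf theta_laurent[OF f]])
  qed
  fix l a assume l: "functional l" and a: "a \<in> carrier A"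
  obtain p where p: "\<forall>x. x \<noteq> 0 \<longrightarrow> l (theta alpha x a) = poly p x" "poly (pderiv p) 1 = l (counting alpha a)"
    using theta_coefficient[OF a] l by blast
  have "laurent_repr (\<lambda>x. l (theta alpha x a)) 0 p" using p(1) by (intro laurent_repr_poly) simp
  then show "ev (theta_tangent alpha) (\<lambda>phi. l (phi a)) = l (counting alpha a)"
    unfolding theta_tangent_ev[OF reg_coeff[OF l a]] using laurent_deriv_eq[OF inf] p(2) by fastforce
qed

text \<open>A cochain that is trivial on the cycles avoiding \<open>alpha\<close> is determined on
  all cycles by its value on \<open>z\<close>, and this value is the parameter of the one-parameter
  subgroup.\<close>

lemma scalings_theta:
  assumes z: "z \<in> Q.cycles" "z alpha = 1" and alpha: "alpha \<in> arcs Q"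
  shows "scalings {y \<in> Q.cycles. y alpha = 0} = {out (theta alpha x) |x. x \<noteq> 0}"
proof (intro equalityI subsetI)
  fix X assume "X \<in> scalings {y \<in> Q.cycles. y alpha = 0}"
  then obtain c where c: "\<And>beta. c beta \<noteq> 0" "\<And>y. y \<in> Q.cycles ==> y alpha = 0 ==> Q.cochain_power c y = 1"
    and X: "X = out (scaling c)" by (auto simp: scalings_def)
  define x where "x = Q.cochain_power c z"
  have x: "x \<noteq> 0" unfolding x_def by (rule Q.cochain_power_nonzero) (rule c(1))
  have "out (scaling c) = out (theta alpha x)"
    unfolding theta_def
  proof (rule out_scaling_eqI[OF c(1)])
    fix y assume y: "y \<in> Q.cycles"
    \<comment> \<open>Because \<open>z\<close> has coefficient 1 at \<open>alpha\<close>,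
      subtracting this multiple of \<open>z\<close> produces a cycle that avoids
      \<open>alpha\<close>.\<close>
    define y' where "y' e = y e - y alpha * z e" for e
    have y': "y' \<in> Q.cycles" "y' alpha = 0"
      using y z unfolding y'_def Q.cycles_def by (simp_all add: Q.boundary_diff Q.boundary_cmult)
    have "Q.cochain_power c y' = Q.cochain_power c y / Q.cochain_power c (\<lambda>e. y alpha * z e)"
      unfolding y'_def by (rule Q.cochain_power_diff) (rule c(1))
    moreover have "Q.cochain_power c (\<lambda>e. y alpha * z e) = x powi y alpha"
    proof -
      have "c e powi (y alpha * z e) = (c e powi z e) powi y alpha" for e
        by (simp add: power_int_mult mult.commute[of "y alpha"])
      then show ?thesis
        unfolding x_def Q.cochain_power_def by (simp add: prod_powi)
    qed
    moreover have "x powi y alpha \<noteq> 0" using x by simp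
    ultimately have "Q.cochain_power c y = x powi y alpha" using c(2)[OF y'] by simp
    then show "Q.cochain_power c y = Q.cochain_power (\<lambda>beta. if beta = alpha then x else 1) y"
      unfolding theta_cochain_power[OF alpha] .
  qed (use x in simp)
  then show "X \<in> {out (theta alpha x) |x. x \<noteq> 0}" using X x by blast
next
  fix X assume "X \<in> {out (theta alpha x) |x. x \<noteq> 0}"
  then obtain x where x: "X = out (theta alpha x)" "x \<noteq> 0" by blast
  have "Q.cochain_power (\<lambda>beta. if beta = alpha then x else 1) y = 1" if "y \<in> {y \<in> Q.cycles. y alpha = 0}" for y
    unfolding theta_cochain_power[OF alpha] using that by simp
  then show "X \<in> scalings {y \<in> Q.cycles. y alpha = 0}"
    unfolding scalings_def x(1) theta_def
    by (intro CollectI exI[of _ "\<lambda>beta. if beta = alpha then x else 1"] conjI allI ballI refl) (simp_all add: x(2))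
qed

lemma circ_theta: "x \<noteq> 0 ==> alpha \<in> arcs Q ==> circ z (theta alpha x) = x powi z alpha"
  using circ_graded[OF theta_in_G, of x "\<lambda>beta. if beta = alpha then x else 1" alpha z]
    gr_scaling[of "\<lambda>beta. if beta = alpha then x else 1"] theta_cochain_power[of alpha x z]
  by (simp add: theta_def)

text \<open>The circulation along \<open>z\<close> is a regular function on \<open>Out A\<close>
  that returns \<open>x\<close> on the class of \<open>theta alpha x\<close>, which makes the
  parametrisation an isomorphism of algebraic groups.\<close>

lemma theta_torus:
  assumes z: "z \<in> Q.cycles" "z alpha = 1" and alpha: "alpha \<in> arcs Q"
  shows "torus_char_0 A (HH1_lie_algebra_of A {out (theta alpha x) |x. x \<noteq> 0})"
proof -
  define H where "H = {out (theta alpha x) |x. x \<noteq> 0}"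
  \<comment> \<open>The circulation along the reversed cycle is a regular function that inverts the
    coordinate on \<open>H\<close>; inverting the function itself would not do, since it may vanish
    elsewhere on \<open>Out A\<close>.\<close>
  have mz: "(\<lambda>e. - z e) \<in> Q.cycles"
    using z(1) Q.boundary_cmult[of "-1" z] unfolding Q.cycles_def by simp
  obtain \<Lambda> where \<Lambda>: "\<Lambda> \<in> Out_functions A" "\<And>phi. phi \<in> G ==> \<Lambda> (out phi) = circ z phi"
    by (rule invariant_descends[OF reg_circ circ_inn[OF _ _ z(1)]]) (assumption+, rule that)
  obtain \<Lambda>' where \<Lambda>': "\<Lambda>' \<in> Out_functions A" "\<And>phi. phi \<in> G ==> \<Lambda>' (out phi) = circ (\<lambda>e. - z e) phi"
    by (rule invariant_descends[OF reg_circ circ_inn[OF _ _ mz]]) (assumption+, rule that)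
  have \<Lambda>x: "\<Lambda> (out (theta alpha x)) = x" "\<Lambda>' (out (theta alpha x)) = inverse x" if "x \<noteq> 0" for x
    using that \<Lambda>(2) \<Lambda>'(2) z(2) circ_theta[OF that alpha] by (simp_all add: power_int_minus)
  define h where "h X = mat1 (\<Lambda> X)" for X
  have hx: "h (out (theta alpha x)) = mat1 x" if "x \<noteq> 0" for x unfolding h_def \<Lambda>x(1)[OF that] ..
  have Hc: "H = (\<lambda>x. out (theta alpha x)) ` (UNIV - {0})" unfolding H_def by auto
  have HO: "X \<in> carrier (Out A)" if "X \<in> H" for X using that unfolding H_def by auto
  have inj: "inj_on h H"
  proof (rule inj_onI)
    fix X Y assume "X \<in> H" "Y \<in> H" and e: "h X = h Y"
    then obtain x y where x: "x \<noteq> 0" "X = out (theta alpha x)" and y: "y \<noteq> 0" "Y = out (theta alpha y)"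
      unfolding H_def by blast
    have "mat1 x = mat1 y" using e unfolding x(2) y(2) hx[OF x(1)] hx[OF y(1)] .
    then have "x = y" by (metis mat1_index)
    then show "X = Y" using x y by simp
  qed
  have im: "h ` H = carrier (diagonal_group 1)"
    unfolding Hc carrier_diagonal_group_1 image_image by (rule image_cong) (simp_all add: hx)
  have cH: "carrier (Out A\<lparr>carrier := H\<rparr>) = H" by simp
  show ?thesis
    unfolding H_def[symmetric]
  proof (rule torus_char_0I)
    show "closed_subgroup (Out A) (Out_functions A) H"
      unfolding H_def scalings_theta[OF z alpha, symmetric] by (rule scalings_closed) blast
    show "algebraic_group_iso (Out A\<lparr>carrier := H\<rparr>) ((\<lambda>f. restrict f H) ` Out_functions A)
      (diagonal_group 1) (diagonal_group_functions 1) h"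
      unfolding algebraic_group_iso_def cH
    proof (intro conjI ballI)
      show "h \<in> iso (Out A\<lparr>carrier := H\<rparr>) (diagonal_group 1)"
      proof (rule isoI)
        show "h \<in> hom (Out A\<lparr>carrier := H\<rparr>) (diagonal_group 1)"
        proof (rule homI)
          show "h X \<in> carrier (diagonal_group 1)" if "X \<in> carrier (Out A\<lparr>carrier := H\<rparr>)" for X
            using that im by auto
          fix X Y assume "X \<in> carrier (Out A\<lparr>carrier := H\<rparr>)" "Y \<in> carrier (Out A\<lparr>carrier := H\<rparr>)"
          then obtain x y where x: "x \<noteq> 0" "X = out (theta alpha x)" and y: "y \<noteq> 0" "Y = out (theta alpha y)"
            unfolding H_def by auto
          have "X \<otimes>\<^bsub>Out A\<^esub> Y = out (theta alpha (x * y))"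
            unfolding x(2) y(2) using x y by (simp add: out_mult theta_comp)
          then have "h (X \<otimes>\<^bsub>Out A\<^esub> Y) = mat1 x * mat1 y" using hx[of "x * y"] x y by (simp add: mat1_mult)
          then show "h (X \<otimes>\<^bsub>Out A\<lparr>carrier := H\<rparr>\<^esub> Y) = h X \<otimes>\<^bsub>diagonal_group 1\<^esub> h Y"
            unfolding x(2) y(2) hx[OF x(1)] hx[OF y(1)] by (simp add: diagonal_group_def)
        qed
        show "bij_betw h (carrier (Out A\<lparr>carrier := H\<rparr>)) (carrier (diagonal_group 1))"
          using inj im by (simp add: bij_betw_def)
      qed
    next
      \<comment> \<open>A function on the matrix group has to be the restriction of a regular
        function on all of \<open>Out A\<close>; by induction it is enough to extend the matrix
        entry and the inverse determinant, by \<open>\<Lambda>\<close> and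
        \<open>\<Lambda>'\<close>.\<close>
      fix f :: "'k mat => 'k" assume "f \<in> diagonal_group_functions 1"
      then have "\<exists>F\<in>Out_functions A. \<forall>X\<in>H. F X = f (h X)"
        unfolding diagonal_group_functions_def
      proof (induction rule: function_algebra.induct)
        case (const c)
        show ?case
          by (rule bexI[OF _ Out_functions_const[of c]]) (use HO im in auto)
      next
        case (gen f)
        then consider "f = (\<lambda>M. M $$ (0, 0))" | "f = (\<lambda>M. inverse (det M))" by auto
        then show ?case
        proof cases
          case 1
          show ?thesis by (rule bexI[OF _ \<Lambda>(1)]) (use im in \<open>auto simp: 1 h_def\<close>)
        next
          case 2
          show ?thesis
          proof (rule bexI[OF _ \<Lambda>'(1)], rule ballI)
            fix X assume X: "X \<in> H"
            then obtain x where x: "x \<noteq> 0" "X = out (theta alpha x)" unfolding H_def by blast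
            have "h X \<in> carrier (diagonal_group 1)" using X im by blast
            then show "\<Lambda>' X = restrict f (carrier (diagonal_group 1)) (h X)"
              unfolding x(2) hx[OF x(1)] \<Lambda>x(2)[OF x(1)] 2 by (simp add: det_mat1)
          qed
        qed
      next
        case (add f g)
        then obtain F F' where F: "F \<in> Out_functions A" "\<forall>X\<in>H. F X = f (h X)"
          and F': "F' \<in> Out_functions A" "\<forall>X\<in>H. F' X = g (h X)" by blast
        show ?case
          by (rule bexI[OF _ Out_functions_add[OF F(1) F'(1)]]) (use HO im F(2) F'(2) in auto)
      next
        case (mult f g)
        then obtain F F' where F: "F \<in> Out_functions A" "\<forall>X\<in>H. F X = f (h X)"
          and F': "F' \<in> Out_functions A" "\<forall>X\<in>H. F' X = g (h X)" by blast
        show ?case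
          by (rule bexI[OF _ Out_functions_mult[OF F(1) F'(1)]]) (use HO im F(2) F'(2) in auto)
      qed
      then obtain F where F: "F \<in> Out_functions A" "\<And>X. X \<in> H ==> F X = f (h X)" by blast
      show "(\<lambda>X\<in>H. f (h X)) \<in> (\<lambda>f. restrict f H) ` Out_functions A"
        by (rule image_eqI[OF _ F(1)]) (rule restrict_ext, simp add: F(2))
    next
      fix f assume "f \<in> (\<lambda>f. restrict f H) ` Out_functions A"
      then obtain F where F: "F \<in> Out_functions A" "f = restrict F H" by blast
      have "reg (\<lambda>phi. F (out phi))" using F(1) by (simp add: Out_functions_iff)
      then have "laurent (\<lambda>x. F (out (theta alpha x)))" by (rule theta_laurent)
      then have "(\<lambda>M\<in>carrier (diagonal_group 1). F (out (theta alpha (M $$ (0, 0))))) \<in> diagonal_group_functions 1"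
        by (rule laurent_diagonal_group_function)
      moreover have "(\<lambda>M\<in>carrier (diagonal_group 1). f (inv_into H h M)) =
        (\<lambda>M\<in>carrier (diagonal_group 1). F (out (theta alpha (M $$ (0, 0)))))"
      proof (rule restrict_ext)
        fix M :: "'k mat" assume "M \<in> carrier (diagonal_group 1)"
        then obtain x where x: "M = mat1 x" "x \<noteq> 0" unfolding carrier_diagonal_group_1 by blast
        have m: "out (theta alpha x) \<in> H" unfolding H_def using x(2) by blast
        have "inv_into H h M = out (theta alpha x)" by (rule inv_into_f_eq[OF inj m]) (simp add: hx x)
        then show "f (inv_into H h M) = F (out (theta alpha (M $$ (0, 0))))" using m by (simp add: F(2) x(1))
      qed
      ultimately show "(\<lambda>M\<in>carrier (diagonal_group 1). f (inv_into H h M)) \<in> diagonal_group_functions 1" by simp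
    qed
  qed
qed

lemma mt_rank_nonforest:
  assumes z: "z \<in> Q.cycles" "z alpha = 1" and alpha: "alpha \<in> arcs Q"
  shows "mt_rank A \<noteq> 0"
proof (cases "CHAR('k) = 0")
  case True
  note inf = infinite_UNIV_CHAR_0[OF True]
  define H where "H = {out (theta alpha x) |x. x \<noteq> 0}"
  have T: "torus A (HH1_lie_algebra_of A H)"
    unfolding torus_def H_def using True theta_torus[OF z alpha] by simp
  have "annihilates H (theta_tangent alpha)"
    unfolding annihilates_def
  proof (intro ballI impI)
    fix F assume F: "F \<in> Out_functions A" and F0: "\<forall>X\<in>H. F X = 0"
    have "ev (theta_tangent alpha) (\<lambda>phi. F (out phi)) = laurent_deriv (\<lambda>x. F (out (theta alpha x)))"
      by (rule theta_tangent_ev) (use F in \<open>simp add: Out_functions_iff\<close>)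
    also have "\<dots> = 0"
    \<comment> \<open>Along the one-parameter subgroup \<open>F\<close> is identically zero, so it
      has the presentation by the zero polynomial.\<close>
    proof -
      have "laurent_repr (\<lambda>x. F (out (theta alpha x))) 0 0"
        using F0 by (intro laurent_repr_poly) (auto simp: H_def)
      then show ?thesis using laurent_deriv_eq[OF inf] by fastforce
    qed
    finally show "ev (theta_tangent alpha) (\<lambda>phi. F (out phi)) = 0" .
  qed
  then have "H.cls (counting alpha) \<in> HH1_lie_algebra_of A H"
    by (rule HH1_lie_algebra_of_memI[OF counting_derivation theta_tangent[OF inf]])
  then show ?thesis by (rule mt_rank_pos[OF T _ cls_counting_nonzero[OF z alpha]])
next
  case False
  then show ?thesis by (intro mt_rank_nonforest_char_p[OF _ z alpha]) simp
qed

end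

section \<open>Path algebras\<close>

abbreviation (input) psingle where "psingle \<equiv> Poly_Mapping.single"
abbreviation (input) pkeys where "pkeys \<equiv> Poly_Mapping.keys"
abbreviation (input) plookup where "plookup \<equiv> Poly_Mapping.lookup"
abbreviation (input) pmap where "pmap \<equiv> Poly_Mapping.map"

lemma poly_mapping_eq_sum:
  fixes f :: "'x \<Rightarrow>\<^sub>0 'b::comm_monoid_add"
  shows "f = (\<Sum>p\<in>pkeys f. psingle p (plookup f p))"
  by (rule poly_mapping_eqI) (simp add: lookup_sum lookup_single when_def not_in_keys_iff_lookup_eq_zero)

lemma keys_add_subset: "pkeys f \<subseteq> S ==> pkeys g \<subseteq> S ==> pkeys (f + g) \<subseteq> S"
  using Poly_Mapping.keys_add[of f g] by blast

lemma poly_mapping_keys_induct: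
  fixes f :: "'x \<Rightarrow>\<^sub>0 'b::comm_monoid_add"
  assumes f: "pkeys f \<subseteq> S" and zero: "P 0"
    and single: "\<And>p c. p \<in> S ==> P (psingle p c)"
    and add: "\<And>f g. pkeys f \<subseteq> S ==> pkeys g \<subseteq> S ==> P f ==> P g ==> P (f + g)"
  shows "P f"
proof -
  define s where "s J = (\<Sum>p\<in>J. psingle p (plookup f p))" for J
  have "finite J ==> J \<subseteq> S ==> pkeys (s J) \<subseteq> S \<and> P (s J)" for J
  proof (induction J rule: finite_induct)
    case empty
    then show ?case using zero by (simp add: s_def)
  next
    case (insert p J)
    have e: "s (insert p J) = psingle p (plookup f p) + s J"
      unfolding s_def using insert.hyps by simp
    have k: "pkeys (psingle p (plookup f p)) \<subseteq> S" using insert.prems by auto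
    have IH: "pkeys (s J) \<subseteq> S" "P (s J)" using insert by auto
    show ?case unfolding e using keys_add_subset[OF k IH(1)] add[OF k IH(1) single IH(2)] insert.prems by blast
  qed
  from this[OF finite_keys f] show ?thesis unfolding s_def poly_mapping_eq_sum[symmetric] ..
qed

definition path_prod :: "'k::comm_ring_1 => ('v, 'e) qpath => ('v, 'e) qpath => (('v, 'e) qpath \<Rightarrow>\<^sub>0 'k)" where
  "path_prod c p q = (if snd (snd p) = fst q
     then psingle (fst p, fst (snd p) @ fst (snd q), snd (snd q)) c else 0)"

lemma lookup_map_times: "plookup (pmap ((*) c) f) p = c * plookup (f :: 'x \<Rightarrow>\<^sub>0 'k::comm_ring_1) p"
  by (simp add: map.rep_eq when_def)

lemma map_path_mult: "pmap ((*) c) (path_mult p q) = path_prod c p q"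
  by (cases p; cases q) (auto simp: path_prod_def lookup_map_times lookup_single when_def intro!: poly_mapping_eqI)

lemma path_prod_zero [simp]: "path_prod 0 p q = 0" by (simp add: path_prod_def)
lemma path_prod_add: "path_prod (a + b) p q = path_prod a p q + path_prod b p q"
  by (simp add: path_prod_def single_add)

definition convolve :: "(('v, 'e) qpath \<Rightarrow>\<^sub>0 'k::comm_ring_1) => (('v, 'e) qpath \<Rightarrow>\<^sub>0 'k) => (('v, 'e) qpath \<Rightarrow>\<^sub>0 'k)" where
  "convolve f g = (\<Sum>p\<in>pkeys f. \<Sum>q\<in>pkeys g.
     path_prod (plookup f p * plookup g q) p q)"

text \<open>Sums over larger finite sets allow a common support for several arguments, from which
  additivity can be read off termwise.\<close>

lemma convolve_superset:
  assumes "finite S" "pkeys f \<subseteq> S" "finite R" "pkeys g \<subseteq> R"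
  shows "convolve f g = (\<Sum>p\<in>S. \<Sum>q\<in>R. path_prod (plookup f p * plookup g q) p q)"
proof -
  have "convolve f g = (\<Sum>p\<in>pkeys f. \<Sum>q\<in>R. path_prod (plookup f p * plookup g q) p q)"
    unfolding convolve_def
    by (intro sum.cong[OF refl] sum.mono_neutral_left) (use assms in \<open>auto simp: not_in_keys_iff_lookup_eq_zero\<close>)
  also have "\<dots> = (\<Sum>p\<in>S. \<Sum>q\<in>R. path_prod (plookup f p * plookup g q) p q)"
    by (rule sum.mono_neutral_left) (use assms in \<open>auto simp: not_in_keys_iff_lookup_eq_zero\<close>)
  finally show ?thesis .
qed

lemma convolve_add_left: "convolve (f + f') g = convolve f g + convolve f' g"
proof -
  define S where "S = pkeys f \<union> pkeys f'"
  have S: "finite S" "pkeys f \<subseteq> S" "pkeys f' \<subseteq> S" "pkeys (f + f') \<subseteq> S"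
    unfolding S_def using Poly_Mapping.keys_add[of f f'] by auto
  note R = finite_keys order.refl
  show ?thesis
    unfolding convolve_superset[OF S(1,2) R] convolve_superset[OF S(1,3) R] convolve_superset[OF S(1,4) R]
    by (simp add: lookup_add distrib_right path_prod_add sum.distrib)
qed

lemma convolve_add_right: "convolve f (g + g') = convolve f g + convolve f g'"
proof -
  define S where "S = pkeys g \<union> pkeys g'"
  have S: "finite S" "pkeys g \<subseteq> S" "pkeys g' \<subseteq> S" "pkeys (g + g') \<subseteq> S"
    unfolding S_def using Poly_Mapping.keys_add[of g g'] by auto
  note R = finite_keys order.refl
  show ?thesis
    unfolding convolve_superset[OF R S(1,2)] convolve_superset[OF R S(1,3)] convolve_superset[OF R S(1,4)]
    by (simp add: lookup_add distrib_left path_prod_add sum.distrib)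
qed

lemma convolve_zero [simp]: "convolve 0 g = 0" "convolve f 0 = 0" by (simp_all add: convolve_def)

lemma convolve_single: "convolve (psingle p a) (psingle q b) = path_prod (a * b) p q"
  by (subst convolve_superset[of "{p}" _ "{q}"]) auto

lemma convolve_assoc: "convolve (convolve f g) h = convolve f (convolve g h)"
proof (rule poly_mapping_keys_induct[of f UNIV])
  fix p :: "('a, 'b) qpath" and a :: 'c
  show "convolve (convolve (psingle p a) g) h = convolve (psingle p a) (convolve g h)"
  proof (rule poly_mapping_keys_induct[of g UNIV])
    fix q :: "('a, 'b) qpath" and b :: 'c
    show "convolve (convolve (psingle p a) (psingle q b)) h =
      convolve (psingle p a) (convolve (psingle q b) h)"
    proof (rule poly_mapping_keys_induct[of h UNIV])
      fix r :: "('a, 'b) qpath" and c :: 'c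
      show "convolve (convolve (psingle p a) (psingle q b)) (psingle r c) =
        convolve (psingle p a) (convolve (psingle q b) (psingle r c))"
        unfolding convolve_single by (simp add: path_prod_def convolve_single mult.assoc)
    qed (simp_all add: convolve_add_right)
  qed (simp_all add: convolve_add_right convolve_add_left)
qed (simp_all add: convolve_add_left)

lemma convolve_scale_left: "convolve (pmap ((*) c) f) g = pmap ((*) c) (convolve f g)"
  and convolve_scale_right: "convolve f (pmap ((*) c) g) = pmap ((*) c) (convolve f g)"
proof -
  have m: "pmap ((*) c) (f + g) = pmap ((*) c) f + pmap ((*) c) g"
    for f g :: "'x \<Rightarrow>\<^sub>0 'k::comm_ring_1" and c
    by (rule poly_mapping_eqI) (simp add: lookup_map_times lookup_add distrib_left)
  have s: "pmap ((*) c) (psingle p a) = psingle p (c * a)"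
    for p :: 'x and a c :: "'k::comm_ring_1"
    by (rule poly_mapping_eqI) (simp add: lookup_map_times lookup_single when_def)
  have m0: "pmap ((*) c) 0 = (0 :: 'x \<Rightarrow>\<^sub>0 'k)" for c :: "'k::comm_ring_1"
    by (rule poly_mapping_eqI) (simp add: lookup_map_times)
  have pp: "pmap ((*) c) (path_prod a p q) = path_prod (c * a) p q" for a p q
    by (simp add: path_prod_def s m0)
  show "convolve (pmap ((*) c) f) g = pmap ((*) c) (convolve f g)"
  proof (rule poly_mapping_keys_induct[of f UNIV])
    fix p a
    show "convolve (pmap ((*) c) (psingle p a)) g =
      pmap ((*) c) (convolve (psingle p a) g)"
      by (rule poly_mapping_keys_induct[of g UNIV]) (simp_all add: s m m0 pp convolve_add_right convolve_single mult.assoc)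
  qed (simp_all add: m m0 convolve_add_left)
  show "convolve f (pmap ((*) c) g) = pmap ((*) c) (convolve f g)"
  proof (rule poly_mapping_keys_induct[of f UNIV])
    fix p a
    show "convolve (psingle p a) (pmap ((*) c) g) =
      pmap ((*) c) (convolve (psingle p a) g)"
      by (rule poly_mapping_keys_induct[of g UNIV]) (simp_all add: s m m0 pp convolve_add_right convolve_single mult.left_commute)
  qed (simp_all add: m m0 convolve_add_left)
qed

lemma keys_convolve:
  "pkeys (convolve f g) \<subseteq>
    {(u, p @ q, w) |u p v q w. (u, p, v) \<in> pkeys f \<and> (v, q, w) \<in> pkeys g}"
proof -
  have "pkeys (path_prod c x y) \<subseteq> {(u, p @ q, w) |u p v q w. x = (u, p, v) \<and> y = (v, q, w)}"
    for c :: 'c and x y :: "('a, 'b) qpath"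
    by (cases x; cases y) (auto simp: path_prod_def)
  then have "pkeys (path_prod (plookup f x * plookup g y) x y) \<subseteq>
    {(u, p @ q, w) |u p v q w. (u, p, v) \<in> pkeys f \<and> (v, q, w) \<in> pkeys g}"
    if "x \<in> pkeys f" "y \<in> pkeys g" for x y using that by blast
  then show ?thesis
    unfolding convolve_def
    by (intro order.trans[OF Poly_Mapping.keys_sum] UN_least) blast+
qed

locale quiver_algebra = fin_digraph Q for Q :: "('v, 'e) pre_digraph" +
  fixes K :: "('k::field, ('v, 'e) qpath \<Rightarrow>\<^sub>0 'k) module" (structure)
  assumes K: "K = path_algebra Q"
begin

lemma carrier_K: "f \<in> carrier K \<longleftrightarrow> pkeys f \<subseteq> qpaths Q" by (simp add: K path_algebra_def)
lemma mult_K: "f \<otimes> g = convolve f g" by (simp add: K path_algebra_def convolve_def map_path_mult)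
lemma add_K: "f \<oplus> g = f + g" by (simp add: K path_algebra_def)
lemma zero_K: "\<zero> = 0" by (simp add: K path_algebra_def)
lemma one_K: "\<one> = (\<Sum>v\<in>verts Q. psingle (v, [], v) 1)" by (simp add: K path_algebra_def)
lemma smult_K: "c \<odot> f = pmap ((*) c) f" by (simp add: K path_algebra_def)

lemma lookup_smult: "plookup (c \<odot> f) p = c * plookup f p"
  by (simp add: smult_K lookup_map_times)

lemma path_concat: "(u, p, v) \<in> qpaths Q ==> (v, q, w) \<in> qpaths Q ==> (u, p @ q, w) \<in> qpaths Q"
  by (auto simp: qpaths_def)

lemma single_in: "p \<in> qpaths Q ==> psingle p c \<in> carrier K"
  by (auto simp: carrier_K)

lemma mult_in: "f \<in> carrier K ==> g \<in> carrier K ==> f \<otimes> g \<in> carrier K"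
  unfolding carrier_K mult_K using keys_convolve[of f g] path_concat by fastforce

lemma K_induct [consumes 1, case_names zero single add]:
  assumes "f \<in> carrier K" "P 0" "\<And>p c. p \<in> qpaths Q ==> P (psingle p c)"
    and "\<And>f g. f \<in> carrier K ==> g \<in> carrier K ==> P f ==> P g ==> P (f + g)"
  shows "P f"
  by (rule poly_mapping_keys_induct[OF assms(1)[unfolded carrier_K] assms(2,3)]) (use assms(4) in \<open>auto simp: carrier_K\<close>)

lemma one_convolve:
  assumes "f \<in> carrier K" shows "convolve \<one> f = f" and "convolve f \<one> = f"
proof -
  have V: "(\<Sum>v\<in>V. if v = u then g v else 0) = g u" if "finite V" "u \<in> V" for V u and g :: "'v => ('v, 'e) qpath \<Rightarrow>\<^sub>0 'k"
    using that by simp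
  have cl: "convolve (\<Sum>v\<in>V. h v) f = (\<Sum>v\<in>V. convolve (h v) f)" "convolve f (\<Sum>v\<in>V. h v) = (\<Sum>v\<in>V. convolve f (h v))"
    for V :: "'v set" and h and f :: "('v, 'e) qpath \<Rightarrow>\<^sub>0 'k"
    by (induction V rule: infinite_finite_induct) (simp_all add: convolve_add_left convolve_add_right)
  show "convolve \<one> f = f"
    using assms
  proof (induction f rule: K_induct)
    case (single p c)
    obtain u ps w where p: "p = (u, ps, w)" by (metis prod_cases3)
    have u: "u \<in> verts Q" using single unfolding p by (auto simp: qpaths_def)
    have "convolve \<one> (psingle p c) = (\<Sum>v\<in>verts Q. if v = u then psingle p c else 0)"
      unfolding one_K cl convolve_single by (rule sum.cong) (auto simp: path_prod_def p)
    then show ?case using u by simp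
  qed (simp_all add: convolve_add_right)
  show "convolve f \<one> = f"
    using assms
  proof (induction f rule: K_induct)
    case (single p c)
    obtain u ps w where p: "p = (u, ps, w)" by (metis prod_cases3)
    have w: "w \<in> verts Q" using single unfolding p by (auto simp: qpaths_def)
    have "convolve (psingle p c) \<one> = (\<Sum>v\<in>verts Q. if v = w then psingle p c else 0)"
      unfolding one_K cl convolve_single by (rule sum.cong) (auto simp: path_prod_def p)
    then show ?case using w by simp
  qed (simp_all add: convolve_add_left)
qed

lemma vertex_path: "v \<in> verts Q ==> (v, [], v) \<in> qpaths Q" by (simp add: qpaths_def awalk_Nil_iff)

lemma one_in: "\<one> \<in> carrier K"
  unfolding carrier_K one_K
  by (rule order.trans[OF Poly_Mapping.keys_sum]) (auto simp: vertex_path)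

lemma add_in: "f \<in> carrier K ==> g \<in> carrier K ==> f + g \<in> carrier K"
  unfolding carrier_K by (rule keys_add_subset)

lemma smult_in_K: "f \<in> carrier K ==> c \<odot> f \<in> carrier K"
  unfolding carrier_K in_keys_iff subset_iff lookup_smult by auto

lemma abelian_group_K: "abelian_group K"
proof (rule abelian_groupI)
  fix f assume "f \<in> carrier K"
  then show "\<exists>g\<in>carrier K. g \<oplus> f = \<zero>"
    by (intro bexI[of _ "- f"]) (simp_all add: carrier_K add_K zero_K)
qed (simp_all add: add_K zero_K add_in, simp_all add: carrier_K algebra_simps)

lemma ring_K: "ring K"
proof (rule ringI[OF abelian_group_K])
  show "monoid K"
    by (rule monoidI) (simp_all add: mult_in one_in, simp_all add: mult_K convolve_assoc one_convolve)
qed (simp_all add: mult_K add_K convolve_add_left convolve_add_right)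

lemma kspace_K: "kspace K"
  unfolding kspace_def
proof (rule vectorspace_class_ringI[OF abelian_group_K])
  show "(c + d) \<odot> f = c \<odot> f \<oplus> d \<odot> f" for c d f
    by (rule poly_mapping_eqI) (simp add: lookup_smult add_K lookup_add algebra_simps)
  show "c \<odot> (f \<oplus> g) = c \<odot> f \<oplus> c \<odot> g" for c f g
    by (rule poly_mapping_eqI) (simp add: lookup_smult add_K lookup_add algebra_simps)
  show "(c * d) \<odot> f = c \<odot> (d \<odot> f)" for c d f
    by (rule poly_mapping_eqI) (simp add: lookup_smult algebra_simps)
  show "1 \<odot> f = f" for f
    by (rule poly_mapping_eqI) (simp add: lookup_smult)
qed (rule smult_in_K)

lemma single_mult: "psingle p a \<otimes> psingle q b = path_prod (a * b) p q"
  by (simp add: mult_K convolve_single)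

sublocale K: ring K by (rule ring_K)
sublocale KV: kspace K by (rule kspace_K)

lemma ideal_smult: "ideal J K ==> f \<in> J ==> c \<odot> f \<in> J"
proof -
  assume J: "ideal J K" and f: "f \<in> J"
  have fc: "f \<in> carrier K" using ideal.Icarr[OF J f] .
  have "c \<odot> f = (c \<odot> \<one>) \<otimes> f"
    unfolding mult_K unfolding smult_K convolve_scale_left one_convolve(1)[OF fc] ..
  then show ?thesis using ideal.I_l_closed[OF J f smult_in_K[OF one_in]] by simp
qed

lemma ideal_sum:
  assumes J: "ideal J K" and "finite S" "\<And>i. i \<in> S ==> h i \<in> J"
  shows "(\<Sum>i\<in>S. h i) \<in> J"
  using assms(2,3)
proof (induction S rule: finite_induct)
  case empty
  then show ?case using additive_subgroup.zero_closed[OF ideal.axioms(1)[OF J]] by (simp add: zero_K)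
next
  case (insert i S)
  then show ?case using additive_subgroup.a_closed[OF ideal.axioms(1)[OF J], of "h i" "\<Sum>i\<in>S. h i"] by (simp add: add_K)
qed

text \<open>Serves two ends: the elements supported on long paths, and the elements all of whose
  paths belong to a given monomial ideal.\<close>

lemma keys_idealI:
  assumes P: "\<And>u p v q w. (u, p, v) \<in> qpaths Q ==> (v, q, w) \<in> qpaths Q ==>
      P (u, p, v) \<or> P (v, q, w) ==> P (u, p @ q, w)"
  shows "ideal {f \<in> carrier K. \<forall>p\<in>pkeys f. P p} K" (is "ideal ?J K")
proof (rule idealI[OF ring_K])
  show "subgroup ?J (add_monoid K)"
  proof (rule group.subgroupI)
    show "Group.group (add_monoid K)" by (rule K.add.is_group)
    show "?J \<subseteq> carrier (add_monoid K)" by auto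
    have "0 \<in> ?J" by (simp add: carrier_K)
    then show "?J \<noteq> {}" by blast
    fix f assume f: "f \<in> ?J"
    have "\<ominus> f = - f"
      by (rule K.minus_equality) (use f in \<open>simp_all add: add_K zero_K carrier_K\<close>)
    then show "inv\<^bsub>add_monoid K\<^esub> f \<in> ?J"
      using f unfolding a_inv_def[symmetric] by (simp add: carrier_K)
    fix g assume g: "g \<in> ?J"
    show "f \<otimes>\<^bsub>add_monoid K\<^esub> g \<in> ?J"
      using f g Poly_Mapping.keys_add[of f g] add_in by (auto simp: add_K)
  qed
  fix f g assume f: "f \<in> ?J" and g: "g \<in> carrier K"
  have k: "P x" if x: "x \<in> pkeys (convolve h h')" and h: "h \<in> carrier K" "h' \<in> carrier K" "h \<in> ?J \<or> h' \<in> ?J" for h h' x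
  proof -
    obtain u p v q w where x': "x = (u, p @ q, w)" "(u, p, v) \<in> pkeys h" "(v, q, w) \<in> pkeys h'"
      using x keys_convolve[of h h'] by blast
    then show ?thesis using P[of u p v q w] h by (auto simp: carrier_K)
  qed
  show "g \<otimes> f \<in> ?J" using mult_in[OF g] f g k[of _ g f] by (auto simp: mult_K)
  show "f \<otimes> g \<in> ?J" using mult_in[OF _ g] f g k[of _ f g] by (auto simp: mult_K)
qed

lemma ideal_power_keys:
  assumes f: "f \<in> ideal_power K (arrow_ideal Q) n"
  shows "f \<in> carrier K" and "p \<in> pkeys f ==> n \<le> length (path_arrows p)"
proof -
  define F where "F m = {f \<in> carrier K. \<forall>p\<in>pkeys f. m \<le> length (path_arrows p)}" for m
  have F: "ideal (F m) K" for m
    unfolding F_def by (rule keys_idealI) (auto simp: path_arrows_def)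
  have arr: "arrow_ideal Q \<subseteq> F 1"
    unfolding arrow_ideal_def K[symmetric]
  proof (rule K.genideal_minimal[OF F])
    show "(\<lambda>e. psingle (tail Q e, [e], head Q e) 1) ` arcs Q \<subseteq> F 1"
      unfolding F_def by (auto simp: path_arrows_def intro!: single_in) (simp add: qpaths_def arc_implies_awalk)
  qed
  have prod: "ideal_prod K J X \<subseteq> F (Suc m)" if J: "J \<subseteq> F 1" and X: "X \<subseteq> F m" for J X m
  proof
    fix x assume "x \<in> ideal_prod K J X"
    then show "x \<in> F (Suc m)"
    proof (induction rule: ideal_prod.induct)
      case (prod i j)
      then have i: "i \<in> F 1" and j: "j \<in> F m" using J X by auto
      have "Suc m \<le> length (path_arrows p)" if p: "p \<in> pkeys (convolve i j)" for p
      proof -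
        obtain u q v r w where "p = (u, q @ r, w)" "(u, q, v) \<in> pkeys i" "(v, r, w) \<in> pkeys j"
          using p keys_convolve[of i j] by blast
        then show ?thesis using i j unfolding F_def by (fastforce simp: path_arrows_def)
      qed
      then show ?case using i j mult_in[of i j] unfolding F_def by (simp add: mult_K)
    next
      case (sum s1 s2)
      then show ?case using additive_subgroup.a_closed[OF ideal.axioms(1)[OF F]] by blast
    qed
  qed
  have "ideal_power K (arrow_ideal Q) n \<subseteq> F n"
    unfolding ideal_power_def
  proof (induction n)
    case 0
    then show ?case by (simp add: F_def)
  next
    case (Suc n)
    then show ?case using prod[OF arr] by simp
  qed
  then show "f \<in> carrier K" "p \<in> pkeys f ==> n \<le> length (path_arrows p)"
    using f unfolding F_def by auto
qed

lemma long_path_in_power: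
  "(u, p, w) \<in> qpaths Q ==> n \<le> length p ==> psingle (u, p, w) 1 \<in> ideal_power K (arrow_ideal Q) n"
proof (induction n arbitrary: u p)
  case 0
  then show ?case by (simp add: ideal_power_def single_in)
next
  case (Suc n)
  then obtain alpha q where p: "p = alpha # q" by (cases p) auto
  have alpha: "alpha \<in> arcs Q" "u = tail Q alpha" and q: "(head Q alpha, q, w) \<in> qpaths Q"
    using Suc.prems(1) unfolding p by (auto simp: qpaths_def awalk_Cons_iff)
  have "psingle (head Q alpha, q, w) 1 \<in> ideal_power K (arrow_ideal Q) n"
    by (rule Suc.IH[OF q]) (use Suc.prems(2) p in simp)
  moreover have "psingle (tail Q alpha, [alpha], head Q alpha) (1 :: 'k) \<in> arrow_ideal Q"
    unfolding arrow_ideal_def K[symmetric]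
  proof (rule subsetD[OF K.genideal_self])
    show "(\<lambda>e. psingle (tail Q e, [e], head Q e) 1) ` arcs Q \<subseteq> carrier K"
      by (auto intro!: single_in) (simp add: qpaths_def arc_implies_awalk)
  qed (use alpha(1) in blast)
  ultimately have "psingle (tail Q alpha, [alpha], head Q alpha) 1 \<otimes> psingle (head Q alpha, q, w) 1 \<in>
    ideal_prod K (arrow_ideal Q) (ideal_power K (arrow_ideal Q) n)"
    by (intro ideal_prod.prod)
  moreover have "psingle (tail Q alpha, [alpha], head Q alpha) 1 \<otimes> psingle (head Q alpha, q, w) 1 =
    (psingle (u, p, w) 1 :: ('v, 'e) qpath \<Rightarrow>\<^sub>0 'k)"
    unfolding single_mult by (simp add: path_prod_def p alpha(2))
  ultimately show ?case by (simp add: ideal_power_def)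
qed

text \<open>The lift of \<open>T chi\<close> to the path algebra. As \<open>chi\<close> is
  arbitrary, one statement of stability covers characters, counts of an arrow and indicators of the
  length.\<close>

definition weigh :: "('e multiset => 'k) => (('v, 'e) qpath \<Rightarrow>\<^sub>0 'k) => (('v, 'e) qpath \<Rightarrow>\<^sub>0 'k)" where
  "weigh chi f = (\<Sum>p\<in>pkeys f. psingle p (chi (mset (path_arrows p)) * plookup f p))"

lemma lookup_weigh: "plookup (weigh chi f) p = chi (mset (path_arrows p)) * plookup f p"
  unfolding weigh_def
  by (simp add: lookup_sum lookup_single when_def not_in_keys_iff_lookup_eq_zero)

lemma weigh_in: "f \<in> carrier K ==> weigh chi f \<in> carrier K"
  unfolding carrier_K in_keys_iff subset_iff lookup_weigh by auto

lemma weigh_add: "weigh chi (f + g) = weigh chi f + weigh chi g"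
  by (rule poly_mapping_eqI) (simp add: lookup_weigh lookup_add algebra_simps)

lemma weigh_smult: "weigh chi (c \<odot> f) = c \<odot> weigh chi f"
  by (rule poly_mapping_eqI) (simp add: lookup_weigh lookup_smult algebra_simps)

lemma weigh_single: "weigh chi (psingle p c) = chi (mset (path_arrows p)) \<odot> psingle p c"
  by (rule poly_mapping_eqI) (simp add: lookup_weigh lookup_smult lookup_single when_def)

text \<open>An ideal generated by paths contains every path that occurs in one of its elements, so
  coefficients may be changed freely.\<close>

lemma monomial_ideal_weigh:
  assumes J: "monomial_ideal Q J" and f: "f \<in> J"
  shows "weigh chi f \<in> J"
proof -
  obtain S where S: "S \<subseteq> qpaths Q" "J = genideal K ((\<lambda>p. psingle p 1) ` S)"
    using J unfolding monomial_ideal_def K by blast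
  have gen: "(\<lambda>p. psingle p 1) ` S \<subseteq> carrier K" using S(1) single_in by blast
  have Ji: "ideal J K" unfolding S(2) by (rule K.genideal_ideal[OF gen])
  define J' where "J' = {f \<in> carrier K. \<forall>p\<in>pkeys f. psingle p 1 \<in> J}"
  have "ideal J' K"
    unfolding J'_def
  proof (rule keys_idealI)
    fix u p v q w assume p: "(u, p, v) \<in> qpaths Q" and q: "(v, q, w) \<in> qpaths Q"
      and or: "psingle (u, p, v) 1 \<in> J \<or> psingle (v, q, w) 1 \<in> J"
    have "psingle (u, p, v) 1 \<otimes> psingle (v, q, w) 1 \<in> J"
      using or ideal.I_l_closed[OF Ji _ single_in[OF p]] ideal.I_r_closed[OF Ji _ single_in[OF q]] by blast
    then show "psingle (u, p @ q, w) 1 \<in> J" unfolding single_mult by (simp add: path_prod_def)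
  qed
  moreover have "(\<lambda>p. psingle p 1) ` S \<subseteq> J'"
    unfolding J'_def using gen K.genideal_self[OF gen] unfolding S(2)[symmetric] by auto
  ultimately have "J \<subseteq> J'" unfolding S(2) by (rule K.genideal_minimal)
  then have s: "psingle p 1 \<in> J" if "p \<in> pkeys f" for p using f that unfolding J'_def by blast
  show ?thesis
    unfolding weigh_def
  proof (rule ideal_sum[OF Ji finite_keys])
    fix p assume p: "p \<in> pkeys f"
    have e: "psingle p c = c \<odot> psingle p 1" for c :: 'k
      by (rule poly_mapping_eqI) (simp add: lookup_smult lookup_single when_def)
    show "psingle p (chi (mset (path_arrows p)) * plookup f p) \<in> J"
      by (subst e) (rule ideal_smult[OF Ji s[OF p]])
  qed
qed

text \<open>
  A relation that is not minimal splits into two shorter relations, so every relation is a sum of minimal ones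
  with disjoint supports.
\<close>

lemma semimonomial_ideal_weigh:
  assumes J: "ideal J K" and semi: "semimonomial_ideal J" and f: "f \<in> J"
  shows "weigh chi f \<in> J"
  using f
proof (induction "card (pkeys f)" arbitrary: f rule: less_induct)
  case less
  show ?case
  proof (cases "minimal_relation J f")
    case True
    show ?thesis
    proof (cases "f = 0")
      case True
      then have "weigh chi f = f" by (simp add: weigh_def)
      then show ?thesis using less.prems by simp
    next
      case False
      then obtain p where p: "p \<in> pkeys f" by (metis all_not_in_conv keys_eq_empty)
      \<comment> \<open>All paths of a minimal relation have the same multiset of arrows, so the
        operator acts on it as a scalar.\<close>
      have "weigh chi f = chi (mset (path_arrows p)) \<odot> f"
      proof (rule poly_mapping_eqI)
        fix q
        show "plookup (weigh chi f) q = plookup (chi (mset (path_arrows p)) \<odot> f) q"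
        proof (cases "q \<in> pkeys f")
          case True
          then have "mset (path_arrows q) = mset (path_arrows p)"
            using semi \<open>minimal_relation J f\<close> p unfolding semimonomial_ideal_def by blast
          then show ?thesis by (simp add: lookup_weigh lookup_smult)
        next
          case False
          then show ?thesis by (simp add: lookup_weigh lookup_smult not_in_keys_iff_lookup_eq_zero)
        qed
      qed
      then show ?thesis using ideal_smult[OF J less.prems] by simp
    qed
  next
    case False
    show ?thesis
    proof (cases "f = 0")
      case True
      then have "weigh chi f = f" by (simp add: weigh_def)
      then show ?thesis using less.prems by simp
    next
      case False
      define g where "g S = (\<Sum>p\<in>S. psingle p (plookup f p))" for S
      obtain S where S: "S \<subset> pkeys f" "S \<noteq> {}" "g S \<in> J"
        using \<open>\<not> minimal_relation J f\<close> less.prems False unfolding minimal_relation_def g_def by blast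
      define R where "R = pkeys f - S"
      have fin: "finite S" "finite R" using S(1) finite_subset[OF _ finite_keys[of f]] unfolding R_def by auto
      have k: "pkeys (g X) \<subseteq> X" for X
        unfolding g_def by (rule order.trans[OF Poly_Mapping.keys_sum]) auto
      have "f = g (pkeys f)" unfolding g_def by (rule poly_mapping_eq_sum)
      also have "pkeys f = S \<union> R" using S(1) by (auto simp: R_def)
      also have "g (S \<union> R) = g S + g R"
        unfolding g_def by (rule sum.union_disjoint[OF fin]) (auto simp: R_def)
      finally have e: "f = g S + g R" .
      have c: "g S \<in> carrier K" "f \<in> carrier K" using ideal.Icarr[OF J] S(3) less.prems by auto
      have "g R = f + (- 1) \<odot> g S"
        by (rule poly_mapping_eqI) (subst e, simp add: lookup_add lookup_smult)
      then have gR: "g R \<in> J"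
        using additive_subgroup.a_closed[OF ideal.axioms(1)[OF J] less.prems ideal_smult[OF J S(3)]] by (simp add: add_K)
      have "card (pkeys (g S)) < card (pkeys f)"
        by (rule psubset_card_mono[OF finite_keys]) (use k[of S] S(1) in blast)
      moreover have "card (pkeys (g R)) < card (pkeys f)"
        by (rule psubset_card_mono[OF finite_keys]) (use k[of R] S(1,2) in \<open>auto simp: R_def\<close>)
      ultimately have "weigh chi (g S) \<in> J" "weigh chi (g R) \<in> J" using less.hyps S(3) gR by auto
      then have "weigh chi (g S) \<oplus> weigh chi (g R) \<in> J" by (rule additive_subgroup.a_closed[OF ideal.axioms(1)[OF J]])
      then show ?thesis by (subst e) (simp add: weigh_add add_K)
    qed
  qed
qed

end

text \<open>The two inclusions in admissibility become \<open>short\<close> and \<open>long\<close>;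
  \<open>weigh_I\<close> is what monomial and semimonomial ideals have in common.\<close>

locale multigraded_quotient = quiver_algebra Q K
  for Q :: "('v, 'e) pre_digraph" and K :: "('k::field, ('v, 'e) qpath \<Rightarrow>\<^sub>0 'k) module" (structure) +
  fixes I :: "(('v, 'e) qpath \<Rightarrow>\<^sub>0 'k) set" and N :: nat
  assumes I: "ideal I K"
    and short: "\<And>f p. f \<in> I ==> p \<in> pkeys f ==> 2 \<le> length (path_arrows p)"
    and long: "\<And>p. p \<in> qpaths Q ==> N \<le> length (path_arrows p) ==> psingle p 1 \<in> I"
    and weigh_I: "\<And>chi f. f \<in> I ==> weigh chi f \<in> I"
begin

sublocale I: ideal I K by (rule I)

lemma submodule_I: "submodule class_ring I K"
  using I.Icarr I.a_closed I.zero_closed ideal_smult[OF I] KV.module_axioms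
  by (simp add: submodule_def subset_iff)

sublocale quo: quotient_space K I
  by (intro quotient_space.intro quotient_space_axioms.intro kspace_K submodule_I)

abbreviation A :: "('k, (('v, 'e) qpath \<Rightarrow>\<^sub>0 'k) set) module" where "A \<equiv> quotient_algebra K I"

lemma cls_mult: "x \<in> carrier K ==> y \<in> carrier K ==> quo.cls x \<otimes>\<^bsub>A\<^esub> quo.cls y = quo.cls (x \<otimes> y)"
  using I.rcoset_mult_add[of x y] by (simp add: quotient_algebra_def FactRing_def ring.defs)

lemma one_A: "\<one>\<^bsub>A\<^esub> = quo.cls \<one>"
  by (simp add: quotient_algebra_def FactRing_def ring.defs)

lemma kspace_A: "kspace A" by (rule quo.quotient_vectorspace)

lemma cls_in: "x \<in> carrier K ==> quo.cls x \<in> carrier A" by (simp add: quo.quotient_carrier)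

lemma carrier_A_cases:
  assumes "X \<in> carrier A" obtains x where "x \<in> carrier K" "X = quo.cls x"
  using assms unfolding quo.quotient_carrier by blast

lemma ring_A: "ring A"
proof -
  interpret A: kspace A by (rule kspace_A)
  show ?thesis
  proof (rule ringI[OF A.M.abelian_group_axioms])
    show "monoid A"
      by (rule monoidI) (auto simp: one_A quo.quotient_carrier cls_mult mult_in one_in K.m_assoc)
    fix X Y Z assume "X \<in> carrier A" "Y \<in> carrier A" "Z \<in> carrier A"
    then obtain x y z where x: "x \<in> carrier K" "X = quo.cls x" and y: "y \<in> carrier K" "Y = quo.cls y"
      and z: "z \<in> carrier K" "Z = quo.cls z" unfolding quo.quotient_carrier by blast
    show "(X \<oplus>\<^bsub>A\<^esub> Y) \<otimes>\<^bsub>A\<^esub> Z = X \<otimes>\<^bsub>A\<^esub> Z \<oplus>\<^bsub>A\<^esub> Y \<otimes>\<^bsub>A\<^esub> Z"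
      using x y z by (simp add: quo.quotient_add cls_mult K.l_distr)
    show "Z \<otimes>\<^bsub>A\<^esub> (X \<oplus>\<^bsub>A\<^esub> Y) = Z \<otimes>\<^bsub>A\<^esub> X \<oplus>\<^bsub>A\<^esub> Z \<otimes>\<^bsub>A\<^esub> Y"
      using x y z by (simp add: quo.quotient_add cls_mult K.r_distr)
  qed
qed

lemma single_eq_smult: "psingle p c = c \<odot> psingle p 1"
  by (rule poly_mapping_eqI) (simp add: lookup_smult lookup_single when_def)

lemma A_induct:
  assumes x: "X \<in> carrier A" and zero: "P \<zero>\<^bsub>A\<^esub>"
    and add: "\<And>X Y. X \<in> carrier A ==> Y \<in> carrier A ==> P X ==> P Y ==> P (X \<oplus>\<^bsub>A\<^esub> Y)"
    and smult: "\<And>c X. X \<in> carrier A ==> P X ==> P (c \<odot>\<^bsub>A\<^esub> X)"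
    and path: "\<And>p. p \<in> qpaths Q ==> P (quo.cls (psingle p 1))"
  shows "P X"
proof -
  obtain x where xx: "x \<in> carrier K" "X = quo.cls x" using x by (rule carrier_A_cases)
  have "P (quo.cls x)"
    using xx(1)
  proof (induction x rule: K_induct)
    case zero
    have "quo.cls 0 = \<zero>\<^bsub>A\<^esub>" using quo.cls_zero by (simp add: zero_K quo.quotient_zero)
    then show ?case using assms(2) by simp
  next
    case (single p c)
    have s: "psingle p 1 \<in> carrier K" by (rule single_in[OF single])
    have "P (c \<odot>\<^bsub>A\<^esub> quo.cls (psingle p 1))" by (rule smult[OF cls_in[OF s] path[OF single]])
    then show ?case unfolding quo.quotient_smult[OF s] single_eq_smult[of p c] .
  next
    case (add f g)
    have "P (quo.cls f \<oplus>\<^bsub>A\<^esub> quo.cls g)"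
      by (rule assms(3)[OF cls_in[OF add.hyps(1)] cls_in[OF add.hyps(2)] add.IH])
    then show ?case unfolding quo.quotient_add[OF add.hyps] add_K .
  qed
  then show ?thesis by (simp only: xx(2))
qed

lemma fin_dim_A: "vectorspace.fin_dim class_ring A"
proof -
  interpret A: kspace A by (rule kspace_A)
  define B where "B = {p \<in> qpaths Q. length (path_arrows p) < N}"
  define S where "S = (\<lambda>p. quo.cls (psingle p 1)) ` B"
  have "B \<subseteq> verts Q \<times> {xs. set xs \<subseteq> arcs Q \<and> length xs \<le> N} \<times> verts Q"
    unfolding B_def qpaths_def path_arrows_def by auto
  moreover have "finite (verts Q \<times> {xs. set xs \<subseteq> arcs Q \<and> length xs \<le> N} \<times> verts Q)"
    by (intro finite_cartesian_product finite_lists_length_le) auto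
  ultimately have "finite B" by (rule finite_subset)
  then have finS: "finite S" unfolding S_def by simp
  have subS: "S \<subseteq> carrier A" unfolding S_def B_def by (auto intro!: cls_in single_in)
  note sub = A.span_is_submodule[OF subS]
  have "X \<in> A.span S" if "X \<in> carrier A" for X
    using that
  proof (rule A_induct)
    show "\<zero>\<^bsub>A\<^esub> \<in> A.span S" by (rule submodule.zero_closed[OF sub])
    show "X \<oplus>\<^bsub>A\<^esub> Y \<in> A.span S" if "X \<in> A.span S" "Y \<in> A.span S" for X Y
      by (rule submodule.m_closed[OF sub that])
    show "c \<odot>\<^bsub>A\<^esub> X \<in> A.span S" if "X \<in> A.span S" for c X
      by (rule submodule.smult_closed[OF sub _ that]) simp
    fix p assume p: "p \<in> qpaths Q"
    show "quo.cls (psingle p 1) \<in> A.span S"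
    proof (cases "length (path_arrows p) < N")
      case True
      then have "quo.cls (psingle p 1) \<in> S" using p unfolding S_def B_def by blast
      then show ?thesis using A.in_own_span[OF subS] by blast
    next
      case False
      then have "quo.cls (psingle p 1) = \<zero>\<^bsub>A\<^esub>"
        using I.a_rcos_const[OF long[OF p]] by (simp add: quo.quotient_zero)
      then show ?thesis using submodule.zero_closed[OF sub] by simp
    qed
  qed
  then have "A.gen_set S" using A.span_is_subset2[OF subS] by blast
  then show ?thesis using finS subS by (auto simp: A.fin_dim_def)
qed

sublocale A: kalg A
proof -
  interpret A: kspace A by (rule kspace_A)
  interpret Ar: ring A by (rule ring_A)
  have kl: "(c \<odot> x) \<otimes> y = c \<odot> (x \<otimes> y)" "x \<otimes> (c \<odot> y) = c \<odot> (x \<otimes> y)" for c x y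
    by (simp_all add: mult_K smult_K convolve_scale_left convolve_scale_right)
  show "kalg A"
  proof (intro kalg.intro kalg_axioms.intro kspace_A ring_A)
    fix c X Y assume "X \<in> carrier A" "Y \<in> carrier A"
    then obtain x y where x: "x \<in> carrier K" "X = quo.cls x" and y: "y \<in> carrier K" "Y = quo.cls y"
      unfolding quo.quotient_carrier by blast
    show "(c \<odot>\<^bsub>A\<^esub> X) \<otimes>\<^bsub>A\<^esub> Y = c \<odot>\<^bsub>A\<^esub> (X \<otimes>\<^bsub>A\<^esub> Y)"
      using x y by (simp add: quo.quotient_smult cls_mult smult_in_K mult_in kl)
    show "X \<otimes>\<^bsub>A\<^esub> (c \<odot>\<^bsub>A\<^esub> Y) = c \<odot>\<^bsub>A\<^esub> (X \<otimes>\<^bsub>A\<^esub> Y)"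
      using x y by (simp add: quo.quotient_smult cls_mult smult_in_K mult_in kl)
  next
    show "A.fin_dim" by (rule fin_dim_A)
  qed
qed

text \<open>Maps on the quotient are defined through an arbitrary representative; independence of
  the choice comes from \<open>short\<close> for coordinates and from \<open>weigh_I\<close> for the
  operators.\<close>

definition rep :: "(('v, 'e) qpath \<Rightarrow>\<^sub>0 'k) set => (('v, 'e) qpath \<Rightarrow>\<^sub>0 'k)" where "rep X = (SOME x. x \<in> X)"

lemma rep_cls: "x \<in> carrier K ==> rep (quo.cls x) \<in> carrier K \<and> rep (quo.cls x) \<ominus> x \<in> I"
  unfolding rep_def using someI[of "\<lambda>y. y \<in> quo.cls x" x] quo.cls_self[of x] quo.mem_cls_iff[of x] by blast

lemma minus_K: "x \<in> carrier K ==> y \<in> carrier K ==> x \<ominus> y = x - y"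
proof -
  assume x: "x \<in> carrier K" and y: "y \<in> carrier K"
  have "\<ominus> y = - y" by (rule K.minus_equality) (use y in \<open>simp_all add: add_K zero_K carrier_K\<close>)
  then show ?thesis by (simp add: a_minus_def add_K)
qed

definition coeff_of :: "('v, 'e) qpath => (('v, 'e) qpath \<Rightarrow>\<^sub>0 'k) set => 'k" where
  "coeff_of p X = plookup (rep X) p"

definition weigh_cls :: "('e multiset => 'k) => (('v, 'e) qpath \<Rightarrow>\<^sub>0 'k) set => (('v, 'e) qpath \<Rightarrow>\<^sub>0 'k) set" where
  "weigh_cls chi X = quo.cls (weigh chi (rep X))"

text \<open>Elements of \<open>I\<close> involve only paths of length at least 2, so coefficients at
  vertices and arrows are the same for all representatives.\<close>

lemma coeff_of_cls:
  assumes x: "x \<in> carrier K" and p: "length (path_arrows p) \<le> 1"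
  shows "coeff_of p (quo.cls x) = plookup x p"
proof -
  have r: "rep (quo.cls x) \<in> carrier K" "rep (quo.cls x) - x \<in> I" using rep_cls[OF x] minus_K[OF _ x] by auto
  have "p \<notin> pkeys (rep (quo.cls x) - x)" using short[OF r(2)] p by fastforce
  then show ?thesis by (simp add: coeff_of_def not_in_keys_iff_lookup_eq_zero lookup_minus)
qed

lemma weigh_diff: "weigh chi (f - g) = weigh chi f - weigh chi g"
  by (rule poly_mapping_eqI) (simp add: lookup_weigh lookup_minus algebra_simps)

lemma weigh_cls: 
  assumes x: "x \<in> carrier K" shows "weigh_cls chi (quo.cls x) = quo.cls (weigh chi x)"
proof -
  have r: "rep (quo.cls x) \<in> carrier K" "rep (quo.cls x) - x \<in> I" using rep_cls[OF x] minus_K[OF _ x] by auto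
  have "weigh chi (rep (quo.cls x)) - weigh chi x \<in> I" unfolding weigh_diff[symmetric] by (rule weigh_I[OF r(2)])
  then show ?thesis
    unfolding weigh_cls_def using quo.cls_eq_iff[OF weigh_in[OF r(1)] weigh_in[OF x]] minus_K[OF weigh_in[OF r(1)] weigh_in[OF x]] by simp
qed

lemma cls_sum:
  "finite S ==> (\<And>i. i \<in> S ==> h i \<in> carrier K) ==> (\<Sum>i\<in>S. h i) \<in> carrier K \<and> quo.cls (\<Sum>i\<in>S. h i) = (\<Oplus>\<^bsub>A\<^esub>i\<in>S. quo.cls (h i))"
proof (induction S rule: finite_induct)
  case empty
  have "0 \<in> carrier K" by (simp add: carrier_K)
  then show ?case using quo.cls_zero by (simp add: zero_K quo.quotient_zero)
next
  case (insert i S)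
  then have h: "h i \<in> carrier K" "(\<Sum>i\<in>S. h i) \<in> carrier K" and IH: "quo.cls (\<Sum>i\<in>S. h i) = (\<Oplus>\<^bsub>A\<^esub>i\<in>S. quo.cls (h i))" by auto
  have "(\<Oplus>\<^bsub>A\<^esub>i\<in>insert i S. quo.cls (h i)) = quo.cls (h i) \<oplus>\<^bsub>A\<^esub> (\<Oplus>\<^bsub>A\<^esub>i\<in>S. quo.cls (h i))"
    by (rule A.finsum_insert) (use insert cls_in in auto)
  also have "\<dots> = quo.cls (h i + (\<Sum>i\<in>S. h i))" unfolding IH[symmetric] quo.quotient_add[OF h] add_K ..
  finally show ?case using insert.hyps add_in[OF h] by simp
qed

sublocale pq: path_quotient A Q "\<lambda>p. quo.cls (psingle p 1)" weigh_cls coeff_of N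
proof (intro path_quotient.intro path_quotient_axioms.intro A.kalg_axioms fin_digraph_axioms)
  show "quo.cls (psingle p 1) \<in> carrier A" if "p \<in> qpaths Q" for p
    by (rule cls_in[OF single_in[OF that]])
  show "quo.cls (psingle (u, ps, v) 1) \<otimes>\<^bsub>A\<^esub> quo.cls (psingle (w, qs, z) 1) =
      (if v = w then quo.cls (psingle (u, ps @ qs, z) 1) else \<zero>\<^bsub>A\<^esub>)"
    if "(u, ps, v) \<in> qpaths Q" "(w, qs, z) \<in> qpaths Q" for u ps v w qs z
  proof -
    have "quo.cls 0 = \<zero>\<^bsub>A\<^esub>" using quo.cls_zero by (simp add: zero_K quo.quotient_zero)
    then show ?thesis
      unfolding cls_mult[OF single_in[OF that(1)] single_in[OF that(2)]] single_mult by (simp add: path_prod_def)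
  qed
  show "\<one>\<^bsub>A\<^esub> = (\<Oplus>\<^bsub>A\<^esub>v\<in>verts Q. quo.cls (psingle (v, [], v) 1))"
    unfolding one_A one_K using cls_sum[of "verts Q" "\<lambda>v. psingle (v, [], v) 1"] single_in[OF vertex_path] by simp
  show "A.linear_map (weigh_cls chi)" for chi
    unfolding A.linear_map_def quo.quotient_carrier
    by (auto simp: weigh_cls weigh_in quo.quotient_add quo.quotient_smult add_K add_in weigh_add weigh_smult smult_in_K)
  show "weigh_cls chi (quo.cls (psingle p 1)) =
      chi (mset (path_arrows p)) \<odot>\<^bsub>A\<^esub> quo.cls (psingle p 1)" if "p \<in> qpaths Q" for p chi
    unfolding weigh_cls[OF single_in[OF that]] weigh_single quo.quotient_smult[OF single_in[OF that]] ..
  show "A.functional (coeff_of p)" if "length (path_arrows p) \<le> 1" for p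
    unfolding A.functional_def quo.quotient_carrier
    by (auto simp: coeff_of_cls[OF _ that] quo.quotient_add quo.quotient_smult add_K add_in smult_in_K lookup_add lookup_smult)
  show "coeff_of p (quo.cls (psingle q 1)) = of_bool (q = p)"
    if "length (path_arrows p) \<le> 1" "q \<in> qpaths Q" for p q
    unfolding coeff_of_cls[OF single_in[OF that(2)] that(1)] by (simp add: lookup_single when_def)
  show "quo.cls (psingle p 1) = \<zero>\<^bsub>A\<^esub>" if "p \<in> qpaths Q" "N \<le> length (path_arrows p)" for p
    using I.a_rcos_const[OF long[OF that]] by (simp add: quo.quotient_zero)
  show "P X" if "X \<in> carrier A" "P \<zero>\<^bsub>A\<^esub>"
    "\<And>X Y. X \<in> carrier A ==> Y \<in> carrier A ==> P X ==> P Y ==> P (X \<oplus>\<^bsub>A\<^esub> Y)"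
    "\<And>c X. X \<in> carrier A ==> P X ==> P (c \<odot>\<^bsub>A\<^esub> X)"
    "\<And>p. p \<in> qpaths Q ==> P (quo.cls (psingle p 1))" for P X
    by (rule A_induct[of X P]) (rule that; assumption)+
qed

lemma mt_rank_iff: "mt_rank A = 0 \<longleftrightarrow> tree_quiver Q"
proof
  assume "tree_quiver Q"
  then have "\<forall>z\<in>cycles. \<forall>e\<in>arcs Q. z e = 0"
    using forest_cycles unfolding tree_quiver_def betti_number_eq by blast
  then show "mt_rank A = 0" by (rule pq.mt_rank_forest)
next
  assume r: "mt_rank A = 0"
  show "tree_quiver Q"
  proof (rule ccontr)
    assume "\<not> tree_quiver Q"
    then obtain alpha z where "alpha \<in> arcs Q" "z \<in> cycles" "z alpha = 1"
      using nonforest_cycle unfolding tree_quiver_def betti_number_eq by blast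
    then show False using pq.mt_rank_nonforest r by blast
  qed
qed

end

theorem corollary5p4:
  fixes Q :: "('v, 'e) pre_digraph"
    and I :: "(('v, 'e) qpath \<Rightarrow>\<^sub>0 'k::alg_closed_field) set"
  assumes "fin_digraph Q"
    and "admissible_ideal Q I"
    and "monomial_ideal Q I \<or> semimonomial_ideal I"
  shows "mt_rank (quotient_algebra (path_algebra Q) I) = 0 \<longleftrightarrow> tree_quiver Q"
proof -
  let ?K = "path_algebra Q :: ('k, ('v, 'e) qpath \<Rightarrow>\<^sub>0 'k) module"
  interpret fin_digraph Q by (rule assms(1))
  interpret quiver_algebra Q ?K by unfold_locales (rule refl)
  obtain N where I: "ideal I ?K" "I \<subseteq> ideal_power ?K (arrow_ideal Q) 2"
    and N: "ideal_power ?K (arrow_ideal Q) N \<subseteq> I"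
    using assms(2) unfolding admissible_ideal_def by blast
  have "multigraded_quotient Q ?K I N"
  proof (intro multigraded_quotient.intro multigraded_quotient_axioms.intro quiver_algebra_axioms)
    show "ideal I ?K" by (rule I(1))
    show "2 \<le> length (path_arrows p)" if "f \<in> I" "p \<in> pkeys f" for f p
      using ideal_power_keys(2) that I(2) by blast
    show "psingle p 1 \<in> I" if "p \<in> qpaths Q" "N \<le> length (path_arrows p)" for p
    proof -
      obtain u ps w where p: "p = (u, ps, w)" by (metis prod_cases3)
      show ?thesis using long_path_in_power[of u ps w N] that N unfolding p by (auto simp: path_arrows_def)
    qed
    show "weigh chi f \<in> I" if "f \<in> I" for chi f
      using assms(3) monomial_ideal_weigh[OF _ that] semimonomial_ideal_weigh[OF I(1) _ that] by blast
  qed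
  then show ?thesis by (rule multigraded_quotient.mt_rank_iff)
qed

end
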